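(* Let $(\Delta,\mathcal I,\mathcal Z)$ be a partially truncated tetrahedron and let $\Delta^{(1)}$ be the set of edges of $\Delta$. The geometric realizations of $\Delta$ are parameterized up to isometry by the functions $\theta:\Delta^{(1)}\to[0,\pi)$ such that: (i) $\theta(e)=0$ if and only if $e$ is length-$0$, i.e. $e\in\mathcal Z$; (ii) for each vertex $v$ of $\Delta$, if $e_1,e_2,e_3$ are the edges that emanate from $v$, then $\theta(e_1)+\theta(e_2)+\theta(e_3)$ is equal to $\pi$ if $v$ is ideal ($v\in\mathcal I$) and is less than $\pi$ if $v$ is non-ideal. The function $\theta$ corresponding to a geometric realization $\Delta^*$ associates to each non-length-$0$ edge $e$ the dihedral angle $\theta(e)$ of $\Delta^*$ along $e$.
   Context: A partially truncated tetrahedron is a triple $(\Delta,\mathcal I,\mathcal Z)$ (often denoted just $\Delta$) where $\Delta$ is a tetrahedron, $\mathcal I$ is a set of vertices of $\Delta$ (the ideal vertices), and $\mathcal Z$ is a set of edges of $\Delta$ (the length-$0$ edges) such that no endpoint of an edge in $\mathcal Z$ belongs to $\mathcal I$. Its topological realization $\Delta^*$ is obtained from $\Delta$ by removing the ideal vertices, the length-$0$ edges, and small open stars of the non-ideal vertices. A lateral hexagon is the intersection of $\Delta^*$ with a face of $\Delta$; a truncation triangle is the intersection of $\Delta^*$ with the link in $\Delta$ of a non-ideal vertex. (Some vertices of a truncation triangle are missing if $\Delta$ has length-$0$ edges; some closed edges of a lateral hexagon are missing if $\Delta$ has ideal vertices or length-$0$ edges.) A geometric realization of $\Delta$ is an embedding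 of $\Delta^*$ in hyperbolic space $\mathbb H^3$ such that: (1) the truncation triangles are geodesic triangles, with ideal vertices corresponding to missing vertices; (2) the lateral hexagons are geodesic polygons, with ideal vertices corresponding to missing edges; (3) truncation triangles and lateral hexagons lie at right angles to each other. Isometries between realizations are required to respect the labelling of vertices of $\Delta$.
   Formalization: A geometric realization is also required to converge to the corresponding ideal point as a point of Δ* (interior included) tends to a removed ideal vertex or length-0 edge; otherwise a polyhedron minus an interior ray to an ideal vertex would be a second, non-isometric realization with equal angles. *)

theory Defs
  imports "HOL-Analysis.Analysis"
begin

section \<open>Hyperbolic 3-space in the projective (Beltrami--Klein) model\<close>

text \<open>The points of hyperbolic space are those of the open unit ball, the points at infinity are those
  of the unit sphere, and geodesic lines and planes are the traces on the ball of affine lines and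
  planes; so hyperbolic convex hulls, also of points at infinity, are traces of Euclidean convex
  hulls. The metric topology is the Euclidean one. Angles are not Euclidean and are measured with
  the Riemannian metric of the model.\<close>

abbreviation H3 :: "(real^3) set" where
  "H3 \<equiv> ball 0 1"

definition hdist :: "real^3 \<Rightarrow> real^3 \<Rightarrow> real" where
  "hdist x y = arcosh ((1 - x \<bullet> y) / sqrt ((1 - x \<bullet> x) * (1 - y \<bullet> y)))"

definition hmetric :: "real^3 \<Rightarrow> real^3 \<Rightarrow> real^3 \<Rightarrow> real" where
  "hmetric p u v = (u \<bullet> v) / (1 - p \<bullet> p) + (p \<bullet> u) * (p \<bullet> v) / (1 - p \<bullet> p)\<^sup>2"

definition hangle :: "real^3 \<Rightarrow> real^3 \<Rightarrow> real^3 \<Rightarrow> real" where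
  "hangle p u v = arccos (hmetric p u v / sqrt (hmetric p u u * hmetric p v v))"

definition hisometry :: "(real^3 \<Rightarrow> real^3) \<Rightarrow> bool" where
  "hisometry \<phi> \<longleftrightarrow> bij_betw \<phi> H3 H3 \<and> (\<forall>x\<in>H3. \<forall>y\<in>H3. hdist (\<phi> x) (\<phi> y) = hdist x y)"

definition hhull :: "(real^3) set \<Rightarrow> (real^3) set" where
  "hhull V = H3 \<inter> convex hull V"

text \<open>Nondegenerate polygons whose set of vertices, finite or ideal, is exactly \<open>V\<close>; the ideal
  vertices are not points of the polygon.\<close>

definition geodesic_polygon :: "(real^3) set \<Rightarrow> (real^3) set \<Rightarrow> bool" where
  "geodesic_polygon V P \<longleftrightarrow>
     finite V \<and> V \<subseteq> cball 0 1 \<and> aff_dim V = 2 \<and>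
     (\<forall>x\<in>V. x \<notin> convex hull (V - {x})) \<and> P = hhull V"

text \<open>At a point \<open>p\<close> of a side \<open>E\<close> of a convex polygon \<open>A\<close>: the vector \<open>a\<close> is tangent to \<open>A\<close>,
  perpendicular to \<open>E\<close>, and points into \<open>A\<close>.\<close>

definition inward_normal :: "(real^3) set \<Rightarrow> (real^3) set \<Rightarrow> real^3 \<Rightarrow> real^3 \<Rightarrow> bool" where
  "inward_normal E A p a \<longleftrightarrow>
     a \<noteq> 0 \<and> (\<forall>x\<in>E. hmetric p a (x - p) = 0) \<and> (\<exists>s>0. p + s *\<^sub>R a \<in> A)"

text \<open>Polygons \<open>A\<close> and \<open>B\<close> with common side \<open>E\<close>. The end points of \<open>E\<close> are left out because the
  perpendicular to \<open>E\<close> at an end point need not meet the polygon.\<close>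

definition has_dihedral_angle ::
    "(real^3) set \<Rightarrow> (real^3) set \<Rightarrow> (real^3) set \<Rightarrow> real \<Rightarrow> bool" where
  "has_dihedral_angle E A B \<alpha> \<longleftrightarrow>
     (\<forall>p\<in>rel_interior E. \<forall>a b. inward_normal E A p a \<and> inward_normal E B p b \<longrightarrow> hangle p a b = \<alpha>)"

section \<open>Partially truncated tetrahedra\<close>

text \<open>The tetrahedron is the standard simplex in \<open>real^4\<close>: vertices are indices and edges are pairs
  of indices.\<close>

definition edges :: "4 set set" where
  "edges = {e. card e = 2}"

definition partially_truncated_tetrahedron :: "4 set \<Rightarrow> 4 set set \<Rightarrow> bool" where
  "partially_truncated_tetrahedron I Z \<longleftrightarrow> Z \<subseteq> edges \<and> (\<forall>e\<in>Z. e \<inter> I = {})"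

text \<open>The small open star of the vertex \<open>v\<close> is the set of points with \<open>v\<close>-th barycentric coordinate
  above 3/4.\<close>

definition truncated_simplex :: "4 set \<Rightarrow> (real^4) set" where
  "truncated_simplex I =
     {x. (\<forall>i. 0 \<le> x $ i) \<and> (\<Sum>i\<in>UNIV. x $ i) = 1 \<and> (\<forall>v. v \<notin> I \<longrightarrow> x $ v \<le> 3/4)}"

text \<open>The part, in the truncated simplex, of the face spanned by the vertices in \<open>s\<close>.\<close>

definition cell :: "4 set \<Rightarrow> 4 set \<Rightarrow> (real^4) set" where
  "cell I s = {x \<in> truncated_simplex I. \<forall>k. k \<notin> s \<longrightarrow> x $ k = 0}"

text \<open>The faces to be removed: ideal vertices and length-0 edges.\<close>

definition missing :: "4 set \<Rightarrow> 4 set set \<Rightarrow> 4 set set" where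
  "missing I Z = (\<lambda>v. {v}) ` I \<union> Z"

definition Dstar :: "4 set \<Rightarrow> 4 set set \<Rightarrow> (real^4) set" where
  "Dstar I Z = truncated_simplex I - (\<Union>s\<in>missing I Z. cell I s)"

definition edge_part :: "4 set \<Rightarrow> 4 set set \<Rightarrow> 4 set \<Rightarrow> (real^4) set" where
  "edge_part I Z e = Dstar I Z \<inter> cell I e"

text \<open>The lateral hexagon in the face opposite to the vertex \<open>k\<close>.\<close>

definition lateral_hexagon :: "4 set \<Rightarrow> 4 set set \<Rightarrow> 4 \<Rightarrow> (real^4) set" where
  "lateral_hexagon I Z k = Dstar I Z \<inter> cell I (- {k})"

definition truncation_triangle :: "4 set \<Rightarrow> 4 set set \<Rightarrow> 4 \<Rightarrow> (real^4) set" where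
  "truncation_triangle I Z v = {x \<in> Dstar I Z. x $ v = 3/4}"

text \<open>The vertex, on the edge from \<open>v\<close> to \<open>w\<close>, of the truncation triangle at \<open>v\<close>.\<close>

definition corner :: "4 \<Rightarrow> 4 \<Rightarrow> real^4" where
  "corner v w = (3/4) *\<^sub>R axis v 1 + (1/4) *\<^sub>R axis w 1"

section \<open>Geometric realizations\<close>

text \<open>The end at \<open>v\<close> of the image of the edge from \<open>v\<close> to \<open>w\<close>, where \<open>q\<close> gives the ideal point
  that corresponds to each missing face. The two ends of a length-0 edge coincide.\<close>

definition edge_end ::
    "4 set \<Rightarrow> 4 set set \<Rightarrow> (real^4 \<Rightarrow> real^3) \<Rightarrow> (4 set \<Rightarrow> real^3) \<Rightarrow> 4 \<Rightarrow> 4 \<Rightarrow> real^3" where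
  "edge_end I Z f q v w =
     (if v \<in> I then q {v} else if {v, w} \<in> Z then q {v, w} else f (corner v w))"

text \<open>That the ideal points correspond to the missing faces means that \<open>f x\<close> tends to the ideal
  point when \<open>x\<close> tends to the missing face. In particular the image is closed in \<open>H3\<close>.\<close>

definition ideal_vertices ::
    "4 set \<Rightarrow> 4 set set \<Rightarrow> (real^4 \<Rightarrow> real^3) \<Rightarrow> (4 set \<Rightarrow> real^3) \<Rightarrow> bool" where
  "ideal_vertices I Z f q \<longleftrightarrow>
     (\<forall>s\<in>missing I Z. q s \<in> sphere 0 1 \<and>
        (\<forall>x\<in>cell I s. (f \<longlongrightarrow> q s) (at x within Dstar I Z)))"

definition geodesic_triangles ::
    "4 set \<Rightarrow> 4 set set \<Rightarrow> (real^4 \<Rightarrow> real^3) \<Rightarrow> (4 set \<Rightarrow> real^3) \<Rightarrow> bool" where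
  "geodesic_triangles I Z f q \<longleftrightarrow>
     (\<forall>v. v \<notin> I \<longrightarrow>
        geodesic_polygon (edge_end I Z f q v ` (- {v})) (f ` truncation_triangle I Z v) \<and>
        (\<forall>k. k \<noteq> v \<longrightarrow>
           f ` (truncation_triangle I Z v \<inter> lateral_hexagon I Z k) =
             hhull (edge_end I Z f q v ` (- {v, k}))))"

text \<open>The sides that a lateral hexagon shares with truncation triangles are treated in
  \<open>geodesic_triangles\<close>; the other ones are its edges that are not missing.\<close>

definition geodesic_hexagons ::
    "4 set \<Rightarrow> 4 set set \<Rightarrow> (real^4 \<Rightarrow> real^3) \<Rightarrow> (4 set \<Rightarrow> real^3) \<Rightarrow> bool" where
  "geodesic_hexagons I Z f q \<longleftrightarrow>
     (\<forall>k. geodesic_polygon {edge_end I Z f q v w | v w. v \<noteq> w \<and> v \<noteq> k \<and> w \<noteq> k}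
            (f ` lateral_hexagon I Z k)) \<and>
     (\<forall>v w. v \<noteq> w \<and> {v, w} \<notin> Z \<longrightarrow>
        f ` edge_part I Z {v, w} = hhull {edge_end I Z f q v w, edge_end I Z f q w v})"

definition right_angles :: "4 set \<Rightarrow> 4 set set \<Rightarrow> (real^4 \<Rightarrow> real^3) \<Rightarrow> bool" where
  "right_angles I Z f \<longleftrightarrow>
     (\<forall>v k. v \<notin> I \<and> k \<noteq> v \<longrightarrow>
        has_dihedral_angle (f ` (truncation_triangle I Z v \<inter> lateral_hexagon I Z k))
          (f ` truncation_triangle I Z v) (f ` lateral_hexagon I Z k) (pi / 2))"

text \<open>Only the restriction of \<open>f\<close> to \<open>Dstar I Z\<close> matters.\<close>

definition geometric_realization :: "4 set \<Rightarrow> 4 set set \<Rightarrow> (real^4 \<Rightarrow> real^3) \<Rightarrow> bool" where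
  "geometric_realization I Z f \<longleftrightarrow>
     embedding_map (top_of_set (Dstar I Z)) (top_of_set H3) f \<and>
     (\<exists>q. ideal_vertices I Z f q \<and> geodesic_triangles I Z f q \<and> geodesic_hexagons I Z f q) \<and>
     right_angles I Z f"

text \<open>Orientation-reversing isometries are allowed. As faces are labelled by the opposite vertex,
  respecting the labels of the lateral hexagons also accounts for the ideal vertices.\<close>

definition isometric_realizations ::
    "4 set \<Rightarrow> 4 set set \<Rightarrow> (real^4 \<Rightarrow> real^3) \<Rightarrow> (real^4 \<Rightarrow> real^3) \<Rightarrow> bool" where
  "isometric_realizations I Z f g \<longleftrightarrow>
     (\<exists>\<phi>. hisometry \<phi> \<and> \<phi> ` f ` Dstar I Z = g ` Dstar I Z \<and>
        (\<forall>k. \<phi> ` f ` lateral_hexagon I Z k = g ` lateral_hexagon I Z k) \<and>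
        (\<forall>v. v \<notin> I \<longrightarrow> \<phi> ` f ` truncation_triangle I Z v = g ` truncation_triangle I Z v))"

text \<open>The lateral hexagons adjacent to the edge \<open>e\<close> are opposite to the two vertices not in \<open>e\<close>.\<close>

definition has_dihedral_angles ::
    "4 set \<Rightarrow> 4 set set \<Rightarrow> (real^4 \<Rightarrow> real^3) \<Rightarrow> (4 set \<Rightarrow> real) \<Rightarrow> bool" where
  "has_dihedral_angles I Z f \<theta> \<longleftrightarrow>
     (\<forall>e\<in>edges - Z. \<forall>k l. - e = {k, l} \<longrightarrow>
        has_dihedral_angle (f ` edge_part I Z e)
          (f ` lateral_hexagon I Z k) (f ` lateral_hexagon I Z l) (\<theta> e))"

definition angle_functions :: "4 set \<Rightarrow> 4 set set \<Rightarrow> (4 set \<Rightarrow> real) set" where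
  "angle_functions I Z =
     {\<theta> \<in> edges \<rightarrow>\<^sub>E {0..<pi}.
        (\<forall>e\<in>edges. \<theta> e = 0 \<longleftrightarrow> e \<in> Z) \<and>
        (\<forall>v. v \<in> I \<longrightarrow> (\<Sum>e | e \<in> edges \<and> v \<in> e. \<theta> e) = pi) \<and>
        (\<forall>v. v \<notin> I \<longrightarrow> (\<Sum>e | e \<in> edges \<and> v \<in> e. \<theta> e) < pi)}"

end

theory Submission
  imports Defs
begin

text \<open>Lift the ball model to the cone over it in Minkowski space: the point \<open>p\<close> becomes \<open>(p, 1)\<close>, planes
become hyperplanes through the origin, and a plane is its Minkowski normal. A geometric realization
then amounts to eight vectors. Every face has a normal \<open>n k\<close>, and every vertex has a pole \<open>m v\<close>: the
lift of an ideal vertex, or the unit normal of the truncation plane of a non-ideal one. A truncation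
plane is perpendicular to the three faces at its vertex, and an ideal vertex lies on them; in both
cases \<open>m v\<close> is orthogonal to \<open>n k\<close> for \<open>k \<noteq> v\<close>. So \<open>m\<close> and \<open>n\<close> are dual bases up to scaling, and the
realization is a truncated simplex with vertices \<open>m v\<close>, some of which lie outside the ball. Its edge
from \<open>v\<close> to \<open>w\<close> meets the ball, touches it or misses it according to \<open>mink (m v) (m w)\<close>: both
poles being spacelike, below, equal to or above \<open>-1\<close>. This is recorded in the locale
\<open>hyperideal_frame\<close>.

Uniqueness is linear algebra. The normalized Gram matrix of the normals is the matrix of the
\<open>- cos\<close> of the dihedral angles, and a basis is determined by its Gram matrix up to a linear
isometry; an isometry of Minkowski space that respects the time direction is a hyperbolic
isometry (\<open>same_angles_imp_isometric\<close>). Conversely an isometry respects the angles between the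
faces by the law of cosines (\<open>isometric_imp_same_angles\<close>).

The conditions on the angles are sign conditions on minors. The principal \<open>3 \<times> 3\<close> minor of the
matrix of the \<open>- cos\<close> that belongs to a vertex is negative, zero or positive according to whether the
angle sum is smaller than, equal to or greater than \<open>\<pi>\<close>, under a positivity condition on the mixed
terms; and up to a negative factor this minor is the diagonal entry \<open>mink (m v) (m v)\<close> of the inverse
matrix. This gives the conditions for a frame (\<open>ang_in_angle_functions\<close>), and
also, starting from the angles, vectors with the prescribed Gram matrix whose dual basis has the
required signs (\<open>hyperideal_frame_exists\<close>).

Two steps are topological. From a frame, an embedding of the model polyhedron is needed, not just a
polyhedron (\<open>realization_geometric\<close>). In barycentric coordinates both are a simplex \<open>x \<ge> 0\<close> cut
by inequalities \<open>- (A x)\<^sub>v \<ge> 0\<close>, with different symmetric matrices \<open>A\<close>; points \<open>x\<close> and \<open>y\<close> of the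
two correspond if the ratios of \<open>- (A x)\<^sub>v\<close> to \<open>x\<^sub>v\<close> are proportional. The corresponding point
exists as the maximum of a Rayleigh quotient, it is unique by a Perron argument, and it depends
continuously on the other one because the graph of the correspondence is compact.

From a realization, a frame has to be found (\<open>realization_has_frame\<close>). The right angles give the
orthogonality relations between poles and normals. The signs of the poles come from the fact that a
lateral hexagon lies on one side of each of its truncation planes, which is a consequence of the connectedness
of the hexagon without the truncation triangle. That the image of an embedding with the right faces
is the whole polyhedron follows from invariance of domain: a component of the complement of the
faces is either missed or filled, and it cannot be an outer one because the closure of the image has
only finitely many points on the sphere at infinity.\<close>

section \<open>Minkowski space and the projective model\<close>

type_synonym minkowski = "(real^3) \<times> real"

definition mink :: "minkowski \<Rightarrow> minkowski \<Rightarrow> real" where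
  "mink x y = fst x \<bullet> fst y - snd x * snd y"

definition lift :: "real^3 \<Rightarrow> minkowski" where
  "lift p = (p, 1)"

definition proj :: "minkowski \<Rightarrow> real^3" where
  "proj z = fst z /\<^sub>R snd z"

lemma mink_commute: "mink x y = mink y x"
  by (simp add: mink_def inner_commute mult.commute)

lemma bilinear_mink: "bilinear mink"
  unfolding bilinear_def
  by (auto intro!: linearI simp: mink_def inner_add_left inner_add_right algebra_simps)

lemmas mink_simps =
  bilinear_ladd[OF bilinear_mink] bilinear_radd[OF bilinear_mink]
  bilinear_lsub[OF bilinear_mink] bilinear_rsub[OF bilinear_mink]
  bilinear_lmul[OF bilinear_mink] bilinear_rmul[OF bilinear_mink]
  bilinear_lzero[OF bilinear_mink] bilinear_rzero[OF bilinear_mink]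
  bilinear_lneg[OF bilinear_mink] bilinear_rneg[OF bilinear_mink]

lemma mink_sum_left: "mink (sum f S) y = (\<Sum>i\<in>S. mink (f i) y)"
  and mink_sum_right: "mink y (sum f S) = (\<Sum>i\<in>S. mink y (f i))"
proof -
  have "linear (\<lambda>x. mink x y)" "linear (mink y)"
    using bilinear_mink unfolding bilinear_def by blast+
  then show "mink (sum f S) y = (\<Sum>i\<in>S. mink (f i) y)" "mink y (sum f S) = (\<Sum>i\<in>S. mink y (f i))"
    using linear_sum[of "\<lambda>x. mink x y"] linear_sum[of "mink y"] by (simp_all add: o_def)
qed

lemma mink_lift: "mink (lift x) (lift y) = x \<bullet> y - 1"
  by (simp add: mink_def lift_def)

lemma mink_lift_left: "mink (lift x) c = x \<bullet> fst c - snd c"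
  by (simp add: mink_def lift_def)

lemma snd_lift [simp]: "snd (lift x) = 1" and fst_lift [simp]: "fst (lift x) = x"
  by (simp_all add: lift_def)

lemma lift_nonzero [simp]: "lift x \<noteq> 0"
  by (simp add: lift_def zero_prod_def)

lemma lift_inject [simp]: "lift x = lift y \<longleftrightarrow> x = y"
  by (simp add: lift_def)

lemma proj_lift [simp]: "proj (lift x) = x"
  by (simp add: proj_def)

lemma lift_proj: "snd z \<noteq> 0 \<Longrightarrow> lift (proj z) = z /\<^sub>R snd z"
  by (simp add: lift_def proj_def prod_eq_iff)

lemma proj_scale: "t \<noteq> 0 \<Longrightarrow> proj (t *\<^sub>R z) = proj z"
  by (simp add: proj_def)

lemma proj_eqI: "lift x = t *\<^sub>R z \<Longrightarrow> proj z = x"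
  by (metis lift_nonzero proj_lift proj_scale scaleR_zero_left)

lemma mink_proj: "snd z \<noteq> 0 \<Longrightarrow> mink (lift (proj z)) c = mink z c / snd z"
  by (simp add: lift_proj mink_simps divide_inverse_commute)

lemma mem_H3_iff: "x \<in> H3 \<longleftrightarrow> x \<bullet> x < 1"
  by (simp add: norm_eq_sqrt_inner)

lemma mem_H3_iff_mink: "x \<in> H3 \<longleftrightarrow> mink (lift x) (lift x) < 0"
  by (simp only: mem_H3_iff mink_lift) simp

lemma mem_cball_iff_mink: "x \<in> cball 0 1 \<longleftrightarrow> mink (lift x) (lift x) \<le> 0"
  by (simp add: norm_eq_sqrt_inner mink_lift)

lemma mem_sphere_iff_mink: "x \<in> sphere 0 1 \<longleftrightarrow> mink (lift x) (lift x) = 0"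
  by (simp add: norm_eq_sqrt_inner mink_lift)

lemma proj_in_H3: "snd z \<noteq> 0 \<Longrightarrow> proj z \<in> H3 \<longleftrightarrow> mink z z < 0"
  unfolding mem_H3_iff_mink lift_proj
  by (simp add: mink_simps mult.assoc[symmetric] mult_less_0_iff zero_less_mult_iff)
     linarith

lemma proj_in_sphere: "snd z \<noteq> 0 \<Longrightarrow> proj z \<in> sphere 0 1 \<longleftrightarrow> mink z z = 0"
  unfolding mem_sphere_iff_mink lift_proj
  by (simp add: mink_simps)

lemma proj_in_cball: "snd z \<noteq> 0 \<Longrightarrow> proj z \<in> cball 0 1 \<longleftrightarrow> mink z z \<le> 0"
  using proj_in_H3[of z] proj_in_sphere[of z] by (auto simp: less_le)

text \<open>Twice the product is \<open>- norm (x - y)\<^sup>2\<close> up to nonpositive terms: causal vectors in the same half of the light cone have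
  negative product unless they are proportional.\<close>
lemma mink_lift_neg:
  assumes "x \<in> cball 0 1" "y \<in> cball 0 1" "x \<noteq> y"
  shows "mink (lift x) (lift y) < 0"
proof -
  have "x \<bullet> x \<le> 1" "y \<bullet> y \<le> 1" using assms by (auto simp: norm_eq_sqrt_inner)
  moreover have "(x - y) \<bullet> (x - y) > 0" using assms(3) by simp
  ultimately show ?thesis
    by (simp add: mink_lift inner_diff_left inner_diff_right inner_commute)
qed

text \<open>The orthogonal complement of a timelike vector is positive definite, by the Cauchy--Schwarz inequality.\<close>
lemma timelike_orthogonal:
  assumes "mink t t < 0" "mink t c = 0" "c \<noteq> 0"
  shows "mink c c > 0"
proof (rule ccontr)
  assume "\<not> mink c c > 0"
  then have c: "fst c \<bullet> fst c \<le> (snd c)\<^sup>2" by (simp add: mink_def power2_eq_square)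
  have t: "fst t \<bullet> fst t < (snd t)\<^sup>2" using assms(1) by (simp add: mink_def power2_eq_square)
  have e: "fst t \<bullet> fst c = snd t * snd c" using assms(2) by (simp add: mink_def)
  have "(snd t * snd c)\<^sup>2 \<le> (fst t \<bullet> fst t) * (fst c \<bullet> fst c)"
    using Cauchy_Schwarz_ineq[of "fst t" "fst c"] e by simp
  also have "\<dots> \<le> (fst t \<bullet> fst t) * (snd c)\<^sup>2" using c by (intro mult_left_mono) auto
  finally have "((snd t)\<^sup>2 - fst t \<bullet> fst t) * (snd c)\<^sup>2 \<le> 0" by (simp add: algebra_simps power_mult_distrib)
  moreover have "(snd t)\<^sup>2 - fst t \<bullet> fst t > 0" using t by simp
  ultimately have "snd c = 0"
    by (metis linorder_not_le power2_less_eq_zero_iff zero_less_mult_iff mult.commute mult_le_0_iff)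
  then show False using c assms(3) by (metis inner_eq_zero_iff inner_ge_zero order_antisym power_zero_numeral prod_eq_iff fst_zero snd_zero)
qed

lemma mink_timelike_neg_iff:
  assumes "mink x x < 0" "mink y y < 0"
  shows "mink x y < 0 \<longleftrightarrow> snd x * snd y > 0"
proof -
  have "norm (fst x) ^ 2 < \<bar>snd x\<bar> ^ 2" "norm (fst y) ^ 2 < \<bar>snd y\<bar> ^ 2"
    using assms unfolding power2_norm_eq_inner by (simp_all add: mink_def power2_eq_square)
  then have x: "norm (fst x) < \<bar>snd x\<bar>" and y: "norm (fst y) < \<bar>snd y\<bar>"
    by (meson abs_ge_zero power2_less_imp_less)+
  have "\<bar>fst x \<bullet> fst y\<bar> \<le> norm (fst x) * norm (fst y)" by (rule Cauchy_Schwarz_ineq2)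
  also have "\<dots> < \<bar>snd x\<bar> * \<bar>snd y\<bar>" using x y by (intro mult_strict_mono) (auto intro: le_less_trans[OF norm_ge_zero])
  finally have "\<bar>fst x \<bullet> fst y\<bar> < \<bar>snd x * snd y\<bar>" by (simp add: abs_mult)
  then show ?thesis unfolding mink_def by linarith
qed

text \<open>The linear map that exchanges the Minkowski and the Euclidean product, so that dimension formulas
  for Euclidean orthogonality apply.\<close>
definition reflect :: "minkowski \<Rightarrow> minkowski" where
  "reflect x = (fst x, - snd x)"

lemma mink_eq_inner: "mink x y = x \<bullet> reflect y"
  by (simp add: mink_def reflect_def inner_prod_def)

lemma linear_reflect: "linear reflect"
  by (rule linearI) (auto simp: reflect_def)

lemma reflect_reflect [simp]: "reflect (reflect x) = x"
  by (simp add: reflect_def)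

lemma inj_reflect: "inj reflect"
  by (metis injI reflect_reflect)

lemma mink_reflect: "mink (reflect x) (reflect y) = mink x y"
  by (simp add: mink_def reflect_def)

lemma mink_dim_le:
  assumes "\<And>s c. s \<in> S \<Longrightarrow> c \<in> C \<Longrightarrow> mink s c = 0"
  shows "dim S + dim C \<le> 4"
proof -
  have "dim (reflect ` C) = dim C"
    by (rule dim_image_eq[OF linear_reflect]) (use inj_reflect in \<open>auto intro: inj_on_subset\<close>)
  moreover have "dim (S \<union> reflect ` C) = dim S + dim (reflect ` C)"
    by (rule dim_orthogonal_sum) (use assms in \<open>auto simp: mink_eq_inner\<close>)
  moreover have "dim (S \<union> reflect ` C) \<le> 4"
    using dim_subset_UNIV[of "S \<union> reflect ` C"] by simp
  ultimately show ?thesis by linarith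
qed

text \<open>Vectors orthogonal to \<open>C\<close> lie in the span of \<open>S\<close>, as the dimensions leave no room for more. This is the
  standard way to show that a vector is a combination of given ones.\<close>
lemma mink_complement_span:
  assumes o: "\<And>s c. s \<in> S \<Longrightarrow> c \<in> C \<Longrightarrow> mink s c = 0" and d: "4 \<le> dim S + dim C"
    and z: "\<And>c. c \<in> C \<Longrightarrow> mink z c = 0"
  shows "z \<in> span S"
proof (rule ccontr)
  assume "z \<notin> span S"
  then have "dim (insert z S) = dim S + 1" by (simp add: dim_insert)
  moreover have "mink s c = 0" if "s \<in> insert z S" "c \<in> C" for s c
    using that(1) o[OF _ that(2)] z[OF that(2)] by blast
  then have "dim (insert z S) + dim C \<le> 4" by (rule mink_dim_le)
  ultimately show False using d by linarith
qed

lemma mink_zeroI: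
  assumes "dim S \<ge> 4" "\<And>s. s \<in> S \<Longrightarrow> mink x s = 0"
  shows "x = 0"
  using mink_complement_span[of "{}" S x] assms by simp

lemma dim_pair:
  assumes "\<And>s t. s *\<^sub>R a + t *\<^sub>R b = 0 \<Longrightarrow> s = 0 \<and> t = (0::real)"
  shows "dim {a, b :: 'a :: euclidean_space} = 2"
proof -
  have "a \<noteq> 0" "b \<noteq> 0" using assms[of 1 0] assms[of 0 1] by auto
  moreover have "b \<notin> span {a}"
  proof
    assume "b \<in> span {a}"
    then obtain k where "b = k *\<^sub>R a" by (auto simp: span_singleton)
    then show False using assms[of "-k" 1] by simp
  qed
  ultimately show ?thesis by (simp add: dim_insert insert_commute[of a b])
qed

lemma dim_lift_pair:
  assumes "a \<noteq> b"
  shows "dim {lift a, lift b} = 2"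
proof (rule dim_pair)
  fix s t :: real
  assume "s *\<^sub>R lift a + t *\<^sub>R lift b = 0"
  then have "s *\<^sub>R a + t *\<^sub>R b = 0" "s + t = 0" by (auto simp: lift_def prod_eq_iff)
  then have t: "t = -s" by simp
  then have "s *\<^sub>R (a - b) = 0" using \<open>s *\<^sub>R a + t *\<^sub>R b = 0\<close> by (simp add: algebra_simps)
  with t show "s = 0 \<and> t = 0" using assms by auto
qed

text \<open>The tangent vector \<open>u\<close> at \<open>p\<close> of the ball, moved into the orthogonal complement of \<open>lift p\<close>. On that
  complement the Minkowski product is, up to a factor, the Riemannian metric of the model; this is how
  hyperbolic angles become Minkowski products.\<close>
definition tangent_lift :: "real^3 \<Rightarrow> real^3 \<Rightarrow> minkowski" where
  "tangent_lift p u = (u, 0) + ((p \<bullet> u) / (1 - p \<bullet> p)) *\<^sub>R lift p"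

lemma tangent_lift_orthogonal: "p \<in> H3 \<Longrightarrow> mink (tangent_lift p u) (lift p) = 0"
  unfolding mem_H3_iff
  by (simp add: tangent_lift_def mink_simps mink_lift) (simp add: mink_def lift_def field_simps inner_commute)

lemma hmetric_eq_mink:
  assumes "p \<in> H3"
  shows "mink (tangent_lift p u) (tangent_lift p v) = (1 - p \<bullet> p) * hmetric p u v"
proof -
  have p: "1 - p \<bullet> p \<noteq> 0" using assms unfolding mem_H3_iff by simp
  have "mink (tangent_lift p u) (tangent_lift p v) = mink (tangent_lift p u) (v, 0)"
    by (subst (2) tangent_lift_def) (simp add: mink_simps tangent_lift_orthogonal[OF assms])
  also have "\<dots> = u \<bullet> v + (p \<bullet> u) * (p \<bullet> v) / (1 - p \<bullet> p)"
    by (simp add: tangent_lift_def mink_simps) (simp add: mink_def lift_def)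
  also have "\<dots> = (1 - p \<bullet> p) * hmetric p u v"
    using p by (simp add: hmetric_def distrib_left power2_eq_square)
  finally show ?thesis .
qed

lemma tangent_lift_scale: "tangent_lift p (t *\<^sub>R u) = t *\<^sub>R tangent_lift p u"
  by (simp add: tangent_lift_def algebra_simps prod_eq_iff)

lemma tangent_lift_diff:
  "\<exists>l. tangent_lift p (x - p) = lift x + l *\<^sub>R lift p"
  by (rule exI[of _ "(p \<bullet> (x - p)) / (1 - p \<bullet> p) - 1"])
     (simp add: tangent_lift_def lift_def prod_eq_iff algebra_simps)

lemma tangent_lift_eq_0: 
  assumes "p \<in> H3" shows "tangent_lift p u = 0 \<longleftrightarrow> u = 0"
proof
  assume "tangent_lift p u = 0"
  then have "snd (tangent_lift p u) = 0" "fst (tangent_lift p u) = 0" by simp_all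
  then show "u = 0" by (auto simp: tangent_lift_def lift_def)
qed (simp add: tangent_lift_def zero_prod_def)

lemma span_pairE:
  assumes "z \<in> span {a, b}"
  obtains k h where "z = k *\<^sub>R a + h *\<^sub>R b"
proof -
  obtain k where "z - k *\<^sub>R a \<in> span {b}" using assms span_breakdown_eq[of z a "{b}"] by auto
  then obtain h where "z - k *\<^sub>R a = h *\<^sub>R b" by (auto simp: span_singleton)
  then have "z = k *\<^sub>R a + h *\<^sub>R b" by (simp add: algebra_simps)
  then show ?thesis by (rule that)
qed

lemma hmetric_scale_right: "hmetric p u (t *\<^sub>R v) = t * hmetric p u v"
  unfolding hmetric_def inner_scaleR_right by (simp add: distrib_left mult.left_commute)

lemma hmetric_commute: "hmetric p u v = hmetric p v u"
  unfolding hmetric_def by (simp add: inner_commute[of u v] mult.commute)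

lemma hmetric_scale_left: "hmetric p (t *\<^sub>R u) v = t * hmetric p u v"
  by (metis hmetric_commute hmetric_scale_right)

lemma hmetric_diff_left: "hmetric p (u - v) w = hmetric p u w - hmetric p v w"
  unfolding hmetric_def inner_diff_left inner_diff_right left_diff_distrib diff_divide_distrib by simp

lemma hmetric_pos:
  assumes "p \<in> H3" "u \<noteq> 0" shows "hmetric p u u > 0"
proof -
  have "mink (lift p) (lift p) < 0" using assms(1) mem_H3_iff_mink by blast
  moreover have "mink (lift p) (tangent_lift p u) = 0" using tangent_lift_orthogonal[OF assms(1)] mink_commute by metis
  ultimately have "mink (tangent_lift p u) (tangent_lift p u) > 0"
    using timelike_orthogonal tangent_lift_eq_0[OF assms(1)] assms(2) by blast
  then have "(1 - p \<bullet> p) * hmetric p u u > 0" using hmetric_eq_mink[OF assms(1)] by simp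
  moreover have "1 - p \<bullet> p > 0" using assms(1) mem_H3_iff by simp
  ultimately show ?thesis by (simp add: zero_less_mult_iff)
qed

text \<open>The inward normals at a point of the common side are orthogonal to the side, so their lifts lie in the
  plane spanned by the normals \<open>c\<close> and \<open>d\<close> of the two polygons. Each is orthogonal to the normal of its
  own polygon and on the positive side of the other one; this fixes it up to a positive factor, and the angle
  is a computation in this plane.\<close>
lemma dihedral_angle_normals:
  assumes E: "E \<subseteq> H3" "e1 \<in> E" "e2 \<in> E" "e1 \<noteq> e2"
    and Ecd: "\<And>x. x \<in> E \<Longrightarrow> mink (lift x) c = 0 \<and> mink (lift x) d = 0"
    and A: "\<And>x. x \<in> A \<Longrightarrow> mink (lift x) c = 0 \<and> mink (lift x) d \<ge> 0"
    and B: "\<And>x. x \<in> B \<Longrightarrow> mink (lift x) d = 0 \<and> mink (lift x) c \<ge> 0"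
    and pos: "mink c c > 0" "mink d d > 0" "(mink c d)\<^sup>2 < mink c c * mink d d"
  shows "has_dihedral_angle E A B (arccos (- mink c d / sqrt (mink c c * mink d d)))"
  unfolding has_dihedral_angle_def
proof (intro ballI allI impI, elim conjE)
  fix p a b
  assume "p \<in> rel_interior E" and a: "inward_normal E A p a" and b: "inward_normal E B p b"
  then have pE: "p \<in> E" using rel_interior_subset by blast
  then have p: "p \<in> H3" using E by blast
  obtain e where e: "e \<in> E" "e \<noteq> p" using E by metis
  define C D g where "C = mink c c" "D = mink d d" "g = mink c d"
  note CDg = C_D_g_def
  have pos': "C > 0" "D > 0" "g\<^sup>2 < C * D" using pos by (auto simp: CDg)
  have cd_span: "dim {c, d} = 2"
  proof (rule dim_pair)
    fix s t assume st: "s *\<^sub>R c + t *\<^sub>R d = 0"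
    have "mink (s *\<^sub>R c + t *\<^sub>R d) c = 0" "mink (s *\<^sub>R c + t *\<^sub>R d) d = 0" using st by (simp_all add: mink_simps)
    then have eq: "s * C + t * g = 0" "s * g + t * D = 0" by (simp_all add: mink_simps CDg mink_commute)
    then have "s * (C * D - g\<^sup>2) = 0" "t * (C * D - g\<^sup>2) = 0" 
      by (algebra, algebra)
    then show "s = 0 \<and> t = 0" using pos' by simp
  qed
  have span_cd: "z \<in> span {c, d}" if "mink z (lift p) = 0" "mink z (lift e) = 0" for z
  proof (rule mink_complement_span[where C = "{lift p, lift e}"])
    show "4 \<le> dim {c, d} + dim {lift p, lift e}" using cd_span dim_lift_pair[of p e] e by simp
  qed (use that Ecd pE e in \<open>auto simp: mink_commute\<close>)
  have normal: "\<exists>k>0. tangent_lift p u = k *\<^sub>R (d' - (g / mink c' c') *\<^sub>R c')"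
    if u: "inward_normal E F p u" and F: "\<And>x. x \<in> F \<Longrightarrow> mink (lift x) c' = 0 \<and> mink (lift x) d' \<ge> 0"
      and cd': "(c' = c \<and> d' = d) \<or> (c' = d \<and> d' = c)" for u F c' d'
  proof -
    have g': "mink c' d' = g" "mink d' c' = g" and C': "mink c' c' > 0" "mink d' d' > 0" "g\<^sup>2 < mink c' c' * mink d' d'"
      using cd' pos' by (auto simp: CDg mink_commute mult.commute)
    obtain s where s: "s > 0" "p + s *\<^sub>R u \<in> F" and u0: "u \<noteq> 0" and uE: "\<And>x. x \<in> E \<Longrightarrow> hmetric p u (x - p) = 0"
      using u by (auto simp: inward_normal_def)
    define x where "x = p + s *\<^sub>R u"
    have x: "x \<in> F" "x - p = s *\<^sub>R u" using s by (auto simp: x_def)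
    obtain l where l: "tangent_lift p (x - p) = lift x + l *\<^sub>R lift p" using tangent_lift_diff by blast
    have tl: "s *\<^sub>R tangent_lift p u = lift x + l *\<^sub>R lift p" using l x tangent_lift_scale by metis
    have pc: "mink (lift p) c' = 0" "mink (lift p) d' = 0" using Ecd[OF pE] cd' by auto
    have "mink (s *\<^sub>R tangent_lift p u) c' = 0" "mink (s *\<^sub>R tangent_lift p u) d' \<ge> 0"
      unfolding tl using F[OF x(1)] pc by (simp_all add: mink_simps)
    then have m: "mink (tangent_lift p u) c' = 0" "mink (tangent_lift p u) d' \<ge> 0"
      using s by (simp_all add: mink_simps zero_le_mult_iff)
    obtain l2 where l2: "tangent_lift p (e - p) = lift e + l2 *\<^sub>R lift p" using tangent_lift_diff by blast
    have "mink (tangent_lift p u) (tangent_lift p (e - p)) = 0" using uE[OF e(1)] hmetric_eq_mink[OF p] by simp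
    then have "mink (tangent_lift p u) (lift e) = 0" unfolding l2 using tangent_lift_orthogonal[OF p] by (simp add: mink_simps)
    then have "tangent_lift p u \<in> span {c, d}" using span_cd tangent_lift_orthogonal[OF p] by blast
    then have "tangent_lift p u \<in> span {d', c'}" using cd' by (auto simp: insert_commute)
    then obtain k h where kh: "tangent_lift p u = k *\<^sub>R d' + h *\<^sub>R c'" by (rule span_pairE)
    have "k * g + h * mink c' c' = 0" using m(1) kh g' by (simp add: mink_simps)
    then have h: "h = - k * g / mink c' c'" using C' by (simp add: field_simps)
    have "k * mink d' d' + h * g \<ge> 0" using m(2) kh g' by (simp add: mink_simps)
    then have "mink c' c' * (k * mink d' d' + h * g) \<ge> 0" using C'(1) by simp
    also have "mink c' c' * (k * mink d' d' + h * g) = k * (mink c' c' * mink d' d' - g\<^sup>2)"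
      using \<open>k * g + h * mink c' c' = 0\<close> by algebra
    finally have "k \<ge> 0" using C' by (metis diff_gt_0_iff_gt linorder_not_le zero_le_mult_iff)
    moreover have kh': "tangent_lift p u = k *\<^sub>R (d' - (g / mink c' c') *\<^sub>R c')"
      unfolding kh h by (simp add: scaleR_diff_right)
    moreover have "k \<noteq> 0" using kh' u0 tangent_lift_eq_0[OF p, of u] by (metis scaleR_zero_left)
    ultimately show ?thesis by (intro exI[of _ k]) simp
  qed
  obtain k where k: "k > 0" "tangent_lift p a = k *\<^sub>R (d - (g / C) *\<^sub>R c)" using normal[OF a, of c d] A CDg by auto
  obtain h where h: "h > 0" "tangent_lift p b = h *\<^sub>R (c - (g / D) *\<^sub>R d)" using normal[OF b, of d c] B CDg by auto
  define x y q where "x = g / C" "y = g / D" "q = 1 - x * y"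
  have xC: "x * C = g" and yD: "y * D = g" using pos' by (simp_all add: x_y_q_def)
  have "x * y * (C * D) = (x * C) * (y * D)" by simp
  also have "\<dots> = g\<^sup>2" by (simp add: xC yD power2_eq_square)
  finally have "q * (C * D) = C * D - g\<^sup>2" by (simp add: x_y_q_def(3) left_diff_distrib)
  then have q: "q > 0" using pos' by (smt (verit) zero_less_mult_iff)
  have minks: "mink c c = C" "mink d d = D" "mink c d = g" "mink d c = g" by (simp_all add: CDg mink_commute)
  have "mink (d - x *\<^sub>R c) (c - y *\<^sub>R d) = g - y * D - x * C + x * y * g"
    by (simp add: mink_simps minks algebra_simps)
  also have "\<dots> = - g * q" unfolding x_y_q_def(3) xC yD by (simp add: algebra_simps)
  finally have ab: "mink (tangent_lift p a) (tangent_lift p b) = - (k * h * g * q)"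
    unfolding k h x_y_q_def(1,2)[symmetric] bilinear_lmul[OF bilinear_mink] bilinear_rmul[OF bilinear_mink] by simp
  have "mink (d - x *\<^sub>R c) (d - x *\<^sub>R c) = D - x * g - x * g + x * x * C"
    by (simp add: mink_simps minks algebra_simps)
  also have "\<dots> = D - x * g - x * g + x * (x * C)" by simp
  also have "\<dots> = D - x * (y * D)" unfolding xC yD by simp
  also have "\<dots> = D * q" unfolding x_y_q_def(3) by (simp add: algebra_simps)
  finally have aa: "mink (tangent_lift p a) (tangent_lift p a) = k\<^sup>2 * D * q"
    unfolding k x_y_q_def(1,2)[symmetric] bilinear_lmul[OF bilinear_mink] bilinear_rmul[OF bilinear_mink] by (simp add: power2_eq_square)
  have "mink (c - y *\<^sub>R d) (c - y *\<^sub>R d) = C - y * g - y * g + y * y * D"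
    by (simp add: mink_simps minks algebra_simps)
  also have "\<dots> = C - y * g - y * g + y * (y * D)" by simp
  also have "\<dots> = C - y * (x * C)" unfolding xC yD by simp
  also have "\<dots> = C * q" unfolding x_y_q_def(3) by (simp add: algebra_simps)
  finally have bb: "mink (tangent_lift p b) (tangent_lift p b) = h\<^sup>2 * C * q"
    unfolding h x_y_q_def(1,2)[symmetric] bilinear_lmul[OF bilinear_mink] bilinear_rmul[OF bilinear_mink] by (simp add: power2_eq_square)
  define w where "w = 1 - p \<bullet> p"
  have w: "w > 0" using p mem_H3_iff[of p] by (simp add: w_def)
  have H: "hmetric p a b = - (k * h * g * q) / w" "hmetric p a a = k\<^sup>2 * D * q / w" "hmetric p b b = h\<^sup>2 * C * q / w"
    using ab aa bb w unfolding hmetric_eq_mink[OF p] w_def[symmetric] by (simp_all only: eq_divide_eq mult.commute[of w]) auto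
  have "hmetric p a a * hmetric p b b = (k * h * q / w)\<^sup>2 * (C * D)"
    unfolding H by (simp add: power2_eq_square)
  then have "sqrt (hmetric p a a * hmetric p b b) = (k * h * q / w) * sqrt (C * D)"
    using k(1) h(1) q w by (simp add: real_sqrt_mult)
  then have "hmetric p a b / sqrt (hmetric p a a * hmetric p b b) = (k * h * q / w) * (- g) / ((k * h * q / w) * sqrt (C * D))"
    unfolding H(1) by simp
  also have "\<dots> = - g / sqrt (C * D)"
    using k(1) h(1) q w by (subst mult_divide_mult_cancel_left) auto
  finally have "hmetric p a b / sqrt (hmetric p a a * hmetric p b b) = - g / sqrt (C * D)" .
  then show "hangle p a b = arccos (- mink c d / sqrt (mink c c * mink d d))"
    unfolding hangle_def by (simp add: CDg)
qed

section \<open>Angle sums and Gram determinants\<close>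

lemma angle_sum_less_pi_aux:
  fixes a b c :: real
  assumes "0 \<le> a" "a < pi" "0 \<le> b" "b < pi" "0 \<le> c" "c < pi" and "cos a > - cos (b + c)"
  shows "if b + c \<le> pi then a + b + c < pi else a < b + c - pi"
proof -
  have 1: "- cos (b + c) = cos (pi - (b + c))" "- cos (b + c) = cos (b + c - pi)"
    by (simp_all add: cos_diff)
  show ?thesis
  proof (cases "b + c \<le> pi")
    case True
    have "cos (pi - (b + c)) < cos a" using assms(7) 1(1) by linarith
    then have "a < pi - (b + c)"
      using assms(1-6) True cos_mono_less_eq[of "pi - (b + c)" a] by linarith
    with True show ?thesis by simp
  next
    case False
    have "cos (b + c - pi) < cos a" using assms(7) 1(2) by linarith
    then have "a < b + c - pi"
      using assms(1-6) False cos_mono_less_eq[of "b + c - pi" a] by linarith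
    with False show ?thesis by simp
  qed
qed

lemma angle_sum_eq_pi_aux:
  fixes a b c :: real
  assumes "0 \<le> a" "a < pi" "0 \<le> b" "b < pi" "0 \<le> c" "c < pi" and "cos a = - cos (b + c)"
  shows "if b + c \<le> pi then a + b + c = pi else a = b + c - pi"
proof -
  have 1: "- cos (b + c) = cos (pi - (b + c))" "- cos (b + c) = cos (b + c - pi)"
    by (simp_all add: cos_diff)
  show ?thesis
  proof (cases "b + c \<le> pi")
    case True
    have "cos a = cos (pi - (b + c))" using assms(7) 1(1) by linarith
    then have "a = pi - (b + c)"
      using assms(1-6) True cos_inj_pi[of a "pi - (b + c)"] by linarith
    with True show ?thesis by simp
  next
    case False
    have "cos a = cos (b + c - pi)" using assms(7) 1(2) by linarith
    then have "a = b + c - pi"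
      using assms(1-6) False cos_inj_pi[of a "b + c - pi"] by linarith
    with False show ?thesis by simp
  qed
qed

text \<open>The determinant of the symmetric matrix with diagonal \<open>1\<close> and off-diagonal entries \<open>-x\<close>, \<open>-y\<close>, \<open>-z\<close>.\<close>
definition gram_det :: "real \<Rightarrow> real \<Rightarrow> real \<Rightarrow> real" where
  "gram_det x y z = 1 - 2 * x * y * z - x\<^sup>2 - y\<^sup>2 - z\<^sup>2"

lemma gram_det_permute: "gram_det x y z = gram_det y x z" "gram_det x y z = gram_det x z y"
  by (simp_all add: gram_det_def)

text \<open>The determinant is a difference of two squares, \<open>(sin b sin c)\<^sup>2 - (cos a + cos b cos c)\<^sup>2\<close>; its sign compares \<open>cos a\<close> with
  \<open>cos (\<pi> - b - c)\<close> when the second square has a positive base.\<close>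
lemma gram_det_cos:
  "(cos a + cos b * cos c)\<^sup>2 = (sin b * sin c)\<^sup>2 - gram_det (cos a) (cos b) (cos c)"
  unfolding gram_det_def power_mult_distrib sin_squared_eq power2_sum by (simp add: algebra_simps power2_eq_square)

lemma cos_gt_if_gram_det_neg:
  assumes "0 \<le> b" "b < pi" "0 \<le> c" "c < pi" "cos a + cos b * cos c > 0"
  shows "gram_det (cos a) (cos b) (cos c) < 0 \<Longrightarrow> cos a > - cos (b + c)"
    and "gram_det (cos a) (cos b) (cos c) = 0 \<Longrightarrow> cos a = - cos (b + c)"
proof -
  have s: "sin b * sin c \<ge> 0" using assms by (auto intro!: mult_nonneg_nonneg sin_ge_zero)
  show "cos a > - cos (b + c)" if "gram_det (cos a) (cos b) (cos c) < 0"
  proof -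
    have "(cos a + cos b * cos c)\<^sup>2 > (sin b * sin c)\<^sup>2" using gram_det_cos[of a b c] that by simp
    then have "cos a + cos b * cos c > sin b * sin c" using assms(5) by (meson less_imp_le power2_less_imp_less)
    then show ?thesis by (simp add: cos_add)
  qed
  show "cos a = - cos (b + c)" if "gram_det (cos a) (cos b) (cos c) = 0"
  proof -
    have "(cos a + cos b * cos c)\<^sup>2 = (sin b * sin c)\<^sup>2" using gram_det_cos[of a b c] that by simp
    then have "cos a + cos b * cos c = sin b * sin c" using assms(5) s by (meson less_imp_le power2_eq_imp_eq)
    then show ?thesis by (simp add: cos_add)
  qed
qed

text \<open>If the sum of two of the angles exceeds \<open>\<pi>\<close>, then \<open>cos a > - cos (b + c)\<close> only gives \<open>a < b + c - \<pi>\<close>; the same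
  inequality for \<open>b\<close> excludes this case, which is why two positivity hypotheses appear.\<close>
lemma angle_sum_of_gram_det:
  fixes a b c :: real
  assumes r: "0 \<le> a" "a < pi" "0 \<le> b" "b < pi" "0 \<le> c" "c < pi"
    and p: "cos a + cos b * cos c > 0" "cos b + cos a * cos c > 0"
  shows "gram_det (cos a) (cos b) (cos c) < 0 \<Longrightarrow> a + b + c < pi"
    and "gram_det (cos a) (cos b) (cos c) = 0 \<Longrightarrow> a + b + c = pi"
proof -
  show "a + b + c < pi" if "gram_det (cos a) (cos b) (cos c) < 0"
    using angle_sum_less_pi_aux[of a b c] angle_sum_less_pi_aux[of b a c]
      cos_gt_if_gram_det_neg(1)[of b c a] cos_gt_if_gram_det_neg(1)[of a c b] r p that gram_det_permute(1)[of "cos a" "cos b" "cos c"]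
    by (smt (verit))
  show "a + b + c = pi" if "gram_det (cos a) (cos b) (cos c) = 0"
    using angle_sum_eq_pi_aux[of a b c] angle_sum_eq_pi_aux[of b a c]
      cos_gt_if_gram_det_neg(2)[of b c a] cos_gt_if_gram_det_neg(2)[of a c b] r p that gram_det_permute(1)[of "cos a" "cos b" "cos c"]
    by (smt (verit))
qed

lemma gram_det_of_angle_sum:
  fixes a b c :: real
  assumes r: "0 \<le> a" "0 \<le> b" "b < pi" "0 \<le> c" "c < pi"
  shows "a + b + c < pi \<Longrightarrow> cos a + cos b * cos c > 0 \<and> gram_det (cos a) (cos b) (cos c) < 0"
    and "a + b + c = pi \<Longrightarrow> 0 < b \<Longrightarrow> 0 < c \<Longrightarrow> cos a + cos b * cos c > 0 \<and> gram_det (cos a) (cos b) (cos c) = 0"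
proof -
  have s: "sin b * sin c \<ge> 0" using assms by (auto intro!: mult_nonneg_nonneg sin_ge_zero)
  have 1: "cos (pi - (b + c)) = sin b * sin c - cos b * cos c" by (simp add: cos_diff cos_add)
  show "cos a + cos b * cos c > 0 \<and> gram_det (cos a) (cos b) (cos c) < 0" if "a + b + c < pi"
  proof -
    have "cos (pi - (b + c)) < cos a" using r that by (intro cos_monotone_0_pi) auto
    then have *: "sin b * sin c < cos a + cos b * cos c" using 1 by simp
    then have "(sin b * sin c)\<^sup>2 < (cos a + cos b * cos c)\<^sup>2" using s by (intro power_strict_mono) auto
    then show ?thesis using * s gram_det_cos[of a b c] by linarith
  qed
  show "cos a + cos b * cos c > 0 \<and> gram_det (cos a) (cos b) (cos c) = 0" if "a + b + c = pi" "0 < b" "0 < c"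
  proof -
    have "a = pi - (b + c)" using that by simp
    then have *: "sin b * sin c = cos a + cos b * cos c" using 1 by simp
    moreover have "sin b * sin c > 0" using that r by (auto intro!: mult_pos_pos sin_gt_zero)
    ultimately show ?thesis using gram_det_cos[of a b c] by simp
  qed
qed

lemma cramer_symmetric3:
  fixes u1 u2 u3 x y z p q r :: real
  assumes e: "u1 * x + u2 * p + u3 * q = e1" "u1 * p + u2 * y + u3 * r = e2" "u1 * q + u2 * r + u3 * z = e3"
    and D: "D = x * y * z + 2 * p * q * r - x * r\<^sup>2 - y * q\<^sup>2 - z * p\<^sup>2"
  shows "u2 * D = e1 * (q * r - p * z) + e2 * (x * z - q\<^sup>2) + e3 * (p * q - x * r)"
    and "u3 * D = e1 * (p * r - q * y) + e2 * (p * q - x * r) + e3 * (x * y - p\<^sup>2)"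
  unfolding D e[symmetric] by (simp_all add: algebra_simps power2_eq_square)

text \<open>The matrix \<open>A\<close> is \<open>M o' o'\<close> times the Schur complement of that entry of \<open>M\<close>. It is, up to the same factor,
  inverse to the block of \<open>N\<close> that omits the index \<open>o'\<close>. No division occurs, so the
  identity also covers \<open>M o' o' = 0\<close>.\<close>
lemma inverse_gram_row:
  fixes M N :: "'a \<Rightarrow> 'a \<Rightarrow> real"
  assumes d: "distinct [o', a, b, c]"
    and inv: "\<And>i k. M i o' * N o' k + M i a * N a k + M i b * N b k + M i c * N c k = (if i = k then 1 else 0)"
    and sym: "\<And>i k. M i k = M k i"
    and A: "\<And>v w. A v w = M o' o' * M v w - M o' v * M o' w"
    and k: "k \<noteq> o'"
  shows "A a a * N a k + A a b * N b k + A a c * N c k = (if a = k then M o' o' else 0)"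
proof -
  have 1: "M o' a * N o' k + M a a * N a k + M a b * N b k + M a c * N c k = (if a = k then 1 else 0)"
    using inv[of a k] sym[of a o'] by simp
  have 2: "M o' o' * N o' k + M o' a * N a k + M o' b * N b k + M o' c * N c k = 0"
    using inv[of o' k] k by simp
  have "A a a * N a k + A a b * N b k + A a c * N c k
    = M o' o' * (M o' a * N o' k + M a a * N a k + M a b * N b k + M a c * N c k)
      - M o' a * (M o' o' * N o' k + M o' a * N a k + M o' b * N b k + M o' c * N c k)"
    unfolding A by (simp add: algebra_simps)
  then show ?thesis unfolding 1 2 by simp
qed

text \<open>From the signs of the Gram matrix \<open>M\<close> of the poles to the angle conditions on the Gram matrix \<open>N\<close> of the
  normals. The claims are read off the row of \<open>a\<close> in the matrix \<open>A\<close> of the lemma \<open>inverse_gram_row\<close>: its entries off the diagonal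
  are negative, the one on the diagonal is nonpositive, and up to a factor \<open>A\<close> is inverse to the block of \<open>N\<close> for the three
  faces at the vertex \<open>o'\<close>.\<close>
lemma gram_of_dual_basis:
  fixes M N :: "'a \<Rightarrow> 'a \<Rightarrow> real"
  assumes d: "distinct [o', a, b, c]"
    and inv: "\<And>i k. M i o' * N o' k + M i a * N a k + M i b * N b k + M i c * N c k = (if i = k then 1 else 0)"
    and sym: "\<And>i k. M i k = M k i" "\<And>i k. N i k = N k i"
    and N1: "\<And>k. N k k = 1"
    and neg: "\<And>v w. v \<noteq> w \<Longrightarrow> M v w < 0"
    and nonneg: "\<And>v. M v v \<ge> 0"
    and le: "M o' o' * M a a \<le> (M o' a)\<^sup>2"
    and strict: "M o' o' * M a a < (M o' a)\<^sup>2 \<Longrightarrow> (N b c)\<^sup>2 < 1"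
  shows "M o' o' * M a a = (M o' a)\<^sup>2 \<Longrightarrow> N b c = -1"
    and "- N a c + N a b * N b c > 0"
    and "M o' o' > 0 \<Longrightarrow> - N a b + N a c * N b c > 0 \<Longrightarrow> gram_det (- N a b) (- N a c) (- N b c) < 0"
    and "M o' o' = 0 \<Longrightarrow> gram_det (- N a b) (- N a c) (- N b c) = 0"
proof -
  \<comment> \<open>In the degenerate case \<open>A a a = 0\<close> the row of \<open>a\<close> determines \<open>N b c\<close>; otherwise \<open>key\<close> compares signs.\<close>
  define A where A: "A v w = M o' o' * M v w - M o' v * M o' w" for v w
  note row = inverse_gram_row[OF d inv sym(1) A]
  have neq: "o' \<noteq> a" "o' \<noteq> b" "o' \<noteq> c" "a \<noteq> b" "a \<noteq> c" "b \<noteq> c" using d by auto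
  have ra: "A a a + A a b * N a b + A a c * N a c = M o' o'" using row[of a] neq N1 sym by simp
  have rb: "A a a * N a b + A a b + A a c * N b c = 0" using row[of b] neq N1 sym(2)[of c b] by simp
  have rc: "A a a * N a c + A a b * N b c + A a c = 0" using row[of c] neq N1 by simp
  have An: "A a w < 0" if "w \<noteq> a" "w \<noteq> o'" for w
  proof -
    have "M o' o' * M a w \<le> 0" using neg[of a w] nonneg[of o'] that by (simp add: mult_nonneg_nonpos)
    moreover have "M o' a * M o' w > 0" using neg[of o' a] neg[of o' w] neq that by (simp add: mult_neg_neg)
    ultimately show ?thesis unfolding A by simp
  qed
  then have Ab: "A a b < 0" and Ac: "A a c < 0" using neq by auto
  have Aa: "A a a \<le> 0" using le unfolding A by (simp add: power2_eq_square)
  have key: "A a c * (1 - (N b c)\<^sup>2) = A a a * (N a b * N b c - N a c)"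
    using rb rc by algebra
  have eq: "N b c = -1" if "A a a = 0"
  proof -
    have "A a c * (1 - (N b c)\<^sup>2) = 0" using key that by simp
    then have "(N b c)\<^sup>2 = 1" using Ac by simp
    moreover have "A a b + A a c * N b c = 0" using rb that by simp
    then have "N b c \<noteq> 1" using Ab Ac by auto
    ultimately show ?thesis by (simp add: power2_eq_1_iff)
  qed
  then show "N b c = -1" if "M o' o' * M a a = (M o' a)\<^sup>2" using that unfolding A by (simp add: power2_eq_square)
  show "- N a c + N a b * N b c > 0"
  proof (cases "A a a = 0")
    case True
    then have bc: "N b c = -1" by (rule eq)
    have "M o' o' * M a a = M o' a * M o' a" using True A by simp
    moreover have "M o' a * M o' a > 0" using neg[of o' a] neq by (simp add: mult_neg_neg)
    ultimately have "M o' o' > 0" using nonneg[of o'] by (cases "M o' o' = 0") auto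
    moreover have "A a b = A a c" using rb True bc by simp
    ultimately have "A a b * (N a b + N a c) > 0" using ra True by (simp add: distrib_left)
    then have "N a b + N a c < 0" using Ab by (simp add: zero_less_mult_iff)
    then show ?thesis using bc by simp
  next
    case False
    then have Aneg: "A a a < 0" using Aa by simp
    then have "(N b c)\<^sup>2 < 1" using strict unfolding A by (simp add: power2_eq_square)
    then have "A a c * (1 - (N b c)\<^sup>2) < 0" using Ac by (simp add: mult_neg_pos)
    then have "A a a * (N a b * N b c - N a c) < 0" using key by simp
    then show ?thesis using Aneg by (auto simp: mult_less_0_iff)
  qed
  have cr: "A a b * gram_det (- N a b) (- N a c) (- N b c) = M o' o' * (- N a b + N a c * N b c)"
    using cramer_symmetric3(1)[of "A a a" 1 "A a b" "N a b" "A a c" "N a c" "M o' o'" 1 "N b c" 0 1 0, OF _ _ _ refl] ra rb rc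
    unfolding gram_det_def by (simp add: algebra_simps)
  show "gram_det (- N a b) (- N a c) (- N b c) < 0" if "M o' o' > 0" "- N a b + N a c * N b c > 0"
  proof -
    have "A a b * gram_det (- N a b) (- N a c) (- N b c) > 0" unfolding cr using that by simp
    then show ?thesis using Ab by (auto simp: zero_less_mult_iff)
  qed
  show "gram_det (- N a b) (- N a c) (- N b c) = 0" if "M o' o' = 0"
    using cr that Ab by simp
qed

text \<open>The converse direction. Eliminating \<open>o'\<close> from \<open>N\<close> leaves a symmetric \<open>3 \<times> 3\<close> matrix \<open>P\<close> with nonnegative
  diagonal \<open>x\<close>, \<open>y\<close>, \<open>z\<close> and negative off-diagonal entries \<open>-p\<close>, \<open>-q\<close>, \<open>-r\<close>. The condition \<open>x y \<le> p\<^sup>2\<close> (an angle sum of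
  at most \<open>\<pi>\<close>) makes its determinant \<open>D\<close> negative, and the entries of \<open>M\<close> for the other three indices are cofactors of \<open>P\<close> divided by \<open>D\<close>.\<close>
lemma dual_of_gram:
  fixes M N :: "'a \<Rightarrow> 'a \<Rightarrow> real"
  assumes d: "distinct [o', a, b, c]"
    and inv: "\<And>i k. M i o' * N o' k + M i a * N a k + M i b * N b k + M i c * N c k = (if i = k then 1 else 0)"
    and sym: "\<And>i k. M i k = M k i" "\<And>i k. N i k = N k i"
    and N1: "\<And>k. N k k = 1"
    and pos: "\<And>i j k. distinct [i, j, k] \<Longrightarrow> - N i j + N i k * N j k > 0"
    and le: "\<And>i j. (N i j)\<^sup>2 \<le> 1"
    and gd: "gram_det (- N o' a) (- N o' b) (- N a b) \<le> 0"
  shows "M b c < 0" "M c c \<ge> 0" "M c c = 0 \<longleftrightarrow> gram_det (- N o' a) (- N o' b) (- N a b) = 0"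
    "M b b * M c c \<le> (M b c)\<^sup>2" "M b b * M c c = (M b c)\<^sup>2 \<longleftrightarrow> (N o' a)\<^sup>2 = 1"
proof -
  define P where P: "P i j = N i j - N o' i * N o' j" for i j
  have neq: "o' \<noteq> a" "o' \<noteq> b" "o' \<noteq> c" "a \<noteq> b" "a \<noteq> c" "b \<noteq> c" using d by auto
  have inv': "M i a * P a k + M i b * P b k + M i c * P c k = (if i = k then 1 else 0)"
    if "i \<noteq> o'" for i k
  proof -
    have "M i o' + M i a * N o' a + M i b * N o' b + M i c * N o' c = 0"
      using inv[of i o'] that N1[of o'] unfolding sym(2)[of a o'] sym(2)[of b o'] sym(2)[of c o'] by simp
    then have z: "M i o' = - (M i a * N o' a + M i b * N o' b + M i c * N o' c)" by simp
    have "M i a * P a k + M i b * P b k + M i c * P c k = M i o' * N o' k + M i a * N a k + M i b * N b k + M i c * N c k"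
      unfolding P z by (simp add: algebra_simps)
    then show ?thesis using inv[of i k] by simp
  qed
  define p q r x y z where "p = - P a b" "q = - P a c" "r = - P b c" "x = P a a" "y = P b b" "z = P c c"
  note df = p_q_r_x_y_z_def
  have Psym: "P i j = P j i" for i j unfolding P using sym(2)[of i j] by simp
  have pqr: "p > 0" "q > 0" "r > 0"
    using pos[of a b o'] pos[of a c o'] pos[of b c o'] neq unfolding df P sym(2)[of a o'] sym(2)[of b o'] sym(2)[of c o'] by (simp_all add: mult.commute)
  have xyz: "x \<ge> 0" "y \<ge> 0" "z \<ge> 0"
    using le[of o' a] le[of o' b] le[of o' c] unfolding df P by (simp_all add: N1 power2_eq_square)
  have g: "x * y - p\<^sup>2 = gram_det (- N o' a) (- N o' b) (- N a b)"
    unfolding df P gram_det_def by (simp add: N1 algebra_simps power2_eq_square)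
  then have xy: "x * y \<le> p\<^sup>2" using gd by simp
  define D where "D = x * y * z - 2 * p * q * r - x * r\<^sup>2 - y * q\<^sup>2 - z * p\<^sup>2"
  have "x * y * z \<le> z * p\<^sup>2" using mult_right_mono[OF xy xyz(3)] by (simp add: mult.commute)
  moreover have "2 * p * q * r > 0" "x * r\<^sup>2 \<ge> 0" "y * q\<^sup>2 \<ge> 0" using pqr xyz by auto
  ultimately have D: "D < 0" unfolding D_def by linarith
  have b1: "M b a * x - M b b * p - M b c * q = 0" using inv'[of b a] neq Psym[of b a] Psym[of c a] unfolding df by simp
  have b2: "- M b a * p + M b b * y - M b c * r = 1" using inv'[of b b] neq Psym[of c b] unfolding df by simp
  have b3: "- M b a * q - M b b * r + M b c * z = 0" using inv'[of b c] neq unfolding df by simp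
  have c1: "M c a * x - M c b * p - M c c * q = 0" using inv'[of c a] neq Psym[of b a] Psym[of c a] unfolding df by simp
  have c2: "- M c a * p + M c b * y - M c c * r = 0" using inv'[of c b] neq Psym[of c b] unfolding df by simp
  have c3: "- M c a * q - M c b * r + M c c * z = 1" using inv'[of c c] neq unfolding df by simp
  have D': "D = x * y * z + 2 * (- p) * (- q) * (- r) - x * (- r)\<^sup>2 - y * (- q)\<^sup>2 - z * (- p)\<^sup>2" by (simp add: D_def)
  have bb: "M b b * D = x * z - q\<^sup>2" and bc: "M b c * D = p * q + x * r"
    using cramer_symmetric3[of "M b a" x "M b b" "- p" "M b c" "- q" 0 y "- r" 1 z 0, OF _ _ _ D'] b1 b2 b3 by simp_all
  have cc: "M c c * D = x * y - p\<^sup>2"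
    using cramer_symmetric3(2)[of "M c a" x "M c b" "- p" "M c c" "- q" 0 y "- r" 0 z 1, OF _ _ _ D'] c1 c2 c3 by simp
  show "M b c < 0"
  proof -
    have "M b c * D > 0" unfolding bc using pqr xyz by (simp add: add_pos_nonneg)
    then show ?thesis using D by (auto simp: zero_less_mult_iff)
  qed
  show "M c c \<ge> 0"
  proof -
    have "M c c * D \<le> 0" unfolding cc using xy by simp
    then show ?thesis using D by (auto simp: mult_le_0_iff)
  qed
  show "M c c = 0 \<longleftrightarrow> gram_det (- N o' a) (- N o' b) (- N a b) = 0"
    using cc D g by auto
  have "(M b b * M c c - (M b c)\<^sup>2) * D\<^sup>2 = (M b b * D) * (M c c * D) - (M b c * D)\<^sup>2"
    by (simp add: algebra_simps power2_eq_square)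
  also have "\<dots> = (x * z - q\<^sup>2) * (x * y - p\<^sup>2) - (p * q + x * r)\<^sup>2" by (simp only: bb cc bc)
  also have "\<dots> = x * D" unfolding D_def by (simp add: algebra_simps power2_eq_square)
  finally have "(M b b * M c c - (M b c)\<^sup>2) * D * D = x * D" by (simp add: power2_eq_square)
  then have e: "(M b b * M c c - (M b c)\<^sup>2) * D = x" using D by simp
  show "M b b * M c c \<le> (M b c)\<^sup>2"
  proof -
    have "(M b b * M c c - (M b c)\<^sup>2) * D \<ge> 0" using e xyz by simp
    then show ?thesis using D by (auto simp: zero_le_mult_iff)
  qed
  have "M b b * M c c = (M b c)\<^sup>2 \<longleftrightarrow> x = 0" using e D by auto
  also have "\<dots> \<longleftrightarrow> (N o' a)\<^sup>2 = 1" unfolding df P by (auto simp: N1 power2_eq_square)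
  finally show "M b b * M c c = (M b c)\<^sup>2 \<longleftrightarrow> (N o' a)\<^sup>2 = 1" .
qed

text \<open>Every such matrix \<open>P\<close> is the Gram matrix of three vectors for the form \<open>t\<^sup>2 - 2 u w\<close> of signature \<open>(2, 1)\<close>.\<close>
lemma ex_null_coordinates:
  fixes p q r x y z :: real
  assumes pqr: "p > 0" "q > 0" "r > 0" and xyz: "x \<ge> 0" "y \<ge> 0" "z \<ge> 0" and le: "x * y \<le> p\<^sup>2"
  shows "\<exists>t1 u1 w1 t2 u2 w2 t3 u3 w3. t1 * t1 - 2 * u1 * w1 = x \<and> t2 * t2 - 2 * u2 * w2 = y \<and> t3 * t3 - 2 * u3 * w3 = z \<and>
     t1 * t2 - (u1 * w2 + w1 * u2) = - p \<and> t1 * t3 - (u1 * w3 + w1 * u3) = - q \<and> t2 * t3 - (u2 * w3 + w2 * u3) = - r"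
proof -
  \<comment> \<open>Two of the vectors can be taken to be \<open>(0, 1, -x/2)\<close> and \<open>(\<surd>y, 0, p)\<close>; the products with these determine
  the third one up to its first coordinate \<open>t\<close>, whose norm condition is a quadratic equation.\<close>
  define s where "s = sqrt y"
  have s: "s \<ge> 0" "s * s = y" using xyz by (simp_all add: s_def)
  define a b c where "a = p\<^sup>2 - x * y" "b = 2 * q * p * s + 2 * x * r * s" "c = 2 * q * p * r + x * r\<^sup>2 + p\<^sup>2 * z"
  note df = a_b_c_def
  have "2 * q * p * r > 0" "x * r\<^sup>2 \<ge> 0" "p\<^sup>2 * z \<ge> 0" using pqr xyz by auto
  then have c: "c > 0" unfolding df by linarith
  have a: "a \<ge> 0" using le by (simp add: df)
  have "\<exists>t. a * t\<^sup>2 - b * t - c = 0"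
  proof (cases "a = 0")
    case True
    then have "x * y > 0" using pqr(1) by (simp add: df) (metis zero_less_power)
    then have "s > 0" using s xyz by (metis less_eq_real_def mult_zero_right less_irrefl)
    then have "2 * q * p * s > 0" "2 * x * r * s \<ge> 0" using pqr xyz by auto
    then have "b > 0" unfolding df by linarith
    then show ?thesis using True by (intro exI[of _ "- c / b"]) simp
  next
    case False
    then have "a > 0" using a by simp
    then have d: "b\<^sup>2 + 4 * a * c \<ge> 0" using c by simp
    define w where "w = sqrt (b\<^sup>2 + 4 * a * c)"
    have w: "w * w = b\<^sup>2 + 4 * a * c" using d by (simp add: w_def)
    define t where "t = (b + w) / (2 * a)"
    have t: "2 * a * t = b + w" using \<open>a > 0\<close> by (simp add: t_def)
    have "4 * a * (a * t\<^sup>2 - b * t - c) = (2 * a * t) * (2 * a * t) - 2 * b * (2 * a * t) - 4 * a * c"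
      by (simp add: algebra_simps power2_eq_square)
    also have "\<dots> = 0" unfolding t using w by (simp add: algebra_simps power2_eq_square)
    finally show ?thesis using \<open>a > 0\<close> by auto
  qed
  then obtain t where t: "a * t\<^sup>2 - b * t - c = 0" by blast
  define u where "u = (r + s * t) / p"
  have u: "p * u = r + s * t" using pqr by (simp add: u_def)
  have "p * p * (t * t - 2 * u * (q + x * u / 2)) = p * p * t * t - 2 * q * p * (p * u) - x * (p * u) * (p * u)"
    by (simp add: algebra_simps)
  also have "\<dots> = p * p * z" unfolding u using t unfolding df by (simp add: algebra_simps power2_eq_square s(2)[symmetric])
  finally have n: "t * t - 2 * u * (q + x * u / 2) = z" using pqr by simp
  have "s * t - (0 * (q + x * u / 2) + p * u) = - r" using u by simp
  moreover have "0 * t - (1 * (q + x * u / 2) + (- x / 2) * u) = - q" by simp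
  moreover have "0 * s - (1 * p + (- x / 2) * 0) = - p" "0 * 0 - 2 * 1 * (- x / 2) = x" "s * s - 2 * 0 * p = y" using s by simp_all
  ultimately show ?thesis using n by blast
qed

section \<open>Combinatorics of four indices\<close>

lemma UNIV_4:
  assumes "distinct [a, b, c, d :: 4]"
  shows "UNIV = {a, b, c, d}"
proof (rule card_subset_eq[symmetric])
  show "card {a, b, c, d} = card (UNIV :: 4 set)" using assms by simp
qed auto

lemma complete_4:
  fixes v w :: 4
  assumes "v \<noteq> w"
  obtains k l where "distinct [v, w, k, l]" "UNIV = {v, w, k, l}"
proof -
  have "card (UNIV - {v, w}) = 2" using assms by (simp add: card_Diff_subset)
  then obtain k l where kl: "UNIV - {v, w} = {k, l}" "k \<noteq> l" by (meson card_2_iff)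
  then have "distinct [v, w, k, l]" using assms by auto
  then show ?thesis using that UNIV_4 by blast
qed

lemma sum_4:
  assumes "distinct [a, b, c, d :: 4]"
  shows "sum f UNIV = f a + f b + f c + (f d :: 'b :: comm_monoid_add)"
  unfolding UNIV_4[OF assms] using assms by (simp add: add.assoc)

text \<open>A family with a dual family, up to nonzero factors, is independent.\<close>
lemma dim_dual:
  assumes "finite A" and off: "\<And>v k. v \<in> A \<Longrightarrow> k \<in> A \<Longrightarrow> v \<noteq> k \<Longrightarrow> mink (m v) (n k) = 0"
    and diag: "\<And>v. v \<in> A \<Longrightarrow> mink (m v) (n v) \<noteq> 0"
  shows "dim (n ` A) = card A"
proof -
  have inj: "inj_on n A" using off diag by (intro inj_onI) metis
  have "\<not> dependent (n ` A)"
  proof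
    assume "dependent (n ` A)"
    then obtain u k where k: "k \<in> A" "u (n k) \<noteq> 0" and s: "(\<Sum>v\<in>n ` A. u v *\<^sub>R v) = 0"
      using dependent_finite[of "n ` A"] assms(1) by auto
    have "0 = mink (m k) (\<Sum>v\<in>A. u (n v) *\<^sub>R n v)"
      using s sum.reindex[OF inj, of "\<lambda>v. u v *\<^sub>R v"] by (simp add: mink_simps)
    also have "\<dots> = (\<Sum>v\<in>A. if v = k then u (n k) * mink (m k) (n k) else 0)"
      unfolding mink_sum_right by (intro sum.cong) (use off k in \<open>auto simp: mink_simps\<close>)
    also have "\<dots> = u (n k) * mink (m k) (n k)" using assms(1) k by simp
    finally show False using k diag by simp
  qed
  then show ?thesis using card_image[OF inj] by (simp add: dim_eq_card_independent)
qed

lemma edges_at: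
  assumes d: "distinct [v, a, b, c :: 4]"
  shows "{e. e \<in> edges \<and> v \<in> e} = {{v, a}, {v, b}, {v, c}}"
proof -
  have "e = {v, a} \<or> e = {v, b} \<or> e = {v, c}" if "card e = 2" "v \<in> e" for e
  proof -
    obtain w where "e = {v, w}" "w \<noteq> v" using \<open>card e = 2\<close> \<open>v \<in> e\<close> by (auto simp: card_2_iff)
    moreover have "w \<in> {v, a, b, c}" using UNIV_4[OF d] by blast
    ultimately show ?thesis by auto
  qed
  then show ?thesis using d by (auto simp: edges_def)
qed

lemma sum_edges_at:
  assumes d: "distinct [v, a, b, c :: 4]"
  shows "(\<Sum>e | e \<in> edges \<and> v \<in> e. f e) = f {v, a} + f {v, b} + (f {v, c} :: real)"
  unfolding edges_at[OF d] using d by (auto simp: doubleton_eq_iff)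

section \<open>Cones over hyperbolic convex hulls\<close>

text \<open>The cone over the lift of a convex hull. Unlike the hull it is closed under addition, so membership in a
  hull can be shown by writing a vector as a sum with nonnegative coefficients.\<close>
definition hcone :: "(real^3) set \<Rightarrow> minkowski set" where
  "hcone V = {x. x = 0 \<or> 0 < snd x \<and> proj x \<in> convex hull V}"

lemma hcone_zero [simp]: "0 \<in> hcone V"
  by (simp add: hcone_def)

lemma hcone_add:
  assumes "x \<in> hcone V" "y \<in> hcone V"
  shows "x + y \<in> hcone V"
proof (cases "x = 0 \<or> y = 0")
  case False
  then have x: "0 < snd x" "proj x \<in> convex hull V" and y: "0 < snd y" "proj y \<in> convex hull V"
    using assms by (auto simp: hcone_def)
  define s where "s = snd x / (snd x + snd y)"
  have s: "0 \<le> s" "0 \<le> 1 - s" using x y by (simp_all add: s_def field_simps)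
  have "s * inverse (snd x) = inverse (snd x + snd y)" "(1 - s) * inverse (snd y) = inverse (snd x + snd y)"
    using x y by (simp_all add: s_def field_simps)
  then have "s *\<^sub>R proj x + (1 - s) *\<^sub>R proj y = proj (x + y)"
    by (simp add: proj_def scaleR_add_right)
  moreover have "s *\<^sub>R proj x + (1 - s) *\<^sub>R proj y \<in> convex hull V"
    using convexD[OF convex_convex_hull x(2) y(2)] s by simp
  ultimately show ?thesis using x y by (simp add: hcone_def)
qed (use assms in auto)

lemma hcone_scale: "x \<in> hcone V \<Longrightarrow> 0 \<le> t \<Longrightarrow> t *\<^sub>R x \<in> hcone V"
  by (cases "t = 0") (auto simp: hcone_def proj_scale)

lemma hcone_sum: "(\<And>i. i \<in> S \<Longrightarrow> f i \<in> hcone V) \<Longrightarrow> sum f S \<in> hcone V"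
  by (induction S rule: infinite_finite_induct) (auto intro: hcone_add)

lemma hcone_mono: "V \<subseteq> W \<Longrightarrow> hcone V \<subseteq> hcone W"
  unfolding hcone_def using hull_mono[of V W convex] by auto

lemma hcone_vertex: "0 < snd x \<Longrightarrow> proj x \<in> V \<Longrightarrow> x \<in> hcone V"
  unfolding hcone_def using hull_subset[of V convex] by auto

lemma lift_hcone: "lift x \<in> hcone V \<longleftrightarrow> x \<in> convex hull V"
  by (simp add: hcone_def)

lemma convex_mink_le: "convex {x. mink (lift x) c \<le> 0}"
  and convex_mink_ge: "convex {x. mink (lift x) c \<ge> 0}"
  and convex_mink_less: "convex {x. mink (lift x) c < 0}"
  and convex_mink_gr: "convex {x. mink (lift x) c > 0}"
  and convex_mink_eq: "convex {x. mink (lift x) c = 0}"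
  using convex_halfspace_le[of "fst c" "snd c"] convex_halfspace_ge[of "snd c" "fst c"] convex_halfspace_lt[of "fst c" "snd c"]
    convex_halfspace_gt[of "snd c" "fst c"] convex_hyperplane[of "fst c" "snd c"]
  by (simp_all add: mink_lift_left inner_commute algebra_simps)

text \<open>The ratio test of linear programming: moving from \<open>g\<close> against \<open>h\<close>, some constraint becomes tight before any is
  violated.\<close>
lemma min_ratio:
  fixes g h :: "'a \<Rightarrow> real"
  assumes "finite G" and g: "\<And>i. i \<in> G \<Longrightarrow> 0 \<le> g i" and h: "\<exists>i\<in>G. h i > 0" 
  shows "\<exists>t\<ge>0. (\<forall>i\<in>G. g i - t * h i \<ge> 0 \<or> h i < 0) \<and> (\<exists>i\<in>G. g i - t * h i = 0)"
proof -
  define P where "P = {i \<in> G. h i > 0}"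
  have P: "finite P" "P \<noteq> {}" using assms by (auto simp: P_def)
  define t where "t = Min ((\<lambda>i. g i / h i) ` P)"
  have "t \<in> (\<lambda>i. g i / h i) ` P" unfolding t_def using P by (intro Min_in) auto
  then obtain i where i: "i \<in> P" "t = g i / h i" by blast
  have t: "t \<le> g j / h j" if "j \<in> P" for j using P that by (simp add: t_def)
  show ?thesis
  proof (intro exI conjI ballI bexI)
    show "t \<ge> 0" using i g by (auto simp: P_def)
    show "i \<in> G" "g i - t * h i = 0" using i by (auto simp: P_def)
    fix j assume "j \<in> G"
    then show "g j - t * h j \<ge> 0 \<or> h j < 0"
      using t[of j] g[of j] by (cases "h j > 0") (auto simp: P_def field_simps)
  qed
qed

lemma aff_dim_eq_dim_lift:
  assumes "V \<noteq> {}"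
  shows "aff_dim V = int (dim (lift ` V)) - 1"
proof -
  obtain a where a: "a \<in> V" using assms by blast
  define h where "h = (\<lambda>x::real^3. (x, 0::real))"
  have lin: "linear h" by (rule linearI) (auto simp: h_def)
  define D where "D = h ` ((\<lambda>x. -a + x) ` V)"
  have "dim D = dim ((\<lambda>x. -a + x) ` V)"
    unfolding D_def by (rule dim_image_eq[OF lin]) (auto simp: h_def inj_on_def)
  moreover have "lift a \<notin> span D"
  proof -
    have "span D \<subseteq> {x. snd x = 0}"
      by (rule span_minimal) (auto simp: D_def h_def subspace_def)
    then show ?thesis by auto
  qed
  then have "dim (insert (lift a) D) = dim D + 1" by (simp add: dim_insert)
  moreover have "span (lift ` V) = span (insert (lift a) D)"
    unfolding span_eq
  proof
    have e: "lift x = lift a + h (-a + x)" for x by (simp add: h_def lift_def)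
    have "h (-a + x) \<in> span (insert (lift a) D)" if "x \<in> V" for x using that by (intro span_base) (simp add: D_def)
    then have "lift x \<in> span (insert (lift a) D)" if "x \<in> V" for x
      unfolding e[of x] using that by (intro span_add) (auto intro: span_base)
    then show "lift ` V \<subseteq> span (insert (lift a) D)" by blast
    have "h (-a + x) = lift x - lift a" for x by (simp add: h_def lift_def)
    moreover have "lift x - lift a \<in> span (lift ` V)" if "x \<in> V" for x
      using that a by (intro span_diff span_base) auto
    ultimately have "D \<subseteq> span (lift ` V)" unfolding D_def by (simp only: image_image) blast
    then show "insert (lift a) D \<subseteq> span (lift ` V)" using a by (auto intro: span_base)
  qed
  then have "dim (lift ` V) = dim (insert (lift a) D)" by (metis dim_span)
  moreover have "aff_dim V = int (dim ((\<lambda>x. -a + x) ` V))"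
    using aff_dim_eq_dim[of a V] a by (simp add: hull_inc)
  ultimately show ?thesis by simp
qed

text \<open>A set of points spans a plane as soon as the linear functionals vanishing on it are the multiples of one.\<close>
lemma aff_dim_eq_2I:
  assumes "V \<noteq> {}" "N \<noteq> 0" and N: "\<And>x. x \<in> V \<Longrightarrow> mink (lift x) N = 0"
    and c: "\<And>c. (\<And>x. x \<in> V \<Longrightarrow> mink (lift x) c = 0) \<Longrightarrow> \<exists>t. c = t *\<^sub>R N"
  shows "aff_dim V = 2"
proof -
  have rN: "reflect N \<noteq> 0" using assms(2) by (auto simp: reflect_def prod_eq_iff)
  have o: "x \<bullet> reflect N = 0" if "x \<in> lift ` V" for x using that N by (auto simp: mink_eq_inner)
  have "dim (lift ` V \<union> {reflect N}) = dim (lift ` V) + dim {reflect N}"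
    by (rule dim_orthogonal_sum) (use o in auto)
  then have d: "dim (lift ` V \<union> {reflect N}) = dim (lift ` V) + 1" using rN by simp
  have "\<not> dim (lift ` V) < 3"
  proof
    assume "dim (lift ` V) < 3"
    then have "dim (lift ` V \<union> {reflect N}) < DIM(minkowski)" using d by simp
    then obtain z where z: "z \<noteq> 0" "\<And>y. y \<in> span (lift ` V \<union> {reflect N}) \<Longrightarrow> orthogonal z y"
      using orthogonal_to_subspace_exists by blast
    have z1: "z \<bullet> y = 0" if "y \<in> lift ` V \<union> {reflect N}" for y
      using z(2)[of y] that by (simp add: orthogonal_def span_base)
    have "mink (lift x) (reflect z) = 0" if "x \<in> V" for x
      using z1[of "lift x"] that by (simp add: mink_eq_inner inner_commute)
    then have "\<exists>t. reflect z = t *\<^sub>R N" by (rule c)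
    then obtain t where "reflect z = t *\<^sub>R N" by blast
    then have "z = t *\<^sub>R reflect N" by (metis linear_reflect linear_scale reflect_reflect)
    then show False using z1[of "reflect N"] z(1) rN by simp
  qed
  moreover have "dim (lift ` V \<union> {reflect N}) \<le> 4"
    using dim_subset_UNIV[of "lift ` V \<union> {reflect N}"] by simp
  ultimately have "dim (lift ` V) = 3" using d by simp
  then show ?thesis using aff_dim_eq_dim_lift[OF assms(1)] by simp
qed

text \<open>A functional that vanishes at \<open>x\<close> and is positive on the other points separates \<open>x\<close> from their hull.\<close>
lemma not_in_convex_hull_others:
  assumes "mink (lift x) c = 0" "\<And>y. y \<in> V \<Longrightarrow> y \<noteq> x \<Longrightarrow> mink (lift y) c > 0"
  shows "x \<notin> convex hull (V - {x})"
proof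
  assume "x \<in> convex hull (V - {x})"
  moreover have "convex hull (V - {x}) \<subseteq> {y. mink (lift y) c > 0}"
    by (rule hull_minimal) (use assms convex_mink_gr in auto)
  ultimately show False using assms(1) by auto
qed

lemma open_segment_in_H3:
  assumes "a \<in> cball 0 1" "b \<in> cball 0 1" "p \<in> open_segment a b"
  shows "p \<in> H3"
proof -
  obtain t where t: "0 < t" "t < 1" "p = (1 - t) *\<^sub>R a + t *\<^sub>R b" and "a \<noteq> b"
    using assms(3) by (auto simp: in_segment)
  have "mink (lift a) (lift b) < 0" using mink_lift_neg assms \<open>a \<noteq> b\<close> by blast
  moreover have "mink (lift a) (lift a) \<le> 0" "mink (lift b) (lift b) \<le> 0" using assms mem_cball_iff_mink by blast+
  moreover have lp: "lift p = (1 - t) *\<^sub>R lift a + t *\<^sub>R lift b" by (simp add: t lift_def)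
  define A B C where "A = mink (lift a) (lift a)" "B = mink (lift b) (lift b)" "C = mink (lift a) (lift b)"
  have "mink (lift b) (lift a) = C" by (simp add: A_B_C_def mink_commute)
  then have "mink (lift p) (lift p) = (1-t) * (1-t) * A + t * t * B + 2 * ((1-t) * t) * C"
    unfolding lp by (simp add: mink_simps flip: A_B_C_def) (simp add: algebra_simps)
  moreover have "A \<le> 0" "B \<le> 0" "C < 0" using calculation(1-3) by (simp_all add: A_B_C_def)
  then have "(1-t) * (1-t) * A \<le> 0" "t * t * B \<le> 0" "2 * ((1-t) * t) * C < 0"
    using t by (simp_all add: mult_nonneg_nonpos mult_pos_neg)
  ultimately show ?thesis unfolding mem_H3_iff_mink by linarith
qed

lemma two_points_in_hhull:
  assumes "a \<in> cball 0 1" "b \<in> cball 0 1" "a \<noteq> b"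
  obtains p q where "p \<in> open_segment a b" "q \<in> open_segment a b" "p \<noteq> q" "p \<in> hhull {a, b}" "q \<in> hhull {a, b}"
proof -
  define p q where "p = midpoint a b" "q = midpoint a p"
  have "p \<in> open_segment a b" using assms by (simp add: p_q_def)
  moreover have "a \<noteq> p" using assms(3) by (metis midpoint_eq_endpoint(1) p_q_def(1))
  then have "q \<in> open_segment a p" by (simp add: p_q_def)
  then have "q \<in> open_segment a b" using \<open>p \<in> open_segment a b\<close>
    by (meson subset_open_segment ends_in_segment(1) open_closed_segment in_mono)
  moreover have "p \<noteq> q" using \<open>a \<noteq> p\<close> by (metis midpoint_eq_endpoint(2) p_q_def(2))
  ultimately show ?thesis using that open_segment_in_H3[OF assms(1,2)]
    by (simp add: hhull_def segment_convex_hull[symmetric] open_closed_segment)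
qed

section \<open>Truncated polyhedra from dual bases of Minkowski space\<close>

text \<open>The vector on the edge from \<open>v\<close> to \<open>w\<close> that is orthogonal to \<open>m v\<close>, hence the end of that edge at \<open>v\<close>:
  its intersection with the truncation plane, or a multiple of \<open>m v\<close> itself if \<open>m v\<close> is null.\<close>
definition edge_vector :: "(4 \<Rightarrow> minkowski) \<Rightarrow> 4 \<Rightarrow> 4 \<Rightarrow> minkowski" where
  "edge_vector m v w = mink (m v) (m v) *\<^sub>R m w - mink (m v) (m w) *\<^sub>R m v"

text \<open>The poles \<open>m v\<close> of the vertices and the normals \<open>n k\<close> of the opposite faces. The product of two unit
  spacelike poles is below \<open>-1\<close> if the truncation planes are ultraparallel, which leaves room for an edge of
  positive length, and it is \<open>-1\<close> if they meet at infinity.\<close>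
locale dual_frame =
  fixes I :: "4 set" and Z :: "4 set set" and m n :: "4 \<Rightarrow> minkowski"
  assumes ptt: "partially_truncated_tetrahedron I Z"
    and dual: "mink (m v) (n k) = (if v = k then 1 else 0)"
    and self: "mink (m v) (m v) = (if v \<in> I then 0 else 1)"
    and neg: "v \<noteq> w \<Longrightarrow> mink (m v) (m w) < 0"
    and le: "v \<noteq> w \<Longrightarrow> v \<notin> I \<Longrightarrow> w \<notin> I \<Longrightarrow> mink (m v) (m w) \<le> -1"
    and eq_iff: "v \<noteq> w \<Longrightarrow> v \<notin> I \<Longrightarrow> w \<notin> I \<Longrightarrow> mink (m v) (m w) = -1 \<longleftrightarrow> {v, w} \<in> Z"
begin

abbreviation "M v w \<equiv> mink (m v) (m w)"
abbreviation "X \<equiv> edge_vector m"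

text \<open>The cone over the polyhedron: the \<open>mink x (n k)\<close> are the coordinates of \<open>x\<close> in the basis \<open>m\<close>, and each
  non-ideal vertex is cut off.\<close>
definition K :: "minkowski set" where
  "K = {x. (\<forall>k. 0 \<le> mink x (n k)) \<and> (\<forall>v. v \<notin> I \<longrightarrow> mink x (m v) \<le> 0)}"

lemma nonideal_of_Z: "{v, w} \<in> Z \<Longrightarrow> v \<notin> I \<and> w \<notin> I"
  using ptt by (auto simp: partially_truncated_tetrahedron_def)

lemma disc_le: "v \<noteq> w \<Longrightarrow> M v v * M w w \<le> (M v w)\<^sup>2"
  and disc_Z: "{v, w} \<in> Z \<Longrightarrow> v \<noteq> w \<Longrightarrow> M v v * M w w = (M v w)\<^sup>2"
  and disc_strict: "v \<noteq> w \<Longrightarrow> {v, w} \<notin> Z \<Longrightarrow> M v v * M w w < (M v w)\<^sup>2"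
proof -
  have 1: "(M v w)\<^sup>2 \<ge> 1 \<and> ((M v w)\<^sup>2 = 1 \<longrightarrow> M v w = -1)" if "v \<noteq> w" "v \<notin> I" "w \<notin> I"
    using le[OF that] abs_le_square_iff[of 1 "M v w"] by (auto simp: power2_eq_1_iff)
  show a: "{v, w} \<in> Z \<Longrightarrow> v \<noteq> w \<Longrightarrow> M v v * M w w = (M v w)\<^sup>2"
    using nonideal_of_Z[of v w] eq_iff[of v w] by (simp add: self)
  show b: "v \<noteq> w \<Longrightarrow> {v, w} \<notin> Z \<Longrightarrow> M v v * M w w < (M v w)\<^sup>2"
    using 1 eq_iff[of v w] neg[of v w] by (cases "v \<in> I \<or> w \<in> I") (auto simp: self less_le)
  show "v \<noteq> w \<Longrightarrow> M v v * M w w \<le> (M v w)\<^sup>2"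
    using a b by (cases "{v, w} \<in> Z") (auto intro: less_imp_le)
qed

lemma dim_n: "dim (range n) = 4"
  using dim_dual[of UNIV m n] dual by simp

lemma dim_m: "dim (range m) = 4"
  using dim_dual[of UNIV n m] dual by (simp add: mink_commute)

lemma expand: "x = (\<Sum>k\<in>UNIV. mink x (n k) *\<^sub>R m k)"
proof -
  have "x - (\<Sum>k\<in>UNIV. mink x (n k) *\<^sub>R m k) = 0"
    by (rule mink_zeroI[of "range n"])
       (auto simp: dim_n mink_simps mink_sum_left dual if_distrib cong: if_cong)
  then show ?thesis by simp
qed

lemma expand_n: "x = (\<Sum>k\<in>UNIV. mink x (m k) *\<^sub>R n k)"
proof -
  have "x - (\<Sum>k\<in>UNIV. mink x (m k) *\<^sub>R n k) = 0"
    by (rule mink_zeroI[of "range m"])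
       (auto simp: dim_m mink_simps mink_sum_left dual mink_commute[of "n _"] if_distrib cong: if_cong)
  then show ?thesis by simp
qed

lemma mink_expand: "mink x y = (\<Sum>k\<in>UNIV. mink x (n k) * mink (m k) y)"
  by (subst expand[of x]) (simp add: mink_sum_left mink_simps)

lemma zero_iff_coords: "x = 0 \<longleftrightarrow> (\<forall>k. mink x (n k) = 0)"
  using expand[of x] by (auto simp: mink_simps)

lemma n_nonzero [simp]: "n k \<noteq> 0" and m_nonzero [simp]: "m k \<noteq> 0"
  using dual[of k k] by (auto simp: mink_simps)

lemma edge_vector_coord: "mink (X v w) (n k) = M v v * (if w = k then 1 else 0) - M v w * (if v = k then 1 else 0)"
  by (simp add: edge_vector_def mink_simps dual)

lemma edge_vector_self: "mink (X v w) (m v) = 0"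
  by (simp add: edge_vector_def mink_simps mink_commute[of "m w" "m v"])

lemma edge_vector_other_end: "mink (X v w) (m w) = M v v * M w w - (M v w)\<^sup>2"
  by (simp add: edge_vector_def mink_simps power2_eq_square)

lemma edge_vector_off_edge:
  assumes "distinct [v, w, u]" shows "mink (X v w) (m u) < 0"
proof -
  have "M v v * M w u \<le> 0" using neg[of w u] assms by (simp add: self)
  moreover have "M v w * M v u > 0" using neg assms by (simp add: mult_neg_neg)
  ultimately show ?thesis by (simp add: edge_vector_def mink_simps)
qed

lemma mink_m_le:
  assumes "v \<noteq> w" shows "mink (X v w) (m u) \<le> 0"
  using edge_vector_self edge_vector_other_end edge_vector_off_edge[of v w u] disc_le[OF assms] assms
  by (cases "u = v \<or> u = w") (auto intro: less_imp_le)

lemma edge_vector_coord_nonneg: "v \<noteq> w \<Longrightarrow> 0 \<le> mink (X v w) (n k)"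
  using neg[of v w] by (auto simp: edge_vector_coord self less_imp_le)

lemma edge_vector_in_K: "v \<noteq> w \<Longrightarrow> X v w \<in> K"
  by (simp add: K_def mink_m_le edge_vector_coord_nonneg)

lemma edge_vector_norm: "mink (X v w) (X v w) = M v v * (M v v * M w w - (M v w)\<^sup>2)"
proof -
  have "mink (X v w) (X v w) = M v v * mink (X v w) (m w) - M v w * mink (X v w) (m v)"
    by (subst (2) edge_vector_def) (simp add: mink_simps)
  then show ?thesis by (simp add: edge_vector_self edge_vector_other_end)
qed

lemma edge_vector_norm_le: "v \<noteq> w \<Longrightarrow> mink (X v w) (X v w) \<le> 0"
  using disc_le[of v w] by (simp add: edge_vector_norm mult_nonneg_nonpos self)

lemma edge_vector_cross: "mink (X v w) (X w v) = M v w * ((M v w)\<^sup>2 - M v v * M w w)"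
proof -
  have "mink (X v w) (X w v) = M w w * mink (X v w) (m v) - M w v * mink (X v w) (m w)"
    by (subst (2) edge_vector_def) (simp add: mink_simps)
  then show ?thesis by (simp add: edge_vector_self edge_vector_other_end mink_commute[of "m w" "m v"] algebra_simps)
qed

text \<open>For an ideal vertex the inequality is not imposed but follows, since its pole has nonpositive product with all poles.\<close>
lemma mink_m_le_K: "x \<in> K \<Longrightarrow> mink x (m v) \<le> 0"
proof (cases "v \<in> I")
  case True
  assume "x \<in> K"
  then have x: "0 \<le> mink x (n k)" for k by (simp add: K_def)
  have "mink x (n k) * M k v \<le> 0" for k
    using neg[of k v] x[of k] True by (cases "k = v") (auto simp: self mult_nonneg_nonpos)
  then show ?thesis unfolding mink_expand[of x "m v"] by (simp add: sum_nonpos)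
qed (simp add: K_def)

end

text \<open>The time direction is the part of the data that the Gram matrix does not see. It is fixed by
  asking that the edge vectors point to the future.\<close>
locale hyperideal_frame = dual_frame +
  assumes future: "v \<noteq> w \<Longrightarrow> 0 < snd (edge_vector m v w)"
begin

definition vert :: "4 \<Rightarrow> 4 \<Rightarrow> real^3" where "vert v w = proj (X v w)"

definition verts :: "4 set \<Rightarrow> (real^3) set" where
  "verts J = {vert v w | v w. v \<in> J \<and> w \<in> J \<and> v \<noteq> w}"

definition pol :: "(real^3) set" where "pol = {x \<in> H3. lift x \<in> K}"

definition face :: "4 set \<Rightarrow> (real^3) set" where
  "face J = {x \<in> pol. \<forall>k. k \<notin> J \<longrightarrow> mink (lift x) (n k) = 0}"

definition tri :: "4 \<Rightarrow> (real^3) set" where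
  "tri v = {x \<in> pol. mink (lift x) (m v) = 0}"

lemma mink_vert: "v \<noteq> w \<Longrightarrow> mink (lift (vert v w)) c = mink (X v w) c / snd (X v w)"
  using future[of v w] by (simp add: vert_def mink_proj)

lemma vert_in_cball: "v \<noteq> w \<Longrightarrow> vert v w \<in> cball 0 1"
  using future[of v w] edge_vector_norm_le[of v w] proj_in_cball[of "X v w"] unfolding vert_def by (metis less_irrefl)

lemma vert_in_K: "v \<noteq> w \<Longrightarrow> lift (vert v w) \<in> K"
  using future[of v w] edge_vector_in_K[of v w] by (auto simp: K_def mink_vert divide_nonpos_pos)

text \<open>On the truncation plane the coordinate of \<open>x\<close> along \<open>m v\<close> can be eliminated; the remaining
  coordinates of \<open>x\<close> are then its coefficients with respect to the edge vectors at \<open>v\<close>.\<close>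
lemma tri_cone:
  assumes x: "x \<in> K" "mink x (m v) = 0" "v \<notin> I" and J: "\<And>k. k \<notin> J \<Longrightarrow> mink x (n k) = 0"
  shows "x \<in> hcone (vert v ` (J - {v}))"
proof -
  have Mv: "M v v = 1" using x by (simp add: self)
  have "0 = (\<Sum>k\<in>UNIV. mink x (n k) * M k v)" using x mink_expand by metis
  also have "\<dots> = mink x (n v) + (\<Sum>k\<in>UNIV-{v}. mink x (n k) * M k v)"
    by (subst sum.remove[of _ v]) (auto simp: Mv)
  finally have xv: "mink x (n v) = - (\<Sum>k\<in>UNIV-{v}. mink x (n k) * M k v)" by simp
  have "x = mink x (n v) *\<^sub>R m v + (\<Sum>k\<in>UNIV-{v}. mink x (n k) *\<^sub>R m k)"
    by (subst expand, subst sum.remove[of _ v]) auto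
  also have "\<dots> = (\<Sum>k\<in>UNIV-{v}. mink x (n k) *\<^sub>R X v k)"
    unfolding xv edge_vector_def Mv
    by (simp add: scaleR_diff_right sum_subtractf scaleR_sum_left mink_commute)
  finally have e: "x = (\<Sum>k\<in>UNIV-{v}. mink x (n k) *\<^sub>R X v k)" .
  have "mink x (n k) *\<^sub>R X v k \<in> hcone (vert v ` (J - {v}))" if "k \<in> UNIV - {v}" for k
  proof (cases "k \<in> J")
    case True
    have "X v k \<in> hcone (vert v ` (J - {v}))"
      using True that future[of v k] by (intro hcone_vertex) (auto simp: vert_def)
    then show ?thesis using x(1) by (intro hcone_scale) (auto simp: K_def)
  qed (simp add: J)
  then show ?thesis by (subst e) (rule hcone_sum)
qed

lemma verts_mono: "J \<subseteq> J' \<Longrightarrow> verts J \<subseteq> verts J'"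
  by (auto simp: verts_def)

text \<open>Every vector of a face of the cone is a nonnegative combination of edge vectors. For an edge this
  is solved explicitly. Otherwise subtract the largest multiple of the sum \<open>u\<close> of all edge vectors of the
  face that stays in the cone; what remains lies in a smaller face or on a truncation plane.\<close>
lemma face_cone:
  assumes "card J \<ge> 2" "x \<in> K" "\<And>k. k \<notin> J \<Longrightarrow> mink x (n k) = 0"
  shows "x \<in> hcone (verts J)"
  using assms
proof (induction "card J" arbitrary: J x rule: less_induct)
  case less
  show ?case
  proof (cases "card J = 2")
    case True
    then obtain v w where J: "J = {v, w}" "v \<noteq> w" by (meson card_2_iff)
    define s t where "s = mink x (n v)" "t = mink x (n w)"
    have "x = (\<Sum>k\<in>{v, w}. mink x (n k) *\<^sub>R m k)"
      by (subst expand, rule sum.mono_neutral_right) (use less.prems J in auto)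
    then have x: "x = s *\<^sub>R m v + t *\<^sub>R m w" using J by (simp add: s_t_def)
    have V: "X v w \<in> hcone (verts J)" "X w v \<in> hcone (verts J)"
      using J future[of v w] future[of w v] by (auto intro!: hcone_vertex simp: verts_def vert_def)
    define a b where "a = - mink x (m w)" "b = - mink x (m v)"
    have ab: "a \<ge> 0" "b \<ge> 0" using mink_m_le_K[OF less.prems(2)] by (auto simp: a_b_def)
    show ?thesis
    proof (cases "{v, w} \<in> Z")
      case True
      have "M v w = -1" "M v v = 1" "M w w = 1" using eq_iff[of v w] nonideal_of_Z[OF True] True J by (auto simp: self)
      then have "s = t" "X v w = m v + m w" using ab x unfolding a_b_def edge_vector_def
        by (auto simp: mink_simps mink_commute[of "m w" "m v"])
      then have "x = s *\<^sub>R X v w" using x by (simp add: scaleR_add_right)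
      moreover have "s \<ge> 0" using less.prems(2) by (simp add: K_def s_t_def)
      ultimately show ?thesis using V hcone_scale by simp
    next
      case False
      define D where "D = (M v w)\<^sup>2 - M v v * M w w"
      have D: "D > 0" using disc_strict[OF J(2) False] by (simp add: D_def)
      have ab': "a = - (s * M v w + t * M w w)" "b = - (s * M v v + t * M v w)"
        unfolding a_b_def x by (simp_all add: mink_simps mink_commute[of "m w" "m v"])
      have "a *\<^sub>R X v w + b *\<^sub>R X w v = (a * M v v - b * M v w) *\<^sub>R m w + (b * M w w - a * M v w) *\<^sub>R m v"
        unfolding edge_vector_def mink_commute[of "m w" "m v"] by (simp add: algebra_simps)
      also have "a * M v v - b * M v w = D * t" unfolding ab' D_def by (simp add: algebra_simps power2_eq_square)
      also have "b * M w w - a * M v w = D * s" unfolding ab' D_def by (simp add: algebra_simps power2_eq_square)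
      finally have "a *\<^sub>R X v w + b *\<^sub>R X w v = D *\<^sub>R x" unfolding x by (simp add: algebra_simps)
      then have "x = (1 / D) *\<^sub>R (a *\<^sub>R X v w + b *\<^sub>R X w v)" using D by simp
      then show ?thesis using V ab D by (metis hcone_add hcone_scale less_imp_le zero_le_divide_1_iff)
    qed
  next
    case False
    then have c3: "card J \<ge> 3" using less.prems by simp
    define u where "u = (\<Sum>(v,w)\<in>{(v,w). v \<in> J \<and> w \<in> J \<and> v \<noteq> w}. X v w)"
    \<comment> \<open>The constraints of the face, with \<open>Inl k\<close> for the normal \<open>n k\<close> and \<open>Inr v\<close> for the truncation at \<open>v\<close>.\<close>
    define g where "g c = (case c of Inl k \<Rightarrow> n k | Inr v \<Rightarrow> - m v)" for c :: "4 + 4"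
    define G where "G = (Inl ` J :: (4 + 4) set) \<union> Inr ` (- I)"
    have gX: "mink (X v w) (g c) \<ge> 0" if "v \<noteq> w" for v w c
      using that mink_m_le edge_vector_coord_nonneg by (auto simp: g_def mink_simps split: sum.split)
    have gu: "mink u (g c) \<ge> 0" for c
      unfolding u_def mink_sum_left by (rule sum_nonneg) (auto simp: gX)
    obtain v w where vw: "v \<in> J" "w \<in> J" "v \<noteq> w"
      by (metis c3 card_le_Suc0_iff_eq finite_class.finite_UNIV finite_subset not_less_eq_eq numeral_2_eq_2 less.prems(1) subset_UNIV)
    have fin: "finite {(v,w). v \<in> J \<and> w \<in> J \<and> v \<noteq> w}" by (rule finite_subset[of _ UNIV]) auto
    have "mink u (n v) > 0"
      unfolding u_def mink_sum_left using vw neg[of v w]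
      by (intro sum_pos2[OF fin, of "(v, w)"]) (auto simp: edge_vector_coord_nonneg edge_vector_coord self intro!: less_imp_le[OF neg])
    then have ex: "\<exists>c\<in>G. mink u (g c) > 0" using vw by (intro bexI[of _ "Inl v"]) (auto simp: G_def g_def)
    have gx: "mink x (g c) \<ge> 0" if "c \<in> G" for c
      using that less.prems(2) by (auto simp: G_def g_def K_def mink_simps)
    obtain t where t: "t \<ge> 0" "\<forall>c\<in>G. mink x (g c) - t * mink u (g c) \<ge> 0" "\<exists>c\<in>G. mink x (g c) - t * mink u (g c) = 0"
      using min_ratio[of G "\<lambda>c. mink x (g c)" "\<lambda>c. mink u (g c)"] gx ex gu 
      by (auto simp: not_less[symmetric])
    define y where "y = x - t *\<^sub>R u"
    have yg: "mink y (g c) = mink x (g c) - t * mink u (g c)" for c by (simp add: y_def mink_simps)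
    have uJ: "mink u (n k) = 0" if "k \<notin> J" for k
      unfolding u_def mink_sum_left using that by (intro sum.neutral) (auto simp: edge_vector_coord)
    have yJ: "mink y (n k) = 0" if "k \<notin> J" for k
      using uJ that less.prems(3) by (simp add: y_def mink_simps)
    have yK: "y \<in> K"
    proof -
      have "0 \<le> mink y (n k)" for k
      proof (cases "k \<in> J")
        case True
        then have "Inl k \<in> G" by (simp add: G_def)
        then have "mink x (g (Inl k)) - t * mink u (g (Inl k)) \<ge> 0" using t(2) by blast
        then show ?thesis using yg[of "Inl k"] by (simp add: g_def)
      qed (simp add: yJ)
      moreover have "mink y (m v) \<le> 0" if "v \<notin> I" for v
      proof -
        have "Inr v \<in> G" using that by (simp add: G_def)
        then have "mink x (g (Inr v)) - t * mink u (g (Inr v)) \<ge> 0" using t(2) by blast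
        then show ?thesis using yg[of "Inr v"] by (simp add: g_def mink_simps)
      qed
      ultimately show ?thesis by (simp add: K_def)
    qed
    have "y \<in> hcone (verts J)"
    proof -
      obtain c where c: "c \<in> G" "mink y (g c) = 0" using t(3) yg by auto
      show ?thesis
      proof (cases c)
        case (Inl k)
        then have k: "k \<in> J" "mink y (n k) = 0" using c by (auto simp: G_def g_def)
        have "y \<in> hcone (verts (J - {k}))"
        proof (rule less.hyps)
          show "card (J - {k}) < card J" using k by (intro card_Diff1_less) auto
          show "2 \<le> card (J - {k})" using k c3 by (simp add: card_Diff_singleton)
          fix i assume "i \<notin> J - {k}"
          then show "mink y (n i) = 0" using k yJ by (cases "i = k") auto
        qed (rule yK)
        then show ?thesis using hcone_mono[OF verts_mono[of "J - {k}" J]] by blast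
      next
        case (Inr v)
        then have v: "v \<notin> I" "mink y (m v) = 0" using c by (auto simp: G_def g_def mink_simps)
        have "y \<in> hcone (vert v ` (J - {v}))" by (rule tri_cone[OF yK v(2,1) yJ])
        show ?thesis
        proof (cases "v \<in> J")
          case True
          then have "vert v ` (J - {v}) \<subseteq> verts J" by (auto simp: verts_def)
          then show ?thesis using hcone_mono \<open>y \<in> hcone (vert v ` (J - {v}))\<close> by blast
        next
          case False
          have "mink y (n k) * M k v \<le> 0" for k
            using yK neg[of k v] yJ[OF False] by (cases "k = v") (auto simp: K_def mult_nonneg_nonpos)
          then have "mink y (n k) * M k v = 0" for k
            using v(2) sum_nonneg_eq_0_iff[of UNIV "\<lambda>k. - (mink y (n k) * M k v)"] unfolding mink_expand[of y "m v"]
            by (simp add: sum_negf)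
          then have "mink y (n k) = 0" for k using neg[of k v] yJ[OF False] by (cases "k = v") (auto, metis less_irrefl)
          then show ?thesis using zero_iff_coords[of y] by simp
        qed
      qed
    qed
    moreover have "u \<in> hcone (verts J)"
      unfolding u_def by (rule hcone_sum) (auto intro!: hcone_vertex future simp: verts_def vert_def)
    moreover have "x = y + t *\<^sub>R u" by (simp add: y_def)
    ultimately show ?thesis using hcone_add hcone_scale t(1) by metis
  qed
qed

lemma convex_in_K: "convex {x. lift x \<in> K}"
proof -
  have "{x. lift x \<in> K} = (\<Inter>k. {x. mink (lift x) (n k) \<ge> 0}) \<inter> (\<Inter>v\<in>-I. {x. mink (lift x) (m v) \<le> 0})"
    by (auto simp: K_def)
  then show ?thesis by (simp only:) (intro convex_Int convex_INT convex_mink_ge convex_mink_le)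
qed

lemma face_eq_hhull:
  assumes "card J \<ge> 2" shows "face J = hhull (verts J)"
proof
  show "face J \<subseteq> hhull (verts J)"
    using face_cone[OF assms, of "lift _"] unfolding lift_hcone by (auto simp: face_def pol_def hhull_def)
  have "convex hull verts J \<subseteq> {x. lift x \<in> K} \<inter> (\<Inter>k\<in>-J. {x. mink (lift x) (n k) = 0})"
    by (intro hull_minimal convex_Int convex_INT convex_mink_eq convex_in_K)
       (auto simp: verts_def vert_in_K mink_vert edge_vector_coord)
  then show "hhull (verts J) \<subseteq> face J" by (auto simp: hhull_def face_def pol_def)
qed

lemma tri_face_eq_hhull:
  assumes "v \<notin> I" "v \<in> J" shows "tri v \<inter> face J = hhull (vert v ` (J - {v}))"
proof
  show "tri v \<inter> face J \<subseteq> hhull (vert v ` (J - {v}))"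
    using tri_cone[of "lift _" v J] assms unfolding lift_hcone by (auto simp: face_def tri_def pol_def hhull_def)
  have "convex hull (vert v ` (J - {v})) \<subseteq> {x. lift x \<in> K} \<inter> (\<Inter>k\<in>-J. {x. mink (lift x) (n k) = 0}) \<inter> {x. mink (lift x) (m v) = 0}"
    using assms(2) by (intro hull_minimal convex_Int convex_INT convex_mink_eq convex_in_K)
       (auto simp: vert_in_K mink_vert edge_vector_coord edge_vector_self)
  then show "hhull (vert v ` (J - {v})) \<subseteq> tri v \<inter> face J" by (auto simp: hhull_def face_def pol_def tri_def)
qed

lemma face_UNIV: "face UNIV = pol"
  by (simp add: face_def)

lemma tri_eq_hhull: "v \<notin> I \<Longrightarrow> tri v = hhull (vert v ` (- {v}))"
  using tri_face_eq_hhull[of v UNIV] by (auto simp: face_UNIV tri_def Compl_eq_Diff_UNIV)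

text \<open>The end of an edge is characterized by orthogonality relations; this identifies it in whatever form it appears.\<close>
lemma vert_unique:
  assumes "v \<noteq> w" and x: "\<And>k. k \<noteq> v \<Longrightarrow> k \<noteq> w \<Longrightarrow> mink (lift x) (n k) = 0"
    and "v \<notin> I \<Longrightarrow> mink (lift x) (m v) = 0" "v \<in> I \<Longrightarrow> mink (lift x) (n w) = 0"
  shows "x = vert v w"
proof -
  define s t where "s = mink (lift x) (n v)" "t = mink (lift x) (n w)"
  have "lift x = (\<Sum>k\<in>{v, w}. mink (lift x) (n k) *\<^sub>R m k)"
    by (subst expand, rule sum.mono_neutral_right) (use x in auto)
  then have e: "lift x = s *\<^sub>R m v + t *\<^sub>R m w" using assms(1) by (simp add: s_t_def)
  show ?thesis
  proof (cases "v \<in> I")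
    case True
    then have "lift x = (- s / M v w) *\<^sub>R X v w"
      using e assms(4) neg[OF assms(1)] by (simp add: edge_vector_def self s_t_def)
    then show ?thesis unfolding vert_def by (rule proj_eqI[symmetric])
  next
    case False
    then have "s + t * M v w = 0" using assms(3) e by (simp add: mink_simps self mink_commute[of "m w" "m v"])
    then have "s = - t * M v w" by simp
    then have "lift x = t *\<^sub>R X v w" using False e by (simp add: edge_vector_def self scaleR_diff_right)
    then show ?thesis unfolding vert_def by (rule proj_eqI[symmetric])
  qed
qed

lemma finite_verts: "finite (verts J)"
proof -
  have "verts J = (\<lambda>(v, w). vert v w) ` {(v, w). v \<in> J \<and> w \<in> J \<and> v \<noteq> w}" by (auto simp: verts_def)
  then show ?thesis by simp
qed

lemma verts_in_cball: "verts J \<subseteq> cball 0 1"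
  using vert_in_cball by (auto simp: verts_def simp del: mem_cball_0)

text \<open>The ends span the plane of the face: if a functional that vanishes on them does not vanish on one pole of the
  face, then its values on the three poles have pairwise opposite signs, which is impossible. Each end
  is extreme because it is the only one with the orthogonality relations of the lemma \<open>vert_unique\<close>.\<close>
lemma hexagon_polygon: "geodesic_polygon (verts (- {k})) (face (- {k}))"
proof -
  have "card (- {k}) = 3" by (simp add: card_Diff_singleton Compl_eq_Diff_UNIV)
  then have face: "face (- {k}) = hhull (verts (- {k}))" by (intro face_eq_hhull) simp
  have ad: "aff_dim (verts (- {k})) = 2"
  proof (rule aff_dim_eq_2I[of _ "n k"])
    obtain a where "a \<noteq> k" by (metis (full_types) zero_neq_one)
    then obtain b c where "distinct [k, a, b, c]" using complete_4 by metis
    then have "vert a b \<in> verts (- {k})" by (auto simp: verts_def)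
    then show "verts (- {k}) \<noteq> {}" by blast
    show "mink (lift x) (n k) = 0" if "x \<in> verts (- {k})" for x
      using that by (auto simp: verts_def mink_vert edge_vector_coord)
    fix c assume c: "\<And>x. x \<in> verts (- {k}) \<Longrightarrow> mink (lift x) c = 0"
    have Xc: "M v v * mink (m w) c = M v w * mink (m v) c" if "v \<noteq> w" "v \<noteq> k" "w \<noteq> k" for v w
    proof -
      have "mink (lift (vert v w)) c = 0" by (rule c) (use that in \<open>auto simp: verts_def\<close>)
      then have "mink (X v w) c = 0" using that future[of v w] by (simp add: mink_vert)
      then show ?thesis by (simp add: edge_vector_def mink_simps)
    qed
    have opp: "M v v = 1 \<and> mink (m w) c * mink (m v) c < 0" if "v \<noteq> w" "v \<noteq> k" "w \<noteq> k" "mink (m v) c \<noteq> 0" for v w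
    proof -
      have "M v v = 1" using Xc[OF that(1-3)] neg[OF that(1)] that(4) by (auto simp: self split: if_splits)
      then have "mink (m w) c * mink (m v) c = M v w * (mink (m v) c)\<^sup>2" using Xc[OF that(1-3)] by (simp add: power2_eq_square)
      also have "\<dots> < 0" using neg[OF that(1)] that(4) by (simp add: mult_neg_pos)
      finally show ?thesis using \<open>M v v = 1\<close> by simp
    qed
    have "mink (m v) c = 0" if vk: "v \<noteq> k" for v
    proof (rule ccontr)
      assume nz: "mink (m v) c \<noteq> 0"
      obtain w u where d: "distinct [v, k, w, u]" using complete_4[OF vk] by metis
      have "mink (m w) c * mink (m v) c < 0" "mink (m u) c * mink (m v) c < 0" using opp[of v w] opp[of v u] d nz by auto
      moreover from this have "mink (m u) c * mink (m w) c < 0" using opp[of w u] d by (cases "mink (m w) c = 0") auto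
      ultimately show False by (auto simp: mult_less_0_iff)
    qed
    then have "c = mink c (m k) *\<^sub>R n k"
      by (subst expand_n, subst sum.remove[of _ k]) (auto simp: mink_commute[of c])
    then show "\<exists>t. c = t *\<^sub>R n k" by blast
  qed simp
  have ex: "x \<notin> convex hull (verts (- {k}) - {x})" if x: "x \<in> verts (- {k})" for x
  proof -
    obtain v w where vw: "x = vert v w" "v \<noteq> k" "w \<noteq> k" "v \<noteq> w" using x by (auto simp: verts_def)
    obtain u where u: "distinct [v, w, k, u]" "UNIV = {v, w, k, u}"
    proof -
      obtain k' l' where "distinct [v, w, k', l']" "UNIV = {v, w, k', l'}" using complete_4[OF vw(4)] by metis
      moreover have "k = k' \<or> k = l'" using calculation(2) vw by auto
      ultimately show ?thesis using that[of l'] that[of k'] by (auto simp: insert_commute)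
    qed
    \<comment> \<open>A sum of functionals that are nonnegative on the face; their common zero is the vertex.\<close>
    define c where "c = n u + (if v \<in> I then n w else - m v)"
    show ?thesis
    proof (rule not_in_convex_hull_others)
      show "mink (lift x) c = 0"
        using u vw by (auto simp: c_def mink_simps mink_vert edge_vector_coord edge_vector_self self)
      fix y assume y: "y \<in> verts (- {k})" "y \<noteq> x"
      then obtain a b where ab: "y = vert a b" "a \<noteq> b" "a \<noteq> k" "b \<noteq> k" by (auto simp: verts_def)
      have yK: "lift y \<in> K" using vert_in_K ab by simp
      then have 0: "mink (lift y) (n u) \<ge> 0" "mink (lift y) (n w) \<ge> 0" "mink (lift y) (m v) \<le> 0"
        by (auto simp: K_def mink_m_le_K[OF yK])
      have yk: "mink (lift y) (n k) = 0" using ab by (simp add: mink_vert edge_vector_coord)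
      show "mink (lift y) c > 0"
      proof (rule ccontr)
        assume "\<not> mink (lift y) c > 0"
        then have "mink (lift y) (n u) = 0" "v \<in> I \<Longrightarrow> mink (lift y) (n w) = 0" "v \<notin> I \<Longrightarrow> mink (lift y) (m v) = 0"
          using 0 by (auto simp: c_def mink_simps split: if_splits)
        then have "y = vert v w" using u yk vw by (intro vert_unique) (metis UNIV_I insertE singletonD)+
        then show False using y vw by simp
      qed
    qed
  qed
  show ?thesis unfolding geodesic_polygon_def
    using finite_verts verts_in_cball ad ex face by blast
qed

lemma triangle_polygon:
  assumes "v \<notin> I"
  shows "geodesic_polygon (vert v ` (- {v})) (tri v)"
proof -
  have Mv: "M v v = 1" using assms by (simp add: self)
  have ad: "aff_dim (vert v ` (- {v})) = 2"
  proof (rule aff_dim_eq_2I[of _ "m v"])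
    obtain a where "a \<noteq> v" by (metis (full_types) zero_neq_one)
    then show "vert v ` (- {v}) \<noteq> {}" by auto
    show "mink (lift x) (m v) = 0" if x: "x \<in> vert v ` (- {v})" for x
    proof -
      obtain w where "x = vert v w" "v \<noteq> w" using x by auto
      then show ?thesis by (simp add: mink_vert edge_vector_self)
    qed
    fix c assume c: "\<And>x. x \<in> vert v ` (- {v}) \<Longrightarrow> mink (lift x) c = 0"
    have Xc: "mink (m w) c = M v w * mink (m v) c" if "v \<noteq> w" for w
    proof -
      have "mink (lift (vert v w)) c = 0" by (rule c) (use that in auto)
      then have "mink (X v w) c = 0" using that future[of v w] by (simp add: mink_vert)
      then show ?thesis by (simp add: edge_vector_def mink_simps Mv)
    qed
    have "c - mink (m v) c *\<^sub>R m v = 0"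
    proof (rule mink_zeroI[of "range m"])
      fix s assume "s \<in> range m"
      then obtain w where w: "s = m w" by blast
      show "mink (c - mink (m v) c *\<^sub>R m v) s = 0"
        using Xc[of w] by (cases "w = v") (auto simp: w mink_simps Mv mink_commute[of c])
    qed (simp add: dim_m)
    then show "\<exists>t. c = t *\<^sub>R m v" by (metis eq_iff_diff_eq_0)
  qed simp
  have ex: "x \<notin> convex hull (vert v ` (- {v}) - {x})" if x: "x \<in> vert v ` (- {v})" for x
  proof -
    obtain w where w: "x = vert v w" "v \<noteq> w" using x by auto
    obtain k l where kl: "distinct [v, w, k, l]" "UNIV = {v, w, k, l}" using complete_4[OF w(2)] by metis
    show ?thesis
    proof (rule not_in_convex_hull_others)
      show "mink (lift x) (n k + n l) = 0" using kl w by (auto simp: mink_simps mink_vert edge_vector_coord)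
      fix y assume "y \<in> vert v ` (- {v})" "y \<noteq> x"
      then obtain u where "y = vert v u" "u \<noteq> v" "u \<noteq> w" using w by auto
      moreover from this have "u = k \<or> u = l" using kl by blast
      ultimately show "mink (lift y) (n k + n l) > 0" using kl future[of v u]
        by (auto simp: mink_simps mink_vert edge_vector_coord Mv)
    qed
  qed
  have "vert v ` (- {v}) \<subseteq> cball 0 1" using vert_in_cball[of v] by (metis ComplD image_subsetI singletonI)
  then show ?thesis unfolding geodesic_polygon_def
    using ad ex tri_eq_hhull[OF assms] by simp
qed

text \<open>A non-missing edge contains points of hyperbolic space.\<close>
lemma timelike_pair:
  assumes "v \<noteq> w" "{v, w} \<notin> Z"
  shows "mink (X v w + X w v) (X v w + X w v) < 0"
proof -
  have "M v w * ((M v w)\<^sup>2 - M v v * M w w) < 0"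
    using disc_strict[OF assms] neg[OF assms(1)] by (simp add: mult_neg_pos)
  then have "mink (X v w) (X w v) < 0" by (simp add: edge_vector_cross)
  then show ?thesis
    using edge_vector_norm_le[of v w] edge_vector_norm_le[of w v] assms(1)
    by (simp add: mink_simps mink_commute[of "X w v" "X v w"])
qed

lemma n_spacelike: "mink (n k) (n k) > 0"
proof -
  obtain a where "k \<noteq> a" by (metis (full_types) zero_neq_one)
  then obtain b c where d: "distinct [k, a, b, c]" using complete_4 by metis
  \<comment> \<open>It suffices to find a timelike vector orthogonal to \<open>n k\<close>. If all edges of the face have length 0, no edge
  provides one, but the sum of the three poles is timelike.\<close>
  show ?thesis
  proof (cases "{a, b} \<in> Z \<and> {b, c} \<in> Z \<and> {a, c} \<in> Z")
    case True
    then have "M a b = -1" "M b c = -1" "M a c = -1" "M a a = 1" "M b b = 1" "M c c = 1"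
      using nonideal_of_Z eq_iff d by (auto simp: self)
    then have "mink (m a + m b + m c) (m a + m b + m c) < 0"
      by (simp add: mink_simps mink_commute[of "m b" "m a"] mink_commute[of "m c" "m a"] mink_commute[of "m c" "m b"])
    then show ?thesis by (rule timelike_orthogonal) (use d in \<open>auto simp: mink_simps dual\<close>)
  next
    case False
    then obtain v w where vw: "v \<noteq> w" "v \<noteq> k" "w \<noteq> k" "{v, w} \<notin> Z"
      using d by (metis distinct_length_2_or_more)
    show ?thesis
      by (rule timelike_orthogonal[OF timelike_pair[OF vw(1,4)]]) (use vw in \<open>auto simp: mink_simps edge_vector_coord\<close>)
  qed
qed

text \<open>The planes of two faces that share a non-missing edge intersect in hyperbolic space: both normals are orthogonal to a
  timelike vector on the edge, so their span is positive definite.\<close>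
lemma normals_not_asymptotic:
  assumes d: "distinct [v, w, k, l]" and "{v, w} \<notin> Z"
  shows "(mink (n k) (n l))\<^sup>2 < mink (n k) (n k) * mink (n l) (n l)"
proof -
  define A B C where "A = mink (n k) (n k)" "B = mink (n l) (n l)" "C = mink (n k) (n l)"
  define c where "c = A *\<^sub>R n l - C *\<^sub>R n k"
  have A: "A > 0" using n_spacelike by (simp add: A_B_C_def)
  have "mink (m l) c = A" using d by (auto simp: c_def mink_simps dual)
  then have "c \<noteq> 0" using A by (auto simp: mink_simps)
  have "mink c c > 0"
    by (rule timelike_orthogonal[OF timelike_pair[of v w]])
       (use d assms(2) \<open>c \<noteq> 0\<close> in \<open>auto simp: c_def mink_simps edge_vector_coord\<close>)
  also have "mink c c = A * (A * B - C\<^sup>2)"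
    by (simp add: c_def mink_simps mink_commute[of "n l" "n k"] flip: A_B_C_def) (simp add: algebra_simps power2_eq_square)
  finally show ?thesis using A by (simp add: zero_less_mult_iff flip: A_B_C_def)
qed

text \<open>The edge does not order the two faces adjacent to it, hence the definite description over both orders.\<close>
definition ang :: "4 set \<Rightarrow> real" where
  "ang e = (if e \<in> edges then (THE a. \<forall>k l. - e = {k, l} \<longrightarrow>
     a = arccos (- mink (n k) (n l) / sqrt (mink (n k) (n k) * mink (n l) (n l)))) else undefined)"

lemma Compl_edge: "distinct [v, w, k, l :: 4] \<Longrightarrow> - {v, w} = {k, l}"
  using UNIV_4[of v w k l] by auto

lemma ang_eq:
  assumes "distinct [v, w, k, l]"
  shows "ang {v, w} = arccos (- mink (n k) (n l) / sqrt (mink (n k) (n k) * mink (n l) (n l)))"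
proof -
  have "{v, w} \<in> edges" using assms by (simp add: edges_def)
  moreover have "- {v, w} = {k, l}" using Compl_edge[OF assms] .
  ultimately show ?thesis unfolding ang_def
    by (simp, intro the_equality) (auto simp: doubleton_eq_iff mink_commute[of "n l" "n k"] mult.commute)
qed

lemma verts_pair: "v \<noteq> w \<Longrightarrow> verts {v, w} = {vert v w, vert w v}"
  by (auto simp: verts_def)

lemma vert_distinct:
  assumes "v \<noteq> w" "{v, w} \<notin> Z" shows "vert v w \<noteq> vert w v"
proof
  assume "vert v w = vert w v"
  then have "mink (X v w) (m w) / snd (X v w) = mink (X w v) (m w) / snd (X w v)" using mink_vert assms(1) by metis
  then show False using edge_vector_self edge_vector_other_end disc_strict[OF assms] future[OF assms(1)] by simp
qed

lemma face_dihedral_angle: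
  assumes d: "distinct [v, w, k, l]" and "{v, w} \<notin> Z"
  shows "has_dihedral_angle (face {v, w}) (face (- {k})) (face (- {l})) (ang {v, w})"
proof -
  have E: "face {v, w} = hhull {vert v w, vert w v}" using face_eq_hhull[of "{v, w}"] verts_pair d by simp
  obtain p q where pq: "p \<noteq> q" "p \<in> face {v, w}" "q \<in> face {v, w}"
    using two_points_in_hhull[of "vert v w" "vert w v"] vert_in_cball vert_distinct assms E by (metis distinct_length_2_or_more)
  show ?thesis unfolding ang_eq[OF d]
  proof (rule dihedral_angle_normals[where ?e1.0 = p and ?e2.0 = q])
    show "face {v, w} \<subseteq> H3" by (auto simp: face_def pol_def)
  qed (use pq d n_spacelike normals_not_asymptotic[OF assms] in \<open>auto simp: face_def pol_def K_def\<close>)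
qed

lemma triangle_hexagon_angle:
  assumes "v \<notin> I" "k \<noteq> v"
  shows "has_dihedral_angle (tri v \<inter> face (- {k})) (tri v) (face (- {k})) (pi / 2)"
proof -
  obtain a b where d: "distinct [v, k, a, b]" using complete_4 assms(2) by metis
  have "- {k} - {v} = {a, b}" using Compl_edge[of v k a b] d by auto
  then have E: "tri v \<inter> face (- {k}) = hhull {vert v a, vert v b}" using tri_face_eq_hhull[of v "- {k}"] assms by auto
  have "mink (lift (vert v a)) (n a) > 0" "mink (lift (vert v b)) (n a) = 0"
    using d assms future[of v a] by (auto simp: mink_vert edge_vector_coord self)
  then have "vert v a \<noteq> vert v b" by auto
  then obtain p q where pq: "p \<noteq> q" "p \<in> tri v \<inter> face (- {k})" "q \<in> tri v \<inter> face (- {k})"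
    using two_points_in_hhull[of "vert v a" "vert v b"] vert_in_cball d E by (metis distinct_length_2_or_more)
  have "has_dihedral_angle (tri v \<inter> face (- {k})) (tri v) (face (- {k})) (arccos (- mink (- m v) (n k) / sqrt (mink (- m v) (- m v) * mink (n k) (n k))))"
  proof (rule dihedral_angle_normals[where ?e1.0 = p and ?e2.0 = q])
    show "tri v \<inter> face (- {k}) \<subseteq> H3" by (auto simp: face_def pol_def)
  qed (use pq assms n_spacelike in \<open>auto simp: face_def tri_def pol_def K_def mink_simps self dual\<close>)
  then show ?thesis using assms by (simp add: mink_simps dual)
qed

section \<open>The dihedral angles of a frame\<close>

lemma gram_inverse: "(\<Sum>j\<in>UNIV. M i j * mink (n j) (n k)) = (if i = k then 1 else 0)"
proof -
  have "mink (m i) (n k) = mink (\<Sum>j\<in>UNIV. mink (m i) (m j) *\<^sub>R n j) (n k)" using expand_n[of "m i"] by simp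
  then show ?thesis by (simp add: mink_sum_left mink_simps dual)
qed

text \<open>The cosine of the angle between the normals, and minus the cosine of the dihedral angle.\<close>
definition norm_gram :: "4 \<Rightarrow> 4 \<Rightarrow> real" where
  "norm_gram k l = mink (n k) (n l) / (sqrt (mink (n k) (n k)) * sqrt (mink (n l) (n l)))"

lemma ang_norm_gram: "distinct [v, w, k, l] \<Longrightarrow> ang {v, w} = arccos (- norm_gram k l)"
  using ang_eq[of v w k l] by (simp add: norm_gram_def real_sqrt_mult)

text \<open>Normalizing \<open>n k\<close> to length \<open>1\<close> and rescaling \<open>m k\<close> inversely keeps the two bases dual and all signs, so the
  algebra of inverse Gram matrices applies.\<close>
lemma norm_gram_facts:
  assumes d: "distinct [v, a, b, c]"
  shows "{v, a} \<in> Z \<Longrightarrow> norm_gram b c = -1" "{v, a} \<notin> Z \<Longrightarrow> (norm_gram b c)\<^sup>2 < 1"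
    "- norm_gram a c + norm_gram a b * norm_gram b c > 0"
    "v \<notin> I \<Longrightarrow> gram_det (- norm_gram a b) (- norm_gram a c) (- norm_gram b c) < 0"
    "v \<in> I \<Longrightarrow> gram_det (- norm_gram a b) (- norm_gram a c) (- norm_gram b c) = 0"
proof -
  define s where "s k = sqrt (mink (n k) (n k))" for k
  have s: "s k > 0" "s k * s k = mink (n k) (n k)" for k using n_spacelike[of k] by (auto simp: s_def)
  define Mh where "Mh v w = s v * s w * M v w" for v w
  have norm_gram: "norm_gram k l = mink (n k) (n l) / (s k * s l)" for k l by (simp add: norm_gram_def s_def)
  have strict: "(norm_gram b c)\<^sup>2 < 1" if "{v, a} \<notin> Z" "distinct [v, a, b, c]" for v a b c
  proof -
    have "(s b * s c)\<^sup>2 = (s b * s b) * (s c * s c)" by (simp add: power2_eq_square)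
    then have "(mink (n b) (n c))\<^sup>2 < (s b * s c)\<^sup>2" using normals_not_asymptotic[OF that(2,1)] by (simp only: s(2))
    then show ?thesis using s[of b] s[of c] by (simp add: norm_gram power_divide divide_less_eq)
  qed
  have inv: "Mh i v * norm_gram v k + Mh i a * norm_gram a k + Mh i b * norm_gram b k + Mh i c * norm_gram c k = (if i = k then 1 else 0)"
    if d: "distinct [v, a, b, c]" for i k v a b c
  proof -
    have t: "Mh i j * norm_gram j k = (s i / s k) * (M i j * mink (n j) (n k))" for j
      using s(1)[of j] by (simp add: Mh_def norm_gram field_simps)
    have "Mh i v * norm_gram v k + Mh i a * norm_gram a k + Mh i b * norm_gram b k + Mh i c * norm_gram c k = (s i / s k) * (\<Sum>j\<in>UNIV. M i j * mink (n j) (n k))"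
      unfolding t sum_4[OF d] by (simp add: algebra_simps)
    then show ?thesis using gram_inverse[of i k] s(1)[of k] by simp
  qed
  have sym: "Mh i k = Mh k i" "norm_gram i k = norm_gram k i" for i k
    by (simp_all add: Mh_def norm_gram mink_commute mult.commute mult.left_commute)
  have one: "norm_gram k k = 1" for k using s(1)[of k] by (simp add: norm_gram flip: s(2))
  have neg': "Mh v w < 0" if "v \<noteq> w" for v w using neg[OF that] s by (simp add: Mh_def mult_pos_neg)
  have nonneg: "Mh v v \<ge> 0" for v using s(1)[of v] by (auto simp: Mh_def self simp flip: s(2))
  have dm: "(Mh v a)\<^sup>2 - Mh v v * Mh a a = (s v * s a)\<^sup>2 * ((M v a)\<^sup>2 - M v v * M a a)" for v a
    by (simp add: Mh_def algebra_simps power2_eq_square)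
  have le': "Mh v v * Mh a a \<le> (Mh v a)\<^sup>2" if "v \<noteq> a" for v a
  proof -
    have "(s v * s a)\<^sup>2 * ((M v a)\<^sup>2 - M v v * M a a) \<ge> 0" using disc_le[OF that] by simp
    then show ?thesis using dm[of v a] by linarith
  qed
  have eq': "Mh v v * Mh a a = (Mh v a)\<^sup>2 \<longleftrightarrow> {v, a} \<in> Z" if "v \<noteq> a" for v a
  proof -
    have "Mh v v * Mh a a = (Mh v a)\<^sup>2 \<longleftrightarrow> (s v * s a)\<^sup>2 * ((M v a)\<^sup>2 - M v v * M a a) = 0" using dm[of v a] by auto
    also have "\<dots> \<longleftrightarrow> (M v a)\<^sup>2 - M v v * M a a = 0" using s(1)[of v] s(1)[of a] by simp
    also have "\<dots> \<longleftrightarrow> {v, a} \<in> Z" using disc_Z disc_strict that by fastforce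
    finally show ?thesis .
  qed
  have va: "v \<noteq> a" using d by simp
  have str: "Mh v v * Mh a a < (Mh v a)\<^sup>2 \<Longrightarrow> (norm_gram b c)\<^sup>2 < 1" using strict[OF _ d] eq'[OF va] by auto
  note G = gram_of_dual_basis[of v a b c Mh norm_gram, OF d inv[OF d] sym one neg' nonneg le'[OF va] str]
  show "{v, a} \<in> Z \<Longrightarrow> norm_gram b c = -1" using G(1) eq'[OF va] by simp
  show "{v, a} \<notin> Z \<Longrightarrow> (norm_gram b c)\<^sup>2 < 1" using strict d by blast
  show p: "- norm_gram a c + norm_gram a b * norm_gram b c > 0" by (rule G(2))
  have d': "distinct [v, a, c, b]" using d by auto
  have str': "Mh v v * Mh a a < (Mh v a)\<^sup>2 \<Longrightarrow> (norm_gram c b)\<^sup>2 < 1" using strict[OF _ d'] eq'[OF va] by auto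
  have p': "- norm_gram a b + norm_gram a c * norm_gram b c > 0"
    using gram_of_dual_basis(2)[of v a c b Mh norm_gram, OF d' inv[OF d'] sym one neg' nonneg le'[OF va] str'] sym(2)[of b c] by simp
  show "gram_det (- norm_gram a b) (- norm_gram a c) (- norm_gram b c) < 0" if "v \<notin> I"
    by (rule G(3)[OF _ _ _ p']) (use that s(1)[of v] in \<open>simp_all add: Mh_def self\<close>)
  show "gram_det (- norm_gram a b) (- norm_gram a c) (- norm_gram b c) = 0" if "v \<in> I"
    by (rule G(4)) (use that in \<open>simp_all add: Mh_def self\<close>)
qed

lemma norm_gram_sym: "norm_gram k l = norm_gram l k"
  by (simp add: norm_gram_def mink_commute mult.commute)

lemma cos_ang:
  assumes d: "distinct [v, w, k, l]"
  shows "cos (ang {v, w}) = - norm_gram k l" "0 \<le> ang {v, w}" "ang {v, w} < pi" "ang {v, w} = 0 \<longleftrightarrow> {v, w} \<in> Z"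
proof -
  have r: "-1 \<le> norm_gram k l" "norm_gram k l < 1" and z: "norm_gram k l = -1 \<longleftrightarrow> {v, w} \<in> Z"
    using norm_gram_facts(1,2)[OF d] by (cases "{v, w} \<in> Z"; force simp: abs_square_less_1 abs_less_iff)+
  show c: "cos (ang {v, w}) = - norm_gram k l" unfolding ang_norm_gram[OF d] using r by simp
  show g: "0 \<le> ang {v, w}" unfolding ang_norm_gram[OF d] using r by (intro arccos_lbound) auto
  have "ang {v, w} \<le> pi" unfolding ang_norm_gram[OF d] using r by (intro arccos_ubound) auto
  moreover have "ang {v, w} \<noteq> pi" using c r by auto
  ultimately show "ang {v, w} < pi" by simp
  have "ang {v, w} = 0 \<longleftrightarrow> - norm_gram k l = 1" using c g \<open>ang {v, w} < pi\<close> cos_inj_pi[of "ang {v, w}" 0] by auto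
  then show "ang {v, w} = 0 \<longleftrightarrow> {v, w} \<in> Z" using z by auto
qed

text \<open>The determinant condition at a vertex decides its angle sum, and the positivity of the mixed terms is
  what the trigonometric lemma needs.\<close>
lemma ang_in_angle_functions: "ang \<in> angle_functions I Z"
proof -
  have edge: "0 \<le> ang e \<and> ang e < pi \<and> (ang e = 0 \<longleftrightarrow> e \<in> Z)" if ee: "e \<in> edges" for e
  proof -
    obtain v w where e: "e = {v, w}" "v \<noteq> w" using ee unfolding edges_def card_2_iff by blast
    obtain k l where "distinct [v, w, k, l]" using complete_4[OF e(2)] by metis
    then show ?thesis using cos_ang e by blast
  qed
  have sum: "if v \<in> I then (\<Sum>e | e \<in> edges \<and> v \<in> e. ang e) = pi else (\<Sum>e | e \<in> edges \<and> v \<in> e. ang e) < pi" for v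
  proof -
    obtain a where "a \<noteq> v" by (metis (full_types) zero_neq_one)
    then obtain b c where d: "distinct [v, a, b, c]" using complete_4 by metis
    have d1: "distinct [v, a, b, c]" and d2: "distinct [v, b, a, c]" and d3: "distinct [v, c, a, b]" using d by auto
    note A = cos_ang[OF d1] and B = cos_ang[OF d2] and C = cos_ang[OF d3]
    have p1: "cos (ang {v, a}) + cos (ang {v, b}) * cos (ang {v, c}) > 0"
      using norm_gram_facts(3)[of v c a b] d not_sym unfolding A(1) B(1) C(1) by (auto simp add: norm_gram_sym[of c] mult.commute)
    have p2: "cos (ang {v, b}) + cos (ang {v, a}) * cos (ang {v, c}) > 0"
      using norm_gram_facts(3)[of v a b c] d unfolding A(1) B(1) C(1) by (simp add: mult.commute)
    have g: "gram_det (cos (ang {v, a})) (cos (ang {v, b})) (cos (ang {v, c})) = gram_det (- norm_gram a b) (- norm_gram a c) (- norm_gram b c)"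
      unfolding A(1) B(1) C(1) by (simp add: gram_det_def)
    show ?thesis
      unfolding sum_edges_at[OF d]
      using angle_sum_of_gram_det[OF A(2,3) B(2,3) C(2,3) p1 p2] norm_gram_facts(4,5)[OF d] g by simp
  qed
  have "ang \<in> edges \<rightarrow>\<^sub>E {0..<pi}" using edge by (auto simp: PiE_def extensional_def ang_def)
  then show ?thesis using edge sum unfolding angle_functions_def by (auto split: if_splits)
qed

end

section \<open>Existence of inward normals\<close>

lemma open_segment_subset_rel_interior_hhull:
  assumes "a \<in> cball 0 1" "b \<in> cball 0 1" "a \<noteq> b"
  shows "open_segment a b \<subseteq> rel_interior (hhull {a, b})"
proof -
  have 1: "open_segment a b \<subseteq> hhull {a, b}"
    using open_segment_in_H3[OF assms(1,2)] by (auto simp: hhull_def segment_convex_hull[symmetric] open_closed_segment simp del: mem_ball_0)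
  have 2: "hhull {a, b} \<subseteq> closed_segment a b" by (auto simp: hhull_def segment_convex_hull)
  have "affine hull (open_segment a b) = affine hull (closed_segment a b)"
    using assms(3) by (simp add: affine_hull_closed_segment affine_hull_open_segment)
  then have "affine hull (open_segment a b) = affine hull (hhull {a, b})"
    using hull_mono[OF 1, of affine] hull_mono[OF 2, of affine] by blast
  then have "rel_interior (open_segment a b) \<subseteq> rel_interior (hhull {a, b})" by (rule subset_rel_interior[OF 1])
  then show ?thesis using assms(3) by (simp add: rel_interior_open_segment)
qed

text \<open>Without an inward normal a statement about the dihedral angle would be vacuous. The component \<open>u\<close> of \<open>x - p\<close>
  perpendicular to the side may leave the polygon, but a short step along \<open>u\<close> is a convex
  combination of \<open>x\<close> and a point \<open>q\<close> of the side, as \<open>p\<close> is not an end of the side.\<close>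
lemma inward_normal_exists:
  assumes ab: "a \<in> cball 0 1" "b \<in> cball 0 1" "a \<noteq> b" and A: "convex A" "hhull {a, b} \<subseteq> A"
    and p: "p \<in> open_segment a b" and x: "x \<in> A" "mink (lift x) c \<noteq> 0" "mink (lift a) c = 0" "mink (lift b) c = 0"
  shows "\<exists>u. inward_normal (hhull {a, b}) A p u"
proof -
  have pH: "p \<in> H3" using open_segment_in_H3 ab p by blast
  obtain t where t: "0 < t" "t < 1" "p = (1 - t) *\<^sub>R a + t *\<^sub>R b" using p by (auto simp: in_segment)
  define d where "d = b - a"
  have d: "hmetric p d d > 0" using hmetric_pos[OF pH] ab by (simp add: d_def)
  define e where "e = hmetric p (x - p) d / hmetric p d d"
  define u where "u = (x - p) - e *\<^sub>R d"
  have ud: "hmetric p u d = 0" unfolding u_def hmetric_diff_left[of p "x - p" "e *\<^sub>R d"] hmetric_scale_left using d by (simp add: e_def)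
  have lin: "lift (q + s *\<^sub>R d) = lift q + s *\<^sub>R (lift b - lift a)" for q s by (simp add: d_def lift_def)
  have "lift p = (1 - t) *\<^sub>R lift a + t *\<^sub>R lift b" by (simp add: t lift_def)
  then have pc: "mink (lift p) c = 0" using x by (simp add: mink_simps)
  have "u \<noteq> 0"
  proof
    assume "u = 0"
    then have "x - p = e *\<^sub>R d" by (simp add: u_def)
    then have "x = p + e *\<^sub>R d" by (metis add.commute diff_add_cancel)
    then show False using lin[of p e] x pc by (simp add: mink_simps)
  qed
  moreover have "hmetric p u (y - p) = 0" if "y \<in> hhull {a, b}" for y
  proof -
    have "y \<in> closed_segment a b" using that by (simp add: hhull_def segment_convex_hull)
    then obtain s where "y = (1 - s) *\<^sub>R a + s *\<^sub>R b" by (auto simp: in_segment)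
    then have "y - p = (s - t) *\<^sub>R d" by (simp add: t d_def algebra_simps)
    then show ?thesis using ud by (simp add: hmetric_scale_right)
  qed
  moreover have "\<exists>s>0. p + s *\<^sub>R u \<in> A"
  proof -
    define \<delta> where "\<delta> = min t (1 - t)"
    have \<delta>: "0 < \<delta>" "\<delta> \<le> t" "\<delta> \<le> 1 - t" using t by (auto simp: \<delta>_def)
    \<comment> \<open>Small enough for the component \<open>- s e d\<close> along the side to be compensated by moving \<open>p\<close> within the side.\<close>
    define s where "s = \<delta> / (\<delta> + \<bar>e\<bar> + 1)"
    have s: "0 < s" "s < 1" using \<delta> by (simp_all add: s_def)
    have "s * (\<delta> + \<bar>e\<bar> + 1) = \<delta>" using \<delta> by (simp add: s_def)
    then have s2: "s * \<bar>e\<bar> < \<delta> * (1 - s)" using s by (simp add: algebra_simps)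
    define h where "h = s * e / (1 - s)"
    have "\<bar>h\<bar> = s * \<bar>e\<bar> / (1 - s)" using s by (simp add: h_def abs_mult)
    then have "\<bar>h\<bar> < \<delta>" using s2 s by (simp add: divide_less_eq)
    then have h: "0 < t - h" "t - h < 1" using \<delta> by linarith+
    define q where "q = (1 - (t - h)) *\<^sub>R a + (t - h) *\<^sub>R b"
    have "q \<in> open_segment a b" unfolding in_segment(2) using h ab(3) q_def by blast
    then have "q \<in> A" using A(2) rel_interior_subset open_segment_subset_rel_interior_hhull[OF ab] by blast
    have "q = p - h *\<^sub>R d" by (simp add: q_def t d_def algebra_simps)
    then have "(1 - s) *\<^sub>R q = (1 - s) *\<^sub>R p - (s * e) *\<^sub>R d" using s by (simp add: h_def scaleR_diff_right)
    then have "p + s *\<^sub>R u = (1 - s) *\<^sub>R q + s *\<^sub>R x" by (simp add: u_def algebra_simps)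
    moreover have "(1 - s) *\<^sub>R q + s *\<^sub>R x \<in> A" using convexD[OF A(1) \<open>q \<in> A\<close> x(1), of "1 - s" s] s by simp
    ultimately show ?thesis using s by metis
  qed
  ultimately show ?thesis unfolding inward_normal_def by blast
qed

section \<open>Isometries preserve angles\<close>

definition hcosh :: "real^3 \<Rightarrow> real^3 \<Rightarrow> real" where
  "hcosh x y = (1 - x \<bullet> y) / sqrt ((1 - x \<bullet> x) * (1 - y \<bullet> y))"

lemma hcosh_ge_1:
  assumes "x \<in> H3" "y \<in> H3" shows "hcosh x y \<ge> 1"
proof -
  have x: "x \<bullet> x < 1" and y: "y \<bullet> y < 1" using assms mem_H3_iff by blast+
  have "x \<bullet> y \<le> norm x * norm y" by (rule norm_cauchy_schwarz)
  moreover have "norm x * norm y < 1 * 1" using assms by (intro mult_strict_mono) auto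
  ultimately have xy: "x \<bullet> y < 1" by simp
  have nn: "(norm x * norm y)\<^sup>2 = (x \<bullet> x) * (y \<bullet> y)" by (simp add: power_mult_distrib power2_norm_eq_inner)
  have "2 * (norm x * norm y) \<le> x \<bullet> x + y \<bullet> y"
    using sum_squares_bound[of "norm x" "norm y"] by (simp add: power2_norm_eq_inner)
  then have "(1 - x \<bullet> x) * (1 - y \<bullet> y) \<le> (1 - norm x * norm y)\<^sup>2"
    using nn by (simp add: algebra_simps power2_eq_square)
  also have "\<dots> \<le> (1 - x \<bullet> y)\<^sup>2" using \<open>x \<bullet> y \<le> norm x * norm y\<close> \<open>norm x * norm y < 1 * 1\<close> by (intro power_mono) auto
  finally have "sqrt ((1 - x \<bullet> x) * (1 - y \<bullet> y)) \<le> 1 - x \<bullet> y" using xy by (intro real_le_lsqrt) auto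
  moreover have "sqrt ((1 - x \<bullet> x) * (1 - y \<bullet> y)) > 0" using x y by simp
  ultimately show ?thesis by (simp add: hcosh_def)
qed

lemma hcosh_eq_iff_hdist:
  assumes "x \<in> H3" "y \<in> H3" "x' \<in> H3" "y' \<in> H3" "hdist x y = hdist x' y'"
  shows "hcosh x y = hcosh x' y'"
proof -
  have "cosh (hdist x y) = cosh (hdist x' y')" using assms(5) by simp
  then show ?thesis
    using hcosh_ge_1[OF assms(1,2)] hcosh_ge_1[OF assms(3,4)] unfolding hdist_def hcosh_def[symmetric]
    by (simp add: cosh_arcosh_real)
qed

text \<open>The hyperbolic law of cosines: inner products of tangent vectors that point to \<open>x\<close> and \<open>y\<close> are determined by
  distances up to positive factors, so isometries preserve angles without being assumed differentiable.\<close>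
lemma hmetric_hcosh:
  assumes "p \<in> H3" "x \<in> H3" "y \<in> H3"
  shows "hmetric p (x - p) (y - p) = sqrt (1 - x \<bullet> x) * sqrt (1 - y \<bullet> y) / (1 - p \<bullet> p) * (hcosh p x * hcosh p y - hcosh x y)"
proof -
  define P a b c where "P = 1 - p \<bullet> p" "a = 1 - p \<bullet> x" "b = 1 - p \<bullet> y" "c = 1 - x \<bullet> y"
  define s t r where "s = sqrt (1 - x \<bullet> x)" "t = sqrt (1 - y \<bullet> y)" "r = sqrt P"
  have P: "P > 0" using assms mem_H3_iff by (simp add: P_a_b_c_def)
  have st: "s > 0" "t > 0" "r > 0" using assms mem_H3_iff P by (simp_all add: s_t_r_def)
  have rr: "r * r = P" using P by (simp add: s_t_r_def)
  have H: "hcosh p x = a / (r * s)" "hcosh p y = b / (r * t)" "hcosh x y = c / (s * t)"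
    by (simp_all add: hcosh_def P_a_b_c_def s_t_r_def real_sqrt_mult)
  have ip: "p \<bullet> (x - p) = P - a" "p \<bullet> (y - p) = P - b" "(x - p) \<bullet> (y - p) = a + b - c - P"
    by (simp_all add: P_a_b_c_def inner_diff_left inner_diff_right inner_commute)
  have "hmetric p (x - p) (y - p) = (a + b - c - P) / P + (P - a) * (P - b) / P\<^sup>2"
    unfolding hmetric_def ip by (simp add: P_a_b_c_def)
  also have "\<dots> = (a * b / P - c) / P"
  proof -
    have "(a + b - c - P) / P = (a + b - c - P) * P / P\<^sup>2" using P by (simp add: power2_eq_square)
    then have "(a + b - c - P) / P + (P - a) * (P - b) / P\<^sup>2 = ((a + b - c - P) * P + (P - a) * (P - b)) / P\<^sup>2"
      by (simp add: add_divide_distrib)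
    also have "\<dots> = (a * b - c * P) / P\<^sup>2" by (simp add: algebra_simps)
    also have "\<dots> = (a * b / P - c) / P" using P by (simp add: diff_divide_distrib power2_eq_square)
    finally show ?thesis .
  qed
  also have "\<dots> = s * t / P * (a / (r * s) * (b / (r * t)) - c / (s * t))"
  proof -
    have "a / (r * s) * (b / (r * t)) = a * b / (r * r * (s * t))" by (simp add: mult_ac)
    also have "\<dots> = (a * b / P) / (s * t)" by (simp add: rr)
    finally have "s * t / P * (a / (r * s) * (b / (r * t)) - c / (s * t)) = (s * t) / P * ((a * b / P - c) / (s * t))"
      by (simp add: diff_divide_distrib)
    also have "\<dots> = (a * b / P - c) / P" using st by simp
    finally show ?thesis by (rule sym)
  qed
  finally show ?thesis unfolding H P_a_b_c_def(1) s_t_r_def(1,2) .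
qed

lemma hangle_scale:
  assumes "s > 0" "t > 0" shows "hangle p (s *\<^sub>R u) (t *\<^sub>R v) = hangle p u v"
proof -
  define A B C where "A = hmetric p u u" "B = hmetric p v v" "C = hmetric p u v"
  have "hmetric p (s *\<^sub>R u) (s *\<^sub>R u) * hmetric p (t *\<^sub>R v) (t *\<^sub>R v) = (s * t)\<^sup>2 * (A * B)"
    by (simp add: hmetric_scale_left hmetric_scale_right A_B_C_def power2_eq_square)
  then have "sqrt (hmetric p (s *\<^sub>R u) (s *\<^sub>R u) * hmetric p (t *\<^sub>R v) (t *\<^sub>R v)) = (s * t) * sqrt (A * B)"
    using assms by (simp add: real_sqrt_mult)
  moreover have "hmetric p (s *\<^sub>R u) (t *\<^sub>R v) = (s * t) * C"
    by (simp add: hmetric_scale_left hmetric_scale_right A_B_C_def)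
  ultimately have "hmetric p (s *\<^sub>R u) (t *\<^sub>R v) / sqrt (hmetric p (s *\<^sub>R u) (s *\<^sub>R u) * hmetric p (t *\<^sub>R v) (t *\<^sub>R v)) = C / sqrt (A * B)"
    using assms by simp
  then show ?thesis by (simp add: hangle_def A_B_C_def)
qed

lemma hangle_hcosh:
  assumes "p \<in> H3" "x \<in> H3" "y \<in> H3"
  shows "hangle p (x - p) (y - p) =
    arccos ((hcosh p x * hcosh p y - hcosh x y) / sqrt ((hcosh p x * hcosh p x - 1) * (hcosh p y * hcosh p y - 1)))"
proof -
  define P s t where "P = 1 - p \<bullet> p" "s = sqrt (1 - x \<bullet> x)" "t = sqrt (1 - y \<bullet> y)"
  have P: "P > 0" "s > 0" "t > 0" using assms mem_H3_iff by (simp_all add: P_s_t_def)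
  have one: "hcosh z z = 1" if "z \<in> H3" for z using that mem_H3_iff[of z] by (simp add: hcosh_def)
  define A B C where "A = hcosh p x * hcosh p x - 1" "B = hcosh p y * hcosh p y - 1" "C = hcosh p x * hcosh p y - hcosh x y"
  have H: "hmetric p (x - p) (x - p) = s * s / P * A" "hmetric p (y - p) (y - p) = t * t / P * B"
    "hmetric p (x - p) (y - p) = s * t / P * C"
    using hmetric_hcosh[OF assms(1,2,2)] hmetric_hcosh[OF assms(1,3,3)] hmetric_hcosh[OF assms] one assms
    by (simp_all add: P_s_t_def A_B_C_def)
  have "hmetric p (x - p) (x - p) * hmetric p (y - p) (y - p) = (s * t / P)\<^sup>2 * (A * B)"
    unfolding H by (simp add: power2_eq_square)
  then have "sqrt (hmetric p (x - p) (x - p) * hmetric p (y - p) (y - p)) = s * t / P * sqrt (A * B)"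
    using P by (simp add: real_sqrt_mult)
  then have "hmetric p (x - p) (y - p) / sqrt (hmetric p (x - p) (x - p) * hmetric p (y - p) (y - p)) = C / sqrt (A * B)"
    unfolding H(3) using P by simp
  then show ?thesis by (simp add: hangle_def A_B_C_def)
qed

lemma has_dihedral_angleD:
  assumes "has_dihedral_angle E A B \<alpha>" "p \<in> rel_interior E" "inward_normal E A p a" "inward_normal E B p b"
  shows "hangle p a b = \<alpha>"
  using assms unfolding has_dihedral_angle_def by simp

text \<open>An isometry need not be given as a differentiable map, so an inward normal is replaced by the point \<open>x\<close>
  to which it leads; the image of \<open>x\<close> again lies in an inward normal direction.\<close>
lemma hisometry_inward_normal:
  assumes \<phi>: "hisometry \<phi>" and sub: "E \<subseteq> H3" "A \<subseteq> H3" "p \<in> H3" and u: "inward_normal E A p u"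
  obtains x s where "x \<in> A" "x - p = s *\<^sub>R u" "s > 0" "inward_normal (\<phi> ` E) (\<phi> ` A) (\<phi> p) (\<phi> x - \<phi> p)"
proof -
  obtain s where s: "s > 0" "p + s *\<^sub>R u \<in> A" and u0: "u \<noteq> 0" and uE: "\<And>y. y \<in> E \<Longrightarrow> hmetric p u (y - p) = 0"
    using u by (auto simp: inward_normal_def)
  define x where "x = p + s *\<^sub>R u"
  have x: "x \<in> A" "x - p = s *\<^sub>R u" "x \<noteq> p" using s u0 by (auto simp: x_def)
  have bij: "bij_betw \<phi> H3 H3" and iso: "hdist (\<phi> y) (\<phi> z) = hdist y z" if "y \<in> H3" "z \<in> H3" for y z
    using \<phi> that unfolding hisometry_def by blast+
  have xH: "x \<in> H3" using x sub by blast
  have im: "\<phi> y \<in> H3" if "y \<in> H3" for y using bij[OF that that] that bij_betwE by blast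
  have pos: "sqrt (1 - y \<bullet> y) * sqrt (1 - z \<bullet> z) / (1 - q \<bullet> q) \<noteq> 0" if "q \<in> H3" "y \<in> H3" "z \<in> H3" for q y z
    using that mem_H3_iff[of q] mem_H3_iff[of y] mem_H3_iff[of z] by simp
  have hc: "hcosh (\<phi> y) (\<phi> z) = hcosh y z" if "y \<in> H3" "z \<in> H3" for y z
    using hcosh_eq_iff_hdist[OF im[OF that(1)] im[OF that(2)] that iso[OF that]] .
  have "\<phi> x \<noteq> \<phi> p" using bij[OF xH sub(3)] x(3) xH sub(3) by (metis bij_betw_imp_inj_on inj_on_eq_iff)
  moreover have "hmetric (\<phi> p) (\<phi> x - \<phi> p) (\<phi> y - \<phi> p) = 0" if "y \<in> E" for y
  proof -
    have yH: "y \<in> H3" using that sub by blast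
    have "hmetric p (x - p) (y - p) = 0" using uE[OF that] x(2) by (simp add: hmetric_scale_left)
    then have "hcosh p x * hcosh p y - hcosh x y = 0"
      using hmetric_hcosh[OF sub(3) xH yH] pos[OF sub(3) xH yH] by (metis mult_eq_0_iff)
    then show ?thesis
      unfolding hmetric_hcosh[OF im[OF sub(3)] im[OF xH] im[OF yH]] hc[OF sub(3) xH] hc[OF sub(3) yH] hc[OF xH yH] by simp
  qed
  moreover have "\<exists>t>0. \<phi> p + t *\<^sub>R (\<phi> x - \<phi> p) \<in> \<phi> ` A"
    by (rule exI[of _ 1]) (use x(1) in simp)
  ultimately have "inward_normal (\<phi> ` E) (\<phi> ` A) (\<phi> p) (\<phi> x - \<phi> p)"
    unfolding inward_normal_def by auto
  then show ?thesis using that x(1,2) s(1) by blast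
qed

lemma hisometry_hangle:
  assumes \<phi>: "hisometry \<phi>" and "p \<in> H3" "x \<in> H3" "y \<in> H3"
  shows "hangle (\<phi> p) (\<phi> x - \<phi> p) (\<phi> y - \<phi> p) = hangle p (x - p) (y - p)"
proof -
  have im: "\<phi> z \<in> H3" if "z \<in> H3" for z using \<phi> that unfolding hisometry_def bij_betw_def by blast
  have hc: "hcosh (\<phi> w) (\<phi> z) = hcosh w z" if "w \<in> H3" "z \<in> H3" for w z
    by (rule hcosh_eq_iff_hdist[OF im[OF that(1)] im[OF that(2)] that]) (use \<phi> that in \<open>simp add: hisometry_def\<close>)
  show ?thesis
    unfolding hangle_hcosh[OF assms(2-4)] hangle_hcosh[OF im[OF assms(2)] im[OF assms(3)] im[OF assms(4)]]
    by (simp only: hc assms)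
qed

section \<open>Realized polyhedra and their dihedral angles\<close>

text \<open>On length-0 edges the value is prescribed, and outside \<open>edges\<close> the functions are \<open>undefined\<close>.\<close>
lemma angle_functions_eqI:
  assumes "\<theta> \<in> angle_functions I Z" "\<eta> \<in> angle_functions I Z" "\<And>e. e \<in> edges - Z \<Longrightarrow> \<theta> e = \<eta> e"
  shows "\<theta> = \<eta>"
proof (rule extensionalityI[of _ edges])
  show "\<theta> \<in> extensional edges" "\<eta> \<in> extensional edges" using assms by (auto simp: angle_functions_def PiE_def)
  fix e assume e: "e \<in> edges"
  show "\<theta> e = \<eta> e"
  proof (cases "e \<in> Z")
    case True
    then have "\<theta> e = 0" "\<eta> e = 0" using assms(1,2) e by (auto simp: angle_functions_def)
    then show ?thesis by simp
  qed (use e assms(3) in auto)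
qed

lemma edge_cases:
  assumes "e \<in> edges"
  obtains v w k l where "e = {v, w}" "- e = {k, l}" "distinct [v, w, k, l]"
proof -
  obtain v w where e: "e = {v, w}" "v \<noteq> w" using assms unfolding edges_def card_2_iff by blast
  obtain k l where d: "distinct [v, w, k, l]" "UNIV = {v, w, k, l}" using complete_4[OF e(2)] by metis
  then have "- e = {k, l}" using e by auto
  then show ?thesis using that e d by blast
qed

lemma edge_part_eq: "- e = {k, l} \<Longrightarrow> edge_part I Z e = lateral_hexagon I Z k \<inter> lateral_hexagon I Z l"
  unfolding edge_part_def lateral_hexagon_def cell_def by blast

context hyperideal_frame begin

definition realized_by :: "(real^4 \<Rightarrow> real^3) \<Rightarrow> bool" where
  "realized_by f \<longleftrightarrow> inj_on f (Dstar I Z) \<and> f ` Dstar I Z = pol \<and>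
     (\<forall>k. f ` lateral_hexagon I Z k = face (- {k})) \<and> (\<forall>v. v \<notin> I \<longrightarrow> f ` truncation_triangle I Z v = tri v)"

lemma face_Int: "face J \<inter> face J' = face (J \<inter> J')"
  by (auto simp: face_def)

lemma realized_edge:
  assumes "realized_by f" "- e = {k, l}"
  shows "f ` edge_part I Z e = face e"
proof -
  have "lateral_hexagon I Z k \<subseteq> Dstar I Z" "lateral_hexagon I Z l \<subseteq> Dstar I Z" by (auto simp: lateral_hexagon_def)
  then have "f ` edge_part I Z e = face (- {k}) \<inter> face (- {l})"
    unfolding edge_part_eq[OF assms(2)] using inj_on_image_Int assms(1) unfolding realized_by_def by metis
  also have "- {k} \<inter> - {l} = e" using assms(2) by auto
  then have "face (- {k}) \<inter> face (- {l}) = face e" unfolding face_Int by simp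
  finally show ?thesis .
qed

lemma realized_has_dihedral_angles:
  assumes "realized_by f" shows "has_dihedral_angles I Z f ang"
  unfolding has_dihedral_angles_def
proof (intro ballI allI impI)
  fix e k l assume e: "e \<in> edges - Z" and kl: "- e = {k, l}"
  obtain v w k' l' where d: "e = {v, w}" "- e = {k', l'}" "distinct [v, w, k', l']" using edge_cases e by blast
  then have "distinct [v, w, k, l]" using kl by (auto simp: doubleton_eq_iff)
  then show "has_dihedral_angle (f ` edge_part I Z e) (f ` lateral_hexagon I Z k) (f ` lateral_hexagon I Z l) (ang e)"
    using face_dihedral_angle[of v w k l] e d(1) assms realized_edge[OF assms kl] by (simp add: realized_by_def)
qed

lemma face_subset_H3: "face J \<subseteq> H3"
  by (auto simp: face_def pol_def)

lemma face_convex: "convex (face J)"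
proof -
  have "face J = H3 \<inter> {x. lift x \<in> K} \<inter> (\<Inter>k\<in>-J. {x. mink (lift x) (n k) = 0})" by (auto simp: face_def pol_def)
  then show ?thesis by (simp only:) (intro convex_Int convex_INT convex_ball convex_in_K convex_mink_eq)
qed

lemma edge_face:
  assumes "v \<noteq> w" shows "face {v, w} = hhull {vert v w, vert w v}"
  using face_eq_hhull[of "{v, w}"] verts_pair assms by simp

lemma face_inward_normal:
  assumes d: "distinct [v, w, k, l]" "{v, w} \<notin> Z" and p: "p \<in> open_segment (vert v w) (vert w v)"
  shows "\<exists>u. inward_normal (face {v, w}) (face (- {k})) p u"
proof -
  have ab: "vert v w \<in> cball 0 1" "vert w v \<in> cball 0 1" "vert v w \<noteq> vert w v"
    using vert_in_cball[of v w] vert_in_cball[of w v] vert_distinct[of v w] d by auto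
  have pf: "p \<in> face {v, w}"
    using edge_face[of v w] open_segment_subset_rel_interior_hhull[OF ab] rel_interior_subset p d by auto
  have pH: "p \<in> H3" using pf face_subset_H3 by blast
  define x where "x = midpoint p (vert l v)"
  have lv: "l \<noteq> v" using d by auto
  have "x \<in> closed_segment p (vert l v)" by (simp add: x_def)
  have lx: "lift x = (1/2) *\<^sub>R (lift p + lift (vert l v))" by (simp add: x_def midpoint_def lift_def)
  have pl: "lift p \<in> K" "mink (lift p) (n i) = 0" if "i \<notin> {v, w}" for i using pf that by (auto simp: face_def pol_def)
  have pK: "lift p \<in> K" using pl[of k] d by auto
  have vK: "lift (vert l v) \<in> K" using vert_in_K[OF lv] .
  have p_ne: "p \<noteq> vert l v"
  proof
    assume "p = vert l v"
    then have "mink (lift (vert l v)) (n l) = 0" using pl(2)[of l] d by auto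
    then show False using lv future[OF lv] neg[OF lv] by (simp add: mink_vert edge_vector_coord split: if_splits)
  qed
  have "x \<in> open_segment p (vert l v)" using p_ne by (simp add: x_def)
  then have xH: "x \<in> H3" using open_segment_in_H3[of p "vert l v"] pH vert_in_cball[OF lv] by auto
  have "lift x \<in> K" using pK vK unfolding K_def lx by (auto simp: mink_simps add_nonpos_nonpos)
  moreover have "mink (lift x) (n k) = 0" using pl(2)[of k] d lv unfolding lx by (auto simp: mink_simps mink_vert edge_vector_coord)
  ultimately have xf: "x \<in> face (- {k})" using xH by (auto simp: face_def pol_def)
  have xl: "mink (lift x) (n l) \<noteq> 0" using pl(2)[of l] d lv neg[OF lv] future[OF lv] unfolding lx
    by (auto simp: mink_simps mink_vert edge_vector_coord)
  show ?thesis
  proof -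
    have vw: "v \<noteq> w" and l: "mink (lift (vert v w)) (n l) = 0" "mink (lift (vert w v)) (n l) = 0"
      using d by (auto simp: mink_vert edge_vector_coord)
    have "face {v, w} \<subseteq> face (- {k})" using d by (auto simp: face_def)
    then show ?thesis
      unfolding edge_face[OF vw]
      by (rule inward_normal_exists[OF ab face_convex _ p xf xl l])
  qed
qed

text \<open>Both functions give the angle between the same pair of inward normals at a point of the edge; such a pair exists.\<close>
lemma realized_angles_unique:
  assumes f: "realized_by f" and \<theta>: "\<theta> \<in> angle_functions I Z" "has_dihedral_angles I Z f \<theta>"
  shows "\<theta> = ang"
proof (rule angle_functions_eqI[OF \<theta>(1) ang_in_angle_functions])
  fix e assume e: "e \<in> edges - Z"
  obtain v w k l where d: "e = {v, w}" "- e = {k, l}" "distinct [v, w, k, l]" using edge_cases e by blast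
  have ab: "vert v w \<in> cball 0 1" "vert w v \<in> cball 0 1" "vert v w \<noteq> vert w v"
    using vert_in_cball[of v w] vert_in_cball[of w v] vert_distinct[of v w] d e by auto
  then obtain p where p: "p \<in> open_segment (vert v w) (vert w v)" using two_points_in_hhull by metis
  then have pr: "p \<in> rel_interior (face {v, w})" using open_segment_subset_rel_interior_hhull[OF ab] edge_face[of v w] d by auto
  obtain a where a: "inward_normal (face {v, w}) (face (- {k})) p a" using face_inward_normal[of v w k l p] d e p by auto
  obtain b where b: "inward_normal (face {v, w}) (face (- {l})) p b" using face_inward_normal[of v w l k p] d e p by auto
  have 1: "has_dihedral_angle (face e) (face (- {k})) (face (- {l})) (\<theta> e)"
  proof -
    have "has_dihedral_angle (f ` edge_part I Z e) (f ` lateral_hexagon I Z k) (f ` lateral_hexagon I Z l) (\<theta> e)"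
      using \<theta>(2) e d(2) unfolding has_dihedral_angles_def by blast
    then show ?thesis using f unfolding realized_edge[OF f d(2)] by (simp add: realized_by_def)
  qed
  have 2: "has_dihedral_angle (face e) (face (- {k})) (face (- {l})) (ang e)"
    using face_dihedral_angle d e by auto
  note pab = pr[folded d(1)] a[folded d(1)] b[folded d(1)]
  show "\<theta> e = ang e" using has_dihedral_angleD[OF 1 pab] has_dihedral_angleD[OF 2 pab] by simp
qed

end

text \<open>The isometry maps faces to faces, hence edges to edges and inward normals to inward normals. As the end points of an
  edge carry no information, the argument is made at a point \<open>p\<close> such that neither \<open>p\<close> nor its image is an end.\<close>
lemma isometric_imp_same_angles:
  assumes F: "hyperideal_frame I Z m n" "hyperideal_frame.realized_by I Z m n f"
    and G: "hyperideal_frame I Z m' n'" "hyperideal_frame.realized_by I Z m' n' g"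
    and iso: "isometric_realizations I Z f g"
  shows "hyperideal_frame.ang n = hyperideal_frame.ang n'"
proof -
  interpret A: hyperideal_frame I Z m n by (rule F)
  interpret B: hyperideal_frame I Z m' n' by (rule G)
  obtain \<phi> where \<phi>: "hisometry \<phi>" "\<And>k. \<phi> ` f ` lateral_hexagon I Z k = g ` lateral_hexagon I Z k"
    using iso unfolding isometric_realizations_def by (elim exE conjE) simp
  have f: "f ` lateral_hexagon I Z k = A.face (- {k})" for k using F(2) by (simp add: A.realized_by_def)
  have g: "g ` lateral_hexagon I Z k = B.face (- {k})" for k using G(2) by (simp add: B.realized_by_def)
  have hex: "\<phi> ` A.face (- {k}) = B.face (- {k})" for k
    using \<phi>(2)[of k] unfolding f g .
  have inj: "inj_on \<phi> H3" using \<phi>(1) by (auto simp: hisometry_def bij_betw_def)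
  show ?thesis
  proof (rule angle_functions_eqI[OF A.ang_in_angle_functions B.ang_in_angle_functions])
    fix e assume e: "e \<in> edges - Z"
    obtain v w k l where d: "e = {v, w}" "- e = {k, l}" "distinct [v, w, k, l]" using edge_cases e by blast
    have Jeq: "- {k} \<inter> - {l} = e" using d(2) by auto
    have edge: "\<phi> ` A.face e = B.face e"
      using inj_on_image_Int[OF inj A.face_subset_H3 A.face_subset_H3, of "- {k}" "- {l}"] hex[of k] hex[of l] 
      unfolding A.face_Int B.face_Int Jeq by (simp add: B.face_Int Jeq)
    have ab: "A.vert v w \<in> cball 0 1" "A.vert w v \<in> cball 0 1" "A.vert v w \<noteq> A.vert w v"
      using A.vert_in_cball[of v w] A.vert_in_cball[of w v] A.vert_distinct[of v w] d e by auto
    have ab': "B.vert v w \<in> cball 0 1" "B.vert w v \<in> cball 0 1" "B.vert v w \<noteq> B.vert w v"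
      using B.vert_in_cball[of v w] B.vert_in_cball[of w v] B.vert_distinct[of v w] d e by auto
    have sub: "open_segment (A.vert v w) (A.vert w v) \<subseteq> A.face e"
      using open_segment_subset_rel_interior_hhull[OF ab] rel_interior_subset A.edge_face[of v w] d by auto
    have "inj_on \<phi> (open_segment (A.vert v w) (A.vert w v))" using inj_on_subset[OF inj] sub A.face_subset_H3 by blast
    \<comment> \<open>The image of the edge is infinite, so some point avoids the ends on both sides.\<close>
    then have "infinite (\<phi> ` open_segment (A.vert v w) (A.vert w v))"
      using ab(3) finite_imageD finite_open_segment by blast
    then have "\<not> \<phi> ` open_segment (A.vert v w) (A.vert w v) \<subseteq> {B.vert v w, B.vert w v}"
      by (meson finite.emptyI finite.insertI finite_subset)
    then obtain p where p: "p \<in> open_segment (A.vert v w) (A.vert w v)" "\<phi> p \<noteq> B.vert v w" "\<phi> p \<noteq> B.vert w v" by blast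
    have pe: "p \<in> A.face e" using p sub by blast
    then have pH: "p \<in> H3" using A.face_subset_H3 by blast
    have "\<phi> p \<in> B.face e" using pe edge by blast
    then have "\<phi> p \<in> closed_segment (B.vert v w) (B.vert w v)"
      using B.edge_face[of v w] d by (auto simp: hhull_def segment_convex_hull)
    then have "\<phi> p \<in> open_segment (B.vert v w) (B.vert w v)" using p by (simp add: open_segment_def)
    then have pr': "\<phi> p \<in> rel_interior (B.face e)" using open_segment_subset_rel_interior_hhull[OF ab'] B.edge_face[of v w] d by auto
    have pr: "p \<in> rel_interior (A.face e)" using p open_segment_subset_rel_interior_hhull[OF ab] A.edge_face[of v w] d by auto
    obtain a where a: "inward_normal (A.face e) (A.face (- {k})) p a" using A.face_inward_normal[of v w k l p] d e p by auto
    obtain b where b: "inward_normal (A.face e) (A.face (- {l})) p b" using A.face_inward_normal[of v w l k p] d e p by auto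
    obtain x s where x: "x \<in> A.face (- {k})" "x - p = s *\<^sub>R a" "s > 0" "inward_normal (B.face e) (B.face (- {k})) (\<phi> p) (\<phi> x - \<phi> p)"
      using hisometry_inward_normal[OF \<phi>(1) A.face_subset_H3 A.face_subset_H3 pH a] hex edge by metis
    obtain y t where y: "y \<in> A.face (- {l})" "y - p = t *\<^sub>R b" "t > 0" "inward_normal (B.face e) (B.face (- {l})) (\<phi> p) (\<phi> y - \<phi> p)"
      using hisometry_inward_normal[OF \<phi>(1) A.face_subset_H3 A.face_subset_H3 pH b] hex edge by metis
    have xy: "x \<in> H3" "y \<in> H3" using x(1) y(1) A.face_subset_H3 by blast+
    have "B.ang e = hangle (\<phi> p) (\<phi> x - \<phi> p) (\<phi> y - \<phi> p)"
      using has_dihedral_angleD[OF _ pr' x(4) y(4)] B.face_dihedral_angle[of v w k l] d e by simp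
    also have "\<dots> = hangle p (s *\<^sub>R a) (t *\<^sub>R b)" unfolding hisometry_hangle[OF \<phi>(1) pH xy] x(2) y(2) ..
    also have "\<dots> = hangle p a b" using hangle_scale x(3) y(3) by blast
    also have "\<dots> = A.ang e" using has_dihedral_angleD[OF _ pr a b] A.face_dihedral_angle[of v w k l] d e by simp
    finally show "A.ang e = B.ang e" by simp
  qed
qed

section \<open>Equal dihedral angles imply isometry\<close>

lemma hdist_proj:
  assumes "snd a > 0" "snd b > 0"
  shows "hdist (proj a) (proj b) = arcosh (- mink a b / sqrt (mink a a * mink b b))"
proof -
  have e: "1 - proj x \<bullet> proj y = - mink x y / (snd x * snd y)" if "snd x > 0" "snd y > 0" for x y
    using that by (simp add: proj_def mink_def field_simps)
  define s t where "s = snd a" "t = snd b"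
  have st: "s > 0" "t > 0" using assms by (simp_all add: s_t_def)
  have "(1 - proj a \<bullet> proj a) * (1 - proj b \<bullet> proj b) = (mink a a * mink b b) / (s * t)\<^sup>2"
    unfolding e[OF assms(1,1)] e[OF assms(2,2)] by (simp add: s_t_def power2_eq_square mult_ac)
  then have "sqrt ((1 - proj a \<bullet> proj a) * (1 - proj b \<bullet> proj b)) = sqrt (mink a a * mink b b) / (s * t)"
    using st by (simp add: real_sqrt_divide)
  then have "(1 - proj a \<bullet> proj b) / sqrt ((1 - proj a \<bullet> proj a) * (1 - proj b \<bullet> proj b)) = - mink a b / sqrt (mink a a * mink b b)"
    unfolding e[OF assms] using st by (simp add: s_t_def)
  then show ?thesis by (simp add: hdist_def)
qed

context hyperideal_frame begin

text \<open>Every vector of the cone is a nonnegative combination of edge vectors, and these are in the future.\<close>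
lemma future_of_K: "x \<in> K \<Longrightarrow> x \<noteq> 0 \<Longrightarrow> snd x > 0"
  using face_cone[of UNIV x] by (auto simp: hcone_def)

lemma pol_nonempty: "\<exists>x. x \<in> pol"
proof -
  obtain v k where "v \<noteq> (k::4)" by (metis zero_neq_one)
  then obtain w l where d: "distinct [v, k, w, l]" using complete_4 by metis
  obtain a b where ab: "a \<noteq> b" "vert a b \<noteq> vert k v" "a \<noteq> k"
  proof -
    show ?thesis
    proof (cases "k \<in> I")
      case True
      have "mink (lift (vert w l)) (n k) = 0" "mink (lift (vert k v)) (n k) > 0"
        using d future[of k v] neg[of k v] by (auto simp: mink_vert edge_vector_coord self divide_neg_pos)
      then have "vert w l \<noteq> vert k v" by auto
      then show ?thesis using that[of w l] d by auto
    next
      case False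
      have "mink (lift (vert w l)) (n v) = 0" "mink (lift (vert k v)) (n v) > 0"
        using d False future[of k v] neg[of k v] by (auto simp: mink_vert edge_vector_coord self divide_neg_pos)
      then have "vert w l \<noteq> vert k v" by auto
      then show ?thesis using that[of w l] d by auto
    qed
  qed
  have kv: "k \<noteq> v" using d by auto
  define p where "p = midpoint (vert a b) (vert k v)"
  have "p \<in> open_segment (vert a b) (vert k v)" using ab by (simp add: p_def)
  then have "p \<in> H3" using open_segment_in_H3 vert_in_cball ab kv by blast
  moreover have "lift p \<in> K"
  proof -
    have "lift p = (1/2) *\<^sub>R (lift (vert a b) + lift (vert k v))" by (simp add: p_def midpoint_def lift_def)
    then show ?thesis using vert_in_K[OF ab(1)] vert_in_K[OF kv] by (auto simp: K_def mink_simps add_nonpos_nonpos)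
  qed
  ultimately show ?thesis by (auto simp: pol_def)
qed

end

text \<open>The linear map \<open>L\<close> carries \<open>n k\<close> to \<open>r k *\<^sub>R n' k\<close>, with \<open>r k\<close> the ratio of the lengths. As the angles agree,
  it preserves the Gram matrix, so it is a Minkowski isometry; it induces the isometry \<open>\<phi>\<close> of the ball.\<close>
locale two_frames = A: hyperideal_frame I Z m n + B: hyperideal_frame I Z m' n' for I Z m n m' n' +
  assumes same: "A.ang = B.ang"
begin

definition r :: "4 \<Rightarrow> real" where "r k = sqrt (mink (n k) (n k)) / sqrt (mink (n' k) (n' k))"

definition L :: "minkowski \<Rightarrow> minkowski" where "L x = (\<Sum>k\<in>UNIV. (mink x (m k) * r k) *\<^sub>R n' k)"

lemma r_pos: "r k > 0"
  using A.n_spacelike B.n_spacelike by (simp add: r_def)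

lemma same_gram: "r k * r l * mink (n' k) (n' l) = mink (n k) (n l)"
proof (cases "k = l")
  case True
  have "sqrt (mink (n k) (n k)) * sqrt (mink (n k) (n k)) = mink (n k) (n k)"
    "sqrt (mink (n' k) (n' k)) * sqrt (mink (n' k) (n' k)) = mink (n' k) (n' k)"
    using A.n_spacelike[of k] B.n_spacelike[of k] by simp_all
  moreover have "mink (n' k) (n' k) > 0" by (rule B.n_spacelike)
  ultimately show ?thesis using True by (simp add: r_def)
next
  case False
  obtain v w where "distinct [k, l, v, w]" using complete_4[OF False] by metis
  then have "distinct [v, w, k, l]" by auto
  then have "A.norm_gram k l = B.norm_gram k l" using A.cos_ang(1) B.cos_ang(1) same by (metis minus_equation_iff)
  moreover have "sqrt (mink (n k) (n k)) > 0" "sqrt (mink (n l) (n l)) > 0" using A.n_spacelike by simp_all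
  ultimately show ?thesis unfolding A.norm_gram_def B.norm_gram_def r_def by (simp add: field_simps)
qed

lemma L_m: "mink (L x) (m' k) = r k * mink x (m k)"
  unfolding L_def by (simp add: mink_sum_left mink_simps mink_commute[of "n' _"] B.dual if_distrib cong: if_cong)

lemma L_n: "mink (L x) (n' k) = mink x (n k) / r k"
proof -
  have "r k * mink (L x) (n' k) = (\<Sum>j\<in>UNIV. mink x (m j) * (r j * r k * mink (n' j) (n' k)))"
    unfolding L_def by (simp add: mink_sum_left mink_simps sum_distrib_left mult_ac)
  also have "\<dots> = mink (\<Sum>k\<in>UNIV. mink x (m k) *\<^sub>R n k) (n k)"
    unfolding same_gram by (simp add: mink_sum_left mink_simps)
  also have "\<dots> = mink x (n k)" using A.expand_n by metis
  finally show ?thesis using r_pos[of k] by (simp add: field_simps)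
qed

lemma L_mink: "mink (L x) (L y) = mink x y"
proof -
  have "mink (L x) (L y) = (\<Sum>k\<in>UNIV. mink x (m k) * r k * mink (L y) (n' k))"
    by (subst L_def) (simp add: mink_sum_left mink_simps mink_commute[of "L y"])
  also have "\<dots> = mink (\<Sum>k\<in>UNIV. mink x (m k) *\<^sub>R n k) y"
    unfolding mink_sum_left
  proof (rule sum.cong)
    fix k show "mink x (m k) * r k * mink (L y) (n' k) = mink (mink x (m k) *\<^sub>R n k) y"
      using r_pos[of k] by (simp add: L_n mink_simps mink_commute[of y])
  qed simp
  also have "\<dots> = mink x y" using A.expand_n[of x] by simp
  finally show ?thesis .
qed

lemma L_K: "L x \<in> B.K \<longleftrightarrow> x \<in> A.K"
  using r_pos by (simp add: A.K_def B.K_def L_m L_n zero_le_divide_iff mult_le_0_iff less_le_not_le)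

lemma L_timelike: "x \<in> H3 \<Longrightarrow> mink (L (lift x)) (L (lift x)) < 0"
  unfolding L_mink by (simp only: mem_H3_iff_mink)

text \<open>A Minkowski isometry could exchange past and future. This one does not, since it maps the cone of the first
  frame, which contains a future timelike vector, to the cone of the second one.\<close>
lemma L_future:
  assumes "x \<in> H3" shows "snd (L (lift x)) > 0"
proof -
  obtain p where p: "p \<in> A.pol" using A.pol_nonempty by blast
  then have pH: "p \<in> H3" by (simp add: A.pol_def)
  have "L (lift p) \<in> B.K" "L (lift p) \<noteq> 0"
    using p L_timelike[OF pH] by (auto simp: L_K A.pol_def mink_simps)
  then have "snd (L (lift p)) > 0" by (rule B.future_of_K)
  moreover have "mink (lift x) (lift p) < 0"
    using mink_timelike_neg_iff[of "lift x" "lift p"] assms pH mem_H3_iff_mink[of x] mem_H3_iff_mink[of p] by simp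
  then have "snd (L (lift x)) * snd (L (lift p)) > 0"
    using mink_timelike_neg_iff[OF L_timelike[OF assms] L_timelike[OF pH]] L_mink by simp
  ultimately show ?thesis by (simp add: zero_less_mult_iff)
qed

definition \<phi> :: "real^3 \<Rightarrow> real^3" where "\<phi> x = proj (L (lift x))"

lemma \<phi>_H3: "x \<in> H3 \<Longrightarrow> \<phi> x \<in> H3"
  using L_future L_timelike proj_in_H3[of "L (lift x)"] unfolding \<phi>_def by (metis less_irrefl)

lemma \<phi>_hdist: "x \<in> H3 \<Longrightarrow> y \<in> H3 \<Longrightarrow> hdist (\<phi> x) (\<phi> y) = hdist x y"
  unfolding \<phi>_def using hdist_proj[OF L_future L_future, of x y] hdist_proj[of "lift x" "lift y"] by (simp add: L_mink)

lemma \<phi>_m: "x \<in> H3 \<Longrightarrow> mink (lift (\<phi> x)) (m' k) = r k * mink (lift x) (m k) / snd (L (lift x))"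
  and \<phi>_n: "x \<in> H3 \<Longrightarrow> mink (lift (\<phi> x)) (n' k) = mink (lift x) (n k) / r k / snd (L (lift x))"
  using L_future[of x] by (simp_all add: \<phi>_def mink_proj L_m L_n)

lemma \<phi>_pol: "x \<in> H3 \<Longrightarrow> \<phi> x \<in> B.pol \<longleftrightarrow> x \<in> A.pol"
  using \<phi>_H3[of x] r_pos L_future[of x]
  by (simp add: A.pol_def B.pol_def A.K_def B.K_def \<phi>_m \<phi>_n zero_le_divide_iff mult_le_0_iff divide_le_0_iff less_le_not_le)

lemma \<phi>_face: "x \<in> H3 \<Longrightarrow> \<phi> x \<in> B.face J \<longleftrightarrow> x \<in> A.face J"
  using \<phi>_pol[of x] r_pos L_future[of x] by (auto simp: A.face_def B.face_def \<phi>_n less_le)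

lemma \<phi>_tri: "x \<in> H3 \<Longrightarrow> \<phi> x \<in> B.tri v \<longleftrightarrow> x \<in> A.tri v"
  using \<phi>_pol[of x] r_pos L_future[of x] by (auto simp: A.tri_def B.tri_def \<phi>_m less_le)

end

sublocale two_frames \<subseteq> inverse: two_frames I Z m' n' m n
  by unfold_locales (simp add: same)

context two_frames begin

lemma r_inverse: "inverse.r k = 1 / r k"
  by (simp add: r_def inverse.r_def)

lemma \<phi>_inverse:
  assumes "x \<in> H3" shows "inverse.\<phi> (\<phi> x) = x"
proof -
  have "inverse.L (L (lift x)) = lift x"
  proof -
    have "mink (inverse.L (L (lift x))) (m k) = mink (lift x) (m k)" for k
      using r_pos[of k] by (simp add: inverse.L_m L_m r_inverse)
    then show ?thesis using A.expand_n[of "inverse.L (L (lift x))"] A.expand_n[of "lift x"] by simp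
  qed
  moreover have "inverse.L (t *\<^sub>R y) = t *\<^sub>R inverse.L y" for t y
    by (simp add: inverse.L_def mink_simps scaleR_sum_right mult_ac)
  then have "inverse.L (lift (\<phi> x)) = inverse.L (L (lift x)) /\<^sub>R snd (L (lift x))"
    using L_future[OF assms] by (simp add: \<phi>_def lift_proj)
  ultimately show ?thesis using L_future[OF assms] by (simp add: inverse.\<phi>_def proj_scale)
qed

end

lemma (in two_frames) hisometry_\<phi>: "hisometry \<phi>"
  unfolding hisometry_def
proof (intro conjI ballI)
  show "bij_betw \<phi> H3 H3"
  proof (rule bij_betw_byWitness[where f' = inverse.\<phi>])
    show "\<phi> ` H3 \<subseteq> H3" using \<phi>_H3 by blast
    show "inverse.\<phi> ` H3 \<subseteq> H3" using inverse.\<phi>_H3 by blast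
    show "\<forall>x\<in>H3. inverse.\<phi> (\<phi> x) = x" using \<phi>_inverse by blast
    show "\<forall>x\<in>H3. \<phi> (inverse.\<phi> x) = x" using inverse.\<phi>_inverse by blast
  qed
qed (rule \<phi>_hdist)

lemma (in two_frames) \<phi>_image:
  assumes "S \<subseteq> H3" "T \<subseteq> H3" "\<And>x. x \<in> H3 \<Longrightarrow> \<phi> x \<in> T \<longleftrightarrow> x \<in> S"
  shows "\<phi> ` S = T"
proof -
  have "\<phi> ` H3 = H3" using hisometry_\<phi> by (simp add: hisometry_def bij_betw_def)
  then have surj: "\<exists>x\<in>H3. y = \<phi> x" if "y \<in> H3" for y using that by (metis imageE)
  show ?thesis
  proof
    show "\<phi> ` S \<subseteq> T" using assms(1,3) by auto
    show "T \<subseteq> \<phi> ` S"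
    proof
      fix y assume "y \<in> T"
      moreover from this obtain x where "x \<in> H3" "y = \<phi> x" using assms(2) surj by (meson subsetD)
      ultimately show "y \<in> \<phi> ` S" using assms(3) by simp
    qed
  qed
qed

lemma (in two_frames) isometric:
  assumes f: "A.realized_by f" and g: "B.realized_by g"
  shows "isometric_realizations I Z f g"
proof -
  have p: "\<phi> ` A.pol = B.pol" by (rule \<phi>_image[OF _ _ \<phi>_pol]) (auto simp: A.pol_def B.pol_def)
  have h: "\<phi> ` A.face J = B.face J" for J by (rule \<phi>_image[OF A.face_subset_H3 B.face_subset_H3 \<phi>_face])
  have t: "\<phi> ` A.tri v = B.tri v" for v by (rule \<phi>_image[OF _ _ \<phi>_tri]) (auto simp: A.tri_def A.pol_def B.tri_def B.pol_def)
  show ?thesis unfolding isometric_realizations_def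
    by (rule exI[of _ \<phi>]) (use hisometry_\<phi> p h t f g in \<open>simp add: A.realized_by_def B.realized_by_def\<close>)
qed

lemma same_angles_imp_isometric:
  assumes "hyperideal_frame I Z m n" "hyperideal_frame.realized_by I Z m n f"
    "hyperideal_frame I Z m' n'" "hyperideal_frame.realized_by I Z m' n' g"
    "hyperideal_frame.ang n = hyperideal_frame.ang n'"
  shows "isometric_realizations I Z f g"
proof -
  interpret A: hyperideal_frame I Z m n by (rule assms(1))
  interpret B: hyperideal_frame I Z m' n' by (rule assms(3))
  interpret two_frames I Z m n m' n' by unfold_locales (rule assms(5))
  show ?thesis by (rule isometric[OF assms(2,4)])
qed

section \<open>Frames with prescribed dihedral angles\<close>

text \<open>Coordinates in which the form is \<open>y\<^sup>2 + t\<^sup>2 - 2 u w\<close>.\<close>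
definition null_vec :: "real \<Rightarrow> real \<Rightarrow> real \<Rightarrow> real \<Rightarrow> minkowski" where
  "null_vec y t u w = (vector [y, t, w / 2 - u], w / 2 + u)"

lemma mink_null_vec: "mink (null_vec y t u w) (null_vec y' t' u' w') = y * y' + (t * t' - (u * w' + w * u'))"
  by (simp add: null_vec_def mink_def inner_vec_def sum_3 vector_def field_simps)

lemma compl_pair: "distinct [v, w, k, l :: 4] \<Longrightarrow> - {k, l} = {v, w}"
  using UNIV_4[of v w k l] by auto

lemma fourth_index:
  assumes "distinct [i, j, k :: 4]"
  obtains v where "distinct [v, i, j, k]"
proof -
  have "i \<noteq> j" using assms by simp
  then obtain a b where ab: "distinct [i, j, a, b]" using complete_4 by metis
  show ?thesis
  proof (cases "k = a")
    case True
    then show ?thesis using that[of b] ab by auto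
  next
    case False
    then show ?thesis using that[of a] ab assms by auto
  qed
qed

locale angle_data =
  fixes I :: "4 set" and Z :: "4 set set" and \<theta> :: "4 set \<Rightarrow> real"
  assumes ptt: "partially_truncated_tetrahedron I Z" and angles: "\<theta> \<in> angle_functions I Z"
begin

text \<open>The prospective Gram matrix of the unit normals.\<close>
definition N :: "4 \<Rightarrow> 4 \<Rightarrow> real" where "N k l = (if k = l then 1 else - cos (\<theta> (- {k, l})))"

lemma N_sym: "N k l = N l k"
  by (simp add: N_def insert_commute)

lemma N_self: "N k k = 1"
  by (simp add: N_def)

lemma range: assumes "v \<noteq> w" shows "0 \<le> \<theta> {v, w}" "\<theta> {v, w} < pi" "\<theta> {v, w} = 0 \<longleftrightarrow> {v, w} \<in> Z"
proof -
  have "{v, w} \<in> edges" using assms by (simp add: edges_def)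
  then show "0 \<le> \<theta> {v, w}" "\<theta> {v, w} < pi" "\<theta> {v, w} = 0 \<longleftrightarrow> {v, w} \<in> Z"
    using angles by (auto simp: angle_functions_def PiE_def Pi_def)
qed

lemma vertex_sum:
  assumes d: "distinct [v, a, b, c]"
  shows "v \<in> I \<Longrightarrow> \<theta> {v, a} + \<theta> {v, b} + \<theta> {v, c} = pi" "v \<notin> I \<Longrightarrow> \<theta> {v, a} + \<theta> {v, b} + \<theta> {v, c} < pi"
  using angles unfolding angle_functions_def sum_edges_at[OF d, of \<theta>, symmetric] by auto

lemma N_off: "distinct [v, w, k, l] \<Longrightarrow> N k l = - cos (\<theta> {v, w})"
  using compl_pair[of v w k l] by (simp add: N_def)

lemma N_le: "(N k l)\<^sup>2 \<le> 1"
  by (simp add: N_def abs_square_le_1)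

lemma ideal_pos: "v \<in> I \<Longrightarrow> v \<noteq> a \<Longrightarrow> 0 < \<theta> {v, a}"
  using range[of v a] ptt by (fastforce simp: partially_truncated_tetrahedron_def)

lemma N_facts:
  assumes d: "distinct [v, i, j, k]"
  shows "- N i j + N i k * N j k > 0"
    "v \<notin> I \<Longrightarrow> gram_det (- N i j) (- N i k) (- N j k) < 0"
    "v \<in> I \<Longrightarrow> gram_det (- N i j) (- N i k) (- N j k) = 0"
proof -
  have e: "- N i j = cos (\<theta> {v, k})" "- N i k = cos (\<theta> {v, j})" "- N j k = cos (\<theta> {v, i})"
    using N_off[of v k i j] N_off[of v j i k] N_off[of v i j k] d by auto
  then have e': "N i k * N j k = cos (\<theta> {v, j}) * cos (\<theta> {v, i})" by (metis minus_mult_minus)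
  have d': "distinct [v, k, j, i]" "v \<noteq> k" "v \<noteq> j" "v \<noteq> i" using d by auto
  note r = range(1)[OF d'(2)] range(1,2)[OF d'(3)] range(1,2)[OF d'(4)]
  have "cos (\<theta> {v, k}) + cos (\<theta> {v, j}) * cos (\<theta> {v, i}) > 0 \<and>
    (if v \<in> I then gram_det (cos (\<theta> {v, k})) (cos (\<theta> {v, j})) (cos (\<theta> {v, i})) = 0
     else gram_det (cos (\<theta> {v, k})) (cos (\<theta> {v, j})) (cos (\<theta> {v, i})) < 0)"
    using gram_det_of_angle_sum[OF r] vertex_sum[OF d'(1)] ideal_pos[of v j] ideal_pos[of v i] d' by auto
  then show "- N i j + N i k * N j k > 0"
    "v \<notin> I \<Longrightarrow> gram_det (- N i j) (- N i k) (- N j k) < 0"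
    "v \<in> I \<Longrightarrow> gram_det (- N i j) (- N i k) (- N j k) = 0"
    unfolding e e' by auto
qed

lemma N_pos: "distinct [i, j, k] \<Longrightarrow> - N i j + N i k * N j k > 0"
  using fourth_index N_facts(1) by metis

lemma N_gram_le: "distinct [i, j, k] \<Longrightarrow> gram_det (- N i j) (- N i k) (- N j k) \<le> 0"
  using fourth_index N_facts(2,3) by (metis order_refl less_imp_le)

text \<open>The normal \<open>n o'\<close> is the first unit vector, the first coordinates of the others are then prescribed, and the rest
  realizes the matrix \<open>P\<close> left after eliminating \<open>o'\<close>. Independence holds because \<open>P\<close> has negative
  determinant.\<close>
lemma ex_normals: "\<exists>n. (\<forall>k l. mink (n k) (n l) = N k l) \<and> dim (range n) = 4"
proof -
  obtain o' a :: 4 where oa: "o' \<noteq> a" by (metis zero_neq_one)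
  then obtain b c where d: "distinct [o', a, b, c]" "UNIV = {o', a, b, c}" using complete_4 by metis
  have neq: "o' \<noteq> a" "o' \<noteq> b" "o' \<noteq> c" "a \<noteq> b" "a \<noteq> c" "b \<noteq> c" using d by auto
  define P where P: "P i j = N i j - N o' i * N o' j" for i j
  have Psym: "P i j = P j i" for i j unfolding P using N_sym[of i j] by simp
  define p q r x y z where "p = - P a b" "q = - P a c" "r = - P b c" "x = P a a" "y = P b b" "z = P c c"
  note df = p_q_r_x_y_z_def
  have pqr: "p > 0" "q > 0" "r > 0"
    using N_pos[of a b o'] N_pos[of a c o'] N_pos[of b c o'] neq
    unfolding df P N_sym[of a o'] N_sym[of b o'] N_sym[of c o'] by (simp_all add: mult.commute)
  have xyz: "x \<ge> 0" "y \<ge> 0" "z \<ge> 0"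
    using N_le[of o' a] N_le[of o' b] N_le[of o' c] unfolding df P by (simp_all add: N_self power2_eq_square)
  have "x * y - p\<^sup>2 = gram_det (- N o' a) (- N o' b) (- N a b)"
    unfolding df P gram_det_def by (simp add: N_self algebra_simps power2_eq_square)
  then have xy: "x * y \<le> p\<^sup>2" using N_gram_le[of o' a b] neq by simp
  obtain t1 u1 w1 t2 u2 w2 t3 u3 w3 where tu:
     "t1 * t1 - 2 * u1 * w1 = x" "t2 * t2 - 2 * u2 * w2 = y" "t3 * t3 - 2 * u3 * w3 = z"
     "t1 * t2 - (u1 * w2 + w1 * u2) = - p" "t1 * t3 - (u1 * w3 + w1 * u3) = - q" "t2 * t3 - (u2 * w3 + w2 * u3) = - r"
    using ex_null_coordinates[OF pqr xyz xy] by blast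
  define n where "n k = (if k = o' then null_vec 1 0 0 0 else if k = a then null_vec (N o' a) t1 u1 w1
    else if k = b then null_vec (N o' b) t2 u2 w2 else null_vec (N o' c) t3 u3 w3)" for k
  have nn: "n o' = null_vec 1 0 0 0" "n a = null_vec (N o' a) t1 u1 w1" "n b = null_vec (N o' b) t2 u2 w2" "n c = null_vec (N o' c) t3 u3 w3"
    using neq by (simp_all add: n_def)
  have g1: "mink (n o') (n o') = N o' o'" "mink (n o') (n a) = N o' a" "mink (n o') (n b) = N o' b" "mink (n o') (n c) = N o' c"
    unfolding nn mink_null_vec by (simp_all add: N_self)
  have g2: "mink (n a) (n a) = N a a" "mink (n b) (n b) = N b b" "mink (n c) (n c) = N c c"
    unfolding nn mink_null_vec using tu(1-3) unfolding df P by (simp_all add: N_self)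
  have g3: "mink (n a) (n b) = N a b" "mink (n a) (n c) = N a c" "mink (n b) (n c) = N b c"
    unfolding nn mink_null_vec using tu(4-6) unfolding df P by simp_all
  have gram: "mink (n k) (n l) = N k l" for k l
  proof -
    have "k \<in> {o', a, b, c}" "l \<in> {o', a, b, c}" using d(2) by auto
    then show ?thesis using g1 g2 g3 N_sym[of k l] mink_commute[of "n k" "n l"] by auto
  qed
  have "inj n"
  proof (rule injI, rule ccontr)
    fix k l assume nkl: "n k = n l" "k \<noteq> l"
    then have "N k l = 1" using gram[of k l] gram[of l l] N_self by simp
    moreover obtain v w where "distinct [k, l, v, w]" using complete_4[OF nkl(2)] by metis
    then have "N k l = - cos (\<theta> {v, w})" "v \<noteq> w" using N_off[of v w k l] by auto
    ultimately have "cos (\<theta> {v, w}) = cos pi" by simp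
    then show False using range[OF \<open>v \<noteq> w\<close>] cos_inj_pi[of "\<theta> {v, w}" pi] by auto
  qed
  moreover have "\<not> dependent (range n)"
  proof
    assume "dependent (range n)"
    then obtain u' k where k: "u' (n k) \<noteq> 0" and s: "(\<Sum>v\<in>range n. u' v *\<^sub>R v) = 0"
      using dependent_finite[of "range n"] by auto
    define u where "u k = u' (n k)" for k
    have "(\<Sum>k\<in>UNIV. u k *\<^sub>R n k) = 0" using s sum.reindex[OF \<open>inj n\<close>, of "\<lambda>v. u' v *\<^sub>R v"] by (simp add: u_def)
    then have "mink (\<Sum>k\<in>UNIV. u k *\<^sub>R n k) (n l) = 0" for l by (simp add: mink_simps)
    then have "(\<Sum>k\<in>UNIV. u k * N k l) = 0" for l by (simp add: mink_sum_left mink_simps gram)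
    then have sN: "u o' * N o' l + u a * N a l + u b * N b l + u c * N c l = 0" for l using sum_4[OF d(1), of "\<lambda>k. u k * N k l"] by simp
    have u0: "u o' = - (u a * N o' a + u b * N o' b + u c * N o' c)"
      using sN[of o'] unfolding N_sym[of a o'] N_sym[of b o'] N_sym[of c o'] N_self by simp
    have uP: "u a * P a l + u b * P b l + u c * P c l = 0" for l
    proof -
      have "u a * P a l + u b * P b l + u c * P c l = u o' * N o' l + u a * N a l + u b * N b l + u c * N c l"
        unfolding P u0 by (simp add: algebra_simps)
      then show ?thesis using sN by simp
    qed
    define D where "D = x * y * z + 2 * (- p) * (- q) * (- r) - x * (- r)\<^sup>2 - y * (- q)\<^sup>2 - z * (- p)\<^sup>2"
    have e: "u a * x + u b * (- p) + u c * (- q) = 0" "u a * (- p) + u b * y + u c * (- r) = 0" "u a * (- q) + u b * (- r) + u c * z = 0"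
      using uP[of a] uP[of b] uP[of c] Psym[of b a] Psym[of c a] Psym[of c b] unfolding df by simp_all
    have "x * y * z \<le> z * p\<^sup>2" using mult_right_mono[OF xy xyz(3)] by (simp add: mult.commute)
    moreover have "2 * p * q * r > 0" "x * r\<^sup>2 \<ge> 0" "y * q\<^sup>2 \<ge> 0" using pqr xyz by auto
    moreover have "D = x * y * z - 2 * p * q * r - x * r\<^sup>2 - y * q\<^sup>2 - z * p\<^sup>2" by (simp add: D_def)
    ultimately have D: "D < 0" by linarith
    have "u b * D = 0" "u c * D = 0" using cramer_symmetric3[OF e D_def] by simp_all
    then have bc: "u b = 0" "u c = 0" using D by auto
    have "u a * p = 0" using e(2) bc by simp
    then have ua: "u a = 0" using pqr by simp
    then have "u o' = 0" using u0 bc by simp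
    then have "u k = 0" for k using ua bc d(2) by (metis UNIV_I insertE singletonD)
    then show False using k by (simp add: u_def)
  qed
  ultimately have "dim (range n) = 4" by (simp add: dim_eq_card_independent card_image)
  then show ?thesis using gram by blast
qed

lemma N_sq_1: "distinct [v, w, k, l] \<Longrightarrow> (N k l)\<^sup>2 = 1 \<longleftrightarrow> {v, w} \<in> Z"
proof -
  assume d: "distinct [v, w, k, l]"
  then have vw: "v \<noteq> w" by simp
  have "(N k l)\<^sup>2 = 1 \<longleftrightarrow> cos (\<theta> {v, w}) = 1 \<or> cos (\<theta> {v, w}) = - 1"
    using N_off[OF d] by (simp add: power2_eq_1_iff)
  also have "\<dots> \<longleftrightarrow> \<theta> {v, w} = 0"
    using range[OF vw] cos_inj_pi[of "\<theta> {v, w}" 0] cos_inj_pi[of "\<theta> {v, w}" pi] by auto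
  finally show ?thesis using range(3)[OF vw] by simp
qed

text \<open>The dual basis of the normals has the required Gram signs by the lemma \<open>dual_of_gram\<close>, for each choice of two
  indices. It only remains to normalize the spacelike poles and to rescale the normals inversely.\<close>
lemma ex_dual_frame: "\<exists>m n. dual_frame I Z m n \<and> (\<forall>k l. k \<noteq> l \<longrightarrow>
   mink (n k) (n l) / (sqrt (mink (n k) (n k)) * sqrt (mink (n l) (n l))) = N k l)"
proof -
  obtain n where n: "\<And>k l. mink (n k) (n l) = N k l" "dim (range n) = 4" using ex_normals by blast
  have ex: "\<exists>z. mink z (n v) = 1 \<and> (\<forall>k. k \<noteq> v \<longrightarrow> mink z (n k) = 0)" for v
  proof -
    have "dim (reflect ` n ` (- {v})) \<le> card (reflect ` n ` (- {v}))" by (rule dim_le_card') simp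
    also have "\<dots> \<le> card (- {v})" using card_image_le[of "- {v}" "reflect \<circ> n"] by (simp add: image_comp)
    also have "\<dots> = 3" by (simp add: card_Diff_singleton Compl_eq_Diff_UNIV)
    finally have "dim (reflect ` n ` (- {v})) < DIM(minkowski)" by simp
    then obtain z where z: "z \<noteq> 0" "\<And>y. y \<in> span (reflect ` n ` (- {v})) \<Longrightarrow> orthogonal z y"
      using orthogonal_to_subspace_exists by blast
    have z0: "mink z (n k) = 0" if "k \<noteq> v" for k
      using z(2)[of "reflect (n k)"] that by (auto simp: mink_eq_inner orthogonal_def intro: span_base)
    have "mink z (n v) \<noteq> 0"
    proof
      assume "mink z (n v) = 0"
      then have "mink z (n k) = 0" for k using z0 by (cases "k = v") auto
      then have "z = 0" by (intro mink_zeroI[of "range n"]) (auto simp: n(2))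
      then show False using z(1) by simp
    qed
    then show ?thesis using z0 by (intro exI[of _ "(1 / mink z (n v)) *\<^sub>R z"]) (simp add: mink_simps)
  qed
  define m where "m v = (SOME z. mink z (n v) = 1 \<and> (\<forall>k. k \<noteq> v \<longrightarrow> mink z (n k) = 0))" for v
  have dual: "mink (m v) (n k) = (if v = k then 1 else 0)" for v k
    using someI_ex[OF ex[of v]] by (auto simp: m_def)
  have dim_m: "dim (range m) = 4" using dim_dual[of UNIV n m] dual by (simp add: mink_commute)
  have expand_n: "x = (\<Sum>k\<in>UNIV. mink x (m k) *\<^sub>R n k)" for x
  proof -
    have "x - (\<Sum>k\<in>UNIV. mink x (m k) *\<^sub>R n k) = 0"
      by (rule mink_zeroI[of "range m"])
         (auto simp: dim_m mink_simps mink_sum_left dual mink_commute[of "n _"] if_distrib cong: if_cong)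
    then show ?thesis by simp
  qed
  define M where "M i j = mink (m i) (m j)" for i j
  have inv: "(\<Sum>j\<in>UNIV. M i j * N j k) = (if i = k then 1 else 0)" for i k
  proof -
    have "mink (m i) (n k) = mink (\<Sum>j\<in>UNIV. mink (m i) (m j) *\<^sub>R n j) (n k)" using expand_n[of "m i"] by simp
    then show ?thesis by (simp add: mink_sum_left mink_simps dual n M_def)
  qed
  have inv4: "M i o' * N o' k + M i a * N a k + M i b * N b k + M i c * N c k = (if i = k then 1 else 0)"
    if "distinct [o', a, b, c]" for i k o' a b c using inv[of i k] sum_4[OF that, of "\<lambda>j. M i j * N j k"] by simp
  have Msym: "M i k = M k i" for i k by (simp add: M_def mink_commute)
  have D: "M b c < 0" "M c c \<ge> 0" "M c c = 0 \<longleftrightarrow> c \<in> I" "M b b * M c c \<le> (M b c)\<^sup>2" "M b b * M c c = (M b c)\<^sup>2 \<longleftrightarrow> {b, c} \<in> Z"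
    if bc: "b \<noteq> c" for b c
  proof -
    obtain o' a where d: "distinct [b, c, o', a]" using complete_4[OF bc] by metis
    then have d': "distinct [o', a, b, c]" "distinct [o', a, b]" "distinct [c, o', a, b]" by auto
    note G = dual_of_gram[OF d'(1) inv4[OF d'(1)] Msym N_sym N_self N_pos N_le N_gram_le[OF d'(2)]]
    show "M b c < 0" "M c c \<ge> 0" "M b b * M c c \<le> (M b c)\<^sup>2" using G by blast+
    show "M c c = 0 \<longleftrightarrow> c \<in> I" using G(3) N_facts(2,3)[OF d'(3)] by force
    show "M b b * M c c = (M b c)\<^sup>2 \<longleftrightarrow> {b, c} \<in> Z" using G(5) N_sq_1[OF d] by simp
  qed
  have Mpos: "M c c > 0" if "c \<notin> I" for c
  proof -
    obtain b where "b \<noteq> c" by (metis (full_types) zero_neq_one)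
    then show ?thesis using D(2,3)[of b c] that by auto
  qed
  have M0: "M c c = 0" if "c \<in> I" for c
  proof -
    obtain b where "b \<noteq> c" by (metis (full_types) zero_neq_one)
    then show ?thesis using D(3)[of b c] that by auto
  qed
  define s where "s v = (if v \<in> I then 1 else sqrt (M v v))" for v
  have s: "s v > 0" for v using Mpos by (simp add: s_def)
  have ss: "s v * s v = M v v" if "v \<notin> I" for v using Mpos[OF that] that by (simp add: s_def)
  define m2 n2 where "m2 v = (1 / s v) *\<^sub>R m v" "n2 v = s v *\<^sub>R n v" for v
  have m2: "mink (m2 v) (m2 w) = M v w / (s v * s w)" for v w by (simp add: m2_n2_def mink_simps M_def)
  have "dual_frame I Z m2 n2"
  proof
    show "partially_truncated_tetrahedron I Z" by (rule ptt)
    show "mink (m2 v) (n2 k) = (if v = k then 1 else 0)" for v k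
      using s[of v] by (auto simp: m2_n2_def mink_simps dual)
    show "mink (m2 v) (m2 v) = (if v \<in> I then 0 else 1)" for v
    proof (cases "v \<in> I")
      case False
      then have "mink (m2 v) (m2 v) = M v v / M v v" by (simp add: m2 ss)
      then show ?thesis using False Mpos[OF False] by simp
    qed (simp add: m2 M0)
    fix v w :: 4 assume vw: "v \<noteq> w"
    show neg: "mink (m2 v) (m2 w) < 0" using D(1)[OF vw] s by (simp add: m2 divide_neg_pos)
    assume I: "v \<notin> I" "w \<notin> I"
    have sq: "(mink (m2 v) (m2 w))\<^sup>2 = (M v w)\<^sup>2 / (M v v * M w w)"
      by (simp add: m2 power_divide power_mult_distrib) (simp add: power2_eq_square ss I)
    have p: "M v v * M w w > 0" using Mpos I by simp
    have ge: "(mink (m2 v) (m2 w))\<^sup>2 \<ge> 1" and eq: "(mink (m2 v) (m2 w))\<^sup>2 = 1 \<longleftrightarrow> {v, w} \<in> Z"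
      using D(4,5)[OF vw] p unfolding sq by (auto simp: field_simps)
    show "mink (m2 v) (m2 w) \<le> - 1" using ge neg abs_le_square_iff[of 1 "mink (m2 v) (m2 w)"] by simp
    show "mink (m2 v) (m2 w) = - 1 \<longleftrightarrow> {v, w} \<in> Z" using eq neg by (auto simp: power2_eq_1_iff)
  qed
  moreover have "mink (n2 k) (n2 l) / (sqrt (mink (n2 k) (n2 k)) * sqrt (mink (n2 l) (n2 l))) = N k l" for k l
    using s[of k] s[of l] by (simp add: m2_n2_def mink_simps n N_self)
  ultimately show ?thesis by blast
qed

end

context dual_frame begin

text \<open>In particular the cone contains no spacelike vector, so time does not vanish on it except at the origin. As
  the cone is convex and contains no line, it lies in a single half of the light cone (\<open>K_same_side\<close>).\<close>
lemma cone_form_nonpos: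
  assumes "x \<in> K" "y \<in> K" shows "mink x y \<le> 0"
  unfolding mink_expand[of x y]
  by (rule sum_nonpos) (use assms mink_m_le_K[of y] in \<open>auto simp: K_def mult_nonneg_nonpos mink_commute[of _ y]\<close>)

lemma K_add: "x \<in> K \<Longrightarrow> y \<in> K \<Longrightarrow> x + y \<in> K"
  by (auto simp: K_def mink_simps add_nonpos_nonpos)

lemma K_scale: "x \<in> K \<Longrightarrow> 0 \<le> t \<Longrightarrow> t *\<^sub>R x \<in> K"
  by (auto simp: K_def mink_simps mult_nonneg_nonpos)

lemma K_spacelike_zero:
  assumes "x \<in> K" "snd x = 0" shows "x = 0"
proof -
  have "fst x \<bullet> fst x \<le> 0" using cone_form_nonpos[OF assms(1,1)] assms(2) by (simp add: mink_def)
  then have "fst x = 0" by (metis inner_eq_zero_iff inner_ge_zero order_antisym)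
  then show ?thesis using assms(2) by (simp add: prod_eq_iff)
qed

lemma K_salient:
  assumes "x \<in> K" "y \<in> K" "x + y = 0" shows "x = 0"
proof -
  have "mink x (n k) = 0" for k
  proof -
    have "mink x (n k) + mink y (n k) = 0" using assms(3) by (metis bilinear_ladd[OF bilinear_mink] bilinear_lzero[OF bilinear_mink])
    then show ?thesis using assms(1,2) by (simp add: K_def) (metis add_nonneg_eq_0_iff)
  qed
  then show ?thesis using zero_iff_coords by blast
qed

lemma K_same_side:
  assumes "x \<in> K" "y \<in> K" "x \<noteq> 0" "y \<noteq> 0" shows "snd x * snd y > 0"
proof (rule ccontr)
  assume "\<not> snd x * snd y > 0"
  moreover have "snd x \<noteq> 0" "snd y \<noteq> 0" using K_spacelike_zero assms by blast+
  ultimately have "snd x > 0 \<and> snd y < 0 \<or> snd x < 0 \<and> snd y > 0" by (auto simp: zero_less_mult_iff)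
  then have p: "\<bar>snd y\<bar> > 0" "\<bar>snd x\<bar> > 0" and z: "\<bar>snd y\<bar> * snd x + \<bar>snd x\<bar> * snd y = 0" by (auto simp: abs_if)
  have K2: "\<bar>snd y\<bar> *\<^sub>R x \<in> K" "\<bar>snd x\<bar> *\<^sub>R y \<in> K" using K_scale assms by simp_all
  have "\<bar>snd y\<bar> *\<^sub>R x + \<bar>snd x\<bar> *\<^sub>R y = 0"
    by (rule K_spacelike_zero[OF K_add[OF K2]]) (use z in simp)
  then have "\<bar>snd y\<bar> *\<^sub>R x = 0" using K_salient[OF K2] by blast
  then show False using p assms by simp
qed

lemma edge_vector_nonzero: "v \<noteq> w \<Longrightarrow> X v w \<noteq> 0"
  using edge_vector_coord[of v w v] neg[of v w] by (auto simp: mink_simps)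

end

lemma edge_vector_reflect: "edge_vector (\<lambda>v. reflect (m v)) v w = reflect (edge_vector m v w)"
  unfolding edge_vector_def mink_reflect by (simp add: reflect_def)

lemma dual_frame_reflect:
  assumes "dual_frame I Z m n" shows "dual_frame I Z (\<lambda>v. reflect (m v)) (\<lambda>v. reflect (n v))"
  using assms unfolding dual_frame_def mink_reflect .

text \<open>The cone lies in the future or in the past, and in the second case time is reversed.\<close>
lemma hyperideal_frame_exists:
  assumes "partially_truncated_tetrahedron I Z" "\<theta> \<in> angle_functions I Z"
  shows "\<exists>m n. hyperideal_frame I Z m n \<and> hyperideal_frame.ang n = \<theta>"
proof -
  interpret angle_data I Z \<theta> by unfold_locales (use assms in auto)
  obtain m n where F: "dual_frame I Z m n" and N: "\<And>k l. k \<noteq> l \<Longrightarrow> 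
     mink (n k) (n l) / (sqrt (mink (n k) (n k)) * sqrt (mink (n l) (n l))) = N k l" using ex_dual_frame by blast
  interpret F: dual_frame I Z m n by (rule F)
  have "\<exists>m' n'. hyperideal_frame I Z m' n' \<and> (\<forall>k l. mink (n' k) (n' l) = mink (n k) (n l))"
  proof (cases "snd (edge_vector m 0 1) > 0")
    case True
    have "snd (edge_vector m v w) > 0" if "v \<noteq> w" for v w
      using F.K_same_side[OF F.edge_vector_in_K[of 0 1] F.edge_vector_in_K[OF that] F.edge_vector_nonzero[of 0 1] F.edge_vector_nonzero[OF that]] True
      by (simp add: zero_less_mult_iff)
    then have "hyperideal_frame I Z m n" by unfold_locales
    then show ?thesis by blast
  next
    case False
    have "snd (reflect (edge_vector m v w)) > 0" if "v \<noteq> w" for v w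
      using F.K_same_side[OF F.edge_vector_in_K[of 0 1] F.edge_vector_in_K[OF that] F.edge_vector_nonzero[of 0 1] F.edge_vector_nonzero[OF that]] False
      by (simp add: zero_less_mult_iff reflect_def)
    then have "hyperideal_frame I Z (\<lambda>v. reflect (m v)) (\<lambda>v. reflect (n v))"
      unfolding hyperideal_frame_def hyperideal_frame_axioms_def edge_vector_reflect
      using dual_frame_reflect[OF F] by blast
    then show ?thesis using mink_reflect by blast
  qed
  then obtain m' n' where H: "hyperideal_frame I Z m' n'" and eq: "\<And>k l. mink (n' k) (n' l) = mink (n k) (n l)" by blast
  interpret H: hyperideal_frame I Z m' n' by (rule H)
  have "H.ang = \<theta>"
  proof (rule angle_functions_eqI[OF H.ang_in_angle_functions assms(2)])
    fix e assume e: "e \<in> edges - Z"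
    obtain v w k l where d: "e = {v, w}" "- e = {k, l}" "distinct [v, w, k, l]" using edge_cases e by blast
    have "H.norm_gram k l = N k l" using N[of k l] d by (simp add: H.norm_gram_def eq)
    then have "H.ang e = arccos (cos (\<theta> e))" using H.ang_norm_gram[OF d(3)] N_off[OF d(3)] d(1) by simp
    also have "\<dots> = \<theta> e" using range(1,2)[of v w] d by (intro arccos_cos) auto
    finally show "H.ang e = \<theta> e" .
  qed
  then show ?thesis using H by blast
qed

section \<open>Proportional points of two truncated simplices\<close>

text \<open>The sign conditions that a matrix shares with the Gram matrix of poles. The value \<open>-1\<close> is permitted only on length-0
  edges, but not enforced there, so that the matrix describing the model polyhedron is included.\<close>
definition admissible :: "4 set \<Rightarrow> 4 set set \<Rightarrow> (4 \<Rightarrow> 4 \<Rightarrow> real) \<Rightarrow> bool" where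
  "admissible I Z A \<longleftrightarrow> partially_truncated_tetrahedron I Z \<and> (\<forall>v w. A v w = A w v) \<and> (\<forall>v. A v v = (if v \<in> I then 0 else 1)) \<and>
     (\<forall>v w. v \<noteq> w \<longrightarrow> A v w < 0) \<and>
     (\<forall>v w. v \<noteq> w \<and> v \<notin> I \<and> w \<notin> I \<longrightarrow> A v w \<le> -1 \<and> (A v w = -1 \<longrightarrow> {v, w} \<in> Z))"

text \<open>The inequality of the truncation at \<open>v\<close> is \<open>slack A y v \<ge> 0\<close>. Coordinates and slacks play symmetric
  roles: the faces are the zero sets of the former and the truncation triangles those of the latter.\<close>
definition slack :: "(4 \<Rightarrow> 4 \<Rightarrow> real) \<Rightarrow> real^4 \<Rightarrow> 4 \<Rightarrow> real" where
  "slack A y v = - (\<Sum>w\<in>UNIV. A v w * y $ w)"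

definition supp :: "real^4 \<Rightarrow> 4 set" where "supp y = {v. y $ v \<noteq> 0}"

definition unit_simplex :: "(real^4) set" where
  "unit_simplex = {y. (\<forall>v. 0 \<le> y $ v) \<and> (\<Sum>v\<in>UNIV. y $ v) = 1}"

definition slack_simplex :: "4 set \<Rightarrow> (4 \<Rightarrow> 4 \<Rightarrow> real) \<Rightarrow> (real^4) set" where
  "slack_simplex I A = {y \<in> unit_simplex. \<forall>v. v \<notin> I \<longrightarrow> 0 \<le> slack A y v}"

definition bary :: "4 set \<Rightarrow> real^4" where
  "bary s = (\<chi> v. if v \<in> s then 1 / card s else 0)"

lemma admissible_props:
  assumes "admissible I Z A"
  shows "A v w = A w v" "A v v = (if v \<in> I then 0 else 1)" "v \<noteq> w \<Longrightarrow> A v w < 0"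
    "v \<noteq> w \<Longrightarrow> v \<notin> I \<Longrightarrow> w \<notin> I \<Longrightarrow> A v w \<le> -1"
    "v \<noteq> w \<Longrightarrow> v \<notin> I \<Longrightarrow> w \<notin> I \<Longrightarrow> A v w = -1 \<Longrightarrow> {v, w} \<in> Z"
    "{v, w} \<in> Z \<Longrightarrow> v \<notin> I \<and> w \<notin> I"
proof -
  have H: "partially_truncated_tetrahedron I Z" "\<forall>v w. A v w = A w v" "\<forall>v. A v v = (if v \<in> I then 0 else 1)"
    "\<forall>v w. v \<noteq> w \<longrightarrow> A v w < 0"
    "\<forall>v w. v \<noteq> w \<and> v \<notin> I \<and> w \<notin> I \<longrightarrow> A v w \<le> -1 \<and> (A v w = -1 \<longrightarrow> {v, w} \<in> Z)"
    using assms unfolding admissible_def by - (elim conjE, assumption)+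
  show "A v w = A w v" by (rule H(2)[rule_format])
  show "A v v = (if v \<in> I then 0 else 1)" by (rule H(3)[rule_format])
  show "v \<noteq> w \<Longrightarrow> A v w < 0" by (rule H(4)[rule_format])
  show "v \<noteq> w \<Longrightarrow> v \<notin> I \<Longrightarrow> w \<notin> I \<Longrightarrow> A v w \<le> -1"
    "v \<noteq> w \<Longrightarrow> v \<notin> I \<Longrightarrow> w \<notin> I \<Longrightarrow> A v w = -1 \<Longrightarrow> {v, w} \<in> Z"
    using H(5)[rule_format, of v w] by simp_all
  show "{v, w} \<in> Z \<Longrightarrow> v \<notin> I \<and> w \<notin> I" using H(1) unfolding partially_truncated_tetrahedron_def by auto
qed

lemma slack_add: "slack A (y + z) v = slack A y v + slack A z v"
  by (simp add: slack_def sum.distrib distrib_left)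

lemma slack_scale: "slack A (t *\<^sub>R y) v = t * slack A y v"
  by (simp add: slack_def sum_distrib_left mult.left_commute)

lemma slack_diff: "slack A (y - z) v = slack A y v - slack A z v"
  using slack_add[of A y "(-1) *\<^sub>R z" v] slack_scale[of A "-1" z v] by simp

lemma slack_axis: "slack A (t *\<^sub>R axis u 1) v = - t * A v u"
proof -
  have "(\<Sum>w\<in>UNIV. A v w * axis u 1 $ w) = (\<Sum>w\<in>UNIV. if w = u then A v w else 0)"
    by (rule sum.cong) (auto simp: axis_def)
  then show ?thesis unfolding slack_scale by (simp add: slack_def)
qed

lemma slack_symmetric:
  assumes "\<And>v w. A v w = A w v"
  shows "(\<Sum>v\<in>UNIV. z $ v * slack A y v) = (\<Sum>v\<in>UNIV. y $ v * slack A z v)"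
proof -
  have "(\<Sum>v\<in>UNIV. z $ v * slack A y v) = (\<Sum>v\<in>UNIV. \<Sum>w\<in>UNIV. - (z $ v * (A v w * y $ w)))"
    by (simp add: slack_def sum_negf sum_distrib_left)
  also have "\<dots> = (\<Sum>w\<in>UNIV. \<Sum>v\<in>UNIV. - (z $ v * (A v w * y $ w)))" by (rule sum.swap)
  also have "\<dots> = (\<Sum>w\<in>UNIV. \<Sum>v\<in>UNIV. - (y $ w * (A w v * z $ v)))"
  proof (intro sum.cong refl)
    fix v w show "- (z $ v * (A v w * y $ w)) = - (y $ w * (A w v * z $ v))" using assms[of v w] by simp
  qed
  also have "\<dots> = (\<Sum>v\<in>UNIV. y $ v * slack A z v)" by (simp add: slack_def sum_negf sum_distrib_left)
  finally show ?thesis .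
qed

lemma slack_expand:
  assumes "admissible I Z A"
  shows "slack A y v = (\<Sum>w\<in>UNIV - {v}. - A v w * y $ w) - A v v * y $ v"
  by (simp add: slack_def sum.remove[of UNIV v] sum_negf)

lemma slack_nonneg_off:
  assumes "admissible I Z A" "\<And>w. 0 \<le> y $ w"
  shows "0 \<le> (\<Sum>w\<in>UNIV - {v}. - A v w * y $ w)"
  by (rule sum_nonneg) (use admissible_props(3)[OF assms(1)] assms(2) in \<open>auto simp: mult_nonpos_nonneg less_imp_le\<close>)

lemma slack_zero_off:
  assumes "admissible I Z A" "\<And>w. 0 \<le> y $ w" "(\<Sum>w\<in>UNIV - {v}. - A v w * y $ w) = 0" "w \<noteq> v"
  shows "y $ w = 0"
proof -
  have "\<forall>w\<in>UNIV - {v}. - A v w * y $ w = 0"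
    using assms(3) by (subst (asm) sum_nonneg_eq_0_iff) (use admissible_props(3)[OF assms(1)] assms(2) in \<open>auto simp: mult_nonpos_nonneg less_imp_le\<close>)
  then have "- A v w * y $ w = 0" using assms(4) by blast
  then show ?thesis using admissible_props(3)[OF assms(1), of v w] assms(4) by simp
qed

text \<open>Where the coordinate at \<open>v\<close> vanishes or \<open>v\<close> is ideal, the slack is a combination of the other
  coordinates with positive coefficients. A face and the truncation of its opposite vertex are therefore
  disjoint.\<close>
lemma slack_at_zero:
  assumes A: "admissible I Z A" and y: "\<And>w. 0 \<le> y $ w" "y $ v = 0 \<or> v \<in> I"
  shows "slack A y v \<ge> 0" "slack A y v = 0 \<Longrightarrow> w \<noteq> v \<Longrightarrow> y $ w = 0"
proof -
  have e: "slack A y v = (\<Sum>w\<in>UNIV - {v}. - A v w * y $ w)"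
    using slack_expand[OF A, of y v] admissible_props(2)[OF A, of v] y(2) by auto
  show "slack A y v \<ge> 0" unfolding e by (rule slack_nonneg_off[OF A y(1)])
  show "slack A y v = 0 \<Longrightarrow> w \<noteq> v \<Longrightarrow> y $ w = 0" unfolding e using slack_zero_off[OF A y(1)] by blast
qed

lemma unit_simplex_D: "y \<in> unit_simplex \<Longrightarrow> 0 \<le> y $ v" "y \<in> unit_simplex \<Longrightarrow> (\<Sum>v\<in>UNIV. y $ v) = 1"
  by (auto simp: unit_simplex_def)

lemma slack_simplex_D: "y \<in> slack_simplex I A \<Longrightarrow> y \<in> unit_simplex" "y \<in> slack_simplex I A \<Longrightarrow> 0 \<le> y $ v" 
  by (auto simp: slack_simplex_def unit_simplex_def)

lemma slack_simplex_slack: "admissible I Z A \<Longrightarrow> y \<in> slack_simplex I A \<Longrightarrow> 0 \<le> slack A y v"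
  using slack_at_zero(1)[of I Z A y v] slack_simplex_D[of y I A] by (cases "v \<in> I") (auto simp: slack_simplex_def)

lemma supp_nonempty: "y \<in> unit_simplex \<Longrightarrow> supp y \<noteq> {}"
  by (force simp: unit_simplex_def supp_def)

lemma supp_singleton: 
  assumes "y \<in> unit_simplex" "\<And>w. w \<noteq> v \<Longrightarrow> y $ w = 0" shows "y = bary {v}"
proof -
  have "(\<Sum>w\<in>UNIV. y $ w) = y $ v" using assms(2) by (subst sum.remove[of _ v]) auto
  then have "y $ v = 1" using unit_simplex_D(2)[OF assms(1)] by simp
  then show ?thesis using assms(2) by (auto simp: bary_def vec_eq_iff)
qed

lemma slack_0_ideal: "admissible I Z A \<Longrightarrow> y \<in> slack_simplex I A \<Longrightarrow> v \<in> I \<Longrightarrow> slack A y v = 0 \<Longrightarrow> y = bary {v}"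
  using slack_at_zero(2)[of I Z A y v] slack_simplex_D[of y I A] supp_singleton by blast

lemma slack_0_pos: 
  assumes "admissible I Z A" "y \<in> slack_simplex I A" "slack A y v = 0" shows "y $ v > 0"
proof (rule ccontr)
  assume "\<not> y $ v > 0"
  then have 0: "y $ v = 0" using slack_simplex_D(2)[OF assms(2), of v] by simp
  then have "y $ w = 0" for w using slack_at_zero(2)[OF assms(1), of y v w] slack_simplex_D(2)[OF assms(2)] assms(3) by (cases "w = v") auto
  then show False using unit_simplex_D(2)[OF slack_simplex_D(1)[OF assms(2)]] by simp
qed

lemma slack_bary_singleton: "admissible I Z A \<Longrightarrow> slack A (bary {v}) v = (if v \<in> I then 0 else -1)"
  using admissible_props(2)[of I Z A v] by (simp add: slack_def bary_def if_distrib[of "\<lambda>z. _ * z"] cong: if_cong)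

lemma supp_singleton_ideal:
  assumes "admissible I Z A" "y \<in> slack_simplex I A" "\<And>w. w \<noteq> v \<Longrightarrow> y $ w = 0" shows "v \<in> I \<and> y = bary {v}"
proof -
  have "y = bary {v}" using supp_singleton slack_simplex_D(1) assms by blast
  moreover from this have "v \<in> I" using slack_simplex_slack[OF assms(1,2), of v] slack_bary_singleton[OF assms(1), of v] by (auto split: if_splits)
  ultimately show ?thesis by blast
qed

lemma pair_eq:
  assumes "y \<in> unit_simplex" "v \<noteq> w" "\<And>u. u \<noteq> v \<Longrightarrow> u \<noteq> w \<Longrightarrow> y $ u = 0" "y $ v = y $ w"
  shows "y = bary {v, w}"
proof -
  obtain k l where d: "distinct [v, w, k, l]" using complete_4[OF assms(2)] by metis
  then have "y $ v + y $ w = 1" using unit_simplex_D(2)[OF assms(1)] sum_4[OF d, of "\<lambda>v. y $ v"] assms(3)[of k] assms(3)[of l] by auto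
  then have "y $ v = 1/2" "y $ w = 1/2" using assms(4) by auto
  then show ?thesis using assms(2,3) by (auto simp: bary_def vec_eq_iff)
qed

text \<open>Two truncation planes meet only at infinity, at the point of a length-0 edge.\<close>
lemma double_slack_0:
  assumes A: "admissible I Z A" and y: "y \<in> slack_simplex I A" and vw: "v \<noteq> w" "slack A y v = 0" "slack A y w = 0"
  shows "{v, w} \<in> Z \<and> A v w = -1 \<and> y = bary {v, w}"
proof -
  have pos: "y $ v > 0" "y $ w > 0" using slack_0_pos[OF A y] vw by auto
  have I: "v \<notin> I" "w \<notin> I"
    using slack_0_ideal[OF A y, of v] slack_0_ideal[OF A y, of w] vw pos by (auto simp: bary_def)
  obtain k l where d: "distinct [v, w, k, l]" using complete_4[OF vw(1)] by metis
  define a b c e f where "a = - A v w" "b = - A v k" "c = - A v l" "e = - A w k" "f = - A w l"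
  have p: "a \<ge> 1" "b > 0" "c > 0" "e > 0" "f > 0" "A v v = 1" "A w w = 1" "A w v = A v w"
    using admissible_props(4)[OF A vw(1) I] admissible_props(3)[OF A, of v k] admissible_props(3)[OF A, of v l] admissible_props(3)[OF A, of w k]
      admissible_props(3)[OF A, of w l] admissible_props(2)[OF A, of v] admissible_props(2)[OF A, of w] admissible_props(1)[OF A, of w v] I d
    unfolding a_b_c_e_f_def by simp_all
  have 1: "y $ v = a * y $ w + b * y $ k + c * y $ l"
    using vw(2) sum_4[OF d, of "\<lambda>u. A v u * y $ u"] p unfolding slack_def a_b_c_e_f_def by simp
  have 2: "y $ w = a * y $ v + e * y $ k + f * y $ l"
    using vw(3) sum_4[OF d, of "\<lambda>u. A w u * y $ u"] p unfolding slack_def a_b_c_e_f_def by simp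
  have n: "b * y $ k \<ge> 0" "c * y $ l \<ge> 0" "e * y $ k \<ge> 0" "f * y $ l \<ge> 0" using p slack_simplex_D(2)[OF y] by simp_all
  have m: "a * y $ w \<ge> y $ w" "a * y $ v \<ge> y $ v" using p pos by simp_all
  then have eq: "a * y $ w = y $ w" "b * y $ k = 0" "c * y $ l = 0" "y $ v = y $ w" using 1 2 n by linarith+
  then have "a = 1" "y $ k = 0" "y $ l = 0" using p pos by auto
  moreover have "y = bary {v, w}"
  proof (rule pair_eq[OF slack_simplex_D(1)[OF y] vw(1) _ eq(4)])
    fix u assume "u \<noteq> v" "u \<noteq> w"
    then have "u = k \<or> u = l" using UNIV_4[OF d] by auto
    then show "y $ u = 0" using \<open>y $ k = 0\<close> \<open>y $ l = 0\<close> by auto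
  qed
  ultimately show ?thesis using admissible_props(5)[OF A vw(1) I] by (simp add: a_b_c_e_f_def)
qed

lemma supp_Z:
  assumes A: "admissible I Z A" "A v w = -1" and y: "y \<in> slack_simplex I A" and vw: "v \<noteq> w" "v \<notin> I" "w \<notin> I" "\<And>u. u \<noteq> v \<Longrightarrow> u \<noteq> w \<Longrightarrow> y $ u = 0"
  shows "y = bary {v, w}"
proof -
  obtain k l where d: "distinct [v, w, k, l]" using complete_4[OF vw(1)] by metis
  have z: "y $ k = 0" "y $ l = 0" using d vw(4)[of k] vw(4)[of l] by auto
  have p: "A v v = 1" "A w w = 1" "A w v = -1" using admissible_props(1,2)[OF A(1)] vw A(2) by auto
  have "slack A y v = y $ w - y $ v" "slack A y w = y $ v - y $ w"
    using sum_4[OF d, of "\<lambda>u. A v u * y $ u"] sum_4[OF d, of "\<lambda>u. A w u * y $ u"] p z A(2) unfolding slack_def by simp_all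
  then have "y $ v = y $ w" using slack_simplex_slack[OF A(1) y, of v] slack_simplex_slack[OF A(1) y, of w] by simp
  then show ?thesis using pair_eq[OF slack_simplex_D(1)[OF y] vw(1)] vw(4) by blast
qed

text \<open>Every face other than a missing one contains a point of positive \<open>Q y = \<Sum> y\<^sub>v slack\<^sub>v\<close>, that is, a point of
  hyperbolic space: an edge that is not of length 0 does, and if all edges have length 0 then a sum of three poles.\<close>
lemma admissible_positive:
  assumes A: "admissible I Z A" and S: "card S \<ge> 2" "S \<notin> Z"
  shows "\<exists>z. (\<forall>v. 0 \<le> z $ v) \<and> supp z \<subseteq> S \<and> (\<Sum>v\<in>UNIV. z $ v * slack A z v) > 0"
proof (cases "\<exists>v\<in>S. \<exists>w\<in>S. v \<noteq> w \<and> {v, w} \<notin> Z")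
  case True
  then obtain v w where vw: "v \<in> S" "w \<in> S" "v \<noteq> w" "{v, w} \<notin> Z" by blast
  define a b c where "a = A v v" "b = A w w" "c = A v w"
  have abc: "a \<ge> 0" "b \<ge> 0" "c < 0" "A w v = c" using admissible_props(1-3)[OF A] vw by (auto simp: a_b_c_def)
  have "a * b < c * c"
  proof (cases "v \<in> I \<or> w \<in> I")
    case True
    then have "a * b = 0" using admissible_props(2)[OF A] by (auto simp: a_b_c_def)
    then show ?thesis using mult_neg_neg[OF abc(3) abc(3)] by linarith
  next
    case False
    then have "c < -1" using admissible_props(4,5)[OF A vw(3)] vw(4) by (force simp: a_b_c_def less_le)
    then have "(-c) * (-c) > 1 * 1" by (intro mult_strict_mono) auto
    moreover have "a = 1" "b = 1" using False admissible_props(2)[OF A] by (auto simp: a_b_c_def)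
    ultimately show ?thesis by simp
  qed
  then have q: "(c * c - a * b) * (a + b - 2 * c) > 0" using abc by (intro mult_pos_pos) auto
  define z :: "real^4" where "z = (\<chi> i. if i = v then b - c else if i = w then a - c else 0)"
  obtain k l where d: "distinct [v, w, k, l]" using complete_4[OF vw(3)] by metis
  have zz: "z $ v = b - c" "z $ w = a - c" "z $ k = 0" "z $ l = 0" using d by (auto simp: z_def)
  have s: "slack A z v = - (a * (b - c) + c * (a - c))" "slack A z w = - (c * (b - c) + b * (a - c))"
    using sum_4[OF d, of "\<lambda>u. A v u * z $ u"] sum_4[OF d, of "\<lambda>u. A w u * z $ u"] zz abc(4) unfolding slack_def a_b_c_def by simp_all
  have "(\<Sum>v\<in>UNIV. z $ v * slack A z v) = (c * c - a * b) * (a + b - 2 * c)"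
    using sum_4[OF d, of "\<lambda>v. z $ v * slack A z v"] zz s by (simp add: algebra_simps)
  moreover have "\<forall>v. 0 \<le> z $ v" "supp z \<subseteq> S" using abc vw by (auto simp: z_def supp_def)
  ultimately show ?thesis using q by auto
next
  case False
  obtain v w where vw: "v \<in> S" "w \<in> S" "v \<noteq> w"
    using S by (metis card_le_Suc0_iff_eq finite_class.finite_UNIV finite_subset not_less_eq_eq numeral_2_eq_2 subset_UNIV)
  have "S \<noteq> {v, w}" using False vw S by auto
  then obtain u where u: "u \<in> S" "u \<noteq> v" "u \<noteq> w" using vw by blast
  have Z: "{v, w} \<in> Z" "{v, u} \<in> Z" "{w, u} \<in> Z" using False vw u by auto
  then have I: "v \<notin> I" "w \<notin> I" "u \<notin> I" using admissible_props(6)[OF A] by blast+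
  have a: "A v w \<le> -1" "A v u \<le> -1" "A w u \<le> -1" "A v v = 1" "A w w = 1" "A u u = 1"
    "A w v = A v w" "A u v = A v u" "A u w = A w u"
    using admissible_props(1,2,4)[OF A] I vw u by auto
  define z :: "real^4" where "z = (\<chi> i. if i = v \<or> i = w \<or> i = u then 1 else 0)"
  obtain k where d: "distinct [v, w, u, k]"
  proof -
    obtain k l where "distinct [v, w, k, l]" "UNIV = {v, w, k, l}" using complete_4[OF vw(3)] by metis
    then show ?thesis using that[of k] that[of l] u by auto
  qed
  have zz: "z $ v = 1" "z $ w = 1" "z $ u = 1" "z $ k = 0" using d by (auto simp: z_def)
  have s: "slack A z v = - (1 + A v w + A v u)" "slack A z w = - (A v w + 1 + A w u)" "slack A z u = - (A v u + A w u + 1)"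
    using sum_4[OF d, of "\<lambda>i. A v i * z $ i"] sum_4[OF d, of "\<lambda>i. A w i * z $ i"] sum_4[OF d, of "\<lambda>i. A u i * z $ i"] zz a unfolding slack_def by simp_all
  have "(\<Sum>v\<in>UNIV. z $ v * slack A z v) = - 3 - 2 * A v w - 2 * A v u - 2 * A w u"
    using sum_4[OF d, of "\<lambda>v. z $ v * slack A z v"] zz s by simp
  moreover have "\<forall>v. 0 \<le> z $ v" "supp z \<subseteq> S" using vw u by (auto simp: z_def supp_def)
  ultimately show ?thesis using a by (intro exI[of _ z]) auto
qed

text \<open>The first-order condition at a maximum, in the form of a finite inequality.\<close>
lemma first_order:
  fixes c d \<delta> :: real
  assumes "\<delta> > 0" "\<And>t. 0 < t \<Longrightarrow> t \<le> \<delta> \<Longrightarrow> 2 * t * c \<le> t * t * d"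
  shows "c \<le> 0"
proof (rule ccontr)
  assume "\<not> c \<le> 0"
  then have c: "c > 0" by simp
  define t where "t = min \<delta> (c / (\<bar>d\<bar> + 1))"
  have t: "0 < t" "t \<le> \<delta>" "t \<le> c / (\<bar>d\<bar> + 1)" using c assms(1) by (auto simp: t_def)
  have "2 * t * c \<le> t * t * d" using assms(2) t by blast
  then have "2 * c \<le> t * d" using t by simp
  also have "\<dots> \<le> t * (\<bar>d\<bar> + 1)" using t by (intro mult_left_mono) auto
  also have "\<dots> \<le> c" using t by (simp add: pos_le_divide_eq)
  finally show False using c by simp
qed

lemma compact_unit_simplex: "compact unit_simplex"
proof -
  have "closed unit_simplex" unfolding unit_simplex_def
    by (intro closed_Collect_conj closed_Collect_all closed_Collect_le closed_Collect_eq continuous_intros)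
  moreover have "bounded unit_simplex"
  proof (rule boundedI[of _ 4])
    fix y assume y: "y \<in> unit_simplex"
    have "norm y \<le> (\<Sum>i\<in>UNIV. \<bar>y $ i\<bar>)" by (rule norm_le_l1_cart)
    also have "\<dots> = 1" using y by (simp add: unit_simplex_def)
    finally show "norm y \<le> 4" by simp
  qed
  ultimately show ?thesis by (simp add: compact_eq_bounded_closed)
qed

text \<open>The conditions \<open>slack A y v = \<rho> \<kappa>\<^sub>v y\<^sub>v\<close>, with \<open>\<kappa>\<^sub>v = slack B x v / x\<^sub>v\<close>, are the Euler--Lagrange equations for maximizing
  the quotient of the quadratic forms \<open>Q y = \<Sum> y\<^sub>v slack A y v\<close> and \<open>D y = \<Sum> \<kappa>\<^sub>v y\<^sub>v\<^sup>2\<close> over the face of \<open>x\<close>. No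
  coordinate of the face vanishes at the maximum: where \<open>y\<^sub>v = 0\<close> the slack at \<open>v\<close> is positive, and increasing \<open>y\<^sub>v\<close>
  increases the quotient.\<close>
lemma proportional_point_exists:
  assumes A: "admissible I Z A" and B: "admissible I Z B" and x: "x \<in> slack_simplex I B" and S: "card (supp x) \<ge> 2" "supp x \<notin> Z"
  shows "\<exists>y\<in>slack_simplex I A. \<exists>\<rho>>0. supp y = supp x \<and> (\<forall>v. slack A y v * x $ v = \<rho> * slack B x v * y $ v)"
proof -
  define S where "S = supp x"
  define \<kappa> where "\<kappa> v = slack B x v / x $ v" for v
  have xpos: "x $ v > 0" if "v \<in> S" for v using that slack_simplex_D(2)[OF x, of v] by (auto simp: S_def supp_def less_le)
  have \<kappa>: "\<kappa> v \<ge> 0" for v using slack_simplex_slack[OF B x, of v] slack_simplex_D(2)[OF x, of v] by (simp add: \<kappa>_def)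
  \<comment> \<open>At most one of the ratios \<open>\<kappa>\<close> vanishes, and only at a non-ideal vertex, where \<open>Q\<close> is negative; so \<open>D\<close> is
  positive where \<open>Q\<close> is nonnegative.\<close>
  have two: "v = w" if "v \<in> S" "w \<in> S" "\<kappa> v = 0" "\<kappa> w = 0" for v w
  proof (rule ccontr)
    assume "v \<noteq> w"
    moreover have "slack B x v = 0" "slack B x w = 0" using that xpos[of v] xpos[of w] by (auto simp: \<kappa>_def)
    ultimately have "{v, w} \<in> Z" "x = bary {v, w}" using double_slack_0[OF B x] by blast+
    moreover from this have "supp x = {v, w}" using \<open>v \<noteq> w\<close> by (auto simp: supp_def bary_def)
    ultimately show False using S by simp
  qed
  have nonideal: "v \<notin> I" if "v \<in> S" "\<kappa> v = 0" for v
  proof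
    assume "v \<in> I"
    moreover have "slack B x v = 0" using that xpos[of v] by (auto simp: \<kappa>_def)
    ultimately have "x = bary {v}" using slack_0_ideal[OF B x] by blast
    then have "supp x = {v}" by (auto simp: supp_def bary_def)
    then show False using S by simp
  qed
  define Q where "Q y = (\<Sum>v\<in>UNIV. y $ v * slack A y v)" for y
  define D where "D y = (\<Sum>v\<in>S. \<kappa> v * (y $ v * y $ v))" for y
  define C where "C = {y \<in> unit_simplex. (\<forall>v. v \<notin> S \<longrightarrow> y $ v = 0) \<and> 0 \<le> Q y}"
  have contQ: "continuous_on UNIV Q" unfolding Q_def slack_def by (intro continuous_intros)
  have contD: "continuous_on UNIV D" unfolding D_def by (intro continuous_intros)
  have "compact C"
  proof -
    have "C = unit_simplex \<inter> ({y. \<forall>v. v \<in> - S \<longrightarrow> y $ v = 0} \<inter> {y. 0 \<le> Q y})" by (auto simp: C_def)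
    moreover have "closed {y :: real^4. \<forall>v. v \<in> - S \<longrightarrow> y $ v = 0}"
      by (intro closed_Collect_all closed_Collect_imp closed_Collect_eq continuous_intros) simp
    moreover have "closed {y. 0 \<le> Q y}" by (intro closed_Collect_le contQ continuous_intros)
    ultimately show ?thesis using compact_unit_simplex by (simp add: compact_Int_closed closed_Int)
  qed
  have D0: "D y \<ge> 0" for y unfolding D_def by (rule sum_nonneg) (simp add: \<kappa>)
  have Dpos: "D y > 0" if y: "y \<in> C" for y
  proof (rule ccontr)
    assume "\<not> D y > 0"
    then have "D y = 0" using D0[of y] by simp
    then have z: "\<kappa> v * (y $ v * y $ v) = 0" if "v \<in> S" for v
      unfolding D_def using that \<kappa> by (subst (asm) sum_nonneg_eq_0_iff) auto
    have ys: "y \<in> unit_simplex" using y by (simp add: C_def)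
    then obtain v where v: "v \<in> supp y" using supp_nonempty by blast
    then have vS: "v \<in> S" "\<kappa> v = 0" using y z by (auto simp: C_def supp_def)
    have "y $ w = 0" if "w \<noteq> v" for w using z[of w] two[of v w] vS that y by (auto simp: C_def)
    then have yb: "y = bary {v}" using supp_singleton[OF ys] by blast
    have "Q y = slack A y v" unfolding Q_def yb
      by (subst sum.remove[of _ v]) (auto simp: bary_def)
    also have "\<dots> = -1" unfolding yb using slack_bary_singleton[OF A] nonideal[OF vS] by simp
    finally show False using y by (simp add: C_def)
  qed
  obtain z where z: "\<forall>v. 0 \<le> z $ v" "supp z \<subseteq> S" "Q z > 0" using admissible_positive[OF A] S unfolding S_def Q_def by blast
  have Qs: "Q (t *\<^sub>R y) = t * t * Q y" and Ds: "D (t *\<^sub>R y) = t * t * D y" for t y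
    by (simp_all add: Q_def D_def slack_scale sum_distrib_left mult_ac)
  have norm_in: "\<exists>t>0. t *\<^sub>R u \<in> C" if u: "\<forall>v. 0 \<le> u $ v" "supp u \<subseteq> S" "Q u \<ge> 0" "u \<noteq> 0" for u
  proof -
    define s where "s = (\<Sum>v\<in>UNIV. u $ v)"
    obtain v where "u $ v \<noteq> 0" using u(4) by (auto simp: vec_eq_iff)
    then have "u $ v > 0" using u(1) by (simp add: less_le)
    then have s: "s > 0" unfolding s_def using u(1) by (intro sum_pos2[of _ v]) auto
    have "(1 / s) *\<^sub>R u \<in> unit_simplex" using u(1) s by (simp add: unit_simplex_def s_def sum_divide_distrib[symmetric])
    then have "(1 / s) *\<^sub>R u \<in> C" using u Qs[of "1 / s" u] by (auto simp: C_def supp_def)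
    then show ?thesis using s by (intro exI[of _ "1 / s"]) simp
  qed
  have "z \<noteq> 0" using z(3) by (auto simp: Q_def)
  then obtain t0 where t0: "t0 > 0" "t0 *\<^sub>R z \<in> C" using norm_in z by (meson less_imp_le)
  have "continuous_on C (\<lambda>y. Q y / D y)"
  proof (rule continuous_on_divide)
    show "continuous_on C Q" "continuous_on C D" using contQ contD continuous_on_subset by blast+
    show "\<forall>y\<in>C. D y \<noteq> 0" using Dpos by (metis less_irrefl)
  qed
  moreover have "C \<noteq> {}" using t0 by blast
  ultimately obtain y where y: "y \<in> C" "\<And>u. u \<in> C \<Longrightarrow> Q u / D u \<le> Q y / D y"
    using continuous_attains_sup[OF \<open>compact C\<close>, of "\<lambda>y. Q y / D y"] by blast
  define \<rho> where "\<rho> = Q y / D y"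
  have "Q (t0 *\<^sub>R z) / D (t0 *\<^sub>R z) > 0" using z(3) t0 Dpos[OF t0(2)] by (simp add: Qs)
  then have \<rho>: "\<rho> > 0" using y(2)[OF t0(2)] by (simp add: \<rho>_def)
  have Qy: "Q y = \<rho> * D y" using Dpos[OF y(1)] by (simp add: \<rho>_def)
  have max: "Q u \<le> \<rho> * D u" if u: "\<forall>v. 0 \<le> u $ v" "supp u \<subseteq> S" for u
  proof (cases "Q u > 0")
    case True
    then have "u \<noteq> 0" by (auto simp: Q_def)
    then obtain t where t: "t > 0" "t *\<^sub>R u \<in> C" using norm_in[OF u] True by auto
    have Dt: "D (t *\<^sub>R u) > 0" using Dpos t by blast
    then have Du: "D u > 0" using t by (simp add: Ds zero_less_mult_iff)
    have "Q (t *\<^sub>R u) / D (t *\<^sub>R u) \<le> \<rho>" using y(2)[OF t(2)] by (simp add: \<rho>_def)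
    then have "Q u / D u \<le> \<rho>" using t by (simp add: Qs Ds)
    then show ?thesis using Du by (simp add: divide_le_eq)
  next
    case False
    then show ?thesis using D0[of u] \<rho> by (smt (verit) mult_nonneg_nonneg)
  qed
  have ysimp: "y \<in> unit_simplex" and yS: "\<And>v. v \<notin> S \<Longrightarrow> y $ v = 0" using y(1) by (auto simp: C_def)
  have ynn: "0 \<le> y $ v" for v using unit_simplex_D(1)[OF ysimp] .
  have Qp: "Q (y + t *\<^sub>R axis v 1) = Q y + 2 * t * slack A y v - t * t * A v v" for t v
  proof -
    define e :: "real^4" where "e = t *\<^sub>R axis v 1"
    have ea: "(\<Sum>w\<in>UNIV. e $ w * f w) = t * f v" for f
      by (simp add: e_def axis_def if_distrib[of "\<lambda>z. _ * z"] if_distrib[of "\<lambda>z. z * _"] cong: if_cong)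
    have "Q (y + e) = Q y + (\<Sum>w\<in>UNIV. e $ w * slack A y w) + (\<Sum>w\<in>UNIV. y $ w * slack A e w) + (\<Sum>w\<in>UNIV. e $ w * slack A e w)"
      by (simp add: Q_def slack_add distrib_left distrib_right sum.distrib)
    also have "(\<Sum>w\<in>UNIV. y $ w * slack A e w) = (\<Sum>w\<in>UNIV. e $ w * slack A y w)"
      by (rule slack_symmetric) (rule admissible_props(1)[OF A])
    finally show ?thesis unfolding ea by (simp add: e_def[symmetric]) (simp add: e_def slack_axis)
  qed
  have Dp: "D (y + t *\<^sub>R axis v 1) = D y + 2 * t * (\<kappa> v * y $ v) + t * t * \<kappa> v" if "v \<in> S" for t v
  proof -
    have "D (y + t *\<^sub>R axis v 1) = (\<Sum>w\<in>S. \<kappa> w * (y $ w * y $ w) + (if w = v then 2 * t * (\<kappa> v * y $ v) + t * t * \<kappa> v else 0))"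
      unfolding D_def by (rule sum.cong) (auto simp: axis_def algebra_simps)
    also have "\<dots> = D y + (2 * t * (\<kappa> v * y $ v) + t * t * \<kappa> v)" using that by (simp add: D_def sum.distrib)
    finally show ?thesis by simp
  qed
  \<comment> \<open>Comparison of the maximum with the point displaced by \<open>t\<close> in the direction of one coordinate; \<open>t\<close> may be
  negative if that coordinate is positive.\<close>
  have pert: "2 * t * (slack A y v - \<rho> * \<kappa> v * y $ v) \<le> t * t * (A v v + \<rho> * \<kappa> v)" if "v \<in> S" "y $ v + t \<ge> 0" for v t
  proof -
    have "Q (y + t *\<^sub>R axis v 1) \<le> \<rho> * D (y + t *\<^sub>R axis v 1)"
      by (rule max) (use that ynn yS in \<open>auto simp: supp_def axis_def\<close>)
    then show ?thesis unfolding Qp Dp[OF that(1)] using Qy by (simp add: algebra_simps)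
  qed
  have up: "slack A y v - \<rho> * \<kappa> v * y $ v \<le> 0" if "v \<in> S" for v
    by (rule first_order[of 1 _ "A v v + \<rho> * \<kappa> v"]) (use pert[OF that] ynn[of v] in auto)
  have ypos: "y $ v > 0" if v: "v \<in> S" for v
  proof (rule ccontr)
    assume "\<not> y $ v > 0"
    then have 0: "y $ v = 0" using ynn[of v] by simp
    then have "slack A y v \<le> 0" using up[OF v] by simp
    then have "slack A y v = 0" using slack_at_zero(1)[OF A ynn, of v] 0 by simp
    then have "y $ w = 0" for w using slack_at_zero(2)[OF A ynn, of v w] 0 by (cases "w = v") auto
    then show False using unit_simplex_D(2)[OF ysimp] by simp
  qed
  have eq: "slack A y v = \<rho> * \<kappa> v * y $ v" if v: "v \<in> S" for v
  proof -
    have "- (slack A y v - \<rho> * \<kappa> v * y $ v) \<le> 0"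
    proof (rule first_order[OF ypos[OF v], of _ "A v v + \<rho> * \<kappa> v"])
      fix t assume "0 < t" "t \<le> y $ v"
      then show "2 * t * (- (slack A y v - \<rho> * \<kappa> v * y $ v)) \<le> t * t * (A v v + \<rho> * \<kappa> v)"
        using pert[OF v, of "-t"] by (simp only: mult_minus_left mult_minus_right minus_minus)
    qed
    then show ?thesis using up[OF v] by simp
  qed
  have suppy: "supp y = S" using ypos yS by (force simp: supp_def)
  have "slack A y v \<ge> 0" for v
    using slack_at_zero(1)[OF A ynn, of v] yS[of v] eq[of v] ypos[of v] \<rho> \<kappa>[of v] by (cases "v \<in> S") auto
  then have "y \<in> slack_simplex I A" using ysimp by (simp add: slack_simplex_def)
  moreover have "slack A y v * x $ v = \<rho> * slack B x v * y $ v" for v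
  proof (cases "v \<in> S")
    case True
    then show ?thesis using eq[OF True] xpos[OF True] by (simp add: \<kappa>_def)
  next
    case False
    then show ?thesis using yS[of v] by (auto simp: S_def supp_def)
  qed
  ultimately show ?thesis using \<rho> suppy unfolding S_def by blast
qed

text \<open>By the symmetry of the matrix two solutions have the same factor \<open>\<rho>\<close>. The difference of \<open>y\<close> and the largest multiple
  of \<open>y'\<close> below it then solves the same equations, is nonnegative and has a zero coordinate in the face; such a
  solution vanishes, as in the theorem of Perron and Frobenius.\<close>
lemma proportional_point_unique:
  assumes A: "admissible I Z A" and y: "y \<in> unit_simplex" "supp y = S" "\<And>v. v \<in> S \<Longrightarrow> slack A y v = \<rho> * \<kappa> v * y $ v"
    and y': "y' \<in> unit_simplex" "supp y' = S" "\<And>v. v \<in> S \<Longrightarrow> slack A y' v = \<rho>' * \<kappa> v * y' $ v"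
    and \<kappa>: "\<And>v. v \<in> S \<Longrightarrow> 0 \<le> \<kappa> v" "\<exists>v\<in>S. \<kappa> v > 0"
  shows "y = y'"
proof -
  have pos: "y $ v > 0" "y' $ v > 0" if "v \<in> S" for v
    using that y(1,2) y'(1,2) unit_simplex_D(1)[OF y(1), of v] unit_simplex_D(1)[OF y'(1), of v] by (auto simp: supp_def less_le)
  have zero: "y $ v = 0" "y' $ v = 0" if "v \<notin> S" for v using that y(2) y'(2) by (auto simp: supp_def)
  have "(\<Sum>v\<in>UNIV. y' $ v * slack A y v) = \<rho> * (\<Sum>v\<in>S. \<kappa> v * (y $ v * y' $ v))"
    unfolding sum_distrib_left by (rule sum.mono_neutral_cong_right) (auto simp: zero y(3) mult_ac)
  moreover have "(\<Sum>v\<in>UNIV. y $ v * slack A y' v) = \<rho>' * (\<Sum>v\<in>S. \<kappa> v * (y $ v * y' $ v))"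
    unfolding sum_distrib_left by (rule sum.mono_neutral_cong_right) (auto simp: zero y'(3) mult_ac)
  moreover have "(\<Sum>v\<in>UNIV. y' $ v * slack A y v) = (\<Sum>v\<in>UNIV. y $ v * slack A y' v)"
    by (rule slack_symmetric) (rule admissible_props(1)[OF A])
  moreover have "(\<Sum>v\<in>S. \<kappa> v * (y $ v * y' $ v)) > 0"
  proof -
    obtain v where v: "v \<in> S" "\<kappa> v > 0" using \<kappa>(2) by blast
    show ?thesis by (rule sum_pos2[of _ v]) (use v pos \<kappa>(1) in \<open>auto intro!: mult_nonneg_nonneg simp: less_imp_le\<close>)
  qed
  ultimately have \<rho>: "\<rho> = \<rho>'" by simp
  define t where "t = Min ((\<lambda>v. y $ v / y' $ v) ` S)"
  have "S \<noteq> {}" using supp_nonempty[OF y(1)] y(2) by simp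
  then have "t \<in> (\<lambda>v. y $ v / y' $ v) ` S" unfolding t_def by (intro Min_in) auto
  then obtain u where u: "u \<in> S" "t = y $ u / y' $ u" by blast
  have t: "t \<le> y $ v / y' $ v" if "v \<in> S" for v using that by (simp add: t_def)
  define z where "z = y - t *\<^sub>R y'"
  have zn: "0 \<le> z $ v" for v using t[of v] pos[of v] zero[of v] by (cases "v \<in> S") (auto simp: z_def pos_le_divide_eq)
  have zu: "z $ u = 0" using u pos[of u] by (simp add: z_def)
  have "slack A z u = 0"
    using y(3)[OF u(1)] y'(3)[OF u(1)] u(2) pos(2)[OF u(1)] by (simp add: z_def slack_diff slack_scale \<rho>)
  then have "z $ v = 0" for v using slack_at_zero(2)[OF A zn, of u v] zu by (cases "v = u") auto
  then have yt: "y = t *\<^sub>R y'" by (simp add: z_def vec_eq_iff)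
  have "1 = t * 1" using unit_simplex_D(2)[OF y(1)] unit_simplex_D(2)[OF y'(1)] unfolding yt by (simp add: sum_distrib_left[symmetric])
  then show ?thesis using yt by simp
qed

section \<open>The correspondence between the model and a frame\<close>

text \<open>With off-diagonal entries \<open>-3\<close> the slack of a non-ideal vertex is \<open>3 (1 - x\<^sub>v) - x\<^sub>v\<close>, which is nonnegative exactly
  if \<open>x\<^sub>v \<le> 3/4\<close>.\<close>
definition source_matrix :: "4 set \<Rightarrow> 4 \<Rightarrow> 4 \<Rightarrow> real" where
  "source_matrix I v w = (if v = w then (if v \<in> I then 0 else 1) else -3)"

lemma admissible_source: "partially_truncated_tetrahedron I Z \<Longrightarrow> admissible I Z (source_matrix I)"
  by (auto simp: admissible_def source_matrix_def)

lemma slack_source: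
  assumes "x \<in> unit_simplex"
  shows "slack (source_matrix I) x v = (if v \<in> I then 3 - 3 * x $ v else 3 - 4 * x $ v)"
proof -
  have "(\<Sum>w\<in>UNIV. source_matrix I v w * x $ w) = source_matrix I v v * x $ v + (\<Sum>w\<in>UNIV-{v}. source_matrix I v w * x $ w)"
    by (subst sum.remove[of _ v]) auto
  also have "(\<Sum>w\<in>UNIV-{v}. source_matrix I v w * x $ w) = (\<Sum>w\<in>UNIV-{v}. -3 * x $ w)"
    by (rule sum.cong) (auto simp: source_matrix_def)
  also have "\<dots> = -3 * (1 - x $ v)"
    using unit_simplex_D(2)[OF assms] unfolding sum_distrib_left[symmetric] by (subst (asm) sum.remove[of _ v]) auto
  finally show ?thesis by (simp add: slack_def source_matrix_def)
qed

lemma truncated_simplex_eq: "truncated_simplex I = slack_simplex I (source_matrix I)"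
proof -
  have "x \<in> truncated_simplex I \<longleftrightarrow> x \<in> unit_simplex \<and> (\<forall>v. v \<notin> I \<longrightarrow> x $ v \<le> 3/4)" for x
    by (auto simp: truncated_simplex_def unit_simplex_def)
  moreover have "(\<forall>v. v \<notin> I \<longrightarrow> x $ v \<le> 3/4) \<longleftrightarrow> (\<forall>v. v \<notin> I \<longrightarrow> 0 \<le> slack (source_matrix I) x v)" if "x \<in> unit_simplex" for x
    using slack_source[OF that] by auto
  ultimately show ?thesis unfolding slack_simplex_def by blast
qed

lemma slack_continuous: "continuous_on S (\<lambda>y. slack A y v)"
  unfolding slack_def by (intro continuous_intros)

lemma compact_slack_simplex: "compact (slack_simplex I A)"
proof -
  have "slack_simplex I A = unit_simplex \<inter> {y. \<forall>v. v \<in> - I \<longrightarrow> 0 \<le> slack A y v}" by (auto simp: slack_simplex_def)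
  moreover have "closed {y. \<forall>v. v \<in> - I \<longrightarrow> 0 \<le> slack A y v}"
    by (intro closed_Collect_all closed_Collect_imp closed_Collect_le slack_continuous continuous_intros) simp
  ultimately show ?thesis using compact_unit_simplex by (simp add: compact_Int_closed)
qed

text \<open>The target matrix \<open>A\<close>, where the length-0 edges are exactly those with entry \<open>-1\<close>; the source is the
  model polyhedron.\<close>
locale matched =
  fixes I :: "4 set" and Z :: "4 set set" and A :: "4 \<Rightarrow> 4 \<Rightarrow> real"
  assumes A: "admissible I Z A" and AZ: "{v, w} \<in> Z \<Longrightarrow> v \<noteq> w \<Longrightarrow> A v w = -1"
begin

abbreviation "B \<equiv> source_matrix I"

lemma ptt: "partially_truncated_tetrahedron I Z"
  using A by (simp add: admissible_def)

lemma B: "admissible I Z B"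
  by (rule admissible_source[OF ptt])

text \<open>Proportionality of the ratios of slacks and coordinates, in a homogeneous form that makes the relation closed. The
  degenerate values \<open>c = 0\<close> and \<open>c = 1\<close> occur only at missing faces.\<close>
definition related :: "real^4 \<Rightarrow> real^4 \<Rightarrow> bool" where
  "related x y \<longleftrightarrow> (\<exists>c. 0 \<le> c \<and> c \<le> 1 \<and> (\<forall>v. (1 - c) * (y $ v * slack B x v) = c * (x $ v * slack A y v)))"

lemma double_source: "x \<in> slack_simplex I B \<Longrightarrow> v \<noteq> w \<Longrightarrow> slack B x v = 0 \<Longrightarrow> slack B x w \<noteq> 0"
  using double_slack_0[OF B, of x v w] by (auto simp: source_matrix_def)

lemma edge_of_Z: "s \<in> Z \<Longrightarrow> \<exists>v w. s = {v, w} \<and> v \<noteq> w"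
  using ptt unfolding partially_truncated_tetrahedron_def edges_def card_2_iff by blast

lemma missing_iff:
  assumes x: "x \<in> truncated_simplex I" and s: "s \<in> missing I Z"
  shows "x \<in> cell I s \<longleftrightarrow> supp x = s"
proof
  assume "x \<in> cell I s"
  then have sub: "supp x \<subseteq> s" by (auto simp: cell_def supp_def)
  have xt: "x \<in> slack_simplex I B" using x truncated_simplex_eq by simp
  show "supp x = s"
  proof (cases "s \<in> Z")
    case True
    then obtain v w where vw: "s = {v, w}" "v \<noteq> w" using edge_of_Z by blast
    have "v \<notin> I" "w \<notin> I" using admissible_props(6)[OF B, of v w] True vw by auto
    then have "\<not> supp x \<subseteq> {v}" "\<not> supp x \<subseteq> {w}" using supp_singleton_ideal[OF B xt] by (force simp: supp_def)+
    then show ?thesis using sub vw by blast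
  next
    case False
    then obtain v where "s = {v}" using s by (auto simp: missing_def)
    then show ?thesis using sub supp_nonempty[OF slack_simplex_D(1)[OF xt]] by auto
  qed
qed (use x in \<open>auto simp: cell_def supp_def\<close>)

lemma Dstar_iff: "x \<in> Dstar I Z \<longleftrightarrow> x \<in> slack_simplex I B \<and> supp x \<notin> missing I Z"
  using missing_iff unfolding Dstar_def truncated_simplex_eq[symmetric] by blast

lemma supp_ok:
  assumes "admissible I Z C" "x \<in> slack_simplex I C" "supp x \<notin> missing I Z"
  shows "card (supp x) \<ge> 2" "supp x \<notin> Z"
proof -
  show "supp x \<notin> Z" using assms by (simp add: missing_def)
  have "card (supp x) \<noteq> 0" using supp_nonempty[OF slack_simplex_D(1)[OF assms(2)]] by simp
  moreover have "card (supp x) \<noteq> 1"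
  proof
    assume "card (supp x) = 1"
    then obtain v where v: "supp x = {v}" by (auto simp: card_1_singleton_iff)
    then have "x $ w = 0" if "w \<noteq> v" for w using that by (auto simp: supp_def)
    then have "v \<in> I" using supp_singleton_ideal[OF assms(1,2)] by blast
    then show False using assms(3) v by (simp add: missing_def)
  qed
  ultimately show "card (supp x) \<ge> 2" by linarith
qed

lemma supp_bary: "s \<noteq> {} \<Longrightarrow> supp (bary s) = s"
  by (auto simp: supp_def bary_def)

lemma missing_nonempty: "s \<in> missing I Z \<Longrightarrow> s \<noteq> {}"
  using edge_of_Z by (auto simp: missing_def)

lemma target_missing:
  assumes "y \<in> slack_simplex I A" "supp y \<in> missing I Z"
  shows "y = bary (supp y)"
proof (cases "supp y \<in> Z")
  case True
  then obtain v w where vw: "supp y = {v, w}" "v \<noteq> w" using edge_of_Z by blast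
  have "v \<notin> I" "w \<notin> I" using admissible_props(6)[OF A, of v w] True vw by auto
  then show ?thesis
    using supp_Z[OF A AZ assms(1)] vw True by (force simp: supp_def)
next
  case False
  then obtain v where "supp y = {v}" using assms(2) by (auto simp: missing_def)
  then show ?thesis using supp_singleton[OF slack_simplex_D(1)[OF assms(1)], of v] by (force simp: supp_def)
qed

lemma null_target:
  assumes y: "y \<in> slack_simplex I A" and x: "x \<in> slack_simplex I B" and 0: "\<And>v. v \<in> supp x \<Longrightarrow> slack A y v = 0"
  shows "supp x \<in> missing I Z \<and> y = bary (supp x)"
proof -
  define S where eq: "S = supp x"
  have z: "slack A y v = 0" if "v \<in> S" for v using that 0 by (simp add: eq)
  obtain v where v: "v \<in> S" using supp_nonempty[OF slack_simplex_D(1)[OF x]] by (auto simp: eq)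
  show ?thesis
  proof (cases "S = {v}")
    case True
    then have "x $ w = 0" if "w \<noteq> v" for w using eq that by (auto simp: supp_def)
    then have "v \<in> I" using supp_singleton_ideal[OF B x] by blast
    moreover have "y = bary {v}" using slack_0_ideal[OF A y \<open>v \<in> I\<close>] z v by blast
    ultimately show ?thesis using True eq by (auto simp: missing_def)
  next
    case False
    then obtain w where w: "w \<in> S" "w \<noteq> v" using v by blast
    then have d: "{v, w} \<in> Z" "y = bary {v, w}" using double_slack_0[OF A y, of v w] z v by auto
    have "u = v \<or> u = w" if "u \<in> S" for u
    proof (rule ccontr)
      assume "\<not> (u = v \<or> u = w)"
      then have "y = bary {v, u}" using double_slack_0[OF A y, of v u] z v that by auto
      then have "{v, u} = {v, w}" using d(2) supp_bary[of "{v, u}"] supp_bary[of "{v, w}"] by simp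
      then have "u = v \<or> u = w" by blast
      with \<open>\<not> (u = v \<or> u = w)\<close> have "1 = (0::nat)" by blast
      then show False by simp
    qed
    then have "S = {v, w}" using v w by blast
    then show ?thesis using d eq by (auto simp: missing_def)
  qed
qed

text \<open>Away from the missing faces the relation is proportionality with a positive factor and the supports agree. A
  missing face as a whole is related to the single ideal point that represents it.\<close>
lemma related_cases:
  assumes x: "x \<in> slack_simplex I B" and y: "y \<in> slack_simplex I A" and r: "related x y"
  shows "(supp x \<in> missing I Z \<and> y = bary (supp x)) \<or>
    (supp x \<notin> missing I Z \<and> supp y = supp x \<and> (\<exists>\<rho>>0. \<forall>v. slack A y v * x $ v = \<rho> * slack B x v * y $ v))"
proof -
  obtain c where c: "0 \<le> c" "c \<le> 1" "\<And>v. (1 - c) * (y $ v * slack B x v) = c * (x $ v * slack A y v)"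
    using r by (auto simp: related_def)
  have xs: "x \<in> unit_simplex" and ys: "y \<in> unit_simplex" using slack_simplex_D(1) x y by blast+
  consider "c = 0" | "c = 1" | "0 < c" "c < 1" using c by linarith
  then show ?thesis
  proof cases
    case 1
    then have z: "y $ v * slack B x v = 0" for v using c(3)[of v] by simp
    obtain v where v: "y $ v \<noteq> 0" using supp_nonempty[OF ys] by (auto simp: supp_def)
    then have bv: "slack B x v = 0" using z[of v] by simp
    have "y $ w = 0" if "w \<noteq> v" for w using z[of w] double_source[OF x, of v w] bv that by auto
    then have vI: "v \<in> I" "y = bary {v}" using supp_singleton_ideal[OF A y] by blast+
    moreover have "x = bary {v}" using slack_0_ideal[OF B x vI(1) bv] .
    ultimately show ?thesis using supp_bary[of "{v}"] by (simp add: missing_def)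
  next
    case 2
    then have "slack A y v = 0" if "v \<in> supp x" for v using c(3)[of v] that by (auto simp: supp_def)
    then show ?thesis using null_target[OF y x] by blast
  next
    case 3
    have sub: "supp x = supp y"
    proof -
      have "y $ v = 0" if "x $ v = 0" for v
      proof -
        have "slack B x v \<noteq> 0" using slack_0_pos[OF B x, of v] that by auto
        then show ?thesis using c(3)[of v] that 3 by auto
      qed
      moreover have "x $ v = 0" if "y $ v = 0" for v
      proof -
        have "slack A y v \<noteq> 0" using slack_0_pos[OF A y, of v] that by auto
        then show ?thesis using c(3)[of v] that 3 by auto
      qed
      ultimately show ?thesis by (auto simp: supp_def)
    qed
    show ?thesis
    proof (cases "supp x \<in> missing I Z")
      case True
      then show ?thesis using target_missing[OF y] sub by simp
    next
      case False
      have "slack A y v * x $ v = ((1 - c) / c) * slack B x v * y $ v" for v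
        using c(3)[of v] 3 by (simp add: field_simps)
      then show ?thesis using False sub 3 by (intro disjI2 conjI exI[of _ "(1 - c) / c"]) auto
    qed
  qed
qed

lemma relatedI:
  assumes "\<rho> > 0" "\<And>v. slack A y v * x $ v = \<rho> * slack B x v * y $ v"
  shows "related x y"
  unfolding related_def
proof (intro exI[of _ "1 / (1 + \<rho>)"] conjI allI)
  show "(1 - 1 / (1 + \<rho>)) * (y $ v * slack B x v) = 1 / (1 + \<rho>) * (x $ v * slack A y v)" for v
  proof -
    have "1 - 1 / (1 + \<rho>) = \<rho> / (1 + \<rho>)" using assms(1) by (simp add: field_simps)
    then show ?thesis using assms(2)[of v] by (simp add: mult_ac)
  qed
qed (use assms(1) in auto)

lemma bary_in_slack_simplex:
  assumes "s \<in> missing I Z" shows "bary s \<in> slack_simplex I A" "\<And>v. v \<in> s \<Longrightarrow> slack A (bary s) v = 0"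
proof -
  have sl: "0 \<le> slack A (bary s) v \<and> (v \<in> s \<longrightarrow> slack A (bary s) v = 0)" for v
  proof (cases "v \<in> s")
    case False
    then show ?thesis using slack_at_zero(1)[OF A, of "bary s" v] by (simp add: bary_def)
  next
    case v: True
    show ?thesis
    proof (cases "s \<in> Z")
      case True
      then obtain w where w: "s = {v, w}" "v \<noteq> w" using edge_of_Z v by (metis insert_commute insertE singletonD)
      then have "A v w = -1" "A v v = 1" using AZ[of v w] admissible_props(2)[OF A, of v] admissible_props(6)[OF A, of v w] True by auto
      moreover obtain k l where d: "distinct [v, w, k, l]" using complete_4[OF w(2)] by metis
      moreover have "bary s $ v = 1/2" "bary s $ w = 1/2" "bary s $ k = 0" "bary s $ l = 0"
        using d w by (auto simp: bary_def)
      ultimately show ?thesis using sum_4[OF d, of "\<lambda>i. A v i * bary s $ i"] by (simp add: slack_def)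
    next
      case False
      then have "s = {v}" "v \<in> I" using assms v by (auto simp: missing_def)
      then show ?thesis using slack_bary_singleton[OF A, of v] by simp
    qed
  qed
  have "finite s" by (rule finite_subset[of _ UNIV]) auto
  then have "(\<Sum>v\<in>UNIV. bary s $ v) = 1" using missing_nonempty[OF assms] by (simp add: bary_def sum.If_cases)
  then show "bary s \<in> slack_simplex I A" using sl by (simp add: slack_simplex_def unit_simplex_def bary_def)
  show "\<And>v. v \<in> s \<Longrightarrow> slack A (bary s) v = 0" using sl by blast
qed

lemma related_ex1:
  assumes x: "x \<in> slack_simplex I B" shows "\<exists>!y. y \<in> slack_simplex I A \<and> related x y"
proof (cases "supp x \<in> missing I Z")
  case True
  have "related x (bary (supp x))" unfolding related_def
    using bary_in_slack_simplex(2)[OF True] by (intro exI[of _ 1]) (auto simp: supp_def)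
  then show ?thesis using bary_in_slack_simplex(1)[OF True] related_cases[OF x] True by blast
next
  case False
  obtain y \<rho> where y: "y \<in> slack_simplex I A" "\<rho> > 0" "\<And>v. slack A y v * x $ v = \<rho> * slack B x v * y $ v"
    using proportional_point_exists[OF A B x supp_ok[OF B x False]] by blast
  show ?thesis
  proof (rule ex1I[of _ y])
    show "y \<in> slack_simplex I A \<and> related x y" using y relatedI by blast
    fix y' assume y': "y' \<in> slack_simplex I A \<and> related x y'"
    obtain \<rho>' where \<rho>': "supp y' = supp x" "\<And>v. slack A y' v * x $ v = \<rho>' * slack B x v * y' $ v"
      using related_cases[OF x] y' False by blast
    have sy: "supp y = supp x" using related_cases[OF x y(1)] relatedI[OF y(2,3)] False by blast
    define \<kappa> where "\<kappa> v = slack B x v / x $ v" for v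
    show "y' = y"
    proof (rule proportional_point_unique[OF A slack_simplex_D(1) \<rho>'(1) _ slack_simplex_D(1)[OF y(1)] sy, of I A \<rho>' \<kappa> \<rho>])
      show "y' \<in> slack_simplex I A" using y' by simp
      fix v assume v: "v \<in> supp x"
      show "slack A y' v = \<rho>' * \<kappa> v * y' $ v" "slack A y v = \<rho> * \<kappa> v * y $ v"
        using \<rho>'(2)[of v] y(3)[of v] v by (simp_all add: \<kappa>_def supp_def eq_divide_eq mult_ac)
      show "0 \<le> \<kappa> v" using slack_simplex_slack[OF B x, of v] slack_simplex_D(2)[OF x, of v] by (simp add: \<kappa>_def)
    next
      obtain v w where vw: "v \<in> supp x" "w \<in> supp x" "v \<noteq> w"
        using supp_ok(1)[OF B x False]
        by (metis card_le_Suc0_iff_eq finite_class.finite_UNIV finite_subset not_less_eq_eq numeral_2_eq_2 subset_UNIV)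
      then have "slack B x v \<noteq> 0 \<or> slack B x w \<noteq> 0" using double_source[OF x] by blast
      then obtain u where "u \<in> supp x" "slack B x u \<noteq> 0" using vw by blast
      moreover from this have "slack B x u > 0" "x $ u > 0"
        using slack_simplex_slack[OF B x, of u] slack_simplex_D(2)[OF x, of u] by (auto simp: supp_def less_le)
      ultimately show "\<exists>v\<in>supp x. 0 < \<kappa> v" by (intro bexI[of _ u]) (auto simp: \<kappa>_def)
    qed
  qed
qed

definition chart :: "real^4 \<Rightarrow> real^4" where
  "chart x = (THE y. y \<in> slack_simplex I A \<and> related x y)"

lemma chart: "x \<in> slack_simplex I B \<Longrightarrow> chart x \<in> slack_simplex I A" "x \<in> slack_simplex I B \<Longrightarrow> related x (chart x)"
  using theI'[OF related_ex1, of x] by (auto simp: chart_def)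

lemma chart_eqI: "x \<in> slack_simplex I B \<Longrightarrow> y \<in> slack_simplex I A \<Longrightarrow> related x y \<Longrightarrow> chart x = y"
  using related_ex1[of x] chart[of x] by blast

text \<open>The graph is closed, being the projection of a compact set, and the target is compact.\<close>
lemma chart_continuous: "continuous_on (slack_simplex I B) chart"
proof (rule continuous_from_closed_graph[OF compact_slack_simplex[of I A]])
  show "chart \<in> slack_simplex I B \<rightarrow> slack_simplex I A" using chart by blast
  define R where "R = {(x, y, c). x \<in> slack_simplex I B \<and> y \<in> slack_simplex I A \<and> c \<in> {0..1::real} \<and>
    (\<forall>v. (1 - c) * (y $ v * slack B x v) = c * (x $ v * slack A y v))}"
  have "R = (slack_simplex I B \<times> slack_simplex I A \<times> {0..1}) \<inter> {p. \<forall>v. (1 - snd (snd p)) * (fst (snd p) $ v * slack B (fst p) v) = snd (snd p) * (fst p $ v * slack A (fst (snd p)) v)}"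
    by (auto simp: R_def)
  moreover have "closed {p :: (real^4) \<times> (real^4) \<times> real. \<forall>v. (1 - snd (snd p)) * (fst (snd p) $ v * slack B (fst p) v) = snd (snd p) * (fst p $ v * slack A (fst (snd p)) v)}"
    unfolding slack_def by (intro closed_Collect_all closed_Collect_eq continuous_intros)
  ultimately have "compact R" by (simp add: compact_Int_closed compact_Times compact_slack_simplex)
  then have "compact ((\<lambda>p. (fst p, fst (snd p))) ` R)"
    by (intro compact_continuous_image continuous_intros)
  moreover have "(\<lambda>p. (fst p, fst (snd p))) ` R = (\<lambda>x. (x, chart x)) ` slack_simplex I B"
  proof safe
    fix x y c assume "(x, y, c) \<in> R"
    then have "x \<in> slack_simplex I B" "chart x = y" using chart_eqI[of x y] by (auto simp: R_def related_def)
    then show "(fst (x, y, c), fst (snd (x, y, c))) \<in> (\<lambda>x. (x, chart x)) ` slack_simplex I B" by auto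
  next
    fix x assume x: "x \<in> slack_simplex I B"
    then obtain c where "(x, chart x, c) \<in> R" using chart[OF x] by (auto simp: R_def related_def)
    then show "(x, chart x) \<in> (\<lambda>p. (fst p, fst (snd p))) ` R" by force
  qed
  ultimately show "closed ((\<lambda>x. (x, chart x)) ` slack_simplex I B)" by (simp add: compact_imp_closed)
qed

lemma chart_missing: "x \<in> slack_simplex I B \<Longrightarrow> supp x \<in> missing I Z \<Longrightarrow> chart x = bary (supp x)"
  using related_cases chart by blast

lemma chart_Dstar:
  assumes "x \<in> Dstar I Z"
  shows "supp (chart x) = supp x" "\<exists>\<rho>>0. \<forall>v. slack A (chart x) v * x $ v = \<rho> * slack B x v * chart x $ v"
  using related_cases[of x "chart x"] chart[of x] assms unfolding Dstar_iff by blast+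

lemma chart_slack:
  assumes "x \<in> Dstar I Z" shows "slack A (chart x) v = 0 \<longleftrightarrow> slack B x v = 0"
proof -
  obtain \<rho> where \<rho>: "\<rho> > 0" "slack A (chart x) v * x $ v = \<rho> * slack B x v * chart x $ v" using chart_Dstar(2)[OF assms] by blast
  have x: "x \<in> slack_simplex I B" using assms Dstar_iff by blast
  have "x $ v \<noteq> 0 \<longleftrightarrow> chart x $ v \<noteq> 0" using chart_Dstar(1)[OF assms] by (auto simp: supp_def)
  then show ?thesis
    using \<rho> slack_0_pos[OF A chart(1)[OF x], of v] slack_0_pos[OF B x, of v] by (cases "x $ v = 0") auto
qed

text \<open>The relation is symmetric in its two sides, so the uniqueness of proportional points also gives injectivity.\<close>
lemma chart_inj: "inj_on chart (Dstar I Z)"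
proof (rule inj_onI)
  fix x x' assume x: "x \<in> Dstar I Z" and x': "x' \<in> Dstar I Z" and e: "chart x = chart x'"
  define y where "y = chart x"
  have xt: "x \<in> slack_simplex I B" "x' \<in> slack_simplex I B" "supp x \<notin> missing I Z" using x x' Dstar_iff by blast+
  have yt: "y \<in> slack_simplex I A" using chart(1)[OF xt(1)] by (simp add: y_def)
  obtain \<rho> where \<rho>: "\<rho> > 0" "\<And>v. slack A y v * x $ v = \<rho> * slack B x v * y $ v" using chart_Dstar(2)[OF x] by (auto simp: y_def)
  obtain \<rho>' where \<rho>': "\<rho>' > 0" "\<And>v. slack A y v * x' $ v = \<rho>' * slack B x' v * y $ v" using chart_Dstar(2)[OF x'] by (auto simp: y_def e)
  have s: "supp x = supp y" "supp x' = supp y" using chart_Dstar(1)[OF x] chart_Dstar(1)[OF x'] e by (simp_all add: y_def)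
  define \<kappa> where "\<kappa> v = slack A y v / y $ v" for v
  show "x = x'"
  proof (rule proportional_point_unique[OF B slack_simplex_D(1)[OF xt(1)] s(1) _ slack_simplex_D(1)[OF xt(2)] s(2), of "1 / \<rho>" \<kappa> "1 / \<rho>'"])
    fix v assume v: "v \<in> supp y"
    have "y $ v \<noteq> 0" using v by (simp add: supp_def)
    then show "slack B x v = 1 / \<rho> * \<kappa> v * x $ v" "slack B x' v = 1 / \<rho>' * \<kappa> v * x' $ v"
      using \<rho>(1) \<rho>(2)[of v] \<rho>'(1) \<rho>'(2)[of v] by (simp_all add: \<kappa>_def)
    show "0 \<le> \<kappa> v" using slack_simplex_slack[OF A yt, of v] slack_simplex_D(2)[OF yt, of v] by (simp add: \<kappa>_def)
  next
    have sy: "supp y \<notin> missing I Z" using xt s by simp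
    then have "\<exists>u\<in>supp y. slack A y u \<noteq> 0"
      using null_target[OF yt xt(1)] s by auto
    then obtain u where "u \<in> supp y" "slack A y u \<noteq> 0" by blast
    moreover from this have "slack A y u > 0" "y $ u > 0"
      using slack_simplex_slack[OF A yt, of u] slack_simplex_D(2)[OF yt, of u] by (auto simp: supp_def less_le)
    ultimately show "\<exists>v\<in>supp y. 0 < \<kappa> v" by (intro bexI[of _ u]) (auto simp: \<kappa>_def)
  qed
qed

lemma chart_surj:
  assumes y: "y \<in> slack_simplex I A" "supp y \<notin> missing I Z"
  shows "\<exists>x\<in>Dstar I Z. chart x = y"
proof -
  obtain x \<rho> where x: "x \<in> slack_simplex I B" "\<rho> > 0" "supp x = supp y" "\<And>v. slack B x v * y $ v = \<rho> * slack A y v * x $ v"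
    using proportional_point_exists[OF B A y(1) supp_ok[OF A y]] by blast
  have "related x y"
  proof (rule relatedI[of "1 / \<rho>"])
    show "slack A y v * x $ v = 1 / \<rho> * slack B x v * y $ v" for v
      using x(2) x(4)[of v] by simp
  qed (use x(2) in simp)
  then have "chart x = y" by (rule chart_eqI[OF x(1) y(1)])
  moreover have "x \<in> Dstar I Z" unfolding Dstar_iff using x(1,3) y(2) by simp
  ultimately show ?thesis by blast
qed

lemma null_supp:
  assumes y: "y \<in> slack_simplex I A" and z: "\<And>v. y $ v * slack A y v = 0"
  shows "supp y \<in> missing I Z"
proof -
  obtain v where v: "v \<in> supp y" using supp_nonempty[OF slack_simplex_D(1)[OF y]] by blast
  have sl: "slack A y u = 0" if "u \<in> supp y" for u using z[of u] that by (auto simp: supp_def)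
  show ?thesis
  proof (cases "supp y = {v}")
    case True
    then have "v \<in> I" using supp_singleton_ideal[OF A y, of v] by (force simp: supp_def)
    then show ?thesis using True by (simp add: missing_def)
  next
    case False
    then obtain w where w: "w \<in> supp y" "w \<noteq> v" using v by blast
    then have "{v, w} \<in> Z" "y = bary {v, w}" using double_slack_0[OF A y, of v w] sl v by auto
    then show ?thesis using supp_bary[of "{v, w}"] by (simp add: missing_def)
  qed
qed

end

section \<open>A geometric realization of a frame\<close>

lemma lateral_hexagon_subset: "lateral_hexagon I Z k \<subseteq> Dstar I Z"
  and truncation_triangle_subset: "truncation_triangle I Z v \<subseteq> Dstar I Z"
  by (auto simp: lateral_hexagon_def truncation_triangle_def)

context hyperideal_frame begin

sublocale matched I Z "\<lambda>v w. mink (m v) (m w)"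
proof
  show "admissible I Z (\<lambda>v w. mink (m v) (m w))"
    unfolding admissible_def
  proof (intro conjI allI impI)
    show "partially_truncated_tetrahedron I Z" by (rule ptt)
    show "mink (m v) (m w) = mink (m w) (m v)" for v w by (rule mink_commute)
    show "mink (m v) (m v) = (if v \<in> I then 0 else 1)" for v by (rule self)
    show "mink (m v) (m w) < 0" if "v \<noteq> w" for v w by (rule neg[OF that])
    show "mink (m v) (m w) \<le> -1" if "v \<noteq> w \<and> v \<notin> I \<and> w \<notin> I" for v w using le that by simp
    show "{v, w} \<in> Z" if "v \<noteq> w \<and> v \<notin> I \<and> w \<notin> I" "mink (m v) (m w) = -1" for v w using eq_iff[of v w] that by simp
  qed
  show "mink (m v) (m w) = -1" if "{v, w} \<in> Z" "v \<noteq> w" for v w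
    using eq_iff[of v w] that nonideal_of_Z[of v w] by simp
qed

abbreviation "G \<equiv> (\<lambda>v w. mink (m v) (m w))"

text \<open>Barycentric coordinates with respect to the poles: the coordinates are the products with the normals, and the
  slacks are minus the products with the poles.\<close>
definition pole_comb :: "real^4 \<Rightarrow> minkowski" where "pole_comb y = (\<Sum>v\<in>UNIV. y $ v *\<^sub>R m v)"

lemma pole_comb_n: "mink (pole_comb y) (n k) = y $ k"
  by (simp add: pole_comb_def mink_sum_left mink_simps dual if_distrib cong: if_cong)

lemma pole_comb_m: "mink (pole_comb y) (m k) = - slack G y k"
proof -
  have "mink (pole_comb y) (m k) = (\<Sum>v\<in>UNIV. y $ v * mink (m v) (m k))" by (simp add: pole_comb_def mink_sum_left mink_simps)
  also have "\<dots> = (\<Sum>v\<in>UNIV. mink (m k) (m v) * y $ v)"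
    by (rule sum.cong) (simp_all add: mink_commute mult.commute)
  finally show ?thesis by (simp add: slack_def)
qed

lemma pole_comb_K: "y \<in> slack_simplex I G \<Longrightarrow> pole_comb y \<in> K"
proof -
  assume y: "y \<in> slack_simplex I G"
  show ?thesis using slack_simplex_D(2)[OF y] slack_simplex_slack[OF A y] by (simp add: K_def pole_comb_n pole_comb_m)
qed

lemma pole_comb_nonzero: "y \<in> unit_simplex \<Longrightarrow> pole_comb y \<noteq> 0"
proof
  assume y: "y \<in> unit_simplex" "pole_comb y = 0"
  obtain k where "y $ k \<noteq> 0" using supp_nonempty[OF y(1)] by (auto simp: supp_def)
  then show False using pole_comb_n[of y k] y(2) by (simp add: mink_simps)
qed

lemma pole_comb_future: "y \<in> slack_simplex I G \<Longrightarrow> snd (pole_comb y) > 0"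
  using future_of_K[OF pole_comb_K pole_comb_nonzero[OF slack_simplex_D(1)]] by blast

lemma pole_comb_norm: "mink (pole_comb y) (pole_comb y) = - (\<Sum>v\<in>UNIV. y $ v * slack G y v)"
  by (subst mink_expand) (simp add: pole_comb_n mink_commute[of "m _" "pole_comb y"] pole_comb_m sum_negf)

text \<open>The norm is minus the sum of the products of coordinate and slack; so it vanishes
  only if at each index the coordinate or the slack does, which leaves the ideal points.\<close>
lemma pole_comb_null_iff:
  assumes "y \<in> slack_simplex I G"
  shows "mink (pole_comb y) (pole_comb y) \<le> 0" "mink (pole_comb y) (pole_comb y) = 0 \<longleftrightarrow> supp y \<in> missing I Z"
proof -
  have nn: "0 \<le> y $ v * slack G y v" for v using slack_simplex_D(2)[OF assms] slack_simplex_slack[OF A assms] by simp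
  then show "mink (pole_comb y) (pole_comb y) \<le> 0" unfolding pole_comb_norm by (simp add: sum_nonneg)
  have "mink (pole_comb y) (pole_comb y) = 0 \<longleftrightarrow> (\<forall>v. y $ v * slack G y v = 0)"
    unfolding pole_comb_norm using nn by (simp add: sum_nonneg_eq_0_iff)
  also have "\<dots> \<longleftrightarrow> supp y \<in> missing I Z"
  proof
    assume "supp y \<in> missing I Z"
    then have "slack G y v = 0" if "v \<in> supp y" for v
      using bary_in_slack_simplex(2)[of "supp y" v] target_missing[OF assms] that by simp
    then show "\<forall>v. y $ v * slack G y v = 0" by (auto simp: supp_def)
  qed (use null_supp[OF assms] in blast)
  finally show "mink (pole_comb y) (pole_comb y) = 0 \<longleftrightarrow> supp y \<in> missing I Z" .
qed

definition point :: "real^4 \<Rightarrow> real^3" where "point y = proj (pole_comb y)"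

lemma point_in:
  assumes "y \<in> slack_simplex I G"
  shows "supp y \<in> missing I Z \<Longrightarrow> point y \<in> sphere 0 1" "supp y \<notin> missing I Z \<Longrightarrow> point y \<in> H3"
proof -
  have s: "snd (pole_comb y) \<noteq> 0" using pole_comb_future[OF assms] by simp
  show "supp y \<in> missing I Z \<Longrightarrow> point y \<in> sphere 0 1"
    unfolding point_def proj_in_sphere[OF s] using pole_comb_null_iff[OF assms] by simp
  show "supp y \<notin> missing I Z \<Longrightarrow> point y \<in> H3"
    unfolding point_def proj_in_H3[OF s] using pole_comb_null_iff[OF assms] by linarith
qed

lemma point_continuous: "continuous_on (slack_simplex I G) point"
  unfolding point_def proj_def
proof (intro continuous_intros)
  show "continuous_on (slack_simplex I G) pole_comb" unfolding pole_comb_def by (intro continuous_intros)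
  then show "continuous_on (slack_simplex I G) pole_comb" .
  show "\<forall>x\<in>slack_simplex I G. snd (pole_comb x) \<noteq> 0" using pole_comb_future by force
qed

lemma mink_point:
  assumes "y \<in> slack_simplex I G"
  shows "mink (lift (point y)) (n k) = y $ k / snd (pole_comb y)" "mink (lift (point y)) (m k) = - slack G y k / snd (pole_comb y)"
  using pole_comb_future[OF assms] by (simp_all add: point_def mink_proj pole_comb_n pole_comb_m)

lemma point_inj: "inj_on point (slack_simplex I G)"
proof (rule inj_onI)
  fix y y' assume y: "y \<in> slack_simplex I G" and y': "y' \<in> slack_simplex I G" and e: "point y = point y'"
  have "y $ k / snd (pole_comb y) = y' $ k / snd (pole_comb y')" for k using mink_point(1)[OF y, of k] mink_point(1)[OF y', of k] e by simp
  then have yk: "y $ k = (snd (pole_comb y) / snd (pole_comb y')) * y' $ k" for k using pole_comb_future[OF y] pole_comb_future[OF y'] by (simp add: field_simps)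
  define t where "t = snd (pole_comb y) / snd (pole_comb y')"
  have "1 = (\<Sum>k\<in>UNIV. t * y' $ k)" using unit_simplex_D(2)[OF slack_simplex_D(1)[OF y]] yk by (simp add: t_def)
  also have "\<dots> = t" using unit_simplex_D(2)[OF slack_simplex_D(1)[OF y']] by (simp flip: sum_distrib_left)
  finally show "y = y'" using yk by (simp add: vec_eq_iff t_def)
qed

lemma point_surj:
  assumes "x \<in> pol" shows "\<exists>y\<in>slack_simplex I G. supp y \<notin> missing I Z \<and> point y = x"
proof -
  have xK: "lift x \<in> K" and xH: "x \<in> H3" using assms by (auto simp: pol_def)
  define s where "s = (\<Sum>k\<in>UNIV. mink (lift x) (n k))"
  have nn: "0 \<le> mink (lift x) (n k)" for k using xK by (simp add: K_def)
  obtain k where "mink (lift x) (n k) \<noteq> 0" using zero_iff_coords[of "lift x"] by auto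
  then have "mink (lift x) (n k) > 0" using nn[of k] by simp
  then have s: "s > 0" unfolding s_def using nn by (intro sum_pos2[of _ k]) auto
  define y :: "real^4" where "y = (\<chi> k. mink (lift x) (n k) / s)"
  have c: "pole_comb y = (1 / s) *\<^sub>R lift x"
    by (subst (2) expand) (simp add: pole_comb_def y_def scaleR_sum_right)
  have sl: "slack G y v = - mink (lift x) (m v) / s" for v using pole_comb_m[of y v] c by (simp add: mink_simps)
  have y: "y \<in> slack_simplex I G"
  proof -
    have "(\<Sum>k\<in>UNIV. y $ k) = 1" using s by (simp add: y_def sum_divide_distrib[symmetric] flip: s_def)
    then have "y \<in> unit_simplex" using nn s by (simp add: unit_simplex_def y_def)
    moreover have "0 \<le> slack G y v" if "v \<notin> I" for v
      unfolding sl using xK s that by (simp add: K_def divide_nonpos_pos)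
    ultimately show ?thesis by (simp add: slack_simplex_def)
  qed
  moreover have "point y = x" unfolding point_def c using s by (simp add: proj_scale)
  moreover have "supp y \<notin> missing I Z"
  proof
    assume "supp y \<in> missing I Z"
    then have "x \<in> sphere 0 1" using point_in(1)[OF y] \<open>point y = x\<close> by simp
    then show False using xH by simp
  qed
  ultimately show ?thesis by blast
qed

definition realization :: "real^4 \<Rightarrow> real^3" where "realization x = point (chart x)"

lemma realization_continuous: "continuous_on (truncated_simplex I) realization"
proof -
  have "continuous_on (slack_simplex I B) (point \<circ> chart)"
    by (rule continuous_on_compose[OF chart_continuous]) (use point_continuous chart(1) continuous_on_subset in blast)
  then show ?thesis unfolding truncated_simplex_eq by (simp add: o_def realization_def[abs_def])
qed

lemma realization_missing:
  assumes "x \<in> cell I s" "s \<in> missing I Z"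
  shows "realization x = point (bary s)"
proof -
  have x: "x \<in> truncated_simplex I" using assms by (simp add: cell_def)
  then have "supp x = s" using missing_iff assms by blast
  then show ?thesis using chart_missing[of x] x assms(2) by (simp add: realization_def truncated_simplex_eq)
qed

lemma Dstar_subset: "Dstar I Z \<subseteq> truncated_simplex I"
  by (auto simp: Dstar_def)

lemma Dstar_chart: "x \<in> Dstar I Z \<Longrightarrow> chart x \<in> slack_simplex I G \<and> supp (chart x) \<notin> missing I Z"
  using chart(1)[of x] chart_Dstar(1)[of x] Dstar_iff by simp

lemma realization_H3: "x \<in> Dstar I Z \<Longrightarrow> realization x \<in> H3"
  unfolding realization_def using point_in(2) Dstar_chart by blast

lemma realization_sphere:
  assumes "x \<in> truncated_simplex I" "x \<notin> Dstar I Z" shows "realization x \<notin> H3"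
proof -
  obtain s where s: "x \<in> cell I s" "s \<in> missing I Z" using assms unfolding Dstar_def by blast
  have "supp (bary s) = s" by (rule supp_bary[OF missing_nonempty[OF s(2)]])
  then have "point (bary s) \<in> sphere 0 1" by (intro point_in(1) bary_in_slack_simplex(1)) (use s(2) in simp_all)
  then show ?thesis unfolding realization_missing[OF s] by simp
qed

lemma realization_inj: "inj_on realization (Dstar I Z)"
proof -
  have "inj_on (point \<circ> chart) (Dstar I Z)"
  proof (rule comp_inj_on[OF chart_inj])
    show "inj_on point (chart ` Dstar I Z)"
      by (rule inj_on_subset[OF point_inj]) (use Dstar_chart in blast)
  qed
  then show ?thesis by (simp add: o_def realization_def[abs_def])
qed

text \<open>The map extends continuously to the compact truncated simplex and sends the missing faces to the sphere, so it
  is closed as a map into the open ball.\<close>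
lemma realization_embedding: "embedding_map (top_of_set (Dstar I Z)) (top_of_set H3) realization"
proof (rule injective_closed_imp_embedding_map)
  show "continuous_map (top_of_set (Dstar I Z)) (top_of_set H3) realization"
    using realization_H3 continuous_on_subset[OF realization_continuous Dstar_subset] by auto
  show "inj_on realization (topspace (top_of_set (Dstar I Z)))" using realization_inj by simp
  show "closed_map (top_of_set (Dstar I Z)) (top_of_set H3) realization"
    unfolding closed_map_def
  proof (intro allI impI)
    fix U assume "closedin (top_of_set (Dstar I Z)) U"
    then obtain T where T: "closed T" "U = Dstar I Z \<inter> T" by (auto simp: closedin_closed)
    have "compact (truncated_simplex I \<inter> T)" using T(1) compact_slack_simplex truncated_simplex_eq by (simp add: compact_Int_closed)
    then have c: "compact (realization ` (truncated_simplex I \<inter> T))"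
      by (rule compact_continuous_image[rotated]) (rule continuous_on_subset[OF realization_continuous], blast)
    have "realization ` U = H3 \<inter> realization ` (truncated_simplex I \<inter> T)"
    proof
      show "realization ` U \<subseteq> H3 \<inter> realization ` (truncated_simplex I \<inter> T)"
        using T(2) realization_H3 Dstar_subset by auto
      show "H3 \<inter> realization ` (truncated_simplex I \<inter> T) \<subseteq> realization ` U"
      proof safe
        fix x assume "realization x \<in> H3" "x \<in> truncated_simplex I" "x \<in> T"
        then show "realization x \<in> realization ` U" using T(2) realization_sphere[of x] by auto
      qed
    qed
    then show "closedin (top_of_set H3) (realization ` U)"
      using compact_imp_closed[OF c] closedin_closed by metis
  qed
qed

lemma realization_pol: "x \<in> Dstar I Z \<Longrightarrow> realization x \<in> pol"
proof -
  assume x: "x \<in> Dstar I Z"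
  have y: "chart x \<in> slack_simplex I G" using Dstar_chart[OF x] by blast
  have "lift (realization x) \<in> K"
    unfolding K_def realization_def
    using mink_point[OF y] pole_comb_future[OF y] slack_simplex_D(2)[OF y] slack_simplex_slack[OF A y] by simp
  then show ?thesis using realization_H3[OF x] by (simp add: pol_def)
qed

lemma realization_coord: "x \<in> Dstar I Z \<Longrightarrow> mink (lift (realization x)) (n k) = 0 \<longleftrightarrow> x $ k = 0"
  using mink_point(1)[of "chart x" k] pole_comb_future[of "chart x"] Dstar_chart[of x] chart_Dstar(1)[of x]
  by (auto simp: realization_def supp_def)

lemma realization_slack:
  assumes "x \<in> Dstar I Z" "v \<notin> I" shows "mink (lift (realization x)) (m v) = 0 \<longleftrightarrow> x $ v = 3/4"
proof -
  have "x \<in> unit_simplex" using assms(1) Dstar_iff slack_simplex_D(1) by blast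
  then have "slack B x v = 0 \<longleftrightarrow> x $ v = 3/4" using slack_source[of x I v] assms(2) by auto
  then show ?thesis
    using mink_point(2)[of "chart x" v] pole_comb_future[of "chart x"] Dstar_chart[of x] chart_slack[OF assms(1), of v] assms(1)
    by (auto simp: realization_def)
qed

lemma realization_image: "realization ` Dstar I Z = pol"
proof
  show "pol \<subseteq> realization ` Dstar I Z"
  proof
    fix p assume "p \<in> pol"
    then obtain y where y: "y \<in> slack_simplex I G" "supp y \<notin> missing I Z" "point y = p" using point_surj by blast
    then obtain x where "x \<in> Dstar I Z" "chart x = y" using chart_surj by blast
    then show "p \<in> realization ` Dstar I Z" using y(3) by (auto simp: realization_def)
  qed
qed (use realization_pol in blast)

lemma realization_realized: "realized_by realization"
proof -
  have "realization ` lateral_hexagon I Z k = face (- {k})" for k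
  proof -
    have "lateral_hexagon I Z k = {x \<in> Dstar I Z. x $ k = 0}" by (auto simp: lateral_hexagon_def cell_def Dstar_def)
    then have "lateral_hexagon I Z k = {x \<in> Dstar I Z. mink (lift (realization x)) (n k) = 0}" using realization_coord by auto
    then have "realization ` lateral_hexagon I Z k = {p \<in> pol. mink (lift p) (n k) = 0}" using realization_image by auto
    then show ?thesis by (simp add: face_def)
  qed
  moreover have "realization ` truncation_triangle I Z v = tri v" if "v \<notin> I" for v
  proof -
    have "truncation_triangle I Z v = {x \<in> Dstar I Z. mink (lift (realization x)) (m v) = 0}"
      using realization_slack[OF _ that] by (auto simp: truncation_triangle_def)
    then have "realization ` truncation_triangle I Z v = {p \<in> pol. mink (lift p) (m v) = 0}" using realization_image by auto
    then show ?thesis by (simp add: tri_def)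
  qed
  ultimately show ?thesis unfolding realized_by_def using realization_inj realization_image by blast
qed

text \<open>In each of the three cases the point satisfies the orthogonality relations that characterize the vertex.\<close>
lemma edge_end_eq_vert:
  assumes "v \<noteq> w" shows "edge_end I Z realization (\<lambda>s. point (bary s)) v w = vert v w"
proof -
  consider "v \<in> I" | "v \<notin> I" "{v, w} \<in> Z" | "v \<notin> I" "{v, w} \<notin> Z" by blast
  then show ?thesis
  proof cases
    case 1
    then have "{v} \<in> missing I Z" by (simp add: missing_def)
    then have t: "bary {v} \<in> slack_simplex I G" by (rule bary_in_slack_simplex)
    have "point (bary {v}) = vert v w"
      by (rule vert_unique[OF assms]) (use 1 assms mink_point[OF t] in \<open>auto simp: bary_def\<close>)
    then show ?thesis using 1 by (simp add: edge_end_def)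
  next
    case 2
    then have ms: "{v, w} \<in> missing I Z" by (simp add: missing_def)
    then have t: "bary {v, w} \<in> slack_simplex I G" by (rule bary_in_slack_simplex)
    have "point (bary {v, w}) = vert v w"
      by (rule vert_unique[OF assms]) (use 2 assms mink_point[OF t] bary_in_slack_simplex(2)[OF ms, of v] in \<open>auto simp: bary_def\<close>)
    then show ?thesis using 2 by (simp add: edge_end_def)
  next
    case 3
    define x where "x = corner v w"
    have xv: "x $ v = 3/4" "x $ w = 1/4" "\<And>u. u \<noteq> v \<Longrightarrow> u \<noteq> w \<Longrightarrow> x $ u = 0"
      using assms by (auto simp: x_def corner_def axis_def)
    obtain k l where d: "distinct [v, w, k, l]" using complete_4[OF assms] by metis
    have "(\<Sum>i\<in>UNIV. x $ i) = 1" using sum_4[OF d, of "\<lambda>i. x $ i"] d xv(1,2) xv(3)[of k] xv(3)[of l] by auto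
    moreover have nn: "0 \<le> x $ i \<and> x $ i \<le> 3/4" for i using xv by (cases "i = v"; cases "i = w") auto
    ultimately have xt: "x \<in> truncated_simplex I" by (auto simp: truncated_simplex_def)
    have "supp x = {v, w}" using xv by (auto simp: supp_def) 
    moreover have "{v, w} \<notin> missing I Z" using 3 assms by (auto simp: missing_def doubleton_eq_iff)
    ultimately have xD: "x \<in> Dstar I Z" using xt Dstar_iff truncated_simplex_eq by simp
    have "realization x = vert v w"
      by (rule vert_unique[OF assms]) (use xv 3 realization_coord[OF xD] realization_slack[OF xD] in auto)
    then show ?thesis using 3 by (simp add: edge_end_def x_def)
  qed
qed

lemma realization_geometric: "geometric_realization I Z realization"
proof -
  define q where "q = (\<lambda>s. point (bary s))"
  have R: "inj_on realization (Dstar I Z)" "\<And>k. realization ` lateral_hexagon I Z k = face (- {k})"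
    "\<And>v. v \<notin> I \<Longrightarrow> realization ` truncation_triangle I Z v = tri v"
    using realization_realized by (auto simp: realized_by_def)
  have ee: "edge_end I Z realization q v w = vert v w" if "v \<noteq> w" for v w
    using edge_end_eq_vert[OF that] by (simp add: q_def)
  have TH: "realization ` (truncation_triangle I Z v \<inter> lateral_hexagon I Z k) = tri v \<inter> face (- {k})" if "v \<notin> I" for v k
    using inj_on_image_Int[OF R(1) truncation_triangle_subset lateral_hexagon_subset, of v k] R(2)[of k] R(3)[OF that] by simp
  have "ideal_vertices I Z realization q"
    unfolding ideal_vertices_def
  proof (intro ballI conjI)
    fix s assume s: "s \<in> missing I Z"
    show "q s \<in> sphere 0 1"
      unfolding q_def using point_in(1)[OF bary_in_slack_simplex(1)[OF s]] supp_bary[OF missing_nonempty[OF s]] s by simp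
    fix x assume x: "x \<in> cell I s"
    then have "x \<in> truncated_simplex I" by (simp add: cell_def)
    then have "(realization \<longlongrightarrow> realization x) (at x within truncated_simplex I)"
      using realization_continuous by (simp add: continuous_on_def)
    then show "(realization \<longlongrightarrow> q s) (at x within Dstar I Z)"
      using tendsto_within_subset[OF _ Dstar_subset] realization_missing[OF x s] by (simp add: q_def)
  qed
  moreover have "geodesic_triangles I Z realization q"
    unfolding geodesic_triangles_def
  proof (intro allI impI conjI)
    fix v assume v: "v \<notin> I"
    have im: "edge_end I Z realization q v ` J = vert v ` J" if "v \<notin> J" for J
    proof (rule image_cong)
      fix x assume "x \<in> J"
      then have "v \<noteq> x" using that by blast
      then show "edge_end I Z realization q v x = vert v x" by (rule ee)
    qed simp
    show "geodesic_polygon (edge_end I Z realization q v ` (- {v})) (realization ` truncation_triangle I Z v)"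
      using triangle_polygon[OF v] im[of "- {v}"] R(3)[OF v] by simp
    fix k assume "k \<noteq> v"
    then have "tri v \<inter> face (- {k}) = hhull (vert v ` (- {k} - {v}))" using tri_face_eq_hhull[OF v, of "- {k}"] by simp
    moreover have "- {k} - {v} = - {v, k}" by auto
    ultimately show "realization ` (truncation_triangle I Z v \<inter> lateral_hexagon I Z k) = hhull (edge_end I Z realization q v ` (- {v, k}))"
      using TH[OF v] im[of "- {v, k}"] by simp
  qed
  moreover have "geodesic_hexagons I Z realization q"
    unfolding geodesic_hexagons_def
  proof (intro allI impI conjI)
    fix k
    have "{edge_end I Z realization q v w |v w. v \<noteq> w \<and> v \<noteq> k \<and> w \<noteq> k} = verts (- {k})"
      unfolding verts_def by (rule Collect_cong) (metis ComplD ComplI ee singletonD singletonI)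
    then show "geodesic_polygon {edge_end I Z realization q v w |v w. v \<noteq> w \<and> v \<noteq> k \<and> w \<noteq> k} (realization ` lateral_hexagon I Z k)"
      using hexagon_polygon R(2) by simp
  next
    fix v w assume vw: "v \<noteq> w \<and> {v, w} \<notin> Z"
    obtain k l where d: "distinct [v, w, k, l]" using complete_4 vw by metis
    show "realization ` edge_part I Z {v, w} = hhull {edge_end I Z realization q v w, edge_end I Z realization q w v}"
      using realized_edge[OF realization_realized Compl_edge[OF d]] edge_face[of v w] ee vw by auto
  qed
  moreover have "right_angles I Z realization"
    unfolding right_angles_def using triangle_hexagon_angle TH R(2,3) by auto
  ultimately show ?thesis unfolding geometric_realization_def using realization_embedding by blast
qed

end

section \<open>The image of an embedding with the right faces\<close>

text \<open>Move from \<open>z\<close> in a direction along which the functional does not increase. Almost every direction avoids the lines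
  through \<open>z\<close> and a point of the finite set.\<close>
lemma sphere_point_beyond:
  assumes z: "z \<in> H3" "mink (lift z) c < 0" and Q: "finite Q"
  obtains u where "u \<in> sphere 0 1" "u \<notin> Q" "mink (lift u) c < 0"
proof -
  \<comment> \<open>The extra point only ensures \<open>d \<noteq> 0\<close> when \<open>Q\<close> is empty.\<close>
  define Q' where "Q' = insert (z + axis 1 1) Q"
  have ng: "negligible (span {q - z})" for q
  proof (rule negligible_lowdim)
    have "dim (span {q - z}) \<le> card {q - z}" unfolding dim_span by (rule dim_le_card') simp
    then show "dim (span {q - z}) < DIM(real^3)" by simp
  qed
  have "negligible (\<Union>q\<in>Q'. span {q - z})"
  proof (rule negligible_Union)
    show "finite ((\<lambda>q. span {q - z}) ` Q')" using Q by (simp add: Q'_def)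
    show "negligible T" if "T \<in> (\<lambda>q. span {q - z}) ` Q'" for T using that ng by blast
  qed
  then have "(\<Union>q\<in>Q'. span {q - z}) \<noteq> UNIV" by (metis non_negligible_UNIV)
  then obtain d where d: "\<And>q. q \<in> Q' \<Longrightarrow> d \<notin> span {q - z}" by blast
  have d0: "d \<noteq> 0" using d[of "z + axis 1 1"] span_zero by (auto simp: Q'_def)
  have hit: "\<exists>t>0. z + t *\<^sub>R l \<in> sphere 0 1" if l0: "l \<noteq> 0" for l
  proof -
    obtain t where "t > 0" "z + t *\<^sub>R l \<in> frontier H3"
      by (rule ray_to_frontier[of H3 z l]) (use z(1) l0 in \<open>auto simp: interior_open simp del: mem_ball_0\<close>)
    then show ?thesis by (auto simp: frontier_ball simp del: mem_sphere_0)
  qed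
  have notQ: "z + s *\<^sub>R d \<notin> Q" if "s \<noteq> 0" for s
  proof
    assume "z + s *\<^sub>R d \<in> Q"
    then have "d \<notin> span {s *\<^sub>R d}" using d[of "z + s *\<^sub>R d"] by (simp add: Q'_def)
    moreover have "(1 / s) *\<^sub>R (s *\<^sub>R d) \<in> span {s *\<^sub>R d}" by (intro span_scale span_base) simp
    ultimately show False using that by simp
  qed
  have aff: "mink (lift (z + s *\<^sub>R d)) c = mink (lift z) c + s * (d \<bullet> fst c)" for s
    by (simp add: mink_lift_left inner_add_left)
  show ?thesis
  proof (cases "d \<bullet> fst c \<le> 0")
    case True
    obtain t where t: "t > 0" "z + t *\<^sub>R d \<in> sphere 0 1" using hit[OF d0] by blast
    have "t * (d \<bullet> fst c) \<le> 0" using t True by (simp add: mult_nonneg_nonpos)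
    then show ?thesis using that[OF t(2)] notQ[of t] aff[of t] z(2) t(1) by simp
  next
    case False
    obtain t where t: "t > 0" "z + t *\<^sub>R (- d) \<in> sphere 0 1" using hit[of "- d"] d0 by auto
    have "(- t) * (d \<bullet> fst c) \<le> 0" using t False by simp
    then show ?thesis using that[of "z + (- t) *\<^sub>R d"] t notQ[of "- t"] aff[of "- t"] z(2) by simp
  qed
qed

lemma compact_truncated_simplex: "compact (truncated_simplex I)"
  unfolding truncated_simplex_eq by (rule compact_slack_simplex)

text \<open>Limits of sequences that leave the domain are the prescribed ideal points, because the truncated simplex is
  compact.\<close>
lemma closure_of_image:
  assumes cont: "continuous_on (Dstar I Z) f" and q: "ideal_vertices I Z f q"
  shows "closure (f ` Dstar I Z) \<subseteq> f ` Dstar I Z \<union> q ` missing I Z"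
proof
  fix z assume "z \<in> closure (f ` Dstar I Z)"
  then obtain y where y: "\<forall>n. y n \<in> f ` Dstar I Z" "y \<longlonglongrightarrow> z" unfolding closure_sequential by blast
  have "\<forall>n. \<exists>a. a \<in> Dstar I Z \<and> y n = f a" using y(1) by blast
  then obtain x where "\<forall>n. x n \<in> Dstar I Z \<and> y n = f (x n)" by (rule choice[THEN exE])
  then have x: "x n \<in> Dstar I Z" "y n = f (x n)" for n by simp_all
  have "x n \<in> truncated_simplex I" for n using x(1)[of n] by (simp add: Dstar_def)
  then obtain a r where a: "a \<in> truncated_simplex I" "strict_mono r" "(x \<circ> r) \<longlonglongrightarrow> a"
    using seq_compactE[OF compact_imp_seq_compact[OF compact_truncated_simplex[of I]], of x] by blast
  have lim: "(\<lambda>n. f (x (r n))) \<longlonglongrightarrow> z" using LIMSEQ_subseq_LIMSEQ[OF y(2) a(2)] x(2) by (simp add: o_def)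
  show "z \<in> f ` Dstar I Z \<union> q ` missing I Z"
  proof (cases "a \<in> Dstar I Z")
    case True
    have "(\<lambda>n. f ((x \<circ> r) n)) \<longlonglongrightarrow> f a"
      using continuous_on_tendsto_compose[OF cont a(3) True] x(1) by simp
    then have "(\<lambda>n. f (x (r n))) \<longlonglongrightarrow> f a" by (simp add: o_def)
    then have "z = f a" by (rule LIMSEQ_unique[OF lim])
    then show ?thesis using True by blast
  next
    case False
    then obtain s where s: "s \<in> missing I Z" "a \<in> cell I s" using a(1) by (auto simp: Dstar_def)
    then have "(f \<longlongrightarrow> q s) (at a within Dstar I Z)" using q by (auto simp: ideal_vertices_def)
    then have "(f \<circ> (x \<circ> r)) \<longlonglongrightarrow> q s"
    proof -
      have "\<forall>i. (x \<circ> r) i \<in> Dstar I Z - {a}" using x(1) False by auto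
      with \<open>(f \<longlongrightarrow> q s) (at a within Dstar I Z)\<close> a(3) show ?thesis unfolding tendsto_at_iff_sequentially by blast
    qed
    then have "(\<lambda>n. f (x (r n))) \<longlonglongrightarrow> q s" by (simp add: o_def)
    then have "z = q s" by (rule LIMSEQ_unique[OF lim])
    then show ?thesis using s by blast
  qed
qed

lemma finite_missing: "finite (missing I Z)"
  by (rule finite_subset[of _ UNIV]) auto

definition open_part :: "4 set \<Rightarrow> (real^4) set" where
  "open_part I = {x. (\<Sum>i\<in>UNIV. x $ i) = 1 \<and> (\<forall>i. 0 < x $ i) \<and> (\<forall>v. v \<notin> I \<longrightarrow> x $ v < 3/4)}"

lemma open_part_subset:
  assumes "Z \<subseteq> edges" shows "open_part I \<subseteq> Dstar I Z"
proof
  fix x assume x: "x \<in> open_part I"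
  have "x \<notin> cell I s" if "s \<in> missing I Z" for s
  proof -
    have "card s < 4" using that assms by (auto simp: missing_def edges_def)
    then have "s \<noteq> UNIV" by auto
    then obtain k where "k \<notin> s" by blast
    moreover have "x $ k > 0" using x by (simp add: open_part_def)
    ultimately show ?thesis by (auto simp: cell_def)
  qed
  moreover have "x \<in> truncated_simplex I" using x by (simp add: open_part_def truncated_simplex_def less_imp_le)
  ultimately show "x \<in> Dstar I Z" unfolding Dstar_def by blast
qed

lemma Dstar_decomposition:
  assumes "Z \<subseteq> edges"
  shows "Dstar I Z = open_part I \<union> (\<Union>k. lateral_hexagon I Z k) \<union> (\<Union>v\<in>-I. truncation_triangle I Z v)"
proof
  show "Dstar I Z \<subseteq> open_part I \<union> (\<Union>k. lateral_hexagon I Z k) \<union> (\<Union>v\<in>-I. truncation_triangle I Z v)"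
  proof
    fix x assume x: "x \<in> Dstar I Z"
    then have xt: "x \<in> truncated_simplex I" by (simp add: Dstar_def)
    show "x \<in> open_part I \<union> (\<Union>k. lateral_hexagon I Z k) \<union> (\<Union>v\<in>-I. truncation_triangle I Z v)"
    proof (cases "(\<exists>k. x $ k = 0) \<or> (\<exists>v. v \<notin> I \<and> x $ v = 3/4)")
      case True
      then show ?thesis using x xt by (auto simp: lateral_hexagon_def truncation_triangle_def cell_def)
    next
      case False
      then have "x \<in> open_part I" using xt by (auto simp: open_part_def truncated_simplex_def less_le)
      then show ?thesis by blast
    qed
  qed
qed (use open_part_subset[OF assms] in \<open>auto simp: lateral_hexagon_def truncation_triangle_def\<close>)

lemma open_part_disjoint: "x \<in> open_part I \<Longrightarrow> x \<notin> lateral_hexagon I Z k" "x \<in> open_part I \<Longrightarrow> v \<notin> I \<Longrightarrow> x \<notin> truncation_triangle I Z v"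
  by (auto simp: open_part_def lateral_hexagon_def truncation_triangle_def cell_def) (metis less_irrefl)+

text \<open>Invariance of domain, applied in the affine hull of the simplex.\<close>
lemma open_part_image_open:
  fixes f :: "real^4 \<Rightarrow> real^3"
  assumes "continuous_on (open_part I) f" "inj_on f (open_part I)"
  shows "open (f ` open_part I)"
proof -
  define U where "U = {x :: real^4. (\<chi> i. 1) \<bullet> x = 1}"
  have U: "x \<in> U \<longleftrightarrow> (\<Sum>i\<in>UNIV. x $ i) = 1" for x by (simp add: U_def inner_vec_def)
  have "x \<in> open_part I \<longleftrightarrow> x \<in> U \<inter> ((\<Inter>i. {x. 0 < x $ i}) \<inter> (\<Inter>v\<in>-I. {x. x $ v < 3/4}))" for x
    unfolding open_part_def Int_iff U by auto
  then have "open_part I = U \<inter> ((\<Inter>i. {x. 0 < x $ i}) \<inter> (\<Inter>v\<in>-I. {x. x $ v < 3/4}))" by (rule set_eqI)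
  moreover have "open (\<Inter>i. {x :: real^4. 0 < x $ i})"
    by (intro open_INT ballI open_Collect_less continuous_intros) auto
  moreover have "open (\<Inter>v\<in>-I. {x :: real^4. x $ v < 3/4})"
    by (intro open_INT ballI open_Collect_less continuous_intros) auto
  ultimately have "openin (top_of_set U) (open_part I)" by (simp add: open_Int openin_open_Int)
  moreover have "affine U" unfolding U_def by (rule affine_hyperplane)
  moreover have "aff_dim U = 3"
  proof -
    have "(\<chi> i. 1) \<noteq> (0 :: real^4)" by (simp add: vec_eq_iff)
    then show ?thesis unfolding U_def by (subst aff_dim_hyperplane) auto
  qed
  ultimately have "openin (top_of_set UNIV) (f ` open_part I)"
    by (intro invariance_of_domain_affine_sets[of U "open_part I" UNIV f]) (use assms in \<open>auto simp: aff_dim_UNIV\<close>)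
  then show ?thesis by simp
qed

context hyperideal_frame begin

text \<open>The image \<open>W\<close> of the open part is open, and relatively closed away from the faces \<open>S\<close>; so a convex set of
  hyperbolic points disjoint from \<open>S\<close> is missed by \<open>W\<close> or contained in it. An open half-space outside the polyhedron cannot be
  contained, as its points at infinity would be limits of the image. Hence \<open>W\<close> lies in the polyhedron, and it contains
  the interior.\<close>
lemma image_eq_pol:
  assumes cont: "continuous_on (Dstar I Z) f" and inj: "inj_on f (Dstar I Z)" and fH: "f ` Dstar I Z \<subseteq> H3"
    and q: "ideal_vertices I Z f q"
    and hex: "\<And>k. f ` lateral_hexagon I Z k = face (- {k})"
    and tr: "\<And>v. v \<notin> I \<Longrightarrow> f ` truncation_triangle I Z v = tri v"
  shows "f ` Dstar I Z = pol"
proof -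
  have Ze: "Z \<subseteq> edges" using ptt by (simp add: partially_truncated_tetrahedron_def)
  note op = open_part_subset[OF Ze, of I]
  define W where "W = f ` open_part I"
  define S where "S = (\<Union>k. face (- {k})) \<union> (\<Union>v\<in>-I. tri v)"
  have img: "f ` Dstar I Z = W \<union> S"
    unfolding Dstar_decomposition[OF Ze] image_Un image_UN hex W_def S_def using tr by auto
  have "W \<inter> S = {}"
  proof -
    have "f x \<notin> S" if x: "x \<in> open_part I" for x
    proof
      assume "f x \<in> S"
      then obtain y where y: "f y = f x" "y \<in> (\<Union>k. lateral_hexagon I Z k) \<union> (\<Union>v\<in>-I. truncation_triangle I Z v)"
      proof -
        have "f x \<in> f ` ((\<Union>k. lateral_hexagon I Z k) \<union> (\<Union>v\<in>-I. truncation_triangle I Z v))"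
          using \<open>f x \<in> S\<close> tr unfolding S_def image_Un image_UN hex by simp
        then show thesis using that by (metis imageE)
      qed
      then have "y \<in> Dstar I Z" using lateral_hexagon_subset truncation_triangle_subset by blast
      then have "y = x" using inj y(1) x op by (meson inj_onD subsetD)
      then show False using y(2) open_part_disjoint[OF x] by auto
    qed
    then show ?thesis by (auto simp: W_def)
  qed
  have Wop: "open W" unfolding W_def
    by (rule open_part_image_open) (use cont inj op continuous_on_subset inj_on_subset in blast)+
  have qs: "q ` missing I Z \<inter> H3 = {}" using q by (auto simp: ideal_vertices_def)
  have Wcl: "closure W \<inter> H3 \<subseteq> W \<union> S"
  proof -
    have "closure W \<subseteq> closure (f ` Dstar I Z)" unfolding img by (rule closure_mono) simp
    then show ?thesis using closure_of_image[OF cont q] qs img by blast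
  qed
  have clopen: "W \<inter> U = {} \<or> U \<subseteq> W" if U: "convex U" "U \<subseteq> H3" "U \<inter> S = {}" for U
  proof -
    have "openin (top_of_set U) (U \<inter> W)" using Wop by (simp add: openin_open_Int)
    moreover have "U \<inter> W = U \<inter> closure W" using Wcl U(2,3) closure_subset[of W] by blast
    then have "closedin (top_of_set U) (U \<inter> W)" using closedin_closed_Int[OF closed_closure, of U W] by metis
    ultimately have "U \<inter> W = {} \<or> U \<inter> W = U" using convex_connected[OF U(1)] unfolding connected_clopen by blast
    then show ?thesis by blast
  qed
  have Sp: "S \<subseteq> pol" by (auto simp: S_def face_def tri_def)
  \<comment> \<open>If the image met the half-space where \<open>c\<close> is negative, it would contain it and accumulate at a point at infinity
  other than the ideal vertices.\<close>
  have outside: "mink (lift z) c \<ge> 0" if zW: "z \<in> W" and c: "\<And>x. x \<in> pol \<Longrightarrow> mink (lift x) c \<ge> 0" for z c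
  proof (rule ccontr)
    assume "\<not> mink (lift z) c \<ge> 0"
    then have zc: "mink (lift z) c < 0" by simp
    have zH: "z \<in> H3" using zW img fH by blast
    define U where "U = H3 \<inter> {x. mink (lift x) c < 0}"
    have "convex U" unfolding U_def by (intro convex_Int convex_ball convex_mink_less)
    moreover have "U \<subseteq> H3" by (simp add: U_def)
    moreover have "U \<inter> S = {}" using Sp c by (force simp: U_def)
    ultimately have "W \<inter> U = {} \<or> U \<subseteq> W" by (rule clopen)
    moreover have "z \<in> U" using zH zc by (simp add: U_def)
    ultimately have UW: "U \<subseteq> W" using zW by blast
    have "finite (q ` missing I Z)" using finite_missing by blast
    then obtain u where u: "u \<in> sphere 0 1" "u \<notin> q ` missing I Z" "mink (lift u) c < 0"
      by (rule sphere_point_beyond[OF zH zc])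
    have zu: "z \<noteq> u" using zH u(1) by auto
    have "open_segment z u \<subseteq> U"
    proof
      fix x assume x: "x \<in> open_segment z u"
      have "x \<in> H3" by (rule open_segment_in_H3[OF _ _ x]) (use zH u(1) in auto)
      moreover have "closed_segment z u \<subseteq> {x. mink (lift x) c < 0}"
        by (rule closed_segment_subset) (use zc u(3) convex_mink_less in auto)
      moreover have "x \<in> closed_segment z u" using x by (rule open_closed_segment)
      ultimately show "x \<in> U" unfolding U_def by blast
    qed
    then have "open_segment z u \<subseteq> f ` Dstar I Z" using UW img by blast
    then have "closure (open_segment z u) \<subseteq> closure (f ` Dstar I Z)" by (rule closure_mono)
    then have "u \<in> closure (f ` Dstar I Z)" using zu by auto
    then have "u \<in> f ` Dstar I Z" using closure_of_image[OF cont q] u(2) by blast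
    then have "u \<in> H3" using fH by blast
    then show False using u(1) by simp
  qed
  have Wpol: "W \<subseteq> pol"
  proof
    fix z assume z: "z \<in> W"
    have "0 \<le> mink (lift z) (n k)" for k by (rule outside[OF z]) (auto simp: pol_def K_def)
    moreover have "mink (lift z) (m v) \<le> 0" if "v \<notin> I" for v
      using outside[OF z, of "- m v"] that by (auto simp: pol_def K_def mink_simps)
    ultimately show "z \<in> pol" using z img fH by (auto simp: pol_def K_def)
  qed
  define P where "P = H3 \<inter> (\<Inter>k. {x. mink (lift x) (n k) > 0}) \<inter> (\<Inter>v\<in>-I. {x. mink (lift x) (m v) < 0})"
  have Peq: "P = pol - S"
    unfolding P_def S_def face_def tri_def pol_def K_def by (auto simp: less_le simp del: mem_ball_0)
  have "convex P" unfolding P_def by (intro convex_Int convex_INT convex_ball convex_mink_gr convex_mink_less)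
  moreover have "P \<subseteq> H3" "P \<inter> S = {}" using Peq by (auto simp: P_def)
  ultimately have "W \<inter> P = {} \<or> P \<subseteq> W" by (rule clopen)
  moreover have "W \<subseteq> P" using Wpol Peq \<open>W \<inter> S = {}\<close> by blast
  moreover have "(\<chi> i. 1/4) \<in> open_part I" by (simp add: open_part_def)
  then have "W \<noteq> {}" by (auto simp: W_def)
  ultimately have "P \<subseteq> W" by blast
  then show ?thesis using img Peq Wpol Sp by blast
qed

end

section \<open>Planes, right angles and positive combinations\<close>

lemma plane_normal:
  assumes "aff_dim V = 2"
  obtains N where "N \<noteq> 0" "\<And>x. x \<in> V \<Longrightarrow> mink (lift x) N = 0" "\<And>z. mink z N = 0 \<Longrightarrow> z \<in> span (lift ` V)"
proof -
  have "V \<noteq> {}" using assms by auto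
  then have d: "dim (lift ` V) = 3" using aff_dim_eq_dim_lift[of V] assms by simp
  then have "dim (reflect ` lift ` V) < DIM(minkowski)"
    using dim_image_le[OF linear_reflect, of "lift ` V"] by simp
  then obtain N where N: "N \<noteq> 0" "\<And>y. y \<in> span (reflect ` lift ` V) \<Longrightarrow> orthogonal N y"
    using orthogonal_to_subspace_exists by blast
  have N0: "mink (lift x) N = 0" if "x \<in> V" for x
  proof -
    have "orthogonal N (reflect (lift x))" by (rule N(2)[OF span_base]) (use that in blast)
    then have "mink N (lift x) = 0" by (simp add: mink_eq_inner orthogonal_def)
    then show ?thesis by (simp add: mink_commute)
  qed
  have "z \<in> span (lift ` V)" if "mink z N = 0" for z
    by (rule mink_complement_span[of _ "{N}"]) (use N0 N(1) d that in auto)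
  then show ?thesis using that N(1) N0 by blast
qed

text \<open>A point of the polygon off the line of a side, with a functional that detects this; such a point is what
  the construction of an inward normal starts from.\<close>
lemma off_line_point:
  assumes V: "aff_dim V = 2" "V \<subseteq> cball 0 1" and ab: "a \<in> V" "b \<in> V" "a \<noteq> b" and p: "p \<in> open_segment a b"
  obtains x c where "x \<in> hhull V" "mink (lift x) c \<noteq> 0" "mink (lift a) c = 0" "mink (lift b) c = 0"
proof -
  have "\<not> V \<subseteq> affine hull {a, b}"
  proof
    assume "V \<subseteq> affine hull {a, b}"
    then have "aff_dim V \<le> aff_dim {a, b}" by (metis aff_dim_affine_hull aff_dim_subset)
    then show False using V ab by (simp add: aff_dim_2)
  qed
  then obtain y where y: "y \<in> V" "y \<notin> affine hull {a, b}" by blast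
  have "lift y \<notin> span {lift a, lift b}"
  proof
    assume "lift y \<in> span {lift a, lift b}"
    then obtain s t where "lift y = s *\<^sub>R lift a + t *\<^sub>R lift b" by (rule span_pairE)
    then have "y = s *\<^sub>R a + t *\<^sub>R b" "s + t = 1" by (auto simp: lift_def)
    then show False using y(2) by (auto simp: affine_hull_2)
  qed
  obtain y0 z where yz: "y0 \<in> span {lift a, lift b}" "\<And>w. w \<in> span {lift a, lift b} \<Longrightarrow> orthogonal z w" "lift y = y0 + z"
    using orthogonal_subspace_decomp_exists[of "{lift a, lift b}" "lift y"] by blast
  have "z \<noteq> 0" using yz \<open>lift y \<notin> span {lift a, lift b}\<close> by auto
  define c where "c = reflect z"
  have ca: "mink (lift a) c = 0" "mink (lift b) c = 0"
    using yz(2)[of "lift a"] yz(2)[of "lift b"]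
    by (auto simp: c_def mink_eq_inner orthogonal_def inner_commute intro: span_base)
  have "mink (lift y) c = y0 \<bullet> z + z \<bullet> z" by (simp add: c_def mink_eq_inner yz(3) inner_add_left)
  also have "y0 \<bullet> z = 0" using yz(2)[OF yz(1)] by (simp add: orthogonal_def inner_commute)
  finally have cy: "mink (lift y) c \<noteq> 0" using \<open>z \<noteq> 0\<close> by simp
  obtain t where t: "p = (1 - t) *\<^sub>R a + t *\<^sub>R b" using p by (auto simp: in_segment)
  have "lift p = (1 - t) *\<^sub>R lift a + t *\<^sub>R lift b" by (simp add: t lift_def)
  then have cp: "mink (lift p) c = 0" using ca by (simp add: mink_simps)
  have pH: "p \<in> H3" using open_segment_in_H3 V(2) ab p by blast
  have "p \<noteq> y" using cp cy by auto
  define x where "x = midpoint p y"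
  have "x \<in> open_segment p y" using \<open>p \<noteq> y\<close> by (simp add: x_def)
  then have "x \<in> H3" by (rule open_segment_in_H3[rotated 2]) (use pH V(2) y(1) in auto)
  moreover have "p \<in> convex hull V"
    using open_closed_segment[OF p] closed_segment_subset[OF hull_inc[OF ab(1)] hull_inc[OF ab(2)] convex_convex_hull] by blast
  then have "closed_segment p y \<subseteq> convex hull V" by (rule closed_segment_subset[OF _ hull_inc[OF y(1)] convex_convex_hull])
  then have "x \<in> convex hull V" unfolding x_def by (rule subsetD) simp
  moreover have "lift x = (1/2) *\<^sub>R (lift p + lift y)" by (simp add: x_def midpoint_def lift_def)
  then have "mink (lift x) c \<noteq> 0" using cp cy by (simp add: mink_simps)
  ultimately show ?thesis using that[of x c] ca by (simp add: hhull_def)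
qed

lemma convex_hhull: "convex (hhull V)"
  unfolding hhull_def by (intro convex_Int convex_ball convex_convex_hull)

lemma right_angle_orthogonal:
  assumes p: "p \<in> H3" and "hangle p u w = pi / 2" and "u \<noteq> 0" "w \<noteq> 0"
  shows "mink (tangent_lift p u) (tangent_lift p w) = 0"
proof -
  define a b where "a = tangent_lift p u" "b = tangent_lift p w"
  define A B C where "A = mink a a" "B = mink b b" "C = mink a b"
  have "mink (lift p) (lift p) < 0" using p mem_H3_iff_mink by blast
  moreover have o: "mink (lift p) a = 0" "mink (lift p) b = 0" using tangent_lift_orthogonal[OF p] mink_commute by (metis a_b_def)+
  ultimately have pos: "mink z z > 0" if "mink (lift p) z = 0" "z \<noteq> 0" for z using timelike_orthogonal that by blast
  have A: "A > 0" "B > 0" using pos o assms tangent_lift_eq_0[OF p] by (auto simp: A_B_C_def a_b_def)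
  define c where "c = A *\<^sub>R b - C *\<^sub>R a"
  have "mink c c \<ge> 0" using pos[of c] o by (cases "c = 0") (auto simp: c_def mink_simps less_imp_le)
  also have "mink c c = A * (A * B - C\<^sup>2)"
    by (simp add: c_def mink_simps mink_commute[of b a] flip: A_B_C_def) (simp add: algebra_simps power2_eq_square)
  finally have CS: "C\<^sup>2 \<le> A * B" using A by (simp add: zero_le_mult_iff)
  have w: "1 - p \<bullet> p > 0" using p mem_H3_iff by simp
  have h: "hmetric p u w = C / (1 - p \<bullet> p)" "hmetric p u u = A / (1 - p \<bullet> p)" "hmetric p w w = B / (1 - p \<bullet> p)"
    using hmetric_eq_mink[OF p] w by (simp_all add: A_B_C_def a_b_def)
  have "hmetric p u u * hmetric p w w = (A * B) / (1 - p \<bullet> p)\<^sup>2" unfolding h by (simp add: power2_eq_square)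
  then have "sqrt (hmetric p u u * hmetric p w w) = sqrt (A * B) / (1 - p \<bullet> p)" using w by (simp add: real_sqrt_divide)
  then have r: "hmetric p u w / sqrt (hmetric p u u * hmetric p w w) = C / sqrt (A * B)" unfolding h using w by simp
  have "\<bar>C\<bar> \<le> sqrt (A * B)" using real_sqrt_le_mono[OF CS] by simp
  then have "\<bar>C / sqrt (A * B)\<bar> \<le> 1" using A by simp
  moreover have "arccos (C / sqrt (A * B)) = pi / 2" using assms(2) unfolding hangle_def r .
  ultimately have "C / sqrt (A * B) = cos (pi / 2)" by (metis cos_arccos_abs)
  then show ?thesis using A by (simp add: A_B_C_def a_b_def)
qed

text \<open>The converse of computing the angle from the normals. The lifts \<open>u'\<close> and \<open>w'\<close> of inward normals at a point of the side are
  orthogonal, so \<open>w'\<close> is orthogonal to \<open>u'\<close> and to the side, which together span the plane of \<open>T\<close>; hence \<open>w'\<close> is a multiple of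
  the normal \<open>m\<close>, and it is tangent to the plane of \<open>H\<close>.\<close>
lemma perpendicular_planes:
  assumes T: "aff_dim T = 2" "T \<subseteq> cball 0 1" "\<And>x. x \<in> T \<Longrightarrow> mink (lift x) m = 0" "mink m m > 0"
    and H: "aff_dim H = 2" "H \<subseteq> cball 0 1" "\<And>x. x \<in> H \<Longrightarrow> mink (lift x) n = 0"
    and ab: "a \<in> T" "b \<in> T" "a \<in> H" "b \<in> H" "a \<noteq> b"
    and ang: "has_dihedral_angle (hhull {a, b}) (hhull T) (hhull H) (pi / 2)"
  shows "mink m n = 0"
proof -
  have abc: "a \<in> cball 0 1" "b \<in> cball 0 1" using ab T by blast+
  obtain p y where py: "p \<in> open_segment a b" "p \<noteq> y" "p \<in> hhull {a, b}" "y \<in> hhull {a, b}"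
    using two_points_in_hhull[OF abc ab(5)] by metis
  have pr: "p \<in> rel_interior (hhull {a, b})" using open_segment_subset_rel_interior_hhull[OF abc ab(5)] py(1) by blast
  have pH: "p \<in> H3" using py(3) by (simp add: hhull_def)
  have subT: "hhull {a, b} \<subseteq> hhull T" "hhull {a, b} \<subseteq> hhull H"
    using hull_mono[of "{a, b}" T convex] hull_mono[of "{a, b}" H convex] ab by (auto simp: hhull_def)
  obtain x c where xc: "x \<in> hhull T" "mink (lift x) c \<noteq> 0" "mink (lift a) c = 0" "mink (lift b) c = 0"
    using off_line_point[OF T(1,2) ab(1,2,5) py(1)] .
  obtain u where u: "inward_normal (hhull {a, b}) (hhull T) p u"
    using inward_normal_exists[OF abc ab(5) convex_hhull subT(1) py(1) xc] by blast
  obtain x' c' where xc': "x' \<in> hhull H" "mink (lift x') c' \<noteq> 0" "mink (lift a) c' = 0" "mink (lift b) c' = 0"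
    using off_line_point[OF H(1,2) ab(3,4,5) py(1)] .
  obtain w where w: "inward_normal (hhull {a, b}) (hhull H) p w"
    using inward_normal_exists[OF abc ab(5) convex_hhull subT(2) py(1) xc'] by blast
  define u' w' where "u' = tangent_lift p u" "w' = tangent_lift p w"
  have u0: "u \<noteq> 0" "w \<noteq> 0" using u w by (auto simp: inward_normal_def)
  have uw: "mink u' w' = 0"
    unfolding u'_w'_def by (rule right_angle_orthogonal[OF pH has_dihedral_angleD[OF ang pr u w] u0])
  have nonzero: "u' \<noteq> 0" "w' \<noteq> 0" using tangent_lift_eq_0[OF pH] u0 by (auto simp: u'_w'_def)
  have hull0: "mink (lift z) k = 0" if "z \<in> hhull V" "\<And>x. x \<in> V \<Longrightarrow> mink (lift x) k = 0" for z V k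
  proof -
    have "convex hull V \<subseteq> {x. mink (lift x) k = 0}" by (rule hull_minimal) (use that convex_mink_eq in auto)
    then show ?thesis using that(1) by (auto simp: hhull_def)
  qed
  have tang: "mink (tangent_lift p d) k = 0" if d: "inward_normal (hhull {a, b}) F p d" and F: "\<And>x. x \<in> F \<Longrightarrow> mink (lift x) k = 0"
    and pF: "p \<in> F" for d F k
  proof -
    obtain s where s: "s > 0" "p + s *\<^sub>R d \<in> F" using d by (auto simp: inward_normal_def)
    obtain l where l: "tangent_lift p ((p + s *\<^sub>R d) - p) = lift (p + s *\<^sub>R d) + l *\<^sub>R lift p" using tangent_lift_diff by blast
    have "s *\<^sub>R tangent_lift p d = lift (p + s *\<^sub>R d) + l *\<^sub>R lift p" using l by (simp add: tangent_lift_scale)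
    then have "mink (s *\<^sub>R tangent_lift p d) k = 0" using F[OF s(2)] F[OF pF] by (simp add: mink_simps)
    then show ?thesis using s(1) by (simp add: mink_simps)
  qed
  have um: "mink u' m = 0" unfolding u'_w'_def
    by (rule tang[OF u hull0[OF _ T(3)] subsetD[OF subT(1) py(3)]])
  have wn: "mink w' n = 0" unfolding u'_w'_def
    by (rule tang[OF w hull0[OF _ H(3)] subsetD[OF subT(2) py(3)]])
  have side: "mink (tangent_lift p d) (lift y) = 0" if d: "inward_normal (hhull {a, b}) F p d" for d F
  proof -
    have "hmetric p d (y - p) = 0" using d py(4) by (auto simp: inward_normal_def)
    then have 0: "mink (tangent_lift p d) (tangent_lift p (y - p)) = 0" using hmetric_eq_mink[OF pH] by simp
    obtain l where "tangent_lift p (y - p) = lift y + l *\<^sub>R lift p" using tangent_lift_diff by blast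
    then show ?thesis using 0 tangent_lift_orthogonal[OF pH] by (simp add: mink_simps)
  qed
  have uy: "mink u' (lift y) = 0" "mink w' (lift y) = 0" using side u w by (auto simp: u'_w'_def)
  have up: "mink u' (lift p) = 0" "mink w' (lift p) = 0" using tangent_lift_orthogonal[OF pH] by (auto simp: u'_w'_def)
  have "mink (lift p) (lift p) < 0" using pH mem_H3_iff_mink by blast
  moreover have "mink (lift p) u' = 0" using up(1) mink_commute by metis
  ultimately have u_pos: "mink u' u' > 0" using nonzero(1) by (rule timelike_orthogonal)
  have "u' \<notin> span {lift p, lift y}"
  proof
    assume "u' \<in> span {lift p, lift y}"
    then obtain s t where "u' = s *\<^sub>R lift p + t *\<^sub>R lift y" by (rule span_pairE)
    moreover have "mink u' (s *\<^sub>R lift p + t *\<^sub>R lift y) = 0" using uy up by (simp add: mink_simps)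
    ultimately show False using u_pos by (metis less_irrefl)
  qed
  then have d3: "dim {u', lift p, lift y} = 3" using dim_lift_pair[OF py(2)] by (simp add: dim_insert)
  have mp: "mink m (lift p) = 0" "mink m (lift y) = 0"
    using hull0[OF _ T(3)] py(3,4) subT(1) mink_commute[of m] by auto
  have mu: "mink m u' = 0" "mink w' u' = 0" using um uw by (simp_all add: mink_commute)
  have "w' \<in> span {m}"
  proof (rule mink_complement_span[of _ "{u', lift p, lift y}"])
    have "m \<noteq> 0" using T(4) by (auto simp: mink_simps)
    then show "4 \<le> dim {m} + dim {u', lift p, lift y}" using d3 by simp
  qed (use mu mp uy(2) up(2) in blast)+
  then obtain t where t: "w' = t *\<^sub>R m" by (auto simp: span_singleton)
  then have "t * mink m n = 0" "t \<noteq> 0" using wn nonzero(2) by (auto simp: mink_simps)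
  then show ?thesis by simp
qed

text \<open>Vectors in an open half-space have no relation with coefficients of one sign. In a relation of three, one
  coefficient therefore has a sign opposite to the other two, up to zeros, and it can be solved for.\<close>
lemma negative_combination:
  fixes d :: "'i \<Rightarrow> 'a :: real_inner" and g :: 'a
  assumes dis: "distinct [i, j, k]" and neg: "d i \<bullet> g < 0" "d j \<bullet> g < 0" "d k \<bullet> g < 0"
    and dep: "a *\<^sub>R d i + b *\<^sub>R d j + c *\<^sub>R d k = 0" "a \<noteq> 0 \<or> b \<noteq> 0 \<or> c \<noteq> 0"
  shows "\<exists>x y z s t. distinct [x, y, z] \<and> {x, y, z} = {i, j, k} \<and> 0 \<le> s \<and> 0 \<le> t \<and> d x = s *\<^sub>R d y + t *\<^sub>R d z"
proof -
  have g: "a * (d i \<bullet> g) + b * (d j \<bullet> g) + c * (d k \<bullet> g) = 0"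
    using arg_cong[OF dep(1), of "\<lambda>z. z \<bullet> g"] by (simp add: inner_add_left)
  have solve: "\<exists>x y z s t. distinct [x, y, z] \<and> {x, y, z} = {i, j, k} \<and> 0 \<le> s \<and> 0 \<le> t \<and> d x = s *\<^sub>R d y + t *\<^sub>R d z"
    if e: "\<alpha> *\<^sub>R d x + \<beta> *\<^sub>R d y + \<gamma> *\<^sub>R d z = 0" and xyz: "distinct [x, y, z]" "{x, y, z} = {i, j, k}"
      and s: "\<alpha> \<noteq> 0" "\<beta> * \<alpha> \<le> 0" "\<gamma> * \<alpha> \<le> 0" for \<alpha> \<beta> \<gamma> x y z
  proof -
    have "\<alpha> *\<^sub>R d x = - \<beta> *\<^sub>R d y + - \<gamma> *\<^sub>R d z" using e by (simp add: algebra_simps eq_neg_iff_add_eq_0)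
    then have "(1 / \<alpha>) *\<^sub>R (\<alpha> *\<^sub>R d x) = (1 / \<alpha>) *\<^sub>R (- \<beta> *\<^sub>R d y + - \<gamma> *\<^sub>R d z)" by simp
    then have "d x = (- \<beta> / \<alpha>) *\<^sub>R d y + (- \<gamma> / \<alpha>) *\<^sub>R d z" using s(1) by (simp add: scaleR_add_right scaleR_diff_right)
    moreover have "0 \<le> - \<beta> / \<alpha>" "0 \<le> - \<gamma> / \<alpha>" using s by (auto simp: zero_le_divide_iff divide_le_0_iff mult_le_0_iff)
    ultimately show ?thesis using xyz by blast
  qed
  have p1: "distinct [i, j, k]" "{i, j, k} = {i, j, k}" and p2: "distinct [j, i, k]" "{j, i, k} = {i, j, k}"
    and p3: "distinct [k, i, j]" "{k, i, j} = {i, j, k}" using dis by auto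
  have e1: "a *\<^sub>R d i + b *\<^sub>R d j + c *\<^sub>R d k = 0" and e2: "b *\<^sub>R d j + a *\<^sub>R d i + c *\<^sub>R d k = 0"
    and e3: "c *\<^sub>R d k + a *\<^sub>R d i + b *\<^sub>R d j = 0" using dep(1) by (simp_all add: algebra_simps)
  have npos: "\<not> (0 \<le> a \<and> 0 \<le> b \<and> 0 \<le> c)" and nneg: "\<not> (a \<le> 0 \<and> b \<le> 0 \<and> c \<le> 0)"
  proof -
    have "a = 0 \<and> b = 0 \<and> c = 0" if "0 \<le> a \<and> 0 \<le> b \<and> 0 \<le> c"
    proof -
      have "a * (d i \<bullet> g) \<le> 0" "b * (d j \<bullet> g) \<le> 0" "c * (d k \<bullet> g) \<le> 0" using that neg by (auto simp: mult_nonneg_nonpos)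
      then have "a * (d i \<bullet> g) = 0" "b * (d j \<bullet> g) = 0" "c * (d k \<bullet> g) = 0" using g by linarith+
      then show ?thesis using neg by auto
    qed
    moreover have "a = 0 \<and> b = 0 \<and> c = 0" if "a \<le> 0 \<and> b \<le> 0 \<and> c \<le> 0"
    proof -
      have "a * (d i \<bullet> g) \<ge> 0" "b * (d j \<bullet> g) \<ge> 0" "c * (d k \<bullet> g) \<ge> 0" using that neg by (auto simp: mult_nonpos_nonpos)
      then have "a * (d i \<bullet> g) = 0" "b * (d j \<bullet> g) = 0" "c * (d k \<bullet> g) = 0" using g by linarith+
      then show ?thesis using neg by auto
    qed
    ultimately show "\<not> (0 \<le> a \<and> 0 \<le> b \<and> 0 \<le> c)" "\<not> (a \<le> 0 \<and> b \<le> 0 \<and> c \<le> 0)" using dep(2) by blast+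
  qed
  have "(a \<noteq> 0 \<and> b * a \<le> 0 \<and> c * a \<le> 0) \<or> (b \<noteq> 0 \<and> a * b \<le> 0 \<and> c * b \<le> 0) \<or> (c \<noteq> 0 \<and> a * c \<le> 0 \<and> b * c \<le> 0)"
    using npos nneg by (smt (verit) mult_nonneg_nonpos mult_nonpos_nonneg mult_pos_pos mult_le_0_iff)
  then show ?thesis using solve[OF e1 p1] solve[OF e2 p2] solve[OF e3 p3] by blast
qed

section \<open>The poles and normals of a realization\<close>

lemma truncated_simplex_convex: "convex (truncated_simplex I)"
proof -
  have "truncated_simplex I = (\<Inter>i. {x. 0 \<le> x $ i}) \<inter> {x. (\<Sum>i\<in>UNIV. x $ i) = 1} \<inter> (\<Inter>v\<in>-I. {x. x $ v \<le> 3/4})"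
    by (auto simp: truncated_simplex_def)
  moreover have "convex {x :: real^4. 0 \<le> x $ i}" "convex {x :: real^4. x $ i \<le> 3/4}" for i
    using convex_halfspace_ge[of 0 "axis i 1 :: real^4"] convex_halfspace_le[of "axis i 1 :: real^4" "3/4"]
    by (simp_all add: inner_axis')
  moreover have "convex {x :: real^4. (\<Sum>i\<in>UNIV. x $ i) = 1}"
    by (auto simp: convex_def sum.distrib sum_distrib_left[symmetric])
  ultimately show ?thesis by (simp only:) (intro convex_Int convex_INT, auto)
qed

lemma Dstar_convex: "convex (Dstar I Z)"
  unfolding convex_contains_open_segment
proof (intro ballI subsetI)
  fix x y z assume x: "x \<in> Dstar I Z" and y: "y \<in> Dstar I Z" and z: "z \<in> open_segment x y"
  have xy: "x \<in> truncated_simplex I" "y \<in> truncated_simplex I" using x y by (auto simp: Dstar_def)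
  have "z \<in> truncated_simplex I"
    using closed_segment_subset[OF xy truncated_simplex_convex] open_closed_segment[OF z] by blast
  moreover have "z \<notin> cell I s" if s: "s \<in> missing I Z" for s
  proof
    assume zc: "z \<in> cell I s"
    obtain t where t: "0 < t" "t < 1" "z = (1 - t) *\<^sub>R x + t *\<^sub>R y" using z by (auto simp: in_segment)
    have "x $ k = 0" if "k \<notin> s" for k
    proof -
      have "z $ k = 0" using zc that by (simp add: cell_def)
      then have "(1 - t) * x $ k + t * y $ k = 0" by (simp add: t)
      moreover have "0 \<le> x $ k" "0 \<le> y $ k" using xy by (auto simp: truncated_simplex_def)
      ultimately have "(1 - t) * x $ k = 0" using t by (smt (verit) mult_nonneg_nonneg)
      then show ?thesis using t by simp
    qed
    then have "x \<in> cell I s" using xy by (simp add: cell_def)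
    then show False using x s by (auto simp: Dstar_def)
  qed
  ultimately show "z \<in> Dstar I Z" by (auto simp: Dstar_def)
qed

lemma lateral_hexagon_eq: "lateral_hexagon I Z k = {x \<in> Dstar I Z. x $ k = 0}"
  by (auto simp: lateral_hexagon_def cell_def Dstar_def)

text \<open>The source of the connectedness arguments: a face of the model without one of its truncation triangles is convex.\<close>
lemma hexagon_minus_triangle_convex:
  assumes "v \<notin> I" shows "convex (lateral_hexagon I Z k - truncation_triangle I Z v)"
proof -
  have "lateral_hexagon I Z k - truncation_triangle I Z v = Dstar I Z \<inter> {x. x $ k = 0} \<inter> {x. x $ v < 3/4}"
    using assms by (auto simp: lateral_hexagon_eq truncation_triangle_def Dstar_def truncated_simplex_def less_le)
  moreover have "convex {x :: real^4. x $ k = 0}" by (auto simp: convex_def)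
  moreover have "convex {x :: real^4. x $ v < 3/4}"
    using convex_halfspace_lt[of "axis v 1 :: real^4" "3/4"] by (simp add: inner_axis')
  ultimately show ?thesis by (simp only:) (intro convex_Int Dstar_convex)
qed

locale realization_data =
  fixes I Z f q
  assumes ptt: "partially_truncated_tetrahedron I Z"
    and emb: "embedding_map (top_of_set (Dstar I Z)) (top_of_set H3) f"
    and iv: "ideal_vertices I Z f q" and gt: "geodesic_triangles I Z f q" and gh: "geodesic_hexagons I Z f q"
    and ra: "right_angles I Z f"
begin

abbreviation "D \<equiv> Dstar I Z"
abbreviation "hex k \<equiv> lateral_hexagon I Z k"
abbreviation "tr v \<equiv> truncation_triangle I Z v"

definition e :: "4 \<Rightarrow> 4 \<Rightarrow> real^3" where "e v w = edge_end I Z f q v w"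

definition V :: "4 \<Rightarrow> (real^3) set" where "V k = {e v w | v w. v \<noteq> w \<and> v \<noteq> k \<and> w \<noteq> k}"

lemma Ze: "Z \<subseteq> edges" and Z_nonideal: "{v, w} \<in> Z \<Longrightarrow> v \<notin> I \<and> w \<notin> I"
  using ptt by (auto simp: partially_truncated_tetrahedron_def)

lemma f_cont: "continuous_on D f" and f_inj: "inj_on f D" and f_H3: "f ` D \<subseteq> H3"
proof -
  have h: "homeomorphic_map (top_of_set D) (subtopology (top_of_set H3) (f ` D)) f"
    using emb by (simp add: embedding_map_def)
  show "inj_on f D" using homeomorphic_imp_injective_map[OF h] by simp
  have c: "continuous_map (top_of_set D) (top_of_set H3) f"
    using homeomorphic_imp_continuous_map[OF h] by (simp add: continuous_map_in_subtopology)
  then show "continuous_on D f" "f ` D \<subseteq> H3" by (auto simp: continuous_map_in_subtopology)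
qed

lemma q_sphere: "v \<in> I \<Longrightarrow> q {v} \<in> sphere 0 1" "s \<in> Z \<Longrightarrow> q s \<in> sphere 0 1"
  using iv unfolding ideal_vertices_def missing_def by blast+

lemma e_ideal: "v \<in> I \<Longrightarrow> e v w = q {v}"
  and e_Z: "{v, w} \<in> Z \<Longrightarrow> e v w = q {v, w}"
  and e_corner: "v \<notin> I \<Longrightarrow> {v, w} \<notin> Z \<Longrightarrow> e v w = f (corner v w)"
  using Z_nonideal[of v w] by (auto simp: e_def edge_end_def)

lemma e_sym_Z: "{v, w} \<in> Z \<Longrightarrow> e w v = e v w"
  using e_Z[of v w] e_Z[of w v] by (simp add: insert_commute)

lemma corner_nth: "v \<noteq> w \<Longrightarrow> corner v w $ u = (if u = v then 3/4 else if u = w then 1/4 else 0)"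
  by (auto simp: corner_def axis_def)

lemma two_support_in_D:
  assumes vw: "v \<noteq> w" "{v, w} \<notin> Z" and x: "x \<in> truncated_simplex I" "x $ v \<noteq> 0" "x $ w \<noteq> 0"
  shows "x \<in> D"
proof -
  have "x \<notin> cell I s" if s: "s \<in> missing I Z" for s
  proof
    assume "x \<in> cell I s"
    then have sub: "{v, w} \<subseteq> s" using x by (auto simp: cell_def)
    show False
    proof (cases "s \<in> Z")
      case True
      then have "card s = 2" using Ze by (auto simp: edges_def)
      moreover have "finite s" by (rule finite_subset[of _ UNIV]) auto
      ultimately have "{v, w} = s" using sub vw(1) by (intro card_subset_eq) auto
      then show False using True vw by simp
    next
      case False
      then show False using s sub vw(1) by (auto simp: missing_def)
    qed
  qed
  then show ?thesis using x(1) by (auto simp: Dstar_def)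
qed

lemma corner_in_D:
  assumes "v \<noteq> w" "{v, w} \<notin> Z" "v \<notin> I" shows "corner v w \<in> D"
proof (rule two_support_in_D[OF assms(1,2)])
  obtain k l where d: "distinct [v, w, k, l]" using complete_4[OF assms(1)] by metis
  have "corner v w $ v = 3/4" "corner v w $ w = 1/4" "corner v w $ k = 0" "corner v w $ l = 0"
    using d by (auto simp: corner_nth)
  then have "(\<Sum>i\<in>UNIV. corner v w $ i) = 1" by (simp add: sum_4[OF d])
  then show "corner v w \<in> truncated_simplex I" using assms by (auto simp: truncated_simplex_def corner_nth)
qed (use assms in \<open>auto simp: corner_nth\<close>)

lemma e_H3: "v \<noteq> w \<Longrightarrow> v \<notin> I \<Longrightarrow> {v, w} \<notin> Z \<Longrightarrow> e v w \<in> H3"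
  using corner_in_D[of v w] f_H3 e_corner[of v w] by auto

lemma V_poly: "finite (V k)" "V k \<subseteq> cball 0 1" "aff_dim (V k) = 2" "x \<in> V k \<Longrightarrow> x \<notin> convex hull (V k - {x})" "f ` hex k = hhull (V k)"
proof -
  have "geodesic_polygon (V k) (f ` hex k)" using gh unfolding geodesic_hexagons_def V_def e_def by blast
  then show "finite (V k)" "V k \<subseteq> cball 0 1" "aff_dim (V k) = 2" "x \<in> V k \<Longrightarrow> x \<notin> convex hull (V k - {x})" "f ` hex k = hhull (V k)"
    unfolding geodesic_polygon_def by blast+
qed

lemma T_poly:
  assumes "v \<notin> I"
  shows "e v ` (- {v}) \<subseteq> cball 0 1" "aff_dim (e v ` (- {v})) = 2" "f ` tr v = hhull (e v ` (- {v}))"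
    "k \<noteq> v \<Longrightarrow> f ` (tr v \<inter> hex k) = hhull (e v ` (- {v, k}))"
proof -
  have *: "e v = edge_end I Z f q v" by (auto simp: e_def)
  have "geodesic_polygon (e v ` (- {v})) (f ` tr v)" using gt assms unfolding geodesic_triangles_def * by blast
  then show "e v ` (- {v}) \<subseteq> cball 0 1" "aff_dim (e v ` (- {v})) = 2" "f ` tr v = hhull (e v ` (- {v}))"
    unfolding geodesic_polygon_def by blast+
  show "k \<noteq> v \<Longrightarrow> f ` (tr v \<inter> hex k) = hhull (e v ` (- {v, k}))"
    using gt assms unfolding geodesic_triangles_def * by blast
qed

lemma edge_image: "v \<noteq> w \<Longrightarrow> {v, w} \<notin> Z \<Longrightarrow> f ` edge_part I Z {v, w} = hhull {e v w, e w v}"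
  using gh unfolding geodesic_hexagons_def e_def by blast

lemma e_in_V: "v \<noteq> w \<Longrightarrow> v \<noteq> k \<Longrightarrow> w \<noteq> k \<Longrightarrow> e v w \<in> V k"
  by (auto simp: V_def)

lemma e_cball: "v \<noteq> w \<Longrightarrow> e v w \<in> cball 0 1"
proof -
  assume vw: "v \<noteq> w"
  obtain k l where "distinct [v, w, k, l]" using complete_4[OF vw] by metis
  then have "e v w \<in> V k" by (intro e_in_V) auto
  then show ?thesis using V_poly(2) by blast
qed

lemma e_distinct:
  assumes "v \<notin> I" "a \<noteq> v" "b \<noteq> v" "a \<noteq> b" shows "e v a \<noteq> e v b"
proof
  assume eq: "e v a = e v b"
  obtain c where d: "distinct [v, a, b, c]"
  proof -
    obtain x y where "distinct [v, a, x, y]" using complete_4[of v a] assms(2) by metis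
    then show ?thesis using that[of x] that[of y] assms by (cases "b = x") auto
  qed
  have "- {v} = {a, b, c}" using UNIV_4[OF d] d by auto
  then have "e v ` (- {v}) = {e v b, e v c}" using eq by auto
  then have "aff_dim {e v b, e v c} = 2" using T_poly(2)[OF assms(1)] by simp
  moreover have "aff_dim {e v b, e v c} \<le> 1" by (simp add: aff_dim_2)
  ultimately show False by simp
qed

lemma e_ends_distinct:
  assumes "v \<noteq> w" "{v, w} \<notin> Z" shows "e v w \<noteq> e w v"
proof (cases "v \<in> I \<and> w \<in> I")
  case True
  \<comment> \<open>With both ends ideal, an edge with coinciding ends would have no points in the ball, but the midpoint of the edge
  of the model belongs to the domain.\<close>
  define x :: "real^4" where "x = (1/2) *\<^sub>R axis v 1 + (1/2) *\<^sub>R axis w 1"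
  have xn: "x $ u = (if u = v \<or> u = w then 1/2 else 0)" for u using assms(1) by (auto simp: x_def axis_def)
  obtain k l where d: "distinct [v, w, k, l]" using complete_4[OF assms(1)] by metis
  have "x $ v = 1/2" "x $ w = 1/2" "x $ k = 0" "x $ l = 0" using d by (auto simp: xn)
  then have "(\<Sum>i\<in>UNIV. x $ i) = 1" by (simp add: sum_4[OF d])
  then have xt: "x \<in> truncated_simplex I" by (auto simp: truncated_simplex_def xn)
  have "x \<in> D" by (rule two_support_in_D[OF assms xt]) (auto simp: xn)
  then have "x \<in> edge_part I Z {v, w}" using xt by (auto simp: edge_part_def cell_def xn)
  then have ne: "hhull {e v w, e w v} \<noteq> {}" using edge_image[OF assms] by blast
  show ?thesis
  proof
    assume "e v w = e w v"
    then have "hhull {e v w, e w v} = H3 \<inter> {q {v}}" using e_ideal[of v w] True by (simp add: hhull_def)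
    then show False using ne q_sphere(1)[of v] True by auto
  qed
next
  case False
  have aux: "e a b \<noteq> e b a" if ab: "a \<noteq> b" "{a, b} \<notin> Z" "a \<notin> I" for a b
  proof (cases "b \<in> I")
    case True
    then have "e b a \<in> sphere 0 1" using e_ideal q_sphere(1) by simp
    then show ?thesis using e_H3[OF ab(1,3,2)] by auto
  next
    case False
    have ba: "{b, a} \<notin> Z" using ab by (simp add: insert_commute)
    have "corner a b $ a \<noteq> corner b a $ a" using ab by (simp add: corner_nth)
    then have "corner a b \<noteq> corner b a" by metis
    then show ?thesis
      using inj_onD[OF f_inj _ corner_in_D[OF ab(1,2,3)] corner_in_D[OF _ ba False]] e_corner[OF ab(3,2)] e_corner[OF False ba] ab(1) by metis
  qed
  show ?thesis using aux[of v w] aux[of w v] False assms by (auto simp: insert_commute)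
qed

definition n :: "4 \<Rightarrow> minkowski" where
  "n k = (SOME N. N \<noteq> 0 \<and> (\<forall>x\<in>V k. mink (lift x) N = 0))"

lemma n: "n k \<noteq> 0" "x \<in> V k \<Longrightarrow> mink (lift x) (n k) = 0"
proof -
  have "\<exists>N. N \<noteq> 0 \<and> (\<forall>x\<in>V k. mink (lift x) N = 0)" using plane_normal[OF V_poly(3)[of k]] by metis
  from someI_ex[OF this] show "n k \<noteq> 0" "x \<in> V k \<Longrightarrow> mink (lift x) (n k) = 0" by (simp_all add: n_def)
qed

lemma face_point_in_D:
  assumes "\<And>i. i \<noteq> k \<Longrightarrow> 0 < x $ i" "\<And>i. 0 \<le> x $ i" "(\<Sum>i\<in>UNIV. x $ i) = 1" "\<And>i. x $ i \<le> 3/4"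
  shows "x \<in> D"
proof -
  obtain a where "k \<noteq> a" by (metis (full_types) zero_neq_one)
  then obtain b c where d: "distinct [k, a, b, c]" using complete_4 by metis
  have t: "x \<in> truncated_simplex I" using assms by (auto simp: truncated_simplex_def)
  show ?thesis
  proof (cases "{a, b} \<in> Z")
    case False
    show ?thesis by (rule two_support_in_D[OF _ False t]) (use d assms(1)[of a] assms(1)[of b] in auto)
  next
    case True
    show ?thesis
    proof (rule ccontr)
      assume "x \<notin> D"
      then obtain s where s: "s \<in> missing I Z" "x \<in> cell I s" using t by (auto simp: Dstar_def)
      then have "{a, b, c} \<subseteq> s" using assms(1)[of a] assms(1)[of b] assms(1)[of c] d by (auto simp: cell_def)
      then have "card {a, b, c} \<le> card s" by (intro card_mono finite_subset[of s UNIV]) auto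
      moreover have "card s \<le> 2" using s(1) Ze by (auto simp: missing_def edges_def)
      ultimately show False using d by simp
    qed
  qed
qed

lemma n_spacelike: "mink (n k) (n k) > 0"
proof -
  define x :: "real^4" where "x = (\<chi> i. if i = k then 0 else 1/3)"
  obtain a where "k \<noteq> a" by (metis (full_types) zero_neq_one)
  then obtain b c where d: "distinct [k, a, b, c]" using complete_4 by metis
  have "x $ k = 0" "x $ a = 1/3" "x $ b = 1/3" "x $ c = 1/3" using d by (auto simp: x_def)
  then have "(\<Sum>i\<in>UNIV. x $ i) = 1" by (simp add: sum_4[OF d])
  then have "x \<in> D" by (intro face_point_in_D[of k]) (auto simp: x_def)
  then have "x \<in> hex k" by (simp add: lateral_hexagon_eq x_def)
  then have p: "f x \<in> hhull (V k)" using V_poly(5) by blast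
  have "convex hull (V k) \<subseteq> {y. mink (lift y) (n k) = 0}" by (rule hull_minimal) (use n convex_mink_eq in auto)
  then have "mink (lift (f x)) (n k) = 0" using p by (auto simp: hhull_def)
  moreover have "mink (lift (f x)) (lift (f x)) < 0" using p mem_H3_iff_mink by (auto simp: hhull_def simp del: mem_ball_0)
  ultimately show ?thesis using n(1) by (intro timelike_orthogonal)
qed

definition T :: "4 \<Rightarrow> minkowski" where
  "T v = (SOME N. N \<noteq> 0 \<and> (\<forall>w. w \<noteq> v \<longrightarrow> mink (lift (e v w)) N = 0) \<and> (\<forall>z. mink z N = 0 \<longrightarrow> z \<in> span (lift ` e v ` (- {v}))))"

text \<open>The pole, up to sign if the vertex is non-ideal.\<close>
definition m0 :: "4 \<Rightarrow> minkowski" where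
  "m0 v = (if v \<in> I then lift (q {v}) else (1 / sqrt (mink (T v) (T v))) *\<^sub>R T v)"

lemma T:
  assumes "v \<notin> I"
  shows "T v \<noteq> 0" "w \<noteq> v \<Longrightarrow> mink (lift (e v w)) (T v) = 0" "mink z (T v) = 0 \<Longrightarrow> z \<in> span (lift ` e v ` (- {v}))"
proof -
  obtain N where N: "N \<noteq> 0" "\<And>x. x \<in> e v ` (- {v}) \<Longrightarrow> mink (lift x) N = 0" "\<And>z. mink z N = 0 \<Longrightarrow> z \<in> span (lift ` e v ` (- {v}))"
    using plane_normal[OF T_poly(2)[OF assms]] by metis
  have "mink (lift (e v w)) N = 0" if "w \<noteq> v" for w by (rule N(2)[OF imageI]) (use that in simp)
  then have "\<exists>N. N \<noteq> 0 \<and> (\<forall>w. w \<noteq> v \<longrightarrow> mink (lift (e v w)) N = 0) \<and> (\<forall>z. mink z N = 0 \<longrightarrow> z \<in> span (lift ` e v ` (- {v})))"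
    using N(1,3) by blast
  from someI_ex[OF this, folded T_def] show "T v \<noteq> 0" "w \<noteq> v \<Longrightarrow> mink (lift (e v w)) (T v) = 0" "mink z (T v) = 0 \<Longrightarrow> z \<in> span (lift ` e v ` (- {v}))"
    by blast+
qed

lemma T_spacelike: assumes v: "v \<notin> I" shows "mink (T v) (T v) > 0"
proof -
  define x :: "real^4" where "x = (\<chi> i. if i = v then 3/4 else 1/12)"
  obtain a where "v \<noteq> a" by (metis (full_types) zero_neq_one)
  then obtain b c where d: "distinct [v, a, b, c]" using complete_4 by metis
  have "x $ v = 3/4" "x $ a = 1/12" "x $ b = 1/12" "x $ c = 1/12" using d by (auto simp: x_def)
  then have "(\<Sum>i\<in>UNIV. x $ i) = 1" by (simp add: sum_4[OF d])
  then have "x \<in> D" by (intro face_point_in_D[of v]) (auto simp: x_def)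
  then have "x \<in> tr v" by (simp add: truncation_triangle_def x_def)
  then have p: "f x \<in> hhull (e v ` (- {v}))" using T_poly(3)[OF v] by blast
  have "convex hull (e v ` (- {v})) \<subseteq> {y. mink (lift y) (T v) = 0}" by (rule hull_minimal) (use T[OF v] convex_mink_eq in auto)
  then have "mink (lift (f x)) (T v) = 0" using p by (auto simp: hhull_def)
  moreover have "mink (lift (f x)) (lift (f x)) < 0" using p mem_H3_iff_mink by (auto simp: hhull_def simp del: mem_ball_0)
  ultimately show ?thesis using T(1)[OF v] by (intro timelike_orthogonal)
qed

lemma m0_nonideal:
  assumes v: "v \<notin> I"
  shows "mink (m0 v) (m0 v) = 1" "w \<noteq> v \<Longrightarrow> mink (lift (e v w)) (m0 v) = 0" "mink z (m0 v) = 0 \<Longrightarrow> z \<in> span (lift ` e v ` (- {v}))"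
proof -
  define s where "s = 1 / sqrt (mink (T v) (T v))"
  have s: "s > 0" "s * s * mink (T v) (T v) = 1" using T_spacelike[OF v] by (simp_all add: s_def)
  have m: "m0 v = s *\<^sub>R T v" using v by (simp add: m0_def s_def)
  show "mink (m0 v) (m0 v) = 1" using s(2) by (simp add: m mink_simps)
  show "w \<noteq> v \<Longrightarrow> mink (lift (e v w)) (m0 v) = 0" using T(2)[OF v] by (simp add: m mink_simps)
  show "z \<in> span (lift ` e v ` (- {v}))" if "mink z (m0 v) = 0"
    by (rule T(3)[OF v]) (use that s(1) in \<open>simp add: m mink_simps\<close>)
qed

lemma m0_ideal: "v \<in> I \<Longrightarrow> m0 v = lift (e v w)" "v \<in> I \<Longrightarrow> mink (m0 v) (m0 v) = 0"
  using q_sphere(1)[of v] mem_sphere_iff_mink[of "q {v}"] by (auto simp: m0_def e_ideal)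

lemma m0_nonzero: "m0 v \<noteq> 0"
  using m0_nonideal(1)[of v] m0_ideal(1)[of v] by (cases "v \<in> I") (auto simp: mink_simps)

lemma m0_e: "v \<noteq> w \<Longrightarrow> mink (lift (e v w)) (m0 v) = 0"
  using m0_nonideal(2)[of v w] m0_ideal(1)[of v w] m0_ideal(2)[of v] by (cases "v \<in> I") auto

text \<open>For a non-ideal vertex this is the right angle between the truncation triangle and the face.\<close>
lemma m0_n:
  assumes "k \<noteq> v" shows "mink (m0 v) (n k) = 0"
proof -
  obtain a b where d: "distinct [v, k, a, b]" using complete_4[of v k] assms by metis
  show ?thesis
  proof (cases "v \<in> I")
    case True
    have "e v a \<in> V k" by (rule e_in_V) (use d in auto)
    then show ?thesis using n(2) m0_ideal(1)[OF True] by metis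
  next
    case False
    have "- {v, k} = {a, b}" using UNIV_4[OF d] d by auto
    then have E: "f ` (tr v \<inter> hex k) = hhull {e v a, e v b}" using T_poly(4)[OF False assms] by simp
    have "has_dihedral_angle (f ` (tr v \<inter> hex k)) (f ` tr v) (f ` hex k) (pi / 2)"
      using ra False assms unfolding right_angles_def by blast
    then have ang: "has_dihedral_angle (hhull {e v a, e v b}) (hhull (e v ` (- {v}))) (hhull (V k)) (pi / 2)"
      unfolding E T_poly(3)[OF False] V_poly(5) .
    show ?thesis
    proof (rule perpendicular_planes[OF T_poly(2,1)[OF False] _ _ V_poly(3,2) n(2) _ _ _ _ _ ang])
      show "mink (lift x) (m0 v) = 0" if "x \<in> e v ` (- {v})" for x using that m0_nonideal(2)[OF False] by auto
      show "mink (m0 v) (m0 v) > 0" using m0_nonideal(1)[OF False] by simp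
      show "e v a \<in> e v ` (- {v})" "e v b \<in> e v ` (- {v})" using d by auto
      show "e v a \<in> V k" "e v b \<in> V k" using d by (auto intro!: e_in_V)
      show "e v a \<noteq> e v b" using e_distinct[OF False] d by auto
    qed
  qed
qed

end

lemma dim_orthogonal_pair:
  assumes "mink b a = 0" "mink a a \<noteq> 0" "b \<noteq> 0"
  shows "dim {a, b} = 2"
proof (rule dim_pair)
  fix s t :: real assume st: "s *\<^sub>R a + t *\<^sub>R b = 0"
  then have "mink (s *\<^sub>R a + t *\<^sub>R b) a = 0" by (simp add: mink_simps)
  then have "s = 0" using assms by (simp add: mink_simps)
  then show "s = 0 \<and> t = 0" using st assms(3) by simp
qed

context realization_data begin

text \<open>The edges at an ideal vertex are not coplanar. Otherwise one of their directions would be a nonnegative combination of the other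
  two, and near the vertex that edge would run inside the hexagon between the other two. The only common
  point of this edge and this hexagon in the model is the missing vertex, so this contradicts injectivity.\<close>
lemma ideal_link_independent:
  assumes v: "v \<in> I" and d: "distinct [v, a, b, c]"
    and dep: "x *\<^sub>R (e a v - q {v}) + y *\<^sub>R (e b v - q {v}) + z *\<^sub>R (e c v - q {v}) = 0"
  shows "x = 0 \<and> y = 0 \<and> z = 0"
proof (rule ccontr)
  assume nz: "\<not> (x = 0 \<and> y = 0 \<and> z = 0)"
  define g where "g w = e w v - q {v}" for w
  have vZ: "{v, w} \<notin> Z" for w using Z_nonideal v by blast
  have neg: "g w \<bullet> q {v} < 0" if "w \<noteq> v" for w
  proof -
    have ne: "e w v \<noteq> q {v}" using e_ends_distinct[OF that[symmetric] vZ] e_ideal[OF v] by metis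
    have qs: "q {v} \<in> sphere 0 1" by (rule q_sphere(1)[OF v])
    then have "mink (lift (e w v)) (lift (q {v})) < 0" using mink_lift_neg[OF e_cball[OF that] _ ne] by simp
    moreover have "q {v} \<bullet> q {v} = 1" using qs by (simp add: norm_eq_1)
    ultimately show ?thesis by (simp add: g_def mink_lift inner_diff_left)
  qed
  have "distinct [a, b, c]" using d by simp
  moreover have "g a \<bullet> q {v} < 0" "g b \<bullet> q {v} < 0" "g c \<bullet> q {v} < 0" using neg d by auto
  moreover have "x *\<^sub>R g a + y *\<^sub>R g b + z *\<^sub>R g c = 0" using dep by (simp add: g_def)
  ultimately obtain i j k s t where ijk: "distinct [i, j, k]" "{i, j, k} = {a, b, c}" and st: "0 \<le> s" "0 \<le> t"
    and g: "g i = s *\<^sub>R g j + t *\<^sub>R g k"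
    using negative_combination[of a b c g "q {v}" x y z] nz by blast
  have iv': "i \<noteq> v" "j \<noteq> v" "k \<noteq> v" using ijk(2) d by auto
  \<comment> \<open>A step so short that \<open>p\<close> is a convex combination of \<open>q {v}\<close> and the other two ends, and strictly inside the edge.\<close>
  define \<epsilon> where "\<epsilon> = 1 / (2 + s + t)"
  have \<epsilon>: "0 < \<epsilon>" "\<epsilon> < 1" "\<epsilon> * (2 + s + t) = 1" using st by (auto simp: \<epsilon>_def)
  define p where "p = q {v} + \<epsilon> *\<^sub>R g i"
  have p1: "p = (1 - \<epsilon>) *\<^sub>R q {v} + \<epsilon> *\<^sub>R e i v" by (simp add: p_def g_def algebra_simps)
  have ne: "q {v} \<noteq> e i v" using neg[OF iv'(1)] by (auto simp: g_def)
  have po: "p \<in> open_segment (q {v}) (e i v)" using ne \<epsilon> p1 by (auto simp: in_segment)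
  have pH: "p \<in> H3" by (rule open_segment_in_H3[OF _ e_cball[OF iv'(1)] po]) (use q_sphere(1)[OF v] in simp)
  have "p \<in> hhull {e v i, e i v}"
    using pH open_closed_segment[OF po] e_ideal[OF v] by (simp add: hhull_def segment_convex_hull)
  then obtain y1 where y1: "y1 \<in> edge_part I Z {v, i}" "f y1 = p"
    using edge_image[OF iv'(1)[symmetric] vZ] by (metis imageE)
  have "p = (1 - \<epsilon> * s - \<epsilon> * t) *\<^sub>R q {v} + (\<epsilon> * s) *\<^sub>R e j v + (\<epsilon> * t) *\<^sub>R e k v"
    unfolding p_def g by (simp add: g_def algebra_simps)
  moreover have "0 \<le> 1 - \<epsilon> * s - \<epsilon> * t" "0 \<le> \<epsilon> * s" "0 \<le> \<epsilon> * t" using \<epsilon> st by (simp_all add: algebra_simps)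
  ultimately have "p \<in> convex hull {q {v}, e j v, e k v}"
    unfolding convex_hull_3 by (intro CollectI exI[of _ "1 - \<epsilon> * s - \<epsilon> * t"] exI[of _ "\<epsilon> * s"] exI[of _ "\<epsilon> * t"]) simp
  moreover have "q {v} \<in> V i" "e j v \<in> V i" "e k v \<in> V i"
    using e_in_V[of v j i] e_ideal[OF v, of j] e_in_V[of j v i] e_in_V[of k v i] iv' ijk(1) by auto
  then have "convex hull {q {v}, e j v, e k v} \<subseteq> convex hull V i" by (intro hull_mono) simp
  ultimately have "p \<in> hhull (V i)" using pH by (auto simp: hhull_def)
  then obtain y2 where y2: "y2 \<in> hex i" "f y2 = p" using V_poly(5) by (metis imageE)
  have "y1 \<in> D" "y2 \<in> D" using y1(1) y2(1) by (auto simp: edge_part_def lateral_hexagon_def)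
  then have "y1 = y2" using inj_onD[OF f_inj] y1(2) y2(2) by metis
  then have "y1 \<in> cell I {v}" using y1(1) y2(1) by (auto simp: edge_part_def lateral_hexagon_eq cell_def)
  then show False using \<open>y1 \<in> D\<close> v by (auto simp: Dstar_def missing_def)
qed

text \<open>The three faces at a vertex have independent normals. For a non-ideal vertex this is because the truncation
  triangle is nondegenerate, for an ideal one because the edges there are not coplanar.\<close>
lemma link_normal_nonzero:
  assumes d: "distinct [v, i, j, k]"
  shows "\<exists>r. mink r (n i) \<noteq> 0 \<and> mink r (n j) = 0 \<and> mink r (n k) = 0"
proof (cases "v \<in> I")
  case True
  have j0: "mink (lift (e i v)) (n j) = 0" "mink (lift (e i v)) (n k) = 0"
    using n(2) e_in_V[of i v j] e_in_V[of i v k] d by auto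
  have "mink (lift (e i v)) (n i) \<noteq> 0"
  proof
    assume i0: "mink (lift (e i v)) (n i) = 0"
    define u where "u = fst (n i)"
    have eq: "x \<bullet> u = snd (n i)" if "mink (lift x) (n i) = 0" for x using that by (simp add: mink_lift_left u_def)
    have q0: "mink (lift (q {v})) (n i) = 0" using n(2) e_in_V[of v j i] e_ideal[OF True, of j] d by auto
    define S where "S = {e i v - q {v}, e j v - q {v}, e k v - q {v}}"
    have So: "x \<bullet> u = 0" if "x \<in> S" for x
      using that eq[OF i0] eq[OF q0] eq[OF n(2)[OF e_in_V[of j v i]]] eq[OF n(2)[OF e_in_V[of k v i]]] d
      by (auto simp: S_def inner_diff_left)
    have ind: "x = 0 \<and> y = 0 \<and> z = 0"
      if "x *\<^sub>R (e i v - q {v}) + y *\<^sub>R (e j v - q {v}) + z *\<^sub>R (e k v - q {v}) = 0" for x y z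
      by (rule ideal_link_independent[OF True d that])
    have "dim {e j v - q {v}, e k v - q {v}} = 2"
    proof (rule dim_pair)
      fix s t :: real assume "s *\<^sub>R (e j v - q {v}) + t *\<^sub>R (e k v - q {v}) = 0"
      then show "s = 0 \<and> t = 0" using ind[of 0 s t] by simp
    qed
    moreover have "e i v - q {v} \<notin> span {e j v - q {v}, e k v - q {v}}"
    proof
      assume "e i v - q {v} \<in> span {e j v - q {v}, e k v - q {v}}"
      then obtain s t where "e i v - q {v} = s *\<^sub>R (e j v - q {v}) + t *\<^sub>R (e k v - q {v})" by (rule span_pairE)
      then show False using ind[of "-1" s t] by simp
    qed
    ultimately have "dim S = DIM(real^3)" by (simp add: S_def dim_insert)
    then have "u \<in> span S" using dim_eq_full[of S] by simp
    then have "u = 0" using orthogonal_to_span[of u S u] So by (simp add: orthogonal_def inner_commute)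
    then show False using eq[OF q0] n(1)[of i] by (auto simp: u_def prod_eq_iff)
  qed
  then show ?thesis using j0 by blast
next
  case False
  have j0: "mink (lift (e v i)) (n j) = 0" "mink (lift (e v i)) (n k) = 0"
    using n(2) e_in_V[of v i j] e_in_V[of v i k] d by auto
  have "mink (lift (e v i)) (n i) \<noteq> 0"
  proof
    assume i0: "mink (lift (e v i)) (n i) = 0"
    have "mink (n i) (lift (e v w)) = 0" if "w \<noteq> v" for w
      using i0 n(2)[OF e_in_V[of v w i]] that d by (cases "w = i") (auto simp: mink_commute)
    then have c: "mink (n i) s = 0" if "s \<in> lift ` e v ` (- {v})" for s using that by auto
    have "n i \<in> span {m0 v}"
    proof (rule mink_complement_span[of _ "lift ` e v ` (- {v})"])
      show "4 \<le> dim {m0 v} + dim (lift ` e v ` (- {v}))"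
        using aff_dim_eq_dim_lift[of "e v ` (- {v})"] T_poly(2)[OF False] m0_nonzero[of v] by (cases "e v ` (- {v}) = {}") auto
      show "mink s x = 0" if "s \<in> {m0 v}" "x \<in> lift ` e v ` (- {v})" for s x
        using that m0_nonideal(2)[OF False] mink_commute[of "m0 v"] by auto
    qed (rule c)
    then obtain t where t: "n i = t *\<^sub>R m0 v" by (auto simp: span_singleton)
    then have "t * mink (m0 v) (m0 v) = mink (m0 v) (n i)" by (simp add: mink_simps)
    then have "t = 0" using m0_n[of i v] m0_nonideal(1)[OF False] d by auto
    then show False using t n(1) by simp
  qed
  then show ?thesis using j0 by blast
qed

text \<open>The normals of the faces at \<open>v\<close> span a three-dimensional space, so the pole is determined by them up to scaling.\<close>
lemma common_point:
  assumes z: "\<And>k. k \<noteq> v \<Longrightarrow> mink z (n k) = 0"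
  shows "z \<in> span {m0 v}"
proof -
  have "\<forall>i. \<exists>r. i \<noteq> v \<longrightarrow> mink r (n i) \<noteq> 0 \<and> (\<forall>j. j \<noteq> v \<longrightarrow> j \<noteq> i \<longrightarrow> mink r (n j) = 0)"
  proof -
    have "\<exists>r. mink r (n i) \<noteq> 0 \<and> (\<forall>j. j \<noteq> v \<longrightarrow> j \<noteq> i \<longrightarrow> mink r (n j) = 0)" if iv: "i \<noteq> v" for i
    proof -
      obtain j k where d: "distinct [v, i, j, k]" using complete_4[of v i] iv by metis
      obtain x where x: "mink x (n i) \<noteq> 0" "mink x (n j) = 0" "mink x (n k) = 0" using link_normal_nonzero[OF d] by blast
      have "mink x (n l) = 0" if "l \<noteq> v" "l \<noteq> i" for l
      proof -
        have "l = j \<or> l = k" using UNIV_4[OF d] that UNIV_I[of l] by auto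
        then show ?thesis using x by auto
      qed
      then show ?thesis using x(1) by blast
    qed
    then show ?thesis by blast
  qed
  then obtain r where r: "\<And>i. i \<noteq> v \<longrightarrow> mink (r i) (n i) \<noteq> 0 \<and> (\<forall>j. j \<noteq> v \<longrightarrow> j \<noteq> i \<longrightarrow> mink (r i) (n j) = 0)"
    by (metis choice)
  have "dim (n ` (- {v})) = card (- {v})"
    by (rule dim_dual[of _ r]) (use r in auto)
  moreover have "card (- {v}) = 3" by (simp add: Compl_eq_Diff_UNIV card_Diff_subset)
  moreover have "dim {m0 v} = 1" using m0_nonzero[of v] by simp
  ultimately have "4 \<le> dim {m0 v} + dim (n ` (- {v}))" by simp
  then show ?thesis
  proof (rule mink_complement_span[rotated])
    show "mink x c = 0" if "x \<in> {m0 v}" "c \<in> n ` (- {v})" for x c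
    proof -
      from that obtain k where "c = n k" "k \<noteq> v" by blast
      then show ?thesis using m0_n that(1) by simp
    qed
    show "mink z c = 0" if "c \<in> n ` (- {v})" for c
    proof -
      from that obtain k where "c = n k" "k \<noteq> v" by blast
      then show ?thesis using z by simp
    qed
  qed
qed

text \<open>If the pole of \<open>v\<close> were on all four faces, then all poles would be proportional to it, and the plane of a face
  would be orthogonal both to its normal and to this pole.\<close>
lemma m0_n_nonzero: "mink (m0 v) (n v) \<noteq> 0"
proof
  assume 0: "mink (m0 v) (n v) = 0"
  then have all: "mink (m0 v) (n k) = 0" for k using m0_n[of k v] by (cases "k = v") auto
  have par: "mink x (m0 v) = 0" if "mink x (m0 w) = 0" for x w
  proof -
    have "m0 v \<in> span {m0 w}" by (rule common_point) (rule all)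
    then show ?thesis using that by (auto simp: span_singleton mink_simps)
  qed
  have "mink s c = 0" if s: "s \<in> lift ` V v" and c: "c \<in> {n v, m0 v}" for s c
  proof -
    obtain a b where "s = lift (e a b)" "a \<noteq> b" "e a b \<in> V v" using s by (auto simp: V_def)
    then show ?thesis using c n(2) par[OF m0_e] by auto
  qed
  then have "dim (lift ` V v) + dim {n v, m0 v} \<le> 4" by (rule mink_dim_le)
  moreover have "dim (lift ` V v) = 3" using aff_dim_eq_dim_lift[of "V v"] V_poly(3)[of v] by (cases "V v = {}") auto
  moreover have "dim {n v, m0 v} = 2"
    by (rule dim_orthogonal_pair) (use 0 n_spacelike[of v] m0_nonzero in auto)
  ultimately show False by simp
qed

lemma dim_normals: "dim (n ` A) = card A"
  by (rule dim_dual[of _ m0]) (use m0_n m0_n_nonzero in auto)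

lemma dim_poles: "dim (m0 ` A) = card A"
proof (rule dim_dual[of _ n])
  show "mink (n v) (m0 k) = 0" if "v \<noteq> k" for v k using m0_n[OF that] by (simp add: mink_commute)
  show "mink (n v) (m0 v) \<noteq> 0" for v using m0_n_nonzero[of v] by (simp add: mink_commute)
qed simp

lemma e_on_edge:
  assumes "v \<noteq> w" shows "lift (e v w) \<in> span {m0 v, m0 w}"
proof -
  have "card {v, w} = 2" "card (- {v, w}) = 2" using assms by (simp_all add: Compl_eq_Diff_UNIV card_Diff_subset)
  then have "4 \<le> dim (m0 ` {v, w}) + dim (n ` (- {v, w}))" unfolding dim_normals dim_poles by simp
  then have "lift (e v w) \<in> span (m0 ` {v, w})"
  proof (rule mink_complement_span[rotated])
    show "mink x c = 0" if "x \<in> m0 ` {v, w}" "c \<in> n ` (- {v, w})" for x c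
    proof -
      from that obtain k u where "c = n k" "k \<noteq> u" "x = m0 u" by blast
      then show ?thesis using m0_n by simp
    qed
    show "mink (lift (e v w)) c = 0" if "c \<in> n ` (- {v, w})" for c
    proof -
      from that obtain k where k: "c = n k" "v \<noteq> k" "w \<noteq> k" by blast
      then show ?thesis using n(2)[OF e_in_V[OF assms k(2,3)]] by simp
    qed
  qed
  then show ?thesis by simp
qed

text \<open>Otherwise both ends of the edge would lie on three independent planes.\<close>
lemma edge_not_in_triangle_plane:
  assumes "v \<noteq> w" "{v, w} \<notin> Z" "v \<notin> I"
  shows "mink (lift (e w v)) (m0 v) \<noteq> 0"
proof
  assume 0: "mink (lift (e w v)) (m0 v) = 0"
  obtain k l where d: "distinct [v, w, k, l]" using complete_4[OF assms(1)] by metis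
  have "mink s c = 0" if "s \<in> {lift (e v w), lift (e w v)}" "c \<in> {m0 v, n k, n l}" for s c
  proof -
    have "mink (lift (e v w)) c = 0 \<and> mink (lift (e w v)) c = 0"
      using that(2) 0 m0_e[OF assms(1)] n(2)[OF e_in_V[of v w]] n(2)[OF e_in_V[of w v]] d by fastforce
    then show ?thesis using that(1) by blast
  qed
  then have "dim {lift (e v w), lift (e w v)} + dim {m0 v, n k, n l} \<le> 4" by (rule mink_dim_le)
  moreover have "dim {lift (e v w), lift (e w v)} = 2" by (rule dim_lift_pair[OF e_ends_distinct[OF assms(1,2)]])
  moreover have "dim {n k, n l} = 2" using dim_normals[of "{k, l}"] d by simp
  moreover have "m0 v \<notin> span {n k, n l}"
  proof
    assume "m0 v \<in> span {n k, n l}"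
    then obtain s t where "m0 v = s *\<^sub>R n k + t *\<^sub>R n l" by (rule span_pairE)
    moreover have "mink (m0 v) (s *\<^sub>R n k + t *\<^sub>R n l) = s * mink (m0 v) (n k) + t * mink (m0 v) (n l)" by (simp add: mink_simps)
    moreover have "mink (m0 v) (n k) = 0" "mink (m0 v) (n l) = 0" using m0_n d by auto
    ultimately have "mink (m0 v) (m0 v) = 0" by simp
    then show False using m0_nonideal(1)[OF assms(3)] by simp
  qed
  ultimately show False by (simp add: dim_insert)
qed

end

section \<open>Orientation of the poles\<close>

text \<open>A vector in the plane of two unit spacelike vectors that is orthogonal to both forces the plane to be degenerate.\<close>
lemma null_combination:
  assumes q: "q = \<alpha> *\<^sub>R a + \<beta> *\<^sub>R b" "q \<noteq> 0" and o: "mink q a = 0" "mink q b = 0"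
    and ab: "mink a a = 1" "mink b b = 1"
  shows "(mink a b)\<^sup>2 = 1 \<and> \<beta> \<noteq> 0 \<and> q = \<beta> *\<^sub>R (b - mink a b *\<^sub>R a)"
proof -
  define M where "M = mink a b"
  have ba: "mink b a = M" by (simp add: M_def mink_commute)
  have e: "\<alpha> + \<beta> * M = 0" "\<alpha> * M + \<beta> = 0"
    using o ab by (simp_all add: q(1) mink_simps ba flip: M_def)
  then have \<alpha>: "\<alpha> = - \<beta> * M" by simp
  have \<beta>: "\<beta> \<noteq> 0" using q \<alpha> by auto
  have "\<beta> * (1 - M\<^sup>2) = 0" using e(2) by (simp add: \<alpha> algebra_simps power2_eq_square)
  then have "M\<^sup>2 = 1" using \<beta> by simp
  moreover have "q = \<beta> *\<^sub>R (b - M *\<^sub>R a)" by (simp add: q(1) \<alpha> algebra_simps)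
  ultimately show ?thesis using \<beta> by (simp add: M_def)
qed

context realization_data begin

text \<open>A negative coefficient would put the vertex \<open>b\<close> strictly between \<open>a\<close> and \<open>z\<close>.\<close>
lemma V_extreme:
  assumes ab: "a \<in> V k" "b \<in> V k" "a \<noteq> b" and z: "z \<in> convex hull V k" "z = s *\<^sub>R a + t *\<^sub>R b" "s + t = 1"
  shows "0 \<le> s"
proof (rule ccontr)
  assume s: "\<not> 0 \<le> s"
  then have t: "t > 1" "s = 1 - t" using z(3) by auto
  have "z - a = t *\<^sub>R (b - a)" by (simp add: z(2) t(2) algebra_simps)
  then have "a \<noteq> z" using ab(3) t(1) by auto
  moreover have "b = (1 - 1 / t) *\<^sub>R a + (1 / t) *\<^sub>R z"
  proof -
    have "(1 / t) *\<^sub>R z = (1 / t - 1) *\<^sub>R a + b" using t(1) by (simp add: z(2) t(2) scaleR_add_right diff_divide_distrib)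
    then show ?thesis by (simp add: algebra_simps)
  qed
  ultimately have "b \<in> open_segment a z" using t(1) by (auto simp: in_segment intro!: exI[of _ "1 / t"])
  moreover have "b extreme_point_of convex hull V k"
    using extreme_point_of_convex_hull_convex_independent[of "V k" b] V_poly(1)[of k] V_poly(4)[of _ k] ab(2) by (auto simp: finite_imp_compact)
  moreover have "a \<in> convex hull V k" using ab(1) by (rule hull_inc)
  ultimately show False using z(1) by (auto simp: extreme_point_of_def)
qed

text \<open>If the vertices lay on both sides of the truncation plane, the hexagon without the truncation triangle, being
  connected, would meet the plane. But in the plane of the hexagon this truncation plane is the line through the two ends
  at \<open>v\<close>, and the hexagon meets this line only in the side of the truncation triangle.\<close>
lemma hexagon_one_sided:
  assumes v: "v \<notin> I" "k \<noteq> v"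
  shows "(\<forall>x\<in>V k. mink (lift x) (m0 v) \<le> 0) \<or> (\<forall>x\<in>V k. 0 \<le> mink (lift x) (m0 v))"
proof (rule ccontr)
  define g where "g x = mink (lift x) (m0 v)" for x
  assume "\<not> ?thesis"
  then obtain x y where xy: "x \<in> V k" "y \<in> V k" "g x > 0" "g y < 0" by (force simp: g_def)
  obtain a b where d: "distinct [v, k, a, b]" using complete_4[of v k] v(2) by metis
  define S where "S = hhull {e v a, e v b}"
  have ab: "e v a \<in> V k" "e v b \<in> V k" "e v a \<noteq> e v b" using d e_in_V e_distinct[OF v(1), of a b] by auto
  have gab: "g (e v a) = 0" "g (e v b) = 0" using m0_e d by (auto simp: g_def)
  have "- {v, k} = {a, b}" using UNIV_4[OF d] d by auto
  then have S: "f ` (tr v \<inter> hex k) = S" using T_poly(4)[OF v] by (simp add: S_def)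
  have gl: "g ((1 - t) *\<^sub>R x + t *\<^sub>R y) = (1 - t) * g x + t * g y" for t x y
  proof -
    have "lift ((1 - t) *\<^sub>R x + t *\<^sub>R y) = (1 - t) *\<^sub>R lift x + t *\<^sub>R lift y" by (simp add: lift_def)
    then show ?thesis by (simp add: g_def mink_simps)
  qed
  define C where "C = f ` (hex k - tr v)"
  have subD: "hex k \<subseteq> D" by (auto simp: lateral_hexagon_def)
  have "hex k - tr v = hex k - (tr v \<inter> hex k)" by blast
  then have C: "C = hhull (V k) - S"
    unfolding C_def V_poly(5)[symmetric] S[symmetric]
    using inj_on_image_set_diff[OF f_inj, of "hex k" "tr v \<inter> hex k"] subD by auto
  have "continuous_on (hex k - tr v) f" by (rule continuous_on_subset[OF f_cont]) (use subD in blast)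
  then have Cc: "connected C"
    unfolding C_def by (rule connected_continuous_image) (intro convex_connected hexagon_minus_triangle_convex v)
  \<comment> \<open>Vertices may be ideal or on the truncation triangle; replace them by points of \<open>C\<close> on the same side.\<close>
  have near: "\<exists>z\<in>C. g z = g x / 2" if x: "x \<in> V k" and y: "y \<in> V k" and opp: "g x * g y < 0" for x y
  proof -
    define t where "t = g x / (2 * (g x - g y))"
    have gd: "g x - g y \<noteq> 0" using opp by (auto simp: mult_less_0_iff)
    have t: "0 < t" "t < 1" using opp by (auto simp: t_def mult_less_0_iff zero_less_divide_iff divide_less_eq)
    define z where "z = (1 - t) *\<^sub>R x + t *\<^sub>R y"
    have "x \<noteq> y" using gd by auto
    then have zo: "z \<in> open_segment x y" using t by (auto simp: z_def in_segment)
    have "z \<in> H3" by (rule open_segment_in_H3[OF _ _ zo]) (use x y V_poly(2) in blast)+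
    moreover have "z \<in> convex hull V k"
      using open_closed_segment[OF zo] closed_segment_subset[OF hull_inc[OF x] hull_inc[OF y] convex_convex_hull] by blast
    ultimately have zh: "z \<in> hhull (V k)" by (simp add: hhull_def)
    have "g z = g x - t * (g x - g y)" unfolding z_def gl by (simp add: algebra_simps)
    also have "t * (g x - g y) = g x / 2" unfolding t_def using gd by (subst mult.commute) (metis nonzero_mult_divide_mult_cancel_left2 mult.commute times_divide_eq_right)
    finally have gz: "g z = g x / 2" by simp
    have "z \<notin> S"
    proof
      assume "z \<in> S"
      moreover have "convex hull {e v a, e v b} \<subseteq> {x. g x = 0}"
        by (rule hull_minimal) (use gab convex_mink_eq[of "m0 v" ] in \<open>simp_all add: g_def\<close>)
      ultimately have "g z = 0" by (auto simp: S_def hhull_def)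
      then show False using gz opp by simp
    qed
    then show ?thesis using zh gz C by blast
  qed
  obtain x' y' where x': "x' \<in> C" "g x' = g x / 2" and y': "y' \<in> C" "g y' = g y / 2"
    using near[of x y] near[of y x] xy by (auto simp: mult_pos_neg mult_neg_pos)
  have "continuous_on C g" unfolding g_def mink_lift_left by (intro continuous_intros)
  then have "connected (g ` C)" using Cc by (rule connected_continuous_image)
  then have "{g y'..g x'} \<subseteq> g ` C" by (rule connected_contains_Icc) (use x' y' in auto)
  moreover have "0 \<in> {g y'..g x'}" using x'(2) y'(2) xy by simp
  ultimately obtain z where zC: "z \<in> C" and gz: "g z = 0" by (metis (no_types, lifting) imageE subsetD)
  have zh: "z \<in> convex hull V k" "z \<in> H3" "z \<notin> S" using zC C by (auto simp: hhull_def)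
  have "convex hull V k \<subseteq> {x. mink (lift x) (n k) = 0}" by (rule hull_minimal) (use n convex_mink_eq in auto)
  then have zn: "mink (lift z) (n k) = 0" using zh(1) by blast
  have "lift z \<in> span {lift (e v a), lift (e v b)}"
  proof (rule mink_complement_span[of _ "{n k, m0 v}"])
    have "dim {n k, m0 v} = 2" by (rule dim_orthogonal_pair) (use m0_n[OF v(2)] n_spacelike[of k] m0_nonzero in auto)
    then show "4 \<le> dim {lift (e v a), lift (e v b)} + dim {n k, m0 v}" using dim_lift_pair[OF ab(3)] by simp
    show "mink s c = 0" if "s \<in> {lift (e v a), lift (e v b)}" "c \<in> {n k, m0 v}" for s c
      using that gab n(2)[OF ab(1)] n(2)[OF ab(2)] by (auto simp: g_def)
    show "mink (lift z) c = 0" if "c \<in> {n k, m0 v}" for c using that zn gz by (auto simp: g_def)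
  qed
  then obtain s t where "lift z = s *\<^sub>R lift (e v a) + t *\<^sub>R lift (e v b)" by (rule span_pairE)
  then have st: "z = s *\<^sub>R e v a + t *\<^sub>R e v b" "s + t = 1" by (auto simp: lift_def)
  have "0 \<le> s" by (rule V_extreme[OF ab zh(1) st])
  moreover have "0 \<le> t" by (rule V_extreme[OF ab(2,1) ab(3)[symmetric] zh(1), of t s]) (use st in \<open>simp_all add: add.commute\<close>)
  ultimately have "z \<in> convex hull {e v a, e v b}" using st by (auto simp: convex_hull_2)
  then show False using zh by (simp add: S_def hhull_def)
qed

text \<open>Two hexagons at \<open>v\<close> share an edge, whose far end decides the side. If that edge has length 0, its far end lies on
  the truncation plane at \<open>v\<close>. But then its ideal point is a combination of the poles of \<open>v\<close> and \<open>w\<close>, so on the truncation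
  plane at \<open>w\<close> the product with \<open>m0 v\<close> is proportional to the product with this ideal point. The latter is negative at
  the other two vertices of the truncation triangle at \<open>w\<close>, and each hexagon contains one of them.\<close>
lemma hexagons_same_side:
  assumes v: "v \<notin> I" and d: "distinct [v, w, k, l]"
  shows "\<exists>x\<in>V k. \<exists>y\<in>V l. 0 < mink (lift x) (m0 v) * mink (lift y) (m0 v)"
proof (cases "{v, w} \<in> Z")
  case False
  have "mink (lift (e w v)) (m0 v) \<noteq> 0" by (rule edge_not_in_triangle_plane[OF _ False v]) (use d in auto)
  then have "0 < mink (lift (e w v)) (m0 v) * mink (lift (e w v)) (m0 v)" by (auto simp: zero_less_mult_iff)
  moreover have "e w v \<in> V k" "e w v \<in> V l" using d e_in_V by auto
  ultimately show ?thesis by blast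
next
  case True
  have w: "w \<notin> I" using Z_nonideal[OF True] by simp
  have vw: "v \<noteq> w" "v \<noteq> k" "v \<noteq> l" "w \<noteq> k" "w \<noteq> l" "k \<noteq> l" using d by auto
  have ew: "e v w = e w v" using e_sym_Z[OF True] by simp
  obtain \<alpha> \<beta> where ab: "lift (e v w) = \<alpha> *\<^sub>R m0 v + \<beta> *\<^sub>R m0 w" using e_on_edge[OF vw(1)] by (rule span_pairE)
  have "mink (lift (e v w)) (m0 w) = 0" unfolding ew by (rule m0_e) (use vw in auto)
  then have N: "(mink (m0 v) (m0 w))\<^sup>2 = 1 \<and> \<beta> \<noteq> 0 \<and> lift (e v w) = \<beta> *\<^sub>R (m0 w - mink (m0 v) (m0 w) *\<^sub>R m0 v)"
    by (intro null_combination[OF ab]) (use m0_e[OF vw(1)] m0_nonideal(1) v w in auto)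
  have neg: "\<beta> * mink (m0 v) (m0 w) * mink (lift (e w i)) (m0 v) > 0" if i: "i \<noteq> v" "i \<noteq> w" for i
  proof -
    have "e v w \<noteq> e w i" unfolding ew using e_distinct[OF w, of v i] vw(1) i by auto
    then have "mink (lift (e v w)) (lift (e w i)) < 0" using mink_lift_neg[OF e_cball e_cball] vw(1) i by metis
    moreover have "mink (m0 w) (lift (e w i)) = 0" using m0_e[of w i] i by (simp add: mink_commute)
    ultimately show ?thesis using N by (simp add: mink_simps mink_commute[of "m0 v" "lift (e w i)"])
  qed
  have "0 < (\<beta> * mink (m0 v) (m0 w) * mink (lift (e w l)) (m0 v)) * (\<beta> * mink (m0 v) (m0 w) * mink (lift (e w k)) (m0 v))"
    by (rule mult_pos_pos; rule neg) (use vw in auto)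
  also have "\<dots> = (\<beta> * mink (m0 v) (m0 w))\<^sup>2 * (mink (lift (e w l)) (m0 v) * mink (lift (e w k)) (m0 v))"
    by (simp add: power2_eq_square algebra_simps)
  finally have "0 < mink (lift (e w l)) (m0 v) * mink (lift (e w k)) (m0 v)"
    by (simp add: zero_less_mult_iff)
  moreover have "e w l \<in> V k" "e w k \<in> V l" using vw e_in_V by auto
  ultimately show ?thesis by blast
qed

lemma one_side:
  assumes v: "v \<notin> I"
  shows "\<exists>s\<in>{1, -1}. \<forall>a b. a \<noteq> b \<longrightarrow> s * mink (lift (e a b)) (m0 v) \<le> 0"
proof -
  obtain u where "v \<noteq> u" by (metis (full_types) zero_neq_one)
  then obtain w k where d: "distinct [v, u, w, k]" using complete_4 by metis
  have sided: "\<exists>s\<in>{1, -1}. \<forall>x\<in>V k. s * mink (lift x) (m0 v) \<le> 0" if "k \<noteq> v" for k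
    using hexagon_one_sided[OF v that] by auto
  obtain s where s: "s \<in> {1, -1}" "\<forall>x\<in>V k. s * mink (lift x) (m0 v) \<le> 0" proof -
    have "k \<noteq> v" using d by auto
    from sided[OF this] show thesis using that by blast
  qed
  have all: "s * mink (lift x) (m0 v) \<le> 0" if l: "l \<noteq> v" and x: "x \<in> V l" for l x
  proof (cases "l = k")
    case True
    then show ?thesis using s x by blast
  next
    case False
    obtain s' where s': "s' \<in> {1, -1}" "\<forall>x\<in>V l. s' * mink (lift x) (m0 v) \<le> 0" using sided[OF l] by blast
    have "\<exists>i. distinct [v, i, k, l]"
    proof -
      obtain i j where "distinct [v, k, i, j]" using complete_4[of v k] d by auto
      then show ?thesis using l False by (cases "i = l") (auto intro: exI[of _ j] exI[of _ i])
    qed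
    then obtain i where "distinct [v, i, k, l]" ..
    then obtain y z where yz: "y \<in> V k" "z \<in> V l" "0 < mink (lift y) (m0 v) * mink (lift z) (m0 v)"
      using hexagons_same_side[OF v] by blast
    have "s * mink (lift y) (m0 v) \<le> 0" "s' * mink (lift z) (m0 v) \<le> 0" using s s' yz by blast+
    then have "s' = s" using yz(3) s(1) s'(1) by (auto simp: zero_less_mult_iff)
    then show ?thesis using s'(2) x by blast
  qed
  have "s * mink (lift (e a b)) (m0 v) \<le> 0" if ab: "a \<noteq> b" for a b
  proof (cases "a = v")
    case True
    then show ?thesis using m0_e[OF ab] by simp
  next
    case av: False
    obtain i j where ij: "distinct [a, b, i, j]" using complete_4[OF ab] by metis
    obtain l where "l \<noteq> v" "l \<noteq> a" "l \<noteq> b"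
    proof (cases "i = v")
      case True
      then show thesis using that[of j] ij by auto
    next
      case False
      then show thesis using that[of i] ij by auto
    qed
    then show ?thesis using all[of l "e a b"] e_in_V[of a b l] ab by auto
  qed
  then show ?thesis by (intro bexI[OF _ s(1)] allI impI)
qed

end

context realization_data begin

section \<open>The frame of a realization\<close>

definition sgn_pole :: "4 \<Rightarrow> real" where
  "sgn_pole v = (SOME s. s \<in> {1, -1} \<and> (v \<in> I \<longrightarrow> s = 1) \<and> (\<forall>a b. a \<noteq> b \<longrightarrow> s * mink (lift (e a b)) (m0 v) \<le> 0))"

definition m :: "4 \<Rightarrow> minkowski" where "m v = sgn_pole v *\<^sub>R m0 v"

text \<open>The sign that puts the realization on the nonpositive side of the truncation plane.\<close>
lemma sgn_pole: "sgn_pole v \<in> {1, -1}" "v \<in> I \<Longrightarrow> sgn_pole v = 1"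
  and m_le: "a \<noteq> b \<Longrightarrow> mink (lift (e a b)) (m v) \<le> 0"
proof -
  have "\<exists>s. s \<in> {1, -1} \<and> (v \<in> I \<longrightarrow> s = 1) \<and> (\<forall>a b. a \<noteq> b \<longrightarrow> s * mink (lift (e a b)) (m0 v) \<le> 0)"
  proof (cases "v \<in> I")
    case False
    obtain s where "s \<in> {1, -1}" "\<forall>a b. a \<noteq> b \<longrightarrow> s * mink (lift (e a b)) (m0 v) \<le> 0" using one_side[OF False] by (rule bexE)
    then show ?thesis using False by (intro exI[of _ s] conjI impI) simp_all
  next
    case True
    have "mink (lift (e a b)) (m0 v) \<le> 0" if ab: "a \<noteq> b" for a b
    proof (cases "e a b = q {v}")
      case True
      then show ?thesis using m0_ideal(2)[OF \<open>v \<in> I\<close>] \<open>v \<in> I\<close> by (simp add: m0_def)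
    next
      case False
      then show ?thesis using mink_lift_neg[OF e_cball[OF ab] _ False] q_sphere(1)[OF \<open>v \<in> I\<close>] \<open>v \<in> I\<close> by (simp add: m0_def)
    qed
    then show ?thesis by (intro exI[of _ 1]) simp
  qed
  note s = someI_ex[OF this, folded sgn_pole_def]
  show "sgn_pole v \<in> {1, -1}" by (rule conjunct1[OF s])
  show "v \<in> I \<Longrightarrow> sgn_pole v = 1" by (rule mp[OF conjunct1[OF conjunct2[OF s]]])
  show "a \<noteq> b \<Longrightarrow> mink (lift (e a b)) (m v) \<le> 0" using s by (simp add: m_def mink_simps)
qed

lemma sgn_pole_square: "sgn_pole v * sgn_pole v = 1"
  using sgn_pole(1)[of v] by auto

lemma m_self: "mink (m v) (m v) = (if v \<in> I then 0 else 1)"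
  using m0_ideal(2)[of v] m0_nonideal(1)[of v] sgn_pole_square[of v] by (auto simp: m_def mink_simps simp flip: mult.assoc)

lemma m_ideal: "v \<in> I \<Longrightarrow> m v = lift (e v w)"
  using m0_ideal(1)[of v w] sgn_pole(2)[of v] by (simp add: m_def)

lemma m_n: "k \<noteq> v \<Longrightarrow> mink (m v) (n k) = 0" and m_n_nonzero: "mink (m v) (n v) \<noteq> 0"
  using m0_n[of k v] m0_n_nonzero[of v] sgn_pole_square[of v] by (auto simp: m_def mink_simps)

lemma m_e: "v \<noteq> w \<Longrightarrow> mink (lift (e v w)) (m v) = 0"
  using m0_e[of v w] by (simp add: m_def mink_simps)

lemma m_neg:
  assumes "v \<noteq> w" "{v, w} \<notin> Z" shows "mink (lift (e w v)) (m v) < 0"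
proof (cases "v \<in> I")
  case False
  have "mink (lift (e w v)) (m v) \<noteq> 0"
    using edge_not_in_triangle_plane[OF assms False] sgn_pole_square[of v] by (auto simp: m_def mink_simps)
  then show ?thesis using m_le[of w v v] assms(1) by simp
next
  case True
  show ?thesis
    unfolding m_ideal[OF True, of w]
    by (rule mink_lift_neg) (use e_cball e_ends_distinct[OF assms] assms(1) in \<open>auto simp del: mem_cball_0\<close>)
qed

lemma e_combination:
  assumes "v \<noteq> w" obtains \<alpha> \<beta> where "lift (e v w) = \<alpha> *\<^sub>R m v + \<beta> *\<^sub>R m w"
proof -
  obtain x y where xy: "lift (e v w) = x *\<^sub>R m0 v + y *\<^sub>R m0 w" using e_on_edge[OF assms] by (rule span_pairE)
  have "m0 u = sgn_pole u *\<^sub>R m u" for u using sgn_pole_square[of u] by (simp add: m_def)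
  then have "lift (e v w) = (x * sgn_pole v) *\<^sub>R m v + (y * sgn_pole w) *\<^sub>R m w" using xy by simp
  then show thesis by (rule that)
qed

text \<open>The ideal point is a multiple of \<open>m w \<mp> m v\<close>. Its products with another vertex of each of the two truncation triangles
  are negative, and the products of the poles with these vertices are nonpositive; this decides both signs.\<close>
lemma poles_zero_edge:
  assumes Z: "{v, w} \<in> Z" and vw: "v \<noteq> w"
  shows "mink (m v) (m w) = -1 \<and> (\<exists>\<beta>>0. lift (e v w) = \<beta> *\<^sub>R edge_vector m v w)"
proof -
  have vw': "v \<notin> I" "w \<notin> I" using Z_nonideal[OF Z] by auto
  have ew: "e w v = e v w" by (rule e_sym_Z[OF Z])
  obtain k l where d: "distinct [v, w, k, l]" using complete_4[OF vw] by metis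
  define M where "M = mink (m v) (m w)"
  obtain \<alpha> \<beta> where ab: "lift (e v w) = \<alpha> *\<^sub>R m v + \<beta> *\<^sub>R m w" using e_combination[OF vw] .
  have "mink (lift (e v w)) (m w) = 0" using m_e[of w v] vw by (simp add: ew)
  then have N: "M\<^sup>2 = 1 \<and> \<beta> \<noteq> 0 \<and> lift (e v w) = \<beta> *\<^sub>R (m w - M *\<^sub>R m v)"
    unfolding M_def by (intro null_combination[OF ab]) (use m_e[OF vw] m_self vw' in auto)
  have neg: "mink (lift (e v w)) (lift (e u k)) < 0" if u: "u = v \<or> u = w" for u
  proof -
    have uk: "u \<noteq> k" using u d by auto
    have "e v w \<noteq> e u k"
    proof (cases "u = v")
      case True
      then show ?thesis using e_distinct[OF vw'(1), of w k] d by auto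
    next
      case False
      then show ?thesis using u e_distinct[OF vw'(2), of v k] d unfolding ew[symmetric] by auto
    qed
    then show ?thesis using mink_lift_neg[OF e_cball[OF vw] e_cball[OF uk]] by blast
  qed
  have kd: "v \<noteq> k" "w \<noteq> k" using d by auto
  have "mink (m v) (lift (e v k)) = 0" "mink (m w) (lift (e w k)) = 0" using m_e kd by (simp_all add: mink_commute)
  then have "\<beta> * mink (m w) (lift (e v k)) < 0" "\<beta> * M * mink (m v) (lift (e w k)) > 0"
    using neg[of v] neg[of w] N by (simp_all add: mink_simps)
  moreover have "mink (m w) (lift (e v k)) \<le> 0" "mink (m v) (lift (e w k)) \<le> 0"
    using m_le[OF kd(1), of w] m_le[OF kd(2), of v] by (simp_all add: mink_commute)
  ultimately have s: "\<beta> > 0" "\<beta> * M < 0" by (auto simp: mult_less_0_iff zero_less_mult_iff)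
  then have "M < 0" by (simp add: mult_less_0_iff)
  then have "M = -1" using N by (auto simp: power2_eq_1_iff)
  moreover have "lift (e v w) = \<beta> *\<^sub>R edge_vector m v w"
    using N m_self[of v] vw' by (simp add: edge_vector_def M_def)
  ultimately show ?thesis using s(1) by (auto simp: M_def)
qed

text \<open>The end of the edge is orthogonal to \<open>m v\<close>, so it is a multiple of the edge vector; the sign of the factor is
  determined by the product with \<open>m w\<close> and by the end being timelike.\<close>
lemma poles_long_edge:
  assumes v: "v \<notin> I" and vw: "v \<noteq> w" "{v, w} \<notin> Z"
  shows "mink (m w) (m w) < (mink (m v) (m w))\<^sup>2 \<and> (\<exists>\<beta>>0. lift (e v w) = \<beta> *\<^sub>R edge_vector m v w)"
proof -
  define M where "M = mink (m v) (m w)"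
  define c where "c = mink (lift (e v w)) (m w)"
  have c: "c < 0" unfolding c_def by (rule m_neg) (use vw in \<open>auto simp: insert_commute\<close>)
  obtain \<alpha> \<beta> where ab: "lift (e v w) = \<alpha> *\<^sub>R m v + \<beta> *\<^sub>R m w" using e_combination[OF vw(1)] .
  have vv: "mink (m v) (m v) = 1" using m_self[of v] v by simp
  have wv: "mink (m w) (m v) = M" by (simp add: M_def mink_commute)
  have "mink (\<alpha> *\<^sub>R m v + \<beta> *\<^sub>R m w) (m v) = 0" using m_e[OF vw(1)] ab by simp
  then have \<alpha>: "\<alpha> = - \<beta> * M" by (simp add: mink_simps vv wv)
  have "c = mink (\<alpha> *\<^sub>R m v + \<beta> *\<^sub>R m w) (m w)" by (simp add: c_def ab)
  also have "\<dots> = \<beta> * (mink (m w) (m w) - M\<^sup>2)" by (simp add: mink_simps \<alpha> power2_eq_square algebra_simps flip: M_def)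
  finally have c2: "c = \<beta> * (mink (m w) (m w) - M\<^sup>2)" .
  have "mink (lift (e v w)) (lift (e v w)) = mink (lift (e v w)) (\<alpha> *\<^sub>R m v + \<beta> *\<^sub>R m w)" by (simp add: ab)
  also have "\<dots> = \<alpha> * mink (lift (e v w)) (m v) + \<beta> * mink (lift (e v w)) (m w)" by (simp add: mink_simps)
  also have "\<dots> = \<beta> * c" using m_e[OF vw(1)] by (simp add: c_def)
  finally have "\<beta> * c < 0" using e_H3[OF vw(1) v vw(2)] unfolding mem_H3_iff_mink by simp
  then have \<beta>: "\<beta> > 0" using c by (simp add: mult_less_0_iff)
  then have "mink (m w) (m w) < M\<^sup>2" using c c2 by (simp add: mult_less_0_iff)
  moreover have "lift (e v w) = \<beta> *\<^sub>R edge_vector m v w"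
    by (simp add: ab \<alpha> edge_vector_def vv algebra_simps flip: M_def)
  ultimately show ?thesis using \<beta> by (auto simp: M_def)
qed

lemma poles_ideal:
  assumes v: "v \<in> I" and vw: "v \<noteq> w"
  shows "mink (m v) (m w) < 0 \<and> (\<exists>\<beta>>0. lift (e v w) = \<beta> *\<^sub>R edge_vector m v w)"
proof -
  have vZ: "{w, v} \<notin> Z" using Z_nonideal[of w v] v by blast
  have M: "mink (m v) (m w) < 0" unfolding m_ideal[OF v, of w] by (rule m_neg) (use vw vZ in auto)
  have "edge_vector m v w = (- mink (m v) (m w)) *\<^sub>R lift (e v w)"
    using m_self[of v] v by (simp add: edge_vector_def m_ideal[OF v, of w])
  then have "lift (e v w) = (1 / - mink (m v) (m w)) *\<^sub>R edge_vector m v w" using M by simp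
  then show ?thesis using M by (metis neg_0_less_iff_less zero_less_divide_1_iff)
qed

text \<open>The discriminant only gives \<open>M\<^sup>2 > 1\<close>. The sign is that of the product of the two ends of the edge, both in
  the future.\<close>
lemma poles_long_edge_nonideal:
  assumes vw: "v \<notin> I" "w \<notin> I" "v \<noteq> w" "{v, w} \<notin> Z"
  shows "mink (m v) (m w) < -1"
proof -
  define M where "M = mink (m v) (m w)"
  have wv: "mink (m w) (m v) = M" by (simp add: M_def mink_commute)
  have wZ: "{w, v} \<notin> Z" using vw by (simp add: insert_commute)
  obtain \<beta> where M1: "1 < M\<^sup>2" and \<beta>: "\<beta> > 0" "lift (e v w) = \<beta> *\<^sub>R edge_vector m v w"
    using poles_long_edge[OF vw(1,3,4)] m_self[of w] vw(2) by (auto simp: M_def)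
  obtain \<gamma> where \<gamma>: "\<gamma> > 0" "lift (e w v) = \<gamma> *\<^sub>R edge_vector m w v"
    using poles_long_edge[OF vw(2) _ wZ] vw(3) by blast
  have "mink (lift (e v w)) (lift (e w v)) < 0"
    using mink_lift_neg[OF e_cball e_cball e_ends_distinct[OF vw(3,4)]] vw(3) by metis
  moreover have "mink (lift (e v w)) (lift (e w v)) = (\<beta> * \<gamma>) * (M * (M\<^sup>2 - 1))"
    using vw(1,2) by (simp add: \<beta>(2) \<gamma>(2) edge_vector_def mink_simps m_self wv power2_eq_square algebra_simps flip: M_def)
  ultimately have "M * (M\<^sup>2 - 1) < 0" using \<beta>(1) \<gamma>(1) by (simp add: mult_less_0_iff zero_less_mult_iff)
  then have "M < 0" using M1 by (simp add: mult_less_0_iff)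
  then have "\<not> -1 \<le> M" using M1 abs_square_le_1[of M] by auto
  then show ?thesis by (simp add: M_def)
qed

lemma e_edge_vector:
  assumes vw: "v \<noteq> w" shows "\<exists>\<beta>>0. lift (e v w) = \<beta> *\<^sub>R edge_vector m v w"
  using poles_zero_edge[OF _ vw] poles_ideal[OF _ vw] poles_long_edge[OF _ vw] by blast

definition n' :: "4 \<Rightarrow> minkowski" where "n' k = (1 / mink (m k) (n k)) *\<^sub>R n k"

text \<open>Only the normalization of the normals is left.\<close>
lemma frame: "hyperideal_frame I Z m n'"
proof
  fix v w
  show "mink (m v) (n' w) = (if v = w then 1 else 0)"
    using m_n[of w v] m_n_nonzero[of v] by (auto simp: n'_def mink_simps)
  assume vw: "v \<noteq> w"
  have wZ: "{w, v} = {v, w}" by auto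
  show "mink (m v) (m w) < 0"
  proof (cases "v \<in> I \<or> w \<in> I")
    case True
    then show ?thesis using poles_ideal[of v w] poles_ideal[of w v] vw mink_commute[of "m v" "m w"] by auto
  next
    case False
    then show ?thesis using poles_zero_edge[OF _ vw] poles_long_edge_nonideal[OF _ _ vw] by fastforce
  qed
  show "mink (m v) (m w) \<le> -1" if "v \<notin> I" "w \<notin> I"
    using poles_zero_edge[OF _ vw] poles_long_edge_nonideal[OF that vw] by fastforce
  show "mink (m v) (m w) = -1 \<longleftrightarrow> {v, w} \<in> Z" if "v \<notin> I" "w \<notin> I"
    using poles_zero_edge[OF _ vw] poles_long_edge_nonideal[OF that vw] by fastforce
  obtain \<beta> where \<beta>: "\<beta> > 0" "lift (e v w) = \<beta> *\<^sub>R edge_vector m v w" using e_edge_vector[OF vw] by blast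
  have "snd (lift (e v w)) = \<beta> * snd (edge_vector m v w)" unfolding \<beta>(2) by simp
  then have "0 < \<beta> * snd (edge_vector m v w)" by simp
  then show "0 < snd (edge_vector m v w)" using \<beta>(1) by (simp add: zero_less_mult_iff)
qed (rule ptt m_self)+

text \<open>The vertices of the polyhedron of the frame are the edge ends of the realization, so its faces are the hexagons
  and truncation triangles.\<close>
lemma realized: "hyperideal_frame.realized_by I Z m n' f"
proof -
  interpret F: hyperideal_frame I Z m n' by (rule frame)
  have vert: "F.vert v w = e v w" if vw: "v \<noteq> w" for v w
  proof -
    obtain \<beta> where "lift (e v w) = \<beta> *\<^sub>R edge_vector m v w" using e_edge_vector[OF vw] by blast
    then show ?thesis unfolding F.vert_def by (rule proj_eqI)
  qed
  have "F.verts (- {k}) = V k" for k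
  proof -
    have "F.verts (- {k}) = {F.vert v w | v w. v \<noteq> w \<and> v \<noteq> k \<and> w \<noteq> k}" by (auto simp: F.verts_def)
    also have "\<dots> = V k" using vert unfolding V_def by metis
    finally show ?thesis .
  qed
  moreover have "card (- {k :: 4}) = 3" for k by (simp add: Compl_eq_Diff_UNIV card_Diff_subset)
  ultimately have hex: "f ` hex k = F.face (- {k})" for k using F.face_eq_hhull[of "- {k}"] V_poly(5)[of k] by simp
  have tri: "f ` tr v = F.tri v" if v: "v \<notin> I" for v
  proof -
    have "F.vert v ` (- {v}) = e v ` (- {v})" by (rule image_cong) (use vert in auto)
    then show ?thesis using F.tri_eq_hhull[OF v] T_poly(3)[OF v] by simp
  qed
  have "f ` D = F.pol" by (rule F.image_eq_pol[OF f_cont f_inj f_H3 iv hex tri])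
  then show ?thesis unfolding F.realized_by_def using f_inj hex tri by blast
qed

end

lemma realization_has_frame:
  assumes "partially_truncated_tetrahedron I Z" "geometric_realization I Z f"
  shows "\<exists>m n. hyperideal_frame I Z m n \<and> hyperideal_frame.realized_by I Z m n f"
proof -
  obtain q where "realization_data I Z f q"
    using assms unfolding geometric_realization_def realization_data_def by blast
  then interpret realization_data I Z f q .
  show ?thesis using frame realized by blast
qed

section \<open>Parametrization by dihedral angles\<close>

theorem theorem2p2:
  fixes I :: "4 set" and Z :: "4 set set"
  assumes "partially_truncated_tetrahedron I Z"
  shows "(\<forall>f. geometric_realization I Z f \<longrightarrow>
            (\<exists>!\<theta>. \<theta> \<in> angle_functions I Z \<and> has_dihedral_angles I Z f \<theta>)) \<and>
         (\<forall>\<theta>\<in>angle_functions I Z.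
            \<exists>f. geometric_realization I Z f \<and> has_dihedral_angles I Z f \<theta>) \<and>
         (\<forall>f g. \<forall>\<theta>\<in>angle_functions I Z. \<forall>\<eta>\<in>angle_functions I Z.
            geometric_realization I Z f \<and> has_dihedral_angles I Z f \<theta> \<and>
            geometric_realization I Z g \<and> has_dihedral_angles I Z g \<eta> \<longrightarrow>
            (isometric_realizations I Z f g \<longleftrightarrow> \<theta> = \<eta>))"
proof (intro conjI allI ballI impI)
  fix f assume "geometric_realization I Z f"
  then obtain m n where F: "hyperideal_frame I Z m n" "hyperideal_frame.realized_by I Z m n f"
    using realization_has_frame[OF assms] by blast
  show "\<exists>!\<theta>. \<theta> \<in> angle_functions I Z \<and> has_dihedral_angles I Z f \<theta>"
    using hyperideal_frame.ang_in_angle_functions[OF F(1)] hyperideal_frame.realized_has_dihedral_angles[OF F]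
      hyperideal_frame.realized_angles_unique[OF F] by blast
next
  fix \<theta> assume "\<theta> \<in> angle_functions I Z"
  then obtain m n where F: "hyperideal_frame I Z m n" "hyperideal_frame.ang n = \<theta>"
    using hyperideal_frame_exists[OF assms] by blast
  show "\<exists>f. geometric_realization I Z f \<and> has_dihedral_angles I Z f \<theta>"
    using hyperideal_frame.realization_geometric[OF F(1)] hyperideal_frame.realization_realized[OF F(1)]
      hyperideal_frame.realized_has_dihedral_angles[OF F(1)] unfolding F(2) by blast
next
  fix f g \<theta> \<eta>
  assume \<theta>: "\<theta> \<in> angle_functions I Z" and \<eta>: "\<eta> \<in> angle_functions I Z"
    and fg: "geometric_realization I Z f \<and> has_dihedral_angles I Z f \<theta> \<and> geometric_realization I Z g \<and> has_dihedral_angles I Z g \<eta>"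
  obtain m n where F: "hyperideal_frame I Z m n" "hyperideal_frame.realized_by I Z m n f"
    using realization_has_frame[OF assms] fg by blast
  obtain m' n' where G: "hyperideal_frame I Z m' n'" "hyperideal_frame.realized_by I Z m' n' g"
    using realization_has_frame[OF assms] fg by blast
  have "\<theta> = hyperideal_frame.ang n" "\<eta> = hyperideal_frame.ang n'"
    using hyperideal_frame.realized_angles_unique[OF F \<theta>] hyperideal_frame.realized_angles_unique[OF G \<eta>] fg by blast+
  then show "isometric_realizations I Z f g \<longleftrightarrow> \<theta> = \<eta>"
    using isometric_imp_same_angles[OF F G] same_angles_imp_isometric[OF F G] by blast
qed

end
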